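(* Let $(M,d,\mathbf m)$ be a complete metric measure space with $\mathbf m$ a Radon measure, let $p\in(1,\infty)$ and let $\mathcal F_p:D(\mathcal F_p)\to L^p_+(\mathbf m)$, $f\mapsto g_f$, be subadditive and absolutely homogeneous with $D(\mathcal F_p)\subset L^0(\mathbf m)$. Let $\mathcal M=\mathcal M_{\mathcal F_p}$ be the module generated by $\mathcal F_p$, $\hat{\mathcal M}=\mathcal M_{\hat{\mathcal F}_p}$ the module generated by its lower relaxation $\hat{\mathcal F}_p$, $\mathcal M_0$ the submodule of $\mathcal M$ generated by $\mathcal G_0$, and $\hat{\mathcal M}'$ the submodule of $\hat{\mathcal M}$ generated by $\{d_{\hat{\mathcal F}_p}f: f\in D(\mathcal F_p)\}$ (note $D(\mathcal F_p)\subset D(\hat{\mathcal F}_p)$). Assume $\mathcal M$ is weakly reflexive. Then $$\hat{\mathcal M}'\cong\mathcal M/\mathcal M_0$$ (isometric isomorphism of $L^p(\mathbf m)$-normed modules, $\mathcal M/\mathcal M_0$ carrying the quotient norm). In particular, for each $f\in D(\mathcal F_p)$, $$\|d_{\hat{\mathcal F}_p}f\|_{\hat{\mathcal M}}=\inf_{\omega\in\mathcal M_0}\|d_{\mathcal F_p}f+\omega\|_{\mathcal M}.$$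
   Context: $L^0(\mathbf m)$: measurable functions; convergence in $L^0(\mathbf m)$ means $\mathbf m$-a.e. convergence. $L^p_+(\mathbf m)$: non-negative functions in $L^p(\mathbf m)$. Subadditive and absolutely homogeneous: $D(\mathcal F_p)$ is a linear subspace, $g_{f+h}\le g_f+g_h$ and $g_{\lambda f}=|\lambda|g_f$ a.e. An $L^p(\mathbf m)$-normed module is a Banach space with a compatible bilinear multiplication by $L^\infty(\mathbf m)$ and a pointwise norm $|\cdot|$ with values in the non-negative functions of $L^p(\mathbf m)$ with $\|v\|=\||v|\|_{L^p}$, $|fv|=|f||v|$ a.e., which satisfies locality ($\chi_{A_n}v=0$ for all $n$ implies $\chi_{\cup A_n}v=0$) and glueing (compatible families $\chi_{A_i}v_i$ with bounded partial sums glue to an element of the module). A submodule is a closed subspace which is itself an $L^p(\mathbf m)$-normed module; the submodule generated by a set is the smallest submodule containing it. Module generated by $\mathcal F_p$: let $\mathsf{Pfm}$ be the set of countable families $\{(f_i,A_i)\}_{i\in\mathbb N}$ with $(A_i)$ a Borel partition of $M$, $f_i\in D(\mathcal F_p)$, $\sum_i\int_{A_i}g_{f_i}^pd\mathbf m<\infty$; identify $\{(f_i,A_i)\}\sim\{(h_j,B_j)\}$ iff $g_{f_i-h_j}=0$ a.e. on $A_i\cap B_j$ for all $i,j$. With $[(f_i,A_i)]+[(h_j,B_j)]=[(f_i+h_j,A_i\cap B_j)]$, $\lambda[(f_i,A_i)]=[(\lambda f_i,A_i)]$, multiplication by simple functions $(\sum_ja_j\chi_{B_j})[(f_i,A_i)]=[(a_jf_i,A_i\cap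 B_j)]$, pointwise norm $|[(f_i,A_i)]|=g_{f_i}$ on $A_i$, and norm $\|v\|_{\mathcal F_p}=\||v|\|_{L^p}$, $\mathsf{Pfm}/\!\sim$ is a normed space; its completion is the $L^p(\mathbf m)$-normed module $\mathcal M_{\mathcal F_p}$. Set $d_{\mathcal F_p}f=[(f,M)]$ for $f\in D(\mathcal F_p)$ (a linear map). Lower relaxation: $D(\hat{\mathcal F}_p)$ is the set of $f\in L^0(\mathbf m)$ for which there are $f_n\in D(\mathcal F_p)$, $f_n\to f$ in $L^0(\mathbf m)$ with $(g_{f_n})$ bounded in $L^p(\mathbf m)$. For such $f$ let $\hat G_f$ be the set of $G\in L^p(\mathbf m)$ such that $G\le\tilde G$ a.e. whenever $D(\mathcal F_p)\ni f_n\to f$ in $L^0(\mathbf m)$ and $g_{f_n}\rightharpoonup\tilde G$ weakly in $L^p(\mathbf m)$; $\hat{\mathcal F}_p(f)=\hat g_f$ is the ($\mathbf m$-a.e.) largest element of $\hat G_f$. The map $\hat{\mathcal F}_p$ is again subadditive and absolutely homogeneous, so $\mathcal M_{\hat{\mathcal F}_p}$ and $d_{\hat{\mathcal F}_p}$ are defined. $\mathcal G_0=\{\omega\in\mathcal M:\exists f_n\in D(\mathcal F_p),\ f_n\to0\text{ in }L^0(\mathbf m),\ d_{\mathcal F_p}f_n\to\omega\text{ in }\mathcal M\}$, a closed subspace. $\mathcal M$ is weakly reflexive if every bounded sequence $(d_{\mathcal F_p}f_n)$ in $\mathcal M$ with $D(\mathcal F_p)\ni f_n\to f$ in $L^0(\mathbf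 m)$ (for some $f\in L^0(\mathbf m)$) has a weakly convergent subsequence in $\mathcal M$. *)

theory Defs
  imports "HOL-Analysis.Analysis" "HOL-Algebra.AbelCoset" "HOL-Algebra.Module"
begin

section \<open>Measures and function spaces\<close>

definition radon_measure :: "'a::topological_space measure \<Rightarrow> bool" where
  "radon_measure m \<longleftrightarrow>
     sets m = sets borel \<and>
     (\<forall>x. \<exists>U. open U \<and> x \<in> U \<and> emeasure m U < \<infinity>) \<and>
     (\<forall>B\<in>sets m. emeasure m B = (SUP K\<in>{K. compact K \<and> K \<subseteq> B}. emeasure m K))"

text \<open>Elements of \<open>L\<^sup>0\<close>, \<open>L\<^sup>p\<close> and \<open>L\<^sup>\<infinity>\<close> are represented by everywhere defined measurable
  functions; all statements about them are invariant under a.e. equality.\<close>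

definition L0_tendsto :: "'a measure \<Rightarrow> (nat \<Rightarrow> 'a \<Rightarrow> real) \<Rightarrow> ('a \<Rightarrow> real) \<Rightarrow> bool" where
  "L0_tendsto m f h \<longleftrightarrow> (AE x in m. (\<lambda>n. f n x) \<longlonglongrightarrow> h x)"

definition Lp :: "'a measure \<Rightarrow> real \<Rightarrow> ('a \<Rightarrow> real) set" where
  "Lp m p = {f \<in> borel_measurable m. integrable m (\<lambda>x. \<bar>f x\<bar> powr p)}"

definition Lp_plus :: "'a measure \<Rightarrow> real \<Rightarrow> ('a \<Rightarrow> real) set" where
  "Lp_plus m p = {f \<in> Lp m p. AE x in m. 0 \<le> f x}"

definition Lp_norm :: "'a measure \<Rightarrow> real \<Rightarrow> ('a \<Rightarrow> real) \<Rightarrow> real" where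
  "Lp_norm m p f = (\<integral>x. \<bar>f x\<bar> powr p \<partial>m) powr (1 / p)"

definition Linf :: "'a measure \<Rightarrow> ('a \<Rightarrow> real) ring" where
  "Linf m = \<lparr>carrier = {f \<in> borel_measurable m. \<exists>C. AE x in m. \<bar>f x\<bar> \<le> C},
     mult = (\<lambda>f h x. f x * h x), one = (\<lambda>x. 1), zero = (\<lambda>x. 0), add = (\<lambda>f h x. f x + h x)\<rparr>"

definition Linf_tendsto :: "'a measure \<Rightarrow> (nat \<Rightarrow> 'a \<Rightarrow> real) \<Rightarrow> ('a \<Rightarrow> real) \<Rightarrow> bool" where
  "Linf_tendsto m f h \<longleftrightarrow> (\<forall>e>0. \<exists>N. \<forall>n\<ge>N. AE x in m. \<bar>f n x - h x\<bar> \<le> e)"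

definition ae_greatest :: "'a measure \<Rightarrow> ('a \<Rightarrow> real) set \<Rightarrow> 'a \<Rightarrow> real" where
  "ae_greatest m S = (SOME G. G \<in> S \<and> (\<forall>H\<in>S. AE x in m. H x \<le> G x))"


section \<open>Normed modules\<close>

text \<open>The ring fields \<open>mult\<close> and \<open>one\<close> inherited by the library record for modules are unused.
  Multiplication by the real number \<open>c\<close> is multiplication by the constant function \<open>\<lambda>_. c\<close>.\<close>

record ('a, 'v) normed_mod = "('a \<Rightarrow> real, 'v) module" +
  vnorm :: "'v \<Rightarrow> real"
  pnorm :: "'v \<Rightarrow> 'a \<Rightarrow> real"

text \<open>Cut off outside the carrier because \<^locale>\<open>Metric_space\<close> requires nonnegativity and symmetry
  for all elements of the type.\<close>

definition ndist :: "('a, 'v, 'z) normed_mod_scheme \<Rightarrow> 'v \<Rightarrow> 'v \<Rightarrow> real" where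
  "ndist M u v = (if u \<in> carrier M \<and> v \<in> carrier M then vnorm M (u \<ominus>\<^bsub>M\<^esub> v) else 0)"

abbreviation ntopology :: "('a, 'v, 'z) normed_mod_scheme \<Rightarrow> 'v topology" where
  "ntopology M \<equiv> Metric_space.mtopology (carrier M) (ndist M)"

definition module_locality :: "'a measure \<Rightarrow> ('a, 'v, 'z) normed_mod_scheme \<Rightarrow> bool" where
  "module_locality m M \<longleftrightarrow>
     (\<forall>v\<in>carrier M. \<forall>A. range A \<subseteq> sets m \<longrightarrow>
        (\<forall>n::nat. indicat_real (A n) \<odot>\<^bsub>M\<^esub> v = \<zero>\<^bsub>M\<^esub>) \<longrightarrow> indicat_real (\<Union>n. A n) \<odot>\<^bsub>M\<^esub> v = \<zero>\<^bsub>M\<^esub>)"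

definition module_glueing :: "'a measure \<Rightarrow> ('a, 'v, 'z) normed_mod_scheme \<Rightarrow> bool" where
  "module_glueing m M \<longleftrightarrow>
     (\<forall>v A. range v \<subseteq> carrier M \<longrightarrow> range A \<subseteq> sets m \<longrightarrow>
        (\<forall>i j::nat. indicat_real (A i \<inter> A j) \<odot>\<^bsub>M\<^esub> v i = indicat_real (A i \<inter> A j) \<odot>\<^bsub>M\<^esub> v j) \<longrightarrow>
        (\<exists>C. \<forall>n. vnorm M (\<Oplus>\<^bsub>M\<^esub>i\<in>{..<n}. indicat_real (A i) \<odot>\<^bsub>M\<^esub> v i) \<le> C) \<longrightarrow>
        (\<exists>w\<in>carrier M. \<forall>i. indicat_real (A i) \<odot>\<^bsub>M\<^esub> w = indicat_real (A i) \<odot>\<^bsub>M\<^esub> v i))"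

definition lp_normed_module :: "'a measure \<Rightarrow> real \<Rightarrow> ('a, 'v, 'z) normed_mod_scheme \<Rightarrow> bool" where
  "lp_normed_module m p M \<longleftrightarrow>
     Module.module (Linf m) M \<and>
     Metric_space (carrier M) (ndist M) \<and>
     (\<forall>v\<in>carrier M. \<forall>c. vnorm M ((\<lambda>_. c) \<odot>\<^bsub>M\<^esub> v) = \<bar>c\<bar> * vnorm M v) \<and>
     Metric_space.mcomplete (carrier M) (ndist M) \<and>
     (\<forall>v\<in>carrier M. pnorm M v \<in> Lp_plus m p \<and> vnorm M v = Lp_norm m p (pnorm M v)) \<and>
     (\<forall>f\<in>carrier (Linf m). \<forall>v\<in>carrier M.
        AE x in m. pnorm M (f \<odot>\<^bsub>M\<^esub> v) x = \<bar>f x\<bar> * pnorm M v x) \<and>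
     module_locality m M \<and> module_glueing m M"

definition lp_submodule :: "'a measure \<Rightarrow> real \<Rightarrow> ('a, 'v, 'z) normed_mod_scheme \<Rightarrow> 'v set \<Rightarrow> bool" where
  "lp_submodule m p M H \<longleftrightarrow>
     closedin (ntopology M) H \<and> lp_normed_module m p (M\<lparr>carrier := H\<rparr>)"

definition generated_submodule ::
    "'a measure \<Rightarrow> real \<Rightarrow> ('a, 'v, 'z) normed_mod_scheme \<Rightarrow> 'v set \<Rightarrow> 'v set" where
  "generated_submodule m p M S = \<Inter>{H. lp_submodule m p M H \<and> S \<subseteq> H}"

text \<open>The pointwise norm of a coset is the essential infimum of the pointwise norms of its
  elements.\<close>

definition quotient_module ::
    "'a measure \<Rightarrow> real \<Rightarrow> ('a, 'v, 'z) normed_mod_scheme \<Rightarrow> 'v set \<Rightarrow> ('a, 'v set) normed_mod" where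
  "quotient_module m p M H =
     \<lparr>carrier = a_rcosets\<^bsub>M\<^esub> H, mult = undefined, one = undefined,
      zero = H, add = set_add M,
      smult = (\<lambda>f C. \<Union>v\<in>C. H +>\<^bsub>M\<^esub> (f \<odot>\<^bsub>M\<^esub> v)),
      vnorm = (\<lambda>C. INF v\<in>C. vnorm M v),
      pnorm = (\<lambda>C. ae_greatest m {G \<in> Lp m p. \<forall>v\<in>C. AE x in m. G x \<le> pnorm M v x})\<rparr>"

definition lp_isometric :: "'a measure \<Rightarrow> real \<Rightarrow>
    ('a, 'v, 'y) normed_mod_scheme \<Rightarrow> ('a, 'w, 'z) normed_mod_scheme \<Rightarrow> bool" where
  "lp_isometric m p M N \<longleftrightarrow>
     lp_normed_module m p M \<and> lp_normed_module m p N \<and>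
     (\<exists>\<phi>. bij_betw \<phi> (carrier M) (carrier N) \<and>
        (\<forall>u\<in>carrier M. \<forall>v\<in>carrier M. \<phi> (u \<oplus>\<^bsub>M\<^esub> v) = \<phi> u \<oplus>\<^bsub>N\<^esub> \<phi> v) \<and>
        (\<forall>f\<in>carrier (Linf m). \<forall>v\<in>carrier M. \<phi> (f \<odot>\<^bsub>M\<^esub> v) = f \<odot>\<^bsub>N\<^esub> \<phi> v) \<and>
        (\<forall>v\<in>carrier M. vnorm N (\<phi> v) = vnorm M v) \<and>
        (\<forall>v\<in>carrier M. AE x in m. pnorm N (\<phi> v) x = pnorm M v x))"


section \<open>Weak convergence\<close>

definition bounded_functional :: "('a, 'v, 'z) normed_mod_scheme \<Rightarrow> ('v \<Rightarrow> real) \<Rightarrow> bool" where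
  "bounded_functional M l \<longleftrightarrow>
     (\<forall>u\<in>carrier M. \<forall>v\<in>carrier M. l (u \<oplus>\<^bsub>M\<^esub> v) = l u + l v) \<and>
     (\<forall>c. \<forall>v\<in>carrier M. l ((\<lambda>_. c) \<odot>\<^bsub>M\<^esub> v) = c * l v) \<and>
     (\<exists>C. \<forall>v\<in>carrier M. \<bar>l v\<bar> \<le> C * vnorm M v)"

definition weakly_tendsto :: "('a, 'v, 'z) normed_mod_scheme \<Rightarrow> (nat \<Rightarrow> 'v) \<Rightarrow> 'v \<Rightarrow> bool" where
  "weakly_tendsto M \<sigma> v \<longleftrightarrow>
     range \<sigma> \<subseteq> carrier M \<and> v \<in> carrier M \<and>
     (\<forall>l. bounded_functional M l \<longrightarrow> (\<lambda>n. l (\<sigma> n)) \<longlonglongrightarrow> l v)"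

text \<open>\<open>L\<^sup>p\<close> with functions as elements, so \<open>vnorm\<close> is only a seminorm here; every bounded functional
  is automatically constant on a.e.-classes. Used only for weak convergence.\<close>

definition Lp_space :: "'a measure \<Rightarrow> real \<Rightarrow> ('a, 'a \<Rightarrow> real) normed_mod" where
  "Lp_space m p =
     \<lparr>carrier = Lp m p, mult = undefined, one = undefined,
      zero = (\<lambda>x. 0), add = (\<lambda>f h x. f x + h x),
      smult = (\<lambda>f h x. f x * h x),
      vnorm = Lp_norm m p, pnorm = (\<lambda>f x. \<bar>f x\<bar>)\<rparr>"


section \<open>The map \<open>f \<mapsto> g\<^sub>f\<close> and its lower relaxation\<close>

text \<open>\<open>D\<close> is the domain of \<open>\<F>\<^sub>p\<close> and \<open>g f\<close> its value at \<open>f\<close>. The a.e.-saturation of \<open>D\<close> and the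
  a.e.-invariance of \<open>g\<close> express that \<open>\<F>\<^sub>p\<close> is a map from a subset of \<open>L\<^sup>0\<close> to \<open>L\<^sup>p\<close>, that is, on
  a.e.-classes.\<close>

definition subadditive_homogeneous :: "'a measure \<Rightarrow> real \<Rightarrow>
    ('a \<Rightarrow> real) set \<Rightarrow> (('a \<Rightarrow> real) \<Rightarrow> 'a \<Rightarrow> real) \<Rightarrow> bool" where
  "subadditive_homogeneous m p D g \<longleftrightarrow>
     D \<subseteq> borel_measurable m \<and>
     (\<forall>f\<in>D. \<forall>h\<in>borel_measurable m. (AE x in m. f x = h x) \<longrightarrow>
        h \<in> D \<and> (AE x in m. g f x = g h x)) \<and>
     (\<forall>f\<in>D. g f \<in> Lp_plus m p) \<and>
     (\<lambda>x. 0) \<in> D \<and>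
     (\<forall>f\<in>D. \<forall>h\<in>D. (\<lambda>x. f x + h x) \<in> D \<and> (AE x in m. g (\<lambda>x. f x + h x) x \<le> g f x + g h x)) \<and>
     (\<forall>f\<in>D. \<forall>c. (\<lambda>x. c * f x) \<in> D \<and> (AE x in m. g (\<lambda>x. c * f x) x = \<bar>c\<bar> * g f x))"

definition relax_dom :: "'a measure \<Rightarrow> real \<Rightarrow>
    ('a \<Rightarrow> real) set \<Rightarrow> (('a \<Rightarrow> real) \<Rightarrow> 'a \<Rightarrow> real) \<Rightarrow> ('a \<Rightarrow> real) set" where
  "relax_dom m p D g = {f \<in> borel_measurable m.
     \<exists>\<phi>. range \<phi> \<subseteq> D \<and> L0_tendsto m \<phi> f \<and> (\<exists>C. \<forall>n. Lp_norm m p (g (\<phi> n)) \<le> C)}"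

definition relax_set :: "'a measure \<Rightarrow> real \<Rightarrow>
    ('a \<Rightarrow> real) set \<Rightarrow> (('a \<Rightarrow> real) \<Rightarrow> 'a \<Rightarrow> real) \<Rightarrow> ('a \<Rightarrow> real) \<Rightarrow> ('a \<Rightarrow> real) set" where
  "relax_set m p D g f = {G \<in> Lp m p.
     \<forall>\<phi> G'. range \<phi> \<subseteq> D \<longrightarrow> L0_tendsto m \<phi> f \<longrightarrow>
       weakly_tendsto (Lp_space m p) (\<lambda>n. g (\<phi> n)) G' \<longrightarrow> (AE x in m. G x \<le> G' x)}"

definition relax_map :: "'a measure \<Rightarrow> real \<Rightarrow>
    ('a \<Rightarrow> real) set \<Rightarrow> (('a \<Rightarrow> real) \<Rightarrow> 'a \<Rightarrow> real) \<Rightarrow> ('a \<Rightarrow> real) \<Rightarrow> 'a \<Rightarrow> real" where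
  "relax_map m p D g f = ae_greatest m (relax_set m p D g f)"


section \<open>The module generated by \<open>f \<mapsto> g\<^sub>f\<close>\<close>

text \<open>A family \<open>{(f\<^sub>i, A\<^sub>i)}\<close> is a sequence of pairs.\<close>

type_synonym 'a pfm = "nat \<Rightarrow> ('a \<Rightarrow> real) \<times> 'a set"

definition Pfm :: "'a measure \<Rightarrow> real \<Rightarrow>
    ('a \<Rightarrow> real) set \<Rightarrow> (('a \<Rightarrow> real) \<Rightarrow> 'a \<Rightarrow> real) \<Rightarrow> 'a pfm set" where
  "Pfm m p D g = {u.
     (\<forall>i. fst (u i) \<in> D \<and> snd (u i) \<in> sets m) \<and>
     disjoint_family (\<lambda>i. snd (u i)) \<and> (\<Union>i. snd (u i)) = space m \<and>
     (\<Sum>i. \<integral>\<^sup>+x\<in>snd (u i). ennreal (\<bar>g (fst (u i)) x\<bar> powr p) \<partial>m) < \<infinity>}"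

definition pfm_rel :: "'a measure \<Rightarrow> real \<Rightarrow>
    ('a \<Rightarrow> real) set \<Rightarrow> (('a \<Rightarrow> real) \<Rightarrow> 'a \<Rightarrow> real) \<Rightarrow> ('a pfm \<times> 'a pfm) set" where
  "pfm_rel m p D g = {(u, v) \<in> Pfm m p D g \<times> Pfm m p D g.
     \<forall>i j. AE x in m. x \<in> snd (u i) \<inter> snd (v j) \<longrightarrow> g (\<lambda>y. fst (u i) y - fst (v j) y) x = 0}"

text \<open>The doubly indexed families \<open>A\<^sub>i \<inter> B\<^sub>j\<close> are enumerated by \<^const>\<open>prod_decode\<close>. A simple function
  \<open>s\<close> is written as \<open>\<Sum>\<^sub>j a\<^sub>j \<chi>\<^sub>B\<^sub>j\<close> with \<open>a\<^sub>j\<close> its finitely many values, listed by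
  \<open>from_nat_into (range s)\<close>, and \<open>B\<^sub>j = s -` {a\<^sub>j}\<close>, which is empty once \<open>j\<close> exceeds the number of
  values.\<close>

definition pfm_add :: "'a pfm \<Rightarrow> 'a pfm \<Rightarrow> 'a pfm" where
  "pfm_add u v = (\<lambda>n. case prod_decode n of (i, j) \<Rightarrow>
     ((\<lambda>x. fst (u i) x + fst (v j) x), snd (u i) \<inter> snd (v j)))"

definition pfm_smult :: "('a \<Rightarrow> real) \<Rightarrow> 'a pfm \<Rightarrow> 'a pfm" where
  "pfm_smult s u = (\<lambda>n. case prod_decode n of (i, j) \<Rightarrow>
     ((\<lambda>x. from_nat_into (range s) j * fst (u i) x),
      snd (u i) \<inter> {x. to_nat_on (range s) (s x) = j}))"

definition pfm_single :: "'a measure \<Rightarrow> ('a \<Rightarrow> real) \<Rightarrow> 'a pfm" where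
  "pfm_single m f = (\<lambda>n. (f, if n = 0 then space m else {}))"

definition pfm_pnorm :: "(('a \<Rightarrow> real) \<Rightarrow> 'a \<Rightarrow> real) \<Rightarrow> 'a pfm \<Rightarrow> 'a \<Rightarrow> real" where
  "pfm_pnorm g u x = g (fst (u (THE i. x \<in> snd (u i)))) x"

text \<open>\<open>Pfm\<close> modulo \<open>\<sim>\<close>; here \<open>smult\<close> is meaningful for simple functions only.\<close>

definition pfm_module :: "'a measure \<Rightarrow> real \<Rightarrow>
    ('a \<Rightarrow> real) set \<Rightarrow> (('a \<Rightarrow> real) \<Rightarrow> 'a \<Rightarrow> real) \<Rightarrow> ('a, 'a pfm set) normed_mod" where
  "pfm_module m p D g = (let R = pfm_rel m p D g in
     \<lparr>carrier = Pfm m p D g // R, mult = undefined, one = undefined,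
      zero = R `` {pfm_single m (\<lambda>x. 0)},
      add = (\<lambda>U V. \<Union>u\<in>U. \<Union>v\<in>V. R `` {pfm_add u v}),
      smult = (\<lambda>s U. \<Union>u\<in>U. R `` {pfm_smult s u}),
      vnorm = (\<lambda>U. Lp_norm m p (pfm_pnorm g (SOME u. u \<in> U))),
      pnorm = (\<lambda>U. pfm_pnorm g (SOME u. u \<in> U))\<rparr>)"

text \<open>Completion by equivalence classes of Cauchy sequences. Multiplication is extended from simple
  functions to \<open>L\<^sup>\<infinity>\<close>, and norm and pointwise norm to the completion, by continuity.\<close>

definition Cauchy_rel :: "('a, 'v, 'z) normed_mod_scheme \<Rightarrow> ((nat \<Rightarrow> 'v) \<times> (nat \<Rightarrow> 'v)) set" where
  "Cauchy_rel N = {(u, v).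
     Metric_space.MCauchy (carrier N) (ndist N) u \<and> Metric_space.MCauchy (carrier N) (ndist N) v \<and>
     (\<lambda>n. ndist N (u n) (v n)) \<longlonglongrightarrow> 0}"

definition module_completion ::
    "'a measure \<Rightarrow> real \<Rightarrow> ('a, 'v, 'z) normed_mod_scheme \<Rightarrow> ('a, (nat \<Rightarrow> 'v) set) normed_mod" where
  "module_completion m p N = (let R = Cauchy_rel N in
     \<lparr>carrier = {u. Metric_space.MCauchy (carrier N) (ndist N) u} // R,
      mult = undefined, one = undefined,
      zero = R `` {\<lambda>_. \<zero>\<^bsub>N\<^esub>},
      add = (\<lambda>U V. \<Union>u\<in>U. \<Union>v\<in>V. R `` {\<lambda>n. u n \<oplus>\<^bsub>N\<^esub> v n}),
      smult = (\<lambda>f U. \<Union>u\<in>U. \<Union>s\<in>{s. (\<forall>n. simple_function m (s n)) \<and> Linf_tendsto m s f}.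
                 R `` {\<lambda>n. s n \<odot>\<^bsub>N\<^esub> u n}),
      vnorm = (\<lambda>U. lim (\<lambda>n. vnorm N ((SOME u. u \<in> U) n))),
      pnorm = (\<lambda>U. SOME G. G \<in> Lp_plus m p \<and>
                 (\<exists>u\<in>U. (\<lambda>n. Lp_norm m p (\<lambda>x. pnorm N (u n) x - G x)) \<longlonglongrightarrow> 0))\<rparr>)"

definition gen_module :: "'a measure \<Rightarrow> real \<Rightarrow>
    ('a \<Rightarrow> real) set \<Rightarrow> (('a \<Rightarrow> real) \<Rightarrow> 'a \<Rightarrow> real) \<Rightarrow>
    ('a, (nat \<Rightarrow> 'a pfm set) set) normed_mod" where
  "gen_module m p D g = module_completion m p (pfm_module m p D g)"

definition gen_diff :: "'a measure \<Rightarrow> real \<Rightarrow>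
    ('a \<Rightarrow> real) set \<Rightarrow> (('a \<Rightarrow> real) \<Rightarrow> 'a \<Rightarrow> real) \<Rightarrow> ('a \<Rightarrow> real) \<Rightarrow> (nat \<Rightarrow> 'a pfm set) set" where
  "gen_diff m p D g f =
     Cauchy_rel (pfm_module m p D g) `` {\<lambda>_. pfm_rel m p D g `` {pfm_single m f}}"

definition G0 :: "'a measure \<Rightarrow> real \<Rightarrow>
    ('a \<Rightarrow> real) set \<Rightarrow> (('a \<Rightarrow> real) \<Rightarrow> 'a \<Rightarrow> real) \<Rightarrow> (nat \<Rightarrow> 'a pfm set) set set" where
  "G0 m p D g = {\<omega> \<in> carrier (gen_module m p D g).
     \<exists>\<phi>. range \<phi> \<subseteq> D \<and> L0_tendsto m \<phi> (\<lambda>x. 0) \<and>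
       limitin (ntopology (gen_module m p D g)) (\<lambda>n. gen_diff m p D g (\<phi> n)) \<omega> sequentially}"

definition weakly_reflexive :: "'a measure \<Rightarrow> real \<Rightarrow>
    ('a \<Rightarrow> real) set \<Rightarrow> (('a \<Rightarrow> real) \<Rightarrow> 'a \<Rightarrow> real) \<Rightarrow> bool" where
  "weakly_reflexive m p D g \<longleftrightarrow>
     (\<forall>\<phi>. \<forall>f\<in>borel_measurable m. range \<phi> \<subseteq> D \<longrightarrow> L0_tendsto m \<phi> f \<longrightarrow>
        (\<exists>C. \<forall>n. vnorm (gen_module m p D g) (gen_diff m p D g (\<phi> n)) \<le> C) \<longrightarrow>
        (\<exists>r \<omega>. strict_mono (r :: nat \<Rightarrow> nat) \<and>
           weakly_tendsto (gen_module m p D g) (\<lambda>n. gen_diff m p D g (\<phi> (r n))) \<omega>))"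

end

theory Submission
  imports Defs
begin

text \<open>For \<open>f \<in> L\<^sup>0\<close> let \<open>T f\<close> be the set of limits in \<open>\<M>\<close> of sequences \<open>d \<phi>\<^sub>n\<close> with \<open>\<phi>\<^sub>n \<rightarrow> f\<close> a.e. By Mazur's
  lemma, applied once in \<open>L\<^sup>p\<close> and once in \<open>\<M>\<close>, weak reflexivity turns every weak limit of \<open>g\<^bsub>\<phi>\<^sub>n\<^esub>\<close> into an
  upper bound of some \<open>|\<omega>|\<close> with \<open>\<omega> \<in> T f\<close>, so the relaxation of \<open>f\<close> is the essential infimum of \<open>|\<omega>|\<close>
  over \<open>T f\<close>. For \<open>f \<in> D\<close> one has \<open>T f = d f + T 0\<close> and \<open>\<M>\<^sub>0\<close> is the closure of the simple combinations of
  elements of \<open>T 0 = \<G>\<^sub>0\<close>, whence the relaxation of \<open>f\<close> is the pointwise norm of the coset of \<open>d f\<close> in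
  \<open>\<M>/\<M>\<^sub>0\<close>. Two linear families with equal pointwise norms generate isometric modules.\<close>

section \<open>The spaces \<open>L\<^sup>p\<close>\<close>

text \<open>Two mismatches shape the proof. The map \<open>g\<close> is only sublinear, so a weak
  limit of \<open>g (\<phi> n)\<close> need not be the pointwise norm of a weak limit of
  \<open>d (\<phi> n)\<close>, and the values \<open>g \<psi>\<close> need not form a convex set;
  their a.e. upper bounds do. Mazur's lemma is therefore applied to upper bounds in L^p, and the
  resulting constraint is convex and survives the second application. Convex combinations are
  confined to pointwise hulls of tails, which preserves the a.e. limit. The other mismatch: for
  \<open>f\<close> in \<open>D\<close> the set \<open>T f\<close> is a coset of \<open>G0\<close>
  only, while \<open>M\<^sub>0\<close> also contains pieces of different elements pasted along Borel
  sets, and limits of these. The inequality between the relaxation of \<open>f\<close> and |d f +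
  \<eta>| is local and closed, so it passes from \<eta> in \<open>G0\<close> to all of
  \<open>M\<^sub>0\<close>. Pasting inside a coset is also what makes the infimum of the norms equal
  to the norm of the essential infimum. Isometries are built as closed relations between two
  modules, so that well-definedness and injectivity come from one symmetric argument, the equality
  of pointwise norms.\<close>

lemma LpD: "f \<in> Lp m p \<Longrightarrow> f \<in> borel_measurable m" "f \<in> Lp m p \<Longrightarrow> integrable m (\<lambda>x. \<bar>f x\<bar> powr p)"
  by (auto simp: Lp_def)

lemmas Lp_measurable [measurable_dest] = LpD(1)

lemma Lp_plusD: "f \<in> Lp_plus m p \<Longrightarrow> f \<in> Lp m p" "f \<in> Lp_plus m p \<Longrightarrow> AE x in m. 0 \<le> f x"
  by (auto simp: Lp_plus_def)

lemma Lp_norm_nonneg [simp]: "0 \<le> Lp_norm m p f"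
  by (simp add: Lp_norm_def)

lemma Lp_norm_powr: "0 < p \<Longrightarrow> Lp_norm m p f powr p = (\<integral>x. \<bar>f x\<bar> powr p \<partial>m)"
  by (simp add: Lp_norm_def powr_powr)

lemma nn_integral_Lp:
  assumes "0 < p" "f \<in> Lp m p"
  shows "(\<integral>\<^sup>+x. ennreal (\<bar>f x\<bar> powr p) \<partial>m) = ennreal (Lp_norm m p f powr p)"
  using assms by (simp add: Lp_norm_powr nn_integral_eq_integral LpD)

text \<open>One bound on the extended integral yields both membership and the norm estimate; this is
  the form in which monotonicity and Fatou's lemma deliver it.\<close>

lemma Lp_boundI:
  assumes p: "0 < p" and f: "f \<in> borel_measurable m" and c: "0 \<le> c"
    and le: "(\<integral>\<^sup>+x. ennreal (\<bar>f x\<bar> powr p) \<partial>m) \<le> ennreal (c powr p)"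
  shows "f \<in> Lp m p" "Lp_norm m p f \<le> c"
proof -
  have "integrable m (\<lambda>x. \<bar>f x\<bar> powr p)"
    unfolding integrable_iff_bounded
    using f le by (auto intro: le_less_trans[OF le])
  then show L: "f \<in> Lp m p" using f by (simp add: Lp_def)
  have "Lp_norm m p f powr p \<le> c powr p"
    using le nn_integral_Lp[OF p L] by simp
  then show "Lp_norm m p f \<le> c"
    using p c by (meson not_le powr_less_mono2)
qed

lemma Lp_dominated:
  assumes "0 < p" "f \<in> borel_measurable m" "g \<in> Lp m p" "AE x in m. \<bar>f x\<bar> \<le> \<bar>g x\<bar>"
  shows "f \<in> Lp m p" "Lp_norm m p f \<le> Lp_norm m p g"
proof -
  have "(\<integral>\<^sup>+x. ennreal (\<bar>f x\<bar> powr p) \<partial>m) \<le> (\<integral>\<^sup>+x. ennreal (\<bar>g x\<bar> powr p) \<partial>m)"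
    using assms(4) by (intro nn_integral_mono_AE) (use assms(1) in \<open>auto intro!: ennreal_leI powr_mono2 elim!: eventually_mono\<close>)
  also have "\<dots> = ennreal (Lp_norm m p g powr p)" using assms by (simp add: nn_integral_Lp)
  finally show "f \<in> Lp m p" "Lp_norm m p f \<le> Lp_norm m p g"
    using Lp_boundI[OF assms(1,2) Lp_norm_nonneg] by auto
qed

lemma Lp_norm_cong_AE:
  assumes "f \<in> borel_measurable m" "g \<in> borel_measurable m" "AE x in m. \<bar>f x\<bar> = \<bar>g x\<bar>"
  shows "Lp_norm m p f = Lp_norm m p g"
proof -
  have "(\<integral>x. \<bar>f x\<bar> powr p \<partial>m) = (\<integral>x. \<bar>g x\<bar> powr p \<partial>m)"
    using assms by (intro integral_cong_AE) (auto elim!: eventually_mono)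
  then show ?thesis by (simp add: Lp_norm_def)
qed

lemma Lp_norm_abs [simp]: "Lp_norm m p (\<lambda>x. \<bar>f x\<bar>) = Lp_norm m p f"
  by (simp add: Lp_norm_def)

lemma Lp_norm_minus_commute: "Lp_norm m p (\<lambda>x. f x - g x) = Lp_norm m p (\<lambda>x. g x - f x)"
  by (simp add: Lp_norm_def abs_minus_commute)

lemma Lp_norm_zero [simp]: "Lp_norm m p (\<lambda>x. 0) = 0"
  by (simp add: Lp_norm_def)

lemma Lp_zero [simp]: "(\<lambda>x. 0) \<in> Lp m p"
  by (simp add: Lp_def)

lemma Lp_scale: "f \<in> Lp m p \<Longrightarrow> (\<lambda>x. c * f x) \<in> Lp m p"
  by (auto simp: Lp_def abs_mult powr_mult)

lemma Lp_norm_scale: "0 < p \<Longrightarrow> Lp_norm m p (\<lambda>x. c * f x) = \<bar>c\<bar> * Lp_norm m p f"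
  by (simp add: Lp_norm_def abs_mult powr_mult powr_powr)

lemma Lp_abs: "f \<in> Lp m p \<Longrightarrow> (\<lambda>x. \<bar>f x\<bar>) \<in> Lp m p"
  by (auto simp: Lp_def)

lemma Lp_uminus: "f \<in> Lp m p \<Longrightarrow> (\<lambda>x. - f x) \<in> Lp m p"
  by (auto simp: Lp_def)

lemma Lp_cong_AE:
  assumes "f \<in> Lp m p" "g \<in> borel_measurable m" "AE x in m. f x = g x"
  shows "g \<in> Lp m p"
proof -
  have "integrable m (\<lambda>x. \<bar>g x\<bar> powr p) = integrable m (\<lambda>x. \<bar>f x\<bar> powr p)"
    using assms by (intro integrable_cong_AE) (auto simp: Lp_def elim!: eventually_mono)
  then show ?thesis using assms by (auto simp: Lp_def)
qed

lemma Lp_add: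
  assumes p: "0 < p" and "f \<in> Lp m p" "g \<in> Lp m p"
  shows "(\<lambda>x. f x + g x) \<in> Lp m p"
proof -
  \<comment> \<open>The crude constant \<open>2 powr p\<close> is harmless, since only integrability
    is at stake.\<close>
  have *: "\<bar>a + b\<bar> powr p \<le> 2 powr p * (\<bar>a\<bar> powr p + \<bar>b\<bar> powr p)" for a b :: real
  proof -
    have "\<bar>a + b\<bar> powr p \<le> (2 * max \<bar>a\<bar> \<bar>b\<bar>) powr p"
      using p by (intro powr_mono2) auto
    also have "\<dots> \<le> 2 powr p * (\<bar>a\<bar> powr p + \<bar>b\<bar> powr p)"
      by (auto simp: powr_mult max_def)
    finally show ?thesis .
  qed
  have "integrable m (\<lambda>x. \<bar>f x + g x\<bar> powr p)"
    by (rule Bochner_Integration.integrable_bound[where f="\<lambda>x. 2 powr p * (\<bar>f x\<bar> powr p + \<bar>g x\<bar> powr p)"])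
      (use assms * in \<open>auto simp: Lp_def\<close>)
  then show ?thesis using assms by (auto simp: Lp_def)
qed

lemma Lp_diff: "0 < p \<Longrightarrow> f \<in> Lp m p \<Longrightarrow> g \<in> Lp m p \<Longrightarrow> (\<lambda>x. f x - g x) \<in> Lp m p"
  using Lp_add[of p f m "\<lambda>x. - g x"] Lp_uminus[of g m p] by simp

lemma Lp_max:
  assumes "0 < p" "f \<in> Lp m p" "g \<in> Lp m p" shows "(\<lambda>x. max (f x) (g x)) \<in> Lp m p"
  by (rule Lp_dominated(1)[OF assms(1) _ Lp_add[OF assms(1) Lp_abs[OF assms(2)] Lp_abs[OF assms(3)]]])
    (use LpD(1)[OF assms(2)] LpD(1)[OF assms(3)] in auto)

lemma Lp_norm_eq_0:
  assumes p: "0 < p" and f: "f \<in> Lp m p" and "Lp_norm m p f = 0"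
  shows "AE x in m. f x = 0"
proof -
  have "(\<integral>\<^sup>+x. ennreal (\<bar>f x\<bar> powr p) \<partial>m) = 0"
    using nn_integral_Lp[OF p f] assms(3) by simp
  then have "AE x in m. ennreal (\<bar>f x\<bar> powr p) = 0"
    using f by (subst (asm) nn_integral_0_iff_AE) (auto simp: LpD(2) dest: LpD(1))
  then show ?thesis by (auto elim!: eventually_mono)
qed

section \<open>Minkowski's inequality and order under limits in norm\<close>

lemma powr_convex_nonneg:
  fixes x y :: real
  assumes "1 \<le> p" "0 \<le> x" "0 \<le> y" "0 \<le> u" "0 \<le> v" "u + v = 1"
  shows "(u * x + v * y) powr p \<le> u * x powr p + v * y powr p"
proof -
  have le: "t powr p \<le> t" if "0 \<le> t" "t \<le> 1" for t :: real
    using powr_mono'[of 1 p t] that assms by (cases "t = 0") auto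
  \<comment> \<open>A vanishing argument leaves a single term, and the claim becomes
    \<open>t powr p \<le> t\<close> for a weight \<open>t\<close> in [0, 1]; convexity of the power
    on positive numbers settles the rest.\<close>
  consider "x = 0" | "y = 0" | "0 < x" "0 < y" using assms by linarith
  then show ?thesis
  proof cases
    case 1 then show ?thesis
      using assms le[of v] by (auto simp: powr_mult intro!: mult_right_mono)
  next
    case 2 then show ?thesis
      using assms le[of u] by (auto simp: powr_mult intro!: mult_right_mono)
  next
    case 3
    show ?thesis
    proof -
      have "u = 1 - v" using assms by simp
      then show ?thesis
        using convex_onD[OF powr_convex[OF assms(1)], of v x y] 3 assms(4,5) by simp
    qed
  qed
qed

text \<open>Normalising by the two norms a and b writes (|f| + |g|) / (a + b) as the convex
  combination of |f| / a and |g| / b with weights a / (a + b) and b / (a + b). Convexity of the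
  power gives a bound whose integral is (a + b)^p. A vanishing norm is treated apart because of the
  division.\<close>

lemma Lp_norm_triangle:
  assumes p: "1 \<le> p" and f: "f \<in> Lp m p" and g: "g \<in> Lp m p"
  shows "Lp_norm m p (\<lambda>x. f x + g x) \<le> Lp_norm m p f + Lp_norm m p g"
proof -
  have p0: "0 < p" using p by simp
  let ?a = "Lp_norm m p f" and ?b = "Lp_norm m p g"
  consider "?a = 0" | "?b = 0" | "?a > 0" "?b > 0" using Lp_norm_nonneg[of m p f] Lp_norm_nonneg[of m p g] by linarith
  then show ?thesis
  proof cases
    case 1
    then have "AE x in m. f x = 0" using Lp_norm_eq_0[OF p0 f] by simp
    then have "Lp_norm m p (\<lambda>x. f x + g x) = ?b"
      using LpD(1)[OF f] LpD(1)[OF g] by (intro Lp_norm_cong_AE) (auto elim!: eventually_mono)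
    then show ?thesis using 1 by simp
  next
    case 2
    then have "AE x in m. g x = 0" using Lp_norm_eq_0[OF p0 g] by simp
    then have "Lp_norm m p (\<lambda>x. f x + g x) = ?a"
      using LpD(1)[OF f] LpD(1)[OF g] by (intro Lp_norm_cong_AE) (auto elim!: eventually_mono)
    then show ?thesis using 2 by simp
  next
    case 3
    define s where "s = ?a + ?b"
    have s: "s > 0" using 3 by (simp add: s_def)
    have pt: "\<bar>f x + g x\<bar> powr p \<le> s powr p * (?a / s * (\<bar>f x\<bar> powr p / ?a powr p) + ?b / s * (\<bar>g x\<bar> powr p / ?b powr p))" for x
    proof -
      have "\<bar>f x + g x\<bar> powr p \<le> (\<bar>f x\<bar> + \<bar>g x\<bar>) powr p"
        using p by (intro powr_mono2) auto
      also have "\<bar>f x\<bar> + \<bar>g x\<bar> = s * (?a / s * (\<bar>f x\<bar> / ?a) + ?b / s * (\<bar>g x\<bar> / ?b))"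
        using 3 s by (simp add: field_simps)
      also have "\<dots> powr p = s powr p * (?a / s * (\<bar>f x\<bar> / ?a) + ?b / s * (\<bar>g x\<bar> / ?b)) powr p"
        using s 3 by (simp add: powr_mult)
      also have "\<dots> \<le> s powr p * (?a / s * (\<bar>f x\<bar> / ?a) powr p + ?b / s * (\<bar>g x\<bar> / ?b) powr p)"
        using p 3 s by (intro mult_left_mono powr_convex_nonneg) (auto simp: s_def divide_simps)
      finally show ?thesis using 3 by (simp add: powr_divide)
    qed
    have "(\<integral>x. \<bar>f x + g x\<bar> powr p \<partial>m) \<le>
      (\<integral>x. s powr p * (?a / s * (\<bar>f x\<bar> powr p / ?a powr p) + ?b / s * (\<bar>g x\<bar> powr p / ?b powr p)) \<partial>m)"
      using f g Lp_add[OF p0 f g] pt by (intro integral_mono) (auto simp: LpD(2) dest: LpD(1))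
    also have "\<dots> = s powr p * (?a / s * (?a powr p / ?a powr p) + ?b / s * (?b powr p / ?b powr p))"
      using f g p0 by (simp add: LpD Lp_norm_powr)
    also have "\<dots> = s powr p" using 3 s by (simp add: s_def divide_simps)
    finally have "Lp_norm m p (\<lambda>x. f x + g x) powr p \<le> s powr p" using p0 by (simp add: Lp_norm_powr)
    then show ?thesis using p0 s unfolding s_def by (meson not_le powr_less_mono2 less_imp_le)
  qed
qed

lemma Lp_norm_triangle_diff:
  assumes "1 \<le> p" "f \<in> Lp m p" "g \<in> Lp m p"
  shows "\<bar>Lp_norm m p f - Lp_norm m p g\<bar> \<le> Lp_norm m p (\<lambda>x. f x - g x)"
  using Lp_norm_triangle[of p "\<lambda>x. f x - g x" m g] Lp_norm_triangle[of p "\<lambda>x. g x - f x" m f]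
    assms Lp_diff[of p f m g] Lp_diff[of p g m f] Lp_norm_minus_commute[of m p f g] by auto

text \<open>The positive part of F - H is dominated by |f n - F| + |h n - H| because f n \<le> h n,
  so its norm is 0. This way no a.e. convergent subsequence has to be extracted.\<close>

lemma Lp_le_limit:
  assumes p: "1 \<le> p" and f: "\<And>n. f n \<in> Lp m p" "F \<in> Lp m p" and h: "\<And>n. h n \<in> Lp m p" "H \<in> Lp m p"
    and le: "\<And>n. AE x in m. f n x \<le> h n x"
    and lf: "(\<lambda>n. Lp_norm m p (\<lambda>x. f n x - F x)) \<longlonglongrightarrow> 0"
    and lh: "(\<lambda>n. Lp_norm m p (\<lambda>x. h n x - H x)) \<longlonglongrightarrow> 0"
  shows "AE x in m. F x \<le> H x"
proof -
  have p0: "0 < p" using p by simp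
  let ?k = "\<lambda>x. max 0 (F x - H x)"
  have k: "?k \<in> Lp m p" using f h p0 by (intro Lp_max Lp_diff) auto
  have "Lp_norm m p ?k \<le> Lp_norm m p (\<lambda>x. f n x - F x) + Lp_norm m p (\<lambda>x. h n x - H x)" for n
  proof -
    have "Lp_norm m p ?k \<le> Lp_norm m p (\<lambda>x. \<bar>f n x - F x\<bar> + \<bar>h n x - H x\<bar>)"
      by (rule Lp_dominated(2)[OF p0]) (use k f h p0 le[of n] in \<open>auto dest: LpD(1) intro!: Lp_add Lp_abs Lp_diff elim!: eventually_mono\<close>)
    also have "\<dots> \<le> Lp_norm m p (\<lambda>x. \<bar>f n x - F x\<bar>) + Lp_norm m p (\<lambda>x. \<bar>h n x - H x\<bar>)"
      using p f h p0 by (intro Lp_norm_triangle) (auto intro!: Lp_abs Lp_diff)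
    finally show ?thesis by simp
  qed
  moreover have "(\<lambda>n. Lp_norm m p (\<lambda>x. f n x - F x) + Lp_norm m p (\<lambda>x. h n x - H x)) \<longlonglongrightarrow> 0"
    using tendsto_add[OF lf lh] by simp
  ultimately have "Lp_norm m p ?k \<le> 0"
    by (meson LIMSEQ_le_const)
  then have "AE x in m. ?k x = 0" using Lp_norm_eq_0[OF p0 k] by (meson Lp_norm_nonneg order_antisym)
  then show ?thesis by (auto elim!: eventually_mono simp: max_def split: if_splits)
qed

lemma Lp_limit_unique:
  assumes "1 \<le> p" "\<And>n. f n \<in> Lp m p" "F \<in> Lp m p" "H \<in> Lp m p"
    "(\<lambda>n. Lp_norm m p (\<lambda>x. f n x - F x)) \<longlonglongrightarrow> 0" "(\<lambda>n. Lp_norm m p (\<lambda>x. f n x - H x)) \<longlonglongrightarrow> 0"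
  shows "AE x in m. F x = H x"
  using Lp_le_limit[of p f m F f H] Lp_le_limit[of p f m H f F] assms by auto

section \<open>Completeness of L^p\<close>

lemma fast_Cauchy_subsequence:
  fixes d :: "nat \<Rightarrow> nat \<Rightarrow> real"
  assumes "\<And>e. 0 < e \<Longrightarrow> \<exists>N. \<forall>n\<ge>N. \<forall>k\<ge>N. d n k < e"
  obtains r where "strict_mono r" "\<And>k n. r k \<le> n \<Longrightarrow> d (r k) n < (1/2)^k"
proof -
  have "\<exists>N. \<forall>n\<ge>N. \<forall>k\<ge>N. d n k < (1/2)^i" for i :: nat using assms[of "(1/2)^i"] by simp
  then obtain N where N: "\<And>i n k. N i \<le> n \<Longrightarrow> N i \<le> k \<Longrightarrow> d n k < (1/2)^i" by metis
  \<comment> \<open>Summing all earlier thresholds keeps \<open>r i\<close> above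
    \<open>N i\<close>; the summand \<open>i\<close> makes \<open>r\<close> strictly
    increasing.\<close>
  define r where "r i = (\<Sum>j\<le>i. N j) + i" for i
  have "strict_mono r" by (rule strict_mono_Suc_iff[THEN iffD2]) (simp add: r_def)
  moreover have "N i \<le> r i" for i
    unfolding r_def using member_le_sum[of i "{..i}" N] by simp
  then have "d (r k) n < (1/2)^k" if "r k \<le> n" for k n
    using N[of k "r k" n] that by (meson le_trans)
  ultimately show ?thesis using that by blast
qed

lemma Lp_norm_sum_le:
  fixes n :: nat
  assumes "1 \<le> p" "\<And>k. f k \<in> Lp m p"
  shows "(\<lambda>x. \<Sum>k<n. f k x) \<in> Lp m p \<and> Lp_norm m p (\<lambda>x. \<Sum>k<n. f k x) \<le> (\<Sum>k<n. Lp_norm m p (f k))"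
proof (induction n)
  case (Suc n)
  then show ?case
    using assms Lp_norm_triangle[of p "\<lambda>x. \<Sum>k<n. f k x" m "f n"] Lp_add[of p "\<lambda>x. \<Sum>k<n. f k x" m "f n"]
    by (auto intro: order_trans)
qed simp

text \<open>Riesz-Fischer. Along a subsequence with increments below 2^-k the sums of absolute
  increments have norm at most 2, hence are bounded a.e. by monotone convergence, and the
  subsequence converges a.e. Fatou's lemma then compares the whole sequence with this limit.\<close>

theorem Lp_complete:
  assumes p: "1 \<le> p" and f: "\<And>n. f n \<in> Lp m p"
    and C: "\<And>e. 0 < e \<Longrightarrow> \<exists>N. \<forall>n\<ge>N. \<forall>k\<ge>N. Lp_norm m p (\<lambda>x. f n x - f k x) < e"
  obtains F where "F \<in> Lp m p" "(\<lambda>n. Lp_norm m p (\<lambda>x. f n x - F x)) \<longlonglongrightarrow> 0"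
proof -
  have p0: "0 < p" using p by simp
  have [measurable]: "f n \<in> borel_measurable m" for n using LpD(1)[OF f] .
  obtain r where r: "strict_mono r" and rk: "\<And>k n. r k \<le> n \<Longrightarrow> Lp_norm m p (\<lambda>x. f (r k) x - f n x) < (1/2)^k"
    using fast_Cauchy_subsequence[OF C] by metis
  define h where "h k x = \<bar>f (r k) x - f (r (Suc k)) x\<bar>" for k x
  define S where "S n x = (\<Sum>k<n. h k x)" for n x
  have [measurable]: "h k \<in> borel_measurable m" for k unfolding h_def by measurable
  have [measurable]: "S n \<in> borel_measurable m" for n unfolding S_def by measurable
  have h: "h k \<in> Lp m p" for k unfolding h_def using f p0 by (intro Lp_abs Lp_diff)
  have Sn: "0 \<le> S n x" for n x by (simp add: S_def h_def sum_nonneg)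
  have hk: "Lp_norm m p (h k) \<le> (1/2)^k" for k
    unfolding h_def using rk[of k "r (Suc k)"] r by (simp add: strict_mono_less_eq less_imp_le)
  have "(\<Sum>k<n. Lp_norm m p (h k)) \<le> 2" for n
  proof -
    have "(\<Sum>k<n. Lp_norm m p (h k)) \<le> (\<Sum>k<n. (1/2)^k)" by (intro sum_mono hk)
    also have "\<dots> \<le> 2" by (simp add: geometric_sum)
    finally show ?thesis .
  qed
  then have S: "S n \<in> Lp m p" "Lp_norm m p (S n) \<le> 2" for n
    unfolding S_def using Lp_norm_sum_le[of p h m n, OF p h] by (auto intro: order.trans)
  have "(\<integral>\<^sup>+x. (SUP n. ennreal (S n x powr p)) \<partial>m) = (SUP n. \<integral>\<^sup>+x. ennreal (S n x powr p) \<partial>m)"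
  proof (intro nn_integral_monotone_convergence_SUP)
    show "incseq (\<lambda>n x. ennreal (S n x powr p))"
      by (intro incseq_SucI le_funI ennreal_leI powr_mono2) (use p0 Sn in \<open>auto simp: S_def h_def\<close>)
  qed measurable
  also have "\<dots> \<le> ennreal (2 powr p)"
  proof (intro SUP_least)
    fix n
    have "(\<integral>\<^sup>+x. ennreal (S n x powr p) \<partial>m) = (\<integral>\<^sup>+x. ennreal (\<bar>S n x\<bar> powr p) \<partial>m)" using Sn by simp
    also have "\<dots> = ennreal (Lp_norm m p (S n) powr p)" using nn_integral_Lp[OF p0 S(1)] .
    also have "\<dots> \<le> ennreal (2 powr p)" using S(2) p0 by (intro ennreal_leI powr_mono2) auto
    finally show "(\<integral>\<^sup>+x. ennreal (S n x powr p) \<partial>m) \<le> ennreal (2 powr p)" .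
  qed
  finally have "(\<integral>\<^sup>+x. (SUP n. ennreal (S n x powr p)) \<partial>m) < \<infinity>"
    by (auto intro: le_less_trans)
  then have fin: "AE x in m. (SUP n. ennreal (S n x powr p)) \<noteq> \<infinity>"
    by (intro nn_integral_PInf_AE) auto
  have conv: "convergent (\<lambda>k. f (r k) x)" if fx: "(SUP n. ennreal (S n x powr p)) \<noteq> \<infinity>" for x
  proof -
    obtain c where c: "0 \<le> c" "(SUP n. ennreal (S n x powr p)) = ennreal c"
      using fx by (cases "(SUP n. ennreal (S n x powr p))") auto
    have "S n x \<le> c powr (1/p)" for n
    proof -
      have "ennreal (S n x powr p) \<le> ennreal c" unfolding c(2)[symmetric] by (rule SUP_upper) simp
      then have "S n x powr p \<le> c" using c by simp
      then have "(S n x powr p) powr (1/p) \<le> c powr (1/p)" using p0 by (intro powr_mono2) auto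
      then show ?thesis using p0 Sn[of n x] by (simp add: powr_powr)
    qed
    then have "summable (\<lambda>k. h k x)"
      unfolding S_def by (intro summableI_nonneg_bounded) (auto simp: h_def)
    then have "summable (\<lambda>k. \<bar>f (r k) x - f (r (Suc k)) x\<bar>)" by (simp add: h_def)
    then have "summable (\<lambda>k. f (r k) x - f (r (Suc k)) x)" by (rule summable_rabs_cancel)
    then have "convergent (\<lambda>n. \<Sum>k<n. f (r k) x - f (r (Suc k)) x)" by (simp add: summable_iff_convergent)
    moreover have "(\<Sum>k<n. f (r k) x - f (r (Suc k)) x) = f (r 0) x - f (r n) x" for n
      by (induction n) auto
    ultimately have "convergent (\<lambda>n. f (r 0) x - f (r n) x)" by simp
    then have "convergent (\<lambda>n. f (r 0) x - (f (r 0) x - f (r n) x))"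
      by (rule convergent_diff[OF convergent_const])
    then show ?thesis by simp
  qed
  \<comment> \<open>On the null set where the subsequence may diverge \<open>lim\<close> takes some
    default value, which is harmless.\<close>
  define F where "F x = lim (\<lambda>k. f (r k) x)" for x
  have [measurable]: "F \<in> borel_measurable m" unfolding F_def by measurable
  have AEF: "AE x in m. (\<lambda>k. f (r k) x) \<longlonglongrightarrow> F x"
    using fin by eventually_elim (use conv in \<open>auto simp: F_def convergent_LIMSEQ_iff\<close>)
  \<comment> \<open>Fatou's lemma gives membership in L^p only for the differences f n - F with
    large \<open>n\<close>; \<open>F\<close> itself is recovered below as f N - (f N - F).\<close>
  have main: "\<exists>N. \<forall>n\<ge>N. (\<lambda>x. f n x - F x) \<in> Lp m p \<and> Lp_norm m p (\<lambda>x. f n x - F x) \<le> e" if e: "0 < e" for e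
  proof -
    obtain N where N: "\<And>n k. N \<le> n \<Longrightarrow> N \<le> k \<Longrightarrow> Lp_norm m p (\<lambda>x. f n x - f k x) < e" using C[OF e] by auto
    have "(\<lambda>x. f n x - F x) \<in> Lp m p \<and> Lp_norm m p (\<lambda>x. f n x - F x) \<le> e" if n: "N \<le> n" for n
    proof -
      have "AE x in m. ennreal (\<bar>f n x - F x\<bar> powr p) = liminf (\<lambda>k. ennreal (\<bar>f n x - f (r k) x\<bar> powr p))"
        using AEF
      proof eventually_elim
        fix x assume "(\<lambda>k. f (r k) x) \<longlonglongrightarrow> F x"
        then have "(\<lambda>k. ennreal (\<bar>f n x - f (r k) x\<bar> powr p)) \<longlonglongrightarrow> ennreal (\<bar>f n x - F x\<bar> powr p)"
          using p0 by (intro tendsto_intros tendsto_ennrealI tendsto_powr') auto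
        then show "ennreal (\<bar>f n x - F x\<bar> powr p) = liminf (\<lambda>k. ennreal (\<bar>f n x - f (r k) x\<bar> powr p))"
          using lim_imp_Liminf[OF sequentially_bot] by metis
      qed
      then have "(\<integral>\<^sup>+x. ennreal (\<bar>f n x - F x\<bar> powr p) \<partial>m) = (\<integral>\<^sup>+x. liminf (\<lambda>k. ennreal (\<bar>f n x - f (r k) x\<bar> powr p)) \<partial>m)"
        by (rule nn_integral_cong_AE)
      also have "\<dots> \<le> liminf (\<lambda>k. \<integral>\<^sup>+x. ennreal (\<bar>f n x - f (r k) x\<bar> powr p) \<partial>m)"
        by (rule nn_integral_liminf) measurable
      also have "\<dots> \<le> ennreal (e powr p)"
      proof (rule Liminf_le)
        show "\<forall>\<^sub>F k in sequentially. (\<integral>\<^sup>+x. ennreal (\<bar>f n x - f (r k) x\<bar> powr p) \<partial>m) \<le> ennreal (e powr p)"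
        proof (rule eventually_sequentiallyI)
          fix k assume "N \<le> k"
          then have "N \<le> r k" using seq_suble[OF r, of k] by linarith
          then have "Lp_norm m p (\<lambda>x. f n x - f (r k) x) \<le> e" using N[OF n] by (simp add: less_imp_le)
          then show "(\<integral>\<^sup>+x. ennreal (\<bar>f n x - f (r k) x\<bar> powr p) \<partial>m) \<le> ennreal (e powr p)"
            using nn_integral_Lp[OF p0 Lp_diff[OF p0 f f], of n "r k"] p0 by (auto intro!: ennreal_leI powr_mono2)
        qed
      qed simp
      finally show ?thesis using Lp_boundI[OF p0, of "\<lambda>x. f n x - F x" m e] e by simp
    qed
    then show ?thesis by blast
  qed
  obtain N where "(\<lambda>x. f N x - F x) \<in> Lp m p" using main[of 1] by auto
  from Lp_diff[OF p0 f[of N] this] have "F \<in> Lp m p" by simp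
  moreover have "(\<lambda>n. Lp_norm m p (\<lambda>x. f n x - F x)) \<longlonglongrightarrow> 0"
  proof (rule LIMSEQ_I)
    fix e :: real assume "0 < e"
    then obtain N where "\<forall>n\<ge>N. Lp_norm m p (\<lambda>x. f n x - F x) \<le> e/2" using main[of "e/2"] by auto
    then show "\<exists>N. \<forall>n\<ge>N. norm (Lp_norm m p (\<lambda>x. f n x - F x) - 0) < e" using \<open>0 < e\<close> by (intro exI[of _ N]) force
  qed
  ultimately show ?thesis using that by blast
qed

text \<open>The answer is the infimum of a countable subfamily whose p-th power integral is minimal
  among all countable subfamilies: adding one more member \<open>v\<close> cannot lower this finite
  integral, so the infimum already lies a.e. below \<open>v\<close>. The minimum is attained by
  merging a minimising sequence of subfamilies.\<close>

lemma Lp_essential_infimum: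
  assumes p: "0 < p" and W: "W \<noteq> {}" "W \<subseteq> Lp_plus m p"
  obtains w G where "range w \<subseteq> W" "G \<in> Lp_plus m p" "\<And>x. G x = (INF n::nat. \<bar>w n x\<bar>)"
    "\<And>v. v \<in> W \<Longrightarrow> AE x in m. G x \<le> v x"
    "\<And>H. (\<And>v. v \<in> W \<Longrightarrow> AE x in m. H x \<le> v x) \<Longrightarrow> AE x in m. H x \<le> G x"
proof -
  \<comment> \<open>The absolute values bound the family below at every point, not just a.e., so
    that the infimum of reals behaves well everywhere.\<close>
  define I where "I w x = (INF n::nat. \<bar>w n x\<bar>)" for w :: "nat \<Rightarrow> 'a \<Rightarrow> real" and x
  define J where "J w = (\<integral>\<^sup>+x. ennreal (I w x powr p) \<partial>m)" for w
  have Wm: "v \<in> borel_measurable m" if "v \<in> W" for v using that W by (auto dest!: Lp_plusD(1) LpD(1))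
  have Im: "I w \<in> borel_measurable m" if "range w \<subseteq> W" for w
  proof -
    have [measurable]: "w n \<in> borel_measurable m" for n using that Wm by auto
    show ?thesis unfolding I_def[abs_def]
      by (rule borel_measurable_cINF) (auto intro!: bdd_belowI2[of _ 0])
  qed
  have I0: "0 \<le> I w x" for w x unfolding I_def by (auto intro!: cINF_greatest)
  have Ile: "I w x \<le> \<bar>w n x\<bar>" for w n x unfolding I_def by (rule cINF_lower) (auto intro!: bdd_belowI2[of _ 0])
  have Imono: "I w x \<le> I w' x" if "range w' \<subseteq> range w" for w w' x
    unfolding I_def
  proof (rule cINF_greatest)
    fix n
    have "w' n \<in> range w" using that by blast
    then obtain k where "w' n = w k" by blast
    then show "(INF n. \<bar>w n x\<bar>) \<le> \<bar>w' n x\<bar>" using Ile[of w x k] by (simp add: I_def)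
  qed simp
  have Jmono: "J w \<le> J w'" if "range w' \<subseteq> range w" for w w'
    unfolding J_def using Imono[OF that] p I0 by (intro nn_integral_mono ennreal_leI powr_mono2) auto
  let ?S = "{w :: nat \<Rightarrow> 'a \<Rightarrow> real. range w \<subseteq> W}"
  have S: "?S \<noteq> {}"
  proof -
    obtain v where "v \<in> W" using W by auto
    then have "(\<lambda>_::nat. v) \<in> ?S" by auto
    then show ?thesis by blast
  qed
  obtain y where y: "range y \<subseteq> J ` ?S" "(INF w\<in>?S. J w) = (INF i::nat. y i)"
  proof -
    have "J ` ?S \<noteq> {}" using S by (rule contrapos_nn) (rule image_is_empty[THEN iffD1])
    from ennreal_Inf_countable_INF[OF this] show ?thesis by (elim exE conjE) (rule that)
  qed
  have "\<exists>w. range w \<subseteq> W \<and> y i = J w" for i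
  proof -
    have "y i \<in> J ` ?S" using y(1) by (rule subsetD) simp
    then show ?thesis by (elim imageE) auto
  qed
  then obtain ws where ws: "\<And>i. range (ws i) \<subseteq> W" "\<And>i. y i = J (ws i)" by metis
  \<comment> \<open>A single enumeration runs through all the minimising subfamilies.\<close>
  define w where "w n = (case prod_decode n of (i, j) \<Rightarrow> ws i j)" for n
  have w: "range w \<subseteq> W" using ws(1) by (force simp: w_def image_subset_iff split: prod.splits)
  have "range (ws i) \<subseteq> range w" for i
  proof safe
    fix j show "ws i j \<in> range w" by (auto simp: w_def intro!: range_eqI[of _ _ "prod_encode (i, j)"])
  qed
  then have "J w \<le> y i" for i using Jmono ws by simp
  then have Jmin: "J w \<le> J w'" if "range w' \<subseteq> W" for w'
  proof -
    have "J w \<le> (INF i. y i)" using \<open>\<And>i. J w \<le> y i\<close> by (auto intro: INF_greatest)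
    also have "\<dots> \<le> J w'" unfolding y(2)[symmetric] by (rule INF_lower) (use that in auto)
    finally show ?thesis .
  qed
  have G: "I w \<in> Lp m p"
  proof (rule Lp_dominated(1)[OF p Im[OF w]])
    have "w 0 \<in> W" using w by blast
    then show "w 0 \<in> Lp m p" using W by (auto dest: Lp_plusD(1))
    show "AE x in m. \<bar>I w x\<bar> \<le> \<bar>w 0 x\<bar>" using Ile[of w _ 0] I0 by simp
  qed
  have lower: "AE x in m. I w x \<le> v x" if v: "v \<in> W" for v
  proof -
    \<comment> \<open>\<open>v\<close> is put in front of \<open>w\<close>; minimality of
      \<open>J w\<close> forbids a strict decrease on a set of positive measure.\<close>
    define w' where "w' n = (case n of 0 \<Rightarrow> v | Suc k \<Rightarrow> w k)" for n
    have w': "range w' \<subseteq> W" using v range_subsetD[OF w] by (auto simp: w'_def split: nat.splits)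
    have "range w \<subseteq> range w'"
    proof safe
      fix k show "w k \<in> range w'" by (auto simp: w'_def intro!: range_eqI[of _ _ "Suc k"])
    qed
    then have le: "I w' x \<le> I w x" for x by (rule Imono)
    have Jf: "J w \<noteq> \<infinity>"
      using nn_integral_Lp[OF p G] I0 by (simp add: J_def)
    have [measurable]: "I w \<in> borel_measurable m" "I w' \<in> borel_measurable m" using Im w w' by auto
    have "J w' \<le> J w" using \<open>range w \<subseteq> range w'\<close> by (rule Jmono)
    then have "J w' \<noteq> \<infinity>" using Jf by (auto simp: top_unique)
    have "(\<integral>\<^sup>+x. ennreal (I w x powr p) - ennreal (I w' x powr p) \<partial>m) = J w - J w'"
      unfolding J_def by (rule nn_integral_diff)
        (use \<open>J w' \<noteq> \<infinity>\<close> le p I0 in \<open>auto simp: J_def intro!: ennreal_leI powr_mono2\<close>)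
    also have "\<dots> = 0" using Jmin[OF w'] Jf by (simp add: diff_eq_0_ennreal less_top)
    finally have "AE x in m. ennreal (I w x powr p) - ennreal (I w' x powr p) = 0"
      by (subst (asm) nn_integral_0_iff_AE) auto
    then have "AE x in m. I w x \<le> I w' x"
    proof eventually_elim
      fix x assume "ennreal (I w x powr p) - ennreal (I w' x powr p) = 0"
      then have "I w x powr p \<le> I w' x powr p"
        using le[of x] I0[of w' x] by (auto simp: diff_eq_0_iff_ennreal less_top split: if_splits)
      then show "I w x \<le> I w' x" using p I0 by (meson not_le powr_less_mono2)
    qed
    moreover have "AE x in m. 0 \<le> v x" using v W by (auto dest: Lp_plusD(2))
    ultimately show ?thesis
    proof eventually_elim
      fix x assume "I w x \<le> I w' x" "0 \<le> v x"
      then show "I w x \<le> v x" using Ile[of w' x 0] by (simp add: w'_def)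
    qed
  qed
  have greatest: "AE x in m. H x \<le> I w x" if H: "\<And>v. v \<in> W \<Longrightarrow> AE x in m. H x \<le> v x" for H
  proof -
    have "AE x in m. \<forall>n. H x \<le> w n x \<and> 0 \<le> w n x"
      unfolding AE_all_countable using H W range_subsetD[OF w] by (auto dest: Lp_plusD(2))
    then show ?thesis
      by eventually_elim (auto simp: I_def intro!: cINF_greatest)
  qed
  show ?thesis
    by (rule that[of w "I w"]) (use w G I0 lower greatest in \<open>auto simp: Lp_plus_def I_def\<close>)
qed

text \<open>Two greatest elements dominate each other a.e., so the choice made by
  \<open>ae_greatest\<close> matters only on a null set.\<close>

lemma ae_greatest_eqI:
  assumes "G \<in> S" "\<And>H. H \<in> S \<Longrightarrow> AE x in m. H x \<le> G x"
  shows "ae_greatest m S \<in> S" "AE x in m. ae_greatest m S x = G x"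
proof -
  have *: "ae_greatest m S \<in> S \<and> (\<forall>H\<in>S. AE x in m. H x \<le> ae_greatest m S x)"
    unfolding ae_greatest_def by (rule someI2_ex[where Q="\<lambda>G. G \<in> S \<and> (\<forall>H\<in>S. AE x in m. H x \<le> G x)"]) (use assms in auto)
  then show "ae_greatest m S \<in> S" by simp
  show "AE x in m. ae_greatest m S x = G x"
    using bspec[OF conjunct2[OF *] assms(1)] assms(2)[OF conjunct1[OF *]] by eventually_elim auto
qed

section \<open>Bounded functions\<close>

lemma Linf_simps [simp]:
  "mult (Linf m) = (\<lambda>f h x. f x * h x)" "one (Linf m) = (\<lambda>x. 1)" "zero (Linf m) = (\<lambda>x. 0)"
  "add (Linf m) = (\<lambda>f h x. f x + h x)"
  by (simp_all add: Linf_def)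

lemma Linf_carrier: "f \<in> carrier (Linf m) \<longleftrightarrow> f \<in> borel_measurable m \<and> (\<exists>C. AE x in m. \<bar>f x\<bar> \<le> C)"
  by (simp add: Linf_def)

lemma Linf_const [simp]: "(\<lambda>_. c) \<in> carrier (Linf m)"
  by (auto simp: Linf_carrier)

lemma Linf_indicator [simp]: "A \<in> sets m \<Longrightarrow> indicat_real A \<in> carrier (Linf m)"
  by (auto simp: Linf_carrier indicator_def intro!: exI[of _ 1])

lemma Linf_bound:
  assumes "f \<in> carrier (Linf m)"
  obtains C where "0 < C" "AE x in m. \<bar>f x\<bar> \<le> C"
proof -
  obtain C where "AE x in m. \<bar>f x\<bar> \<le> C" using assms by (auto simp: Linf_carrier)
  then have "AE x in m. \<bar>f x\<bar> \<le> max 1 C" by eventually_elim auto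
  then show ?thesis using that[of "max 1 C"] by simp
qed

lemma Linf_cring: "cring (Linf m)"
proof -
  have add: "(\<lambda>x. f x + h x) \<in> carrier (Linf m)" if f: "f \<in> carrier (Linf m)" and h: "h \<in> carrier (Linf m)" for f h
  proof -
    obtain C where "AE x in m. \<bar>f x\<bar> \<le> C" using f by (auto simp: Linf_carrier)
    moreover obtain C' where "AE x in m. \<bar>h x\<bar> \<le> C'" using h by (auto simp: Linf_carrier)
    ultimately have "AE x in m. \<bar>f x + h x\<bar> \<le> C + C'" by eventually_elim auto
    then show ?thesis using f h by (auto simp: Linf_carrier)
  qed
  have mult: "(\<lambda>x. f x * h x) \<in> carrier (Linf m)" if f: "f \<in> carrier (Linf m)" and h: "h \<in> carrier (Linf m)" for f h
  proof -
    obtain C where "0 < C" "AE x in m. \<bar>f x\<bar> \<le> C" using f by (rule Linf_bound)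
    moreover obtain C' where "0 < C'" "AE x in m. \<bar>h x\<bar> \<le> C'" using h by (rule Linf_bound)
    ultimately have "AE x in m. \<bar>f x * h x\<bar> \<le> C * C'" by (auto elim!: eventually_elim2 simp: abs_mult intro!: mult_mono)
    then show ?thesis using f h by (auto simp: Linf_carrier)
  qed
  have "\<exists>h\<in>carrier (Linf m). (\<lambda>x. h x + f x) = (\<lambda>x. 0)" if "f \<in> carrier (Linf m)" for f
    using mult[OF Linf_const[of "-1"] that] by (intro bexI[of _ "\<lambda>x. - f x"]) auto
  then show ?thesis
    by (intro cringI abelian_groupI comm_monoidI) (auto simp: add mult algebra_simps)
qed

lemma Linf_times: "f \<in> carrier (Linf m) \<Longrightarrow> h \<in> carrier (Linf m) \<Longrightarrow> (\<lambda>x. f x * h x) \<in> carrier (Linf m)"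
  using monoid.m_closed[of "Linf m" f h] Linf_cring[of m] by (simp add: cring_def ring_def)

lemma Linf_plus: "f \<in> carrier (Linf m) \<Longrightarrow> h \<in> carrier (Linf m) \<Longrightarrow> (\<lambda>x. f x + h x) \<in> carrier (Linf m)"
  using abelian_monoid.a_closed[of "Linf m" f h] Linf_cring[of m] by (simp add: cring_def ring_def abelian_group_def)

lemma Linf_minus: "f \<in> carrier (Linf m) \<Longrightarrow> h \<in> carrier (Linf m) \<Longrightarrow> (\<lambda>x. f x - h x) \<in> carrier (Linf m)"
  using Linf_plus[of f m "\<lambda>x. -1 * h x"] Linf_times[of "\<lambda>x. -1" m h] by simp

lemma simple_function_Linf:
  assumes "simple_function m s" shows "s \<in> carrier (Linf m)"
proof -
  have "finite (s ` space m)" using assms by (rule simple_functionD)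
  then obtain C where "\<And>x. x \<in> space m \<Longrightarrow> \<bar>s x\<bar> \<le> C"
    using bounded_iff[of "s ` space m"] finite_imp_bounded by (metis imageI real_norm_def)
  then have "AE x in m. \<bar>s x\<bar> \<le> C" by auto
  then show ?thesis using assms by (auto simp: Linf_carrier intro: borel_measurable_simple_function)
qed

lemma Linf_simple_approx:
  assumes "f \<in> carrier (Linf m)"
  obtains s where "\<And>n. simple_function m (s n)" "Linf_tendsto m s f"
proof -
  obtain C where C: "0 < C" "AE x in m. \<bar>f x\<bar> \<le> C" using assms by (rule Linf_bound)
  have [measurable]: "f \<in> borel_measurable m" using assms by (simp add: Linf_carrier)
  \<comment> \<open>Truncation at the essential bound leaves finitely many points of the grid of
    width 1 / (n + 1), and rounding down errs by at most that width wherever |f| \<le> C.\<close>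
  define s where "s n x = of_int \<lfloor>real (Suc n) * max (- C) (min C (f x))\<rfloor> / real (Suc n)" for n x
  have "simple_function m (s n)" for n
  proof (rule simple_function_borel_measurable)
    show "s n \<in> borel_measurable m" unfolding s_def by measurable
    let ?I = "{\<lfloor>real (Suc n) * (- C)\<rfloor>..\<lfloor>real (Suc n) * C\<rfloor>}"
    have "s n ` space m \<subseteq> (\<lambda>k. of_int k / real (Suc n)) ` ?I"
    proof safe
      fix x
      have "max (- C) (min C (f x)) \<le> C" "- C \<le> max (- C) (min C (f x))" using C(1) by auto
      then have "\<lfloor>real (Suc n) * max (- C) (min C (f x))\<rfloor> \<in> ?I"
        by (intro atLeastAtMost_iff[THEN iffD2] conjI floor_mono mult_left_mono) auto
      then show "s n x \<in> (\<lambda>k. of_int k / real (Suc n)) ` ?I" unfolding s_def by blast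
    qed
    then show "finite (s n ` space m)" by (rule finite_subset) auto
  qed
  moreover have "Linf_tendsto m s f"
    unfolding Linf_tendsto_def
  proof safe
    fix e :: real assume "0 < e"
    then obtain N where N: "inverse (real (Suc N)) < e" using reals_Archimedean by blast
    show "\<exists>N. \<forall>n\<ge>N. AE x in m. \<bar>s n x - f x\<bar> \<le> e"
    proof (intro exI[of _ N] allI impI)
      fix n assume "N \<le> n"
      then have "1 / real (Suc n) \<le> e" using N by (intro order_trans[OF _ less_imp_le[OF N]]) (simp add: field_simps)
      show "AE x in m. \<bar>s n x - f x\<bar> \<le> e"
        using C(2)
      proof eventually_elim
        fix x assume "\<bar>f x\<bar> \<le> C"
        then have "max (- C) (min C (f x)) = f x" by auto
        then have "s n x - f x = (of_int \<lfloor>real (Suc n) * f x\<rfloor> - real (Suc n) * f x) / real (Suc n)"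
          by (simp add: s_def diff_divide_distrib del: of_nat_Suc)
        then have "\<bar>s n x - f x\<bar> = \<bar>of_int \<lfloor>real (Suc n) * f x\<rfloor> - real (Suc n) * f x\<bar> / real (Suc n)"
          by (simp add: abs_divide del: of_nat_Suc)
        also have "\<dots> \<le> 1 / real (Suc n)"
        proof (rule divide_right_mono)
          show "\<bar>of_int \<lfloor>real (Suc n) * f x\<rfloor> - real (Suc n) * f x\<bar> \<le> 1" by linarith
        qed simp
        finally show "\<bar>s n x - f x\<bar> \<le> e" using \<open>1 / real (Suc n) \<le> e\<close> by simp
      qed
    qed
  qed
  ultimately show ?thesis using that by blast
qed

lemma Lp_mult_Linf:
  assumes p: "0 < p" and f: "f \<in> borel_measurable m" "0 \<le> C" "AE x in m. \<bar>f x\<bar> \<le> C" and g: "g \<in> Lp m p"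
  shows "(\<lambda>x. f x * g x) \<in> Lp m p" "Lp_norm m p (\<lambda>x. f x * g x) \<le> C * Lp_norm m p g"
proof -
  have *: "AE x in m. \<bar>f x * g x\<bar> \<le> \<bar>C * g x\<bar>"
    using f(3) by eventually_elim (use f(2) in \<open>auto simp: abs_mult intro!: mult_right_mono\<close>)
  have m: "(\<lambda>x. f x * g x) \<in> borel_measurable m" using f LpD(1)[OF g] by auto
  show "(\<lambda>x. f x * g x) \<in> Lp m p" by (rule Lp_dominated(1)[OF p m Lp_scale[OF g] *])
  show "Lp_norm m p (\<lambda>x. f x * g x) \<le> C * Lp_norm m p g"
    using Lp_dominated(2)[OF p m Lp_scale[OF g] *] Lp_norm_scale[OF p, of m C g] f(2) by simp
qed

section \<open>The Hahn-Banach theorem and Mazur's lemma\<close>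

text \<open>Only a seminorm and multiplication by constants are asked for, because Mazur's lemma is
  needed in two places: in the module and in \<open>Lp_space\<close>, whose elements are functions
  and not classes, so that norm 0 does not mean zero.\<close>

locale seminormed_mod = abelian_group M for M :: "('a, 'v, 'z) normed_mod_scheme" (structure) +
  assumes scal_closed [simp]: "v \<in> carrier M \<Longrightarrow> (\<lambda>_. c) \<odot> v \<in> carrier M"
    and scal_l_distr: "v \<in> carrier M \<Longrightarrow> (\<lambda>_. a + b) \<odot> v = (\<lambda>_. a) \<odot> v \<oplus> (\<lambda>_. b) \<odot> v"
    and scal_r_distr: "u \<in> carrier M \<Longrightarrow> v \<in> carrier M \<Longrightarrow> (\<lambda>_. a) \<odot> (u \<oplus> v) = (\<lambda>_. a) \<odot> u \<oplus> (\<lambda>_. a) \<odot> v"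
    and scal_assoc: "v \<in> carrier M \<Longrightarrow> (\<lambda>_. a) \<odot> ((\<lambda>_. b) \<odot> v) = (\<lambda>_. a * b) \<odot> v"
    and scal_one [simp]: "v \<in> carrier M \<Longrightarrow> (\<lambda>_. 1) \<odot> v = v"
    and vnorm_nonneg: "v \<in> carrier M \<Longrightarrow> 0 \<le> vnorm M v"
    and vnorm_triangle: "u \<in> carrier M \<Longrightarrow> v \<in> carrier M \<Longrightarrow> vnorm M (u \<oplus> v) \<le> vnorm M u + vnorm M v"
    and vnorm_scal: "v \<in> carrier M \<Longrightarrow> vnorm M ((\<lambda>_. c) \<odot> v) = \<bar>c\<bar> * vnorm M v"
begin

abbreviation scal :: "real \<Rightarrow> 'v \<Rightarrow> 'v" where "scal c v \<equiv> (\<lambda>_. c) \<odot> v"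

lemma scal_zero [simp]: "v \<in> carrier M \<Longrightarrow> scal 0 v = \<zero>"
  using scal_l_distr[of v 0 0] add.l_cancel_one'[of "scal 0 v" "scal 0 v"] by simp

lemma scal_zero_right [simp]: "scal c \<zero> = \<zero>"
  using scal_r_distr[of \<zero> \<zero> c] add.l_cancel_one'[of "scal c \<zero>" "scal c \<zero>"] by simp

lemma scal_minus_one: "v \<in> carrier M \<Longrightarrow> scal (-1) v = \<ominus> v"
  using scal_l_distr[of v "-1" 1] by (intro minus_equality[symmetric]) auto

lemma scal_minus: "v \<in> carrier M \<Longrightarrow> scal c (\<ominus> v) = \<ominus> (scal c v)"
  using scal_assoc[of v c "-1"] scal_assoc[of v "-1" c] by (simp add: scal_minus_one)

lemma vnorm_minus: "v \<in> carrier M \<Longrightarrow> vnorm M (\<ominus> v) = vnorm M v"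
  using vnorm_scal[of v "-1"] by (simp add: scal_minus_one)

lemma vnorm_zero [simp]: "vnorm M \<zero> = 0"
  using vnorm_scal[of \<zero> 0] by simp

text \<open>One-sided homogeneity is what the infima below readily satisfy; equality follows by
  scaling back with 1 / c.\<close>

definition sublinear :: "('v \<Rightarrow> real) \<Rightarrow> bool" where
  "sublinear q \<longleftrightarrow> (\<forall>u\<in>carrier M. \<forall>v\<in>carrier M. q (u \<oplus> v) \<le> q u + q v) \<and>
    (\<forall>c>0. \<forall>v\<in>carrier M. q (scal c v) \<le> c * q v)"

lemma sublinearD:
  assumes "sublinear q"
  shows "u \<in> carrier M \<Longrightarrow> v \<in> carrier M \<Longrightarrow> q (u \<oplus> v) \<le> q u + q v"
    "0 < c \<Longrightarrow> v \<in> carrier M \<Longrightarrow> q (scal c v) = c * q v" "q \<zero> = 0"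
    "v \<in> carrier M \<Longrightarrow> - q (\<ominus> v) \<le> q v"
    "0 \<le> c \<Longrightarrow> v \<in> carrier M \<Longrightarrow> q (scal c v) = c * q v"
proof -
  show add: "q (u \<oplus> v) \<le> q u + q v" if "u \<in> carrier M" "v \<in> carrier M" for u v
    using that assms by (auto simp: sublinear_def)
  have le: "q (scal c v) \<le> c * q v" if "0 < c" "v \<in> carrier M" for c v
    using that assms by (auto simp: sublinear_def)
  have hom: "q (scal c v) = c * q v" if "0 < c" "v \<in> carrier M" for c v
    using le[OF that] le[of "1/c" "scal c v"] that by (simp add: scal_assoc field_simps)
  then show "0 < c \<Longrightarrow> v \<in> carrier M \<Longrightarrow> q (scal c v) = c * q v" .
  show zero: "q \<zero> = 0" using hom[of 2 \<zero>] by simp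
  show "v \<in> carrier M \<Longrightarrow> - q (\<ominus> v) \<le> q v" using add[of v "\<ominus> v"] zero by (simp add: r_neg)
  show "0 \<le> c \<Longrightarrow> v \<in> carrier M \<Longrightarrow> q (scal c v) = c * q v"
    using hom[of c v] zero by (cases "c = 0") auto
qed

lemma sublinearI:
  assumes "\<And>u v. u \<in> carrier M \<Longrightarrow> v \<in> carrier M \<Longrightarrow> q (u \<oplus> v) \<le> q u + q v"
    "\<And>c v. 0 < c \<Longrightarrow> v \<in> carrier M \<Longrightarrow> q (scal c v) \<le> c * q v"
  shows "sublinear q"
  using assms by (auto simp: sublinear_def)

text \<open>A minimal sublinear functional is linear: otherwise it could be lowered along the direction
  \<open>w\<close>.\<close>

lemma minimal_sublinear_additive:
  assumes r: "sublinear r"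
    and min: "\<And>s v. sublinear s \<Longrightarrow> (\<And>v. v \<in> carrier M \<Longrightarrow> s v \<le> r v) \<Longrightarrow> v \<in> carrier M \<Longrightarrow> r v \<le> s v"
    and v: "v \<in> carrier M" and w: "w \<in> carrier M"
  shows "r (v \<oplus> w) = r v + r w"
proof -
  define s where "s x = (INF t\<in>{0..}. r (x \<oplus> scal t w) - t * r w)" for x
  have lb: "- r (\<ominus> x) \<le> r (x \<oplus> scal t w) - t * r w" if "0 \<le> t" "x \<in> carrier M" for x t
  proof -
    have "t * r w = r ((x \<oplus> scal t w) \<oplus> \<ominus> x)"
      using that w sublinearD(5)[OF r that(1) w] by (simp add: a_ac r_neg2 r_neg1 r_neg)
    also have "\<dots> \<le> r (x \<oplus> scal t w) + r (\<ominus> x)"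
      using that w by (intro sublinearD(1)[OF r]) auto
    finally show ?thesis by simp
  qed
  have s_le: "s x \<le> r (x \<oplus> scal t w) - t * r w" if "0 \<le> t" "x \<in> carrier M" for x t
    unfolding s_def using that lb by (intro cINF_lower bdd_belowI2) auto
  have s_ge: "c \<le> s x" if "\<And>t. 0 \<le> t \<Longrightarrow> c \<le> r (x \<oplus> scal t w) - t * r w" for c x
    unfolding s_def using that by (intro cINF_greatest) auto
  have "sublinear s"
  proof (rule sublinearI)
    fix x y assume xy: "x \<in> carrier M" "y \<in> carrier M"
    have *: "s (x \<oplus> y) \<le> (r (x \<oplus> scal t w) - t * r w) + (r (y \<oplus> scal t' w) - t' * r w)"
      if "0 \<le> t" "0 \<le> t'" for t t'
    proof -
      have "(x \<oplus> y) \<oplus> scal (t + t') w = (x \<oplus> scal t w) \<oplus> (y \<oplus> scal t' w)"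
        using xy w by (simp add: scal_l_distr a_ac)
      then have "s (x \<oplus> y) \<le> r ((x \<oplus> scal t w) \<oplus> (y \<oplus> scal t' w)) - (t + t') * r w"
        using s_le[of "t + t'" "x \<oplus> y"] that xy by simp
      moreover have "r ((x \<oplus> scal t w) \<oplus> (y \<oplus> scal t' w)) \<le> r (x \<oplus> scal t w) + r (y \<oplus> scal t' w)"
        using xy w by (intro sublinearD(1)[OF r]) auto
      ultimately show ?thesis by (simp add: algebra_simps)
    qed
    have "s (x \<oplus> y) - (r (y \<oplus> scal t' w) - t' * r w) \<le> s x" if "0 \<le> t'" for t'
      using *[OF _ that] by (intro s_ge) (simp add: algebra_simps)
    then have "s (x \<oplus> y) - s x \<le> s y" by (intro s_ge) (simp add: algebra_simps)
    then show "s (x \<oplus> y) \<le> s x + s y" by simp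
  next
    fix c x assume c: "(0::real) < c" and x: "x \<in> carrier M"
    have "s (scal c x) / c \<le> r (x \<oplus> scal t w) - t * r w" if t: "0 \<le> t" for t
    proof -
      have "s (scal c x) \<le> r (scal c x \<oplus> scal (c * t) w) - c * t * r w"
        using c t x s_le[of "c * t" "scal c x"] by simp
      also have "scal c x \<oplus> scal (c * t) w = scal c (x \<oplus> scal t w)"
        using x w by (simp add: scal_r_distr scal_assoc)
      also have "r \<dots> = c * r (x \<oplus> scal t w)" using sublinearD(2)[OF r c] x w by simp
      finally show ?thesis using c by (simp add: field_simps)
    qed
    then have "s (scal c x) / c \<le> s x" by (rule s_ge)
    then show "s (scal c x) \<le> c * s x" using c by (simp add: field_simps)
  qed
  moreover have "s x \<le> r x" if "x \<in> carrier M" for x using s_le[of 0 x] that w by simp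
  ultimately have "r v \<le> s v" using min v by blast
  \<comment> \<open>The value t = 1 in the infimum gives the inequality opposite to
    subadditivity.\<close>
  also have "\<dots> \<le> r (v \<oplus> w) - r w" using s_le[of 1 v] v w by simp
  finally show ?thesis using sublinearD(1)[OF r v w] by simp
qed

text \<open>Zorn's lemma is applied to the sublinear functionals below \<open>q\<close> instead of
  partial linear extensions: a minimal one is linear. Functionals are set to 0 off the carrier, so
  that comparing them on the whole type is comparing them on the carrier.\<close>

theorem Hahn_Banach:
  assumes q: "sublinear q"
  obtains l where "\<And>u v. u \<in> carrier M \<Longrightarrow> v \<in> carrier M \<Longrightarrow> l (u \<oplus> v) = l u + l v"
    "\<And>c v. v \<in> carrier M \<Longrightarrow> l (scal c v) = c * l v" "\<And>v. v \<in> carrier M \<Longrightarrow> l v \<le> q v"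
proof -
  define A where "A = {r. sublinear r \<and> (\<forall>v\<in>carrier M. r v \<le> q v) \<and> (\<forall>v. v \<notin> carrier M \<longrightarrow> r v = 0)}"
  define P where "P r s \<longleftrightarrow> (\<forall>v. s v \<le> r v)" for r s :: "'v \<Rightarrow> real"
  have AD: "sublinear r" "v \<in> carrier M \<Longrightarrow> r v \<le> q v" "v \<notin> carrier M \<Longrightarrow> r v = 0" if "r \<in> A" for r v
    using that by (auto simp: A_def)
  have "\<exists>r\<in>A. \<forall>s\<in>A. P r s \<longrightarrow> s = r"
  proof (rule predicate_Zorn)
    show "partial_order_on A (relation_of P A)"
      by (rule partial_order_on_relation_ofI) (auto simp: P_def intro: order_trans, rule ext, meson order_antisym)
    fix C assume C: "C \<in> Chains (relation_of P A)"
    then have CA: "C \<subseteq> A" and tot: "\<And>r s. r \<in> C \<Longrightarrow> s \<in> C \<Longrightarrow> P r s \<or> P s r"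
      by (auto simp: Chains_def relation_of_def)
    show "\<exists>u\<in>A. \<forall>r\<in>C. P r u"
    proof (cases "C = {}")
      case True
      \<comment> \<open>The empty chain still needs some member of \<open>A\<close>:
        \<open>q\<close> itself, cut off outside the carrier.\<close>
      have "(\<lambda>v. if v \<in> carrier M then q v else 0) \<in> A"
        using sublinearD[OF q] by (auto simp: A_def intro!: sublinearI)
      then show ?thesis using True by blast
    next
      case False
      \<comment> \<open>Members of the chain are bounded below by \<open>- q (\<ominus> v)\<close>
        on the carrier, so the infimum is a proper one. Subadditivity survives because of any two
        members one lies below the other.\<close>
      define u where "u v = (INF r\<in>C. r v)" for v
      have lb: "- q (\<ominus> v) \<le> r v" if "r \<in> C" "v \<in> carrier M" for r v
      proof -
        have "r \<in> A" using that CA by auto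
        then show ?thesis using sublinearD(4)[OF AD(1), of r v] AD(2)[of r "\<ominus> v"] that by force
      qed
      have bdd: "bdd_below ((\<lambda>r. r v) ` C)" for v
      proof (cases "v \<in> carrier M")
        case True then show ?thesis using lb by (intro bdd_belowI2[of _ "- q (\<ominus> v)"]) auto
      next
        case False
        show ?thesis
        proof (rule bdd_belowI2[of _ 0])
          fix r assume "r \<in> C"
          then have "r v = 0" by (rule AD(3)[OF subsetD[OF CA] False])
          then show "0 \<le> r v" by simp
        qed
      qed
      have u_le: "u v \<le> r v" if "r \<in> C" for r v
        unfolding u_def using bdd that by (intro cINF_lower) auto
      have u_ge: "c \<le> u v" if "\<And>r. r \<in> C \<Longrightarrow> c \<le> r v" for c v
        unfolding u_def using that False by (intro cINF_greatest) auto
      have "sublinear u"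
      proof (rule sublinearI)
        fix x y assume xy: "x \<in> carrier M" "y \<in> carrier M"
        have *: "u (x \<oplus> y) \<le> r x + s y" if rs: "r \<in> C" "s \<in> C" for r s
        proof -
          obtain t where t: "t \<in> C" "\<And>v. t v \<le> r v" "\<And>v. t v \<le> s v"
            using tot[OF rs] rs by (auto simp: P_def)
          have "u (x \<oplus> y) \<le> t (x \<oplus> y)" using t by (intro u_le)
          also have "\<dots> \<le> t x + t y" using sublinearD(1)[OF AD(1)] t CA xy by blast
          also have "\<dots> \<le> r x + s y" by (intro add_mono t)
          finally show ?thesis .
        qed
        have "u (x \<oplus> y) - s y \<le> u x" if "s \<in> C" for s
          using *[OF _ that] by (intro u_ge) (simp add: algebra_simps)
        then have "u (x \<oplus> y) - u x \<le> u y" by (intro u_ge) (simp add: algebra_simps)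
        then show "u (x \<oplus> y) \<le> u x + u y" by simp
      next
        fix c x assume c: "(0::real) < c" and x: "x \<in> carrier M"
        have "u (scal c x) / c \<le> r x" if "r \<in> C" for r
          using u_le[OF that, of "scal c x"] sublinearD(2)[OF AD(1) c x, of r] that CA c by (auto simp: field_simps)
        then have "u (scal c x) / c \<le> u x" by (rule u_ge)
        then show "u (scal c x) \<le> c * u x" using c by (simp add: field_simps)
      qed
      moreover have "u v \<le> q v" if "v \<in> carrier M" for v
      proof -
        obtain r where "r \<in> C" using False by auto
        then show ?thesis using u_le[of r v] AD(2)[of r v] CA that by force
      qed
      moreover have "u v = 0" if "v \<notin> carrier M" for v
      proof -
        have "(\<lambda>r. r v) ` C = (\<lambda>r. 0) ` C"
          using AD(3)[OF subsetD[OF CA] that] by (rule image_cong[OF refl])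
        also have "\<dots> = {0}" using False by (auto simp: image_constant_conv)
        finally show ?thesis by (simp add: u_def)
      qed
      ultimately have "u \<in> A" by (auto simp: A_def)
      then show ?thesis using u_le by (auto simp: P_def)
    qed
  qed
  then obtain r where rA: "r \<in> A" and rmin: "\<And>s. s \<in> A \<Longrightarrow> P r s \<Longrightarrow> s = r" by blast
  have r: "sublinear r" using rA by (rule AD)
  have min: "r v \<le> s v" if s: "sublinear s" "\<And>v. v \<in> carrier M \<Longrightarrow> s v \<le> r v" "v \<in> carrier M" for s v
  proof -
    let ?s = "\<lambda>v. if v \<in> carrier M then s v else 0"
    have "?s \<in> A"
      using sublinearD(1,2)[OF s(1)] order_trans[OF s(2) AD(2)[OF rA]] by (auto simp: A_def intro!: sublinearI)
    moreover have "P r ?s" using s(2) AD(3)[OF rA] by (auto simp: P_def)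
    ultimately have "?s = r" by (rule rmin)
    from fun_cong[OF this, of v] show ?thesis using s(3) by simp
  qed
  have add: "r (u \<oplus> v) = r u + r v" if "u \<in> carrier M" "v \<in> carrier M" for u v
  proof (rule minimal_sublinear_additive[OF r _ that])
    fix s v assume "sublinear s" "\<And>v. v \<in> carrier M \<Longrightarrow> s v \<le> r v" "v \<in> carrier M"
    then show "r v \<le> s v" by (rule min)
  qed
  have neg: "r (\<ominus> v) = - r v" if "v \<in> carrier M" for v
    using add[of v "\<ominus> v"] that sublinearD(3)[OF r] by (simp add: r_neg)
  have "r (scal c v) = c * r v" if v: "v \<in> carrier M" for c v
  proof (cases "0 \<le> c")
    case True then show ?thesis using sublinearD(5)[OF r] v by simp
  next
    case False
    then have "r (scal (- c) v) = - c * r v" using sublinearD(2)[OF r, of "-c" v] v by simp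
    moreover have "scal (- c) v = \<ominus> (scal c v)" using scal_assoc[of v "-1" c] v by (simp add: scal_minus_one)
    ultimately show ?thesis using neg[of "scal c v"] v by simp
  qed
  then show ?thesis using that[of r] add AD(2)[OF rA] by blast
qed

text \<open>\<open>q x\<close> is the infimum of ||x + t u|| - t e over t \<ge> 0 and
  \<open>u\<close> in \<open>P\<close>. It is sublinear because \<open>P\<close> is convex, at most
  the norm (t = 0), and at most -e at \<ominus> u (t = 1). A linear functional below
  \<open>q\<close> is therefore bounded and at least \<open>e\<close> on \<open>P\<close>.\<close>

lemma separation_from_convex:
  assumes P: "P \<subseteq> carrier M" "P \<noteq> {}"
    and convex: "\<And>u v t. u \<in> P \<Longrightarrow> v \<in> P \<Longrightarrow> 0 < t \<Longrightarrow> t < 1 \<Longrightarrow> scal t u \<oplus> scal (1 - t) v \<in> P"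
    and e: "0 \<le> e" "\<And>u. u \<in> P \<Longrightarrow> e \<le> vnorm M u"
  obtains l where "bounded_functional M l" "\<And>u. u \<in> P \<Longrightarrow> l u \<ge> e"
proof -
  define q where "q x = (INF (t, u)\<in>{0..} \<times> P. vnorm M (x \<oplus> scal t u) - t * e)" for x
  have lb: "- vnorm M x \<le> vnorm M (x \<oplus> scal t u) - t * e" if "0 \<le> t" "u \<in> P" "x \<in> carrier M" for t u x
  proof -
    have u: "u \<in> carrier M" using that P by auto
    have "t * e \<le> t * vnorm M u" using e(2)[OF that(2)] that(1) by (rule mult_left_mono)
    also have "\<dots> = vnorm M (scal t u)" using that u by (simp add: vnorm_scal)
    also have "scal t u = (x \<oplus> scal t u) \<oplus> \<ominus> x" using that u by (simp add: a_ac r_neg2 r_neg1 r_neg)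
    also have "vnorm M \<dots> \<le> vnorm M (x \<oplus> scal t u) + vnorm M x"
      using vnorm_triangle[of "x \<oplus> scal t u" "\<ominus> x"] that u by (simp add: vnorm_minus)
    finally show ?thesis by simp
  qed
  have q_le: "q x \<le> vnorm M (x \<oplus> scal t u) - t * e" if "0 \<le> t" "u \<in> P" "x \<in> carrier M" for t u x
  proof -
    have "q x \<le> (case (t, u) of (t, u) \<Rightarrow> vnorm M (x \<oplus> scal t u) - t * e)"
      unfolding q_def using that lb by (intro cINF_lower bdd_belowI2[of _ "- vnorm M x"]) auto
    then show ?thesis by simp
  qed
  have q_ge: "c \<le> q x" if "\<And>t u. 0 \<le> t \<Longrightarrow> u \<in> P \<Longrightarrow> c \<le> vnorm M (x \<oplus> scal t u) - t * e" for c x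
    unfolding q_def using that P(2) by (intro cINF_greatest) auto
  have "sublinear q"
  proof (rule sublinearI)
    fix x y assume xy: "x \<in> carrier M" "y \<in> carrier M"
    have *: "q (x \<oplus> y) \<le> (vnorm M (x \<oplus> scal t u) - t * e) + (vnorm M (y \<oplus> scal t' u') - t' * e)"
      if t: "0 \<le> t" "0 \<le> t'" and u: "u \<in> P" "u' \<in> P" for t t' u u'
    proof -
      have uc: "u \<in> carrier M" "u' \<in> carrier M" using u P by auto
      \<comment> \<open>By convexity t u + t' u' is t + t' times a point of \<open>P\<close>. If one
        coefficient is 0, the point belonging to the other serves, which keeps the weights strict
        and avoids dividing by t + t' = 0.\<close>
      obtain w where w: "w \<in> P" "scal (t + t') w = scal t u \<oplus> scal t' u'"
      proof (cases "t = 0 \<or> t' = 0")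
        case True then show ?thesis using that[of u] that[of u'] u uc by auto
      next
        case False
        then have tt: "0 < t" "0 < t'" using t by auto
        let ?a = "t / (t + t')"
        let ?w = "scal ?a u \<oplus> scal (1 - ?a) u'"
        have "?w \<in> P" using convex[OF u, of ?a] tt by (auto simp: divide_simps)
        moreover have "scal (t + t') ?w = scal t u \<oplus> scal t' u'"
        proof -
          have "(t + t') * ?a = t" "(t + t') * (1 - ?a) = t'" using tt by (auto simp: field_simps)
          then show ?thesis using uc by (simp add: scal_r_distr scal_assoc)
        qed
        ultimately show ?thesis by (rule that)
      qed
      have "(x \<oplus> y) \<oplus> scal (t + t') w = (x \<oplus> scal t u) \<oplus> (y \<oplus> scal t' u')"
        using xy uc by (simp add: w(2) a_ac)
      then have "q (x \<oplus> y) \<le> vnorm M ((x \<oplus> scal t u) \<oplus> (y \<oplus> scal t' u')) - (t + t') * e"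
        using q_le[of "t + t'" w "x \<oplus> y"] t w xy by simp
      moreover have "vnorm M ((x \<oplus> scal t u) \<oplus> (y \<oplus> scal t' u')) \<le> vnorm M (x \<oplus> scal t u) + vnorm M (y \<oplus> scal t' u')"
        using xy uc by (intro vnorm_triangle) auto
      ultimately show ?thesis by (simp add: algebra_simps)
    qed
    have "q (x \<oplus> y) - (vnorm M (y \<oplus> scal t' u') - t' * e) \<le> q x" if "0 \<le> t'" "u' \<in> P" for t' u'
      using *[OF _ that(1) _ that(2)] by (intro q_ge) (simp add: algebra_simps)
    then have "q (x \<oplus> y) - q x \<le> q y" by (intro q_ge) (simp add: algebra_simps)
    then show "q (x \<oplus> y) \<le> q x + q y" by simp
  next
    fix c x assume c: "(0::real) < c" and x: "x \<in> carrier M"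
    have "q (scal c x) / c \<le> vnorm M (x \<oplus> scal t u) - t * e" if t: "0 \<le> t" and u: "u \<in> P" for t u
    proof -
      have uc: "u \<in> carrier M" using u P by auto
      have "q (scal c x) \<le> vnorm M (scal c x \<oplus> scal (c * t) u) - c * t * e"
        using c t x u q_le[of "c * t" u "scal c x"] by simp
      also have "scal c x \<oplus> scal (c * t) u = scal c (x \<oplus> scal t u)"
        using x uc by (simp add: scal_r_distr scal_assoc)
      also have "vnorm M \<dots> = c * vnorm M (x \<oplus> scal t u)" using c x uc by (simp add: vnorm_scal)
      finally show ?thesis using c by (simp add: field_simps)
    qed
    then have "q (scal c x) / c \<le> q x" by (rule q_ge)
    then show "q (scal c x) \<le> c * q x" using c by (simp add: field_simps)
  qed
  then obtain l where l: "\<And>u v. u \<in> carrier M \<Longrightarrow> v \<in> carrier M \<Longrightarrow> l (u \<oplus> v) = l u + l v"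
    "\<And>c v. v \<in> carrier M \<Longrightarrow> l (scal c v) = c * l v" "\<And>v. v \<in> carrier M \<Longrightarrow> l v \<le> q v"
    by (rule Hahn_Banach) blast
  obtain u0 where u0: "u0 \<in> P" using P by auto
  have neg: "l (\<ominus> v) = - l v" if "v \<in> carrier M" for v using l(2)[OF that, of "-1"] that by (simp add: scal_minus_one)
  have le: "l v \<le> vnorm M v" if "v \<in> carrier M" for v
    using l(3)[OF that] q_le[of 0 u0 v] that u0 P by auto
  have "\<bar>l v\<bar> \<le> 1 * vnorm M v" if "v \<in> carrier M" for v
    using le[OF that] le[of "\<ominus> v"] neg[OF that] that by (simp add: vnorm_minus)
  then have "bounded_functional M l" unfolding bounded_functional_def using l by blast
  moreover have "l u \<ge> e" if u: "u \<in> P" for u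
  proof -
    have uc: "u \<in> carrier M" using u P by auto
    have "- l u \<le> vnorm M (\<ominus> u \<oplus> scal 1 u) - 1 * e"
      using neg[OF uc] l(3)[of "\<ominus> u"] q_le[of 1 u "\<ominus> u"] u uc by simp
    then show ?thesis using uc by (simp add: l_neg)
  qed
  ultimately show ?thesis by (rule that)
qed

text \<open>A convex set staying at distance \<open>e\<close> from \<open>v\<close> could be
  separated from \<open>v\<close> by a bounded functional, against weak convergence.
  \<open>P\<close> is arbitrary rather than the convex hull of the tail, so any convex condition
  that holds along the tail can be built into it.\<close>

theorem Mazur:
  assumes w: "weakly_tendsto M \<sigma> v"
    and P: "P \<subseteq> carrier M"
    and convex: "\<And>u v t. u \<in> P \<Longrightarrow> v \<in> P \<Longrightarrow> 0 < t \<Longrightarrow> t < 1 \<Longrightarrow> scal t u \<oplus> scal (1 - t) v \<in> P"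
    and N: "\<And>n. N \<le> n \<Longrightarrow> \<sigma> n \<in> P" and e: "0 < e"
  obtains u where "u \<in> P" "vnorm M (u \<ominus> v) < e"
proof (rule ccontr)
  assume "\<not> thesis"
  then have far: "e \<le> vnorm M (u \<ominus> v)" if "u \<in> P" for u using that \<open>\<And>u. u \<in> P \<Longrightarrow> vnorm M (u \<ominus> v) < e \<Longrightarrow> thesis\<close> by force
  have v: "v \<in> carrier M" and \<sigma>: "\<sigma> n \<in> carrier M" for n using w by (auto simp: weakly_tendsto_def)
  let ?Q = "(\<lambda>u. u \<ominus> v) ` P"
  have Q: "?Q \<subseteq> carrier M" "?Q \<noteq> {}" using P v N[of N] by auto
  have cQ: "scal t x \<oplus> scal (1 - t) y \<in> ?Q" if "x \<in> ?Q" "y \<in> ?Q" "0 < t" "t < 1" for x y t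
  proof -
    obtain a b where ab: "a \<in> P" "b \<in> P" "x = a \<ominus> v" "y = b \<ominus> v" using \<open>x \<in> ?Q\<close> \<open>y \<in> ?Q\<close> by blast
    have c: "a \<in> carrier M" "b \<in> carrier M" using ab P by auto
    have "scal t x \<oplus> scal (1 - t) y = (scal t a \<oplus> scal (1 - t) b) \<oplus> \<ominus> (scal t v \<oplus> scal (1 - t) v)"
      using ab c v by (simp add: minus_eq scal_r_distr scal_minus minus_add a_ac)
    also have "scal t v \<oplus> scal (1 - t) v = v" using scal_l_distr[of v t "1 - t"] v by simp
    finally show ?thesis using convex[OF ab(1,2) that(3,4)] by (auto simp: minus_eq)
  qed
  have fe: "e \<le> vnorm M u" if "u \<in> ?Q" for u using far that by blast
  obtain l where l: "bounded_functional M l" "\<And>u. u \<in> ?Q \<Longrightarrow> l u \<ge> e"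
    by (rule separation_from_convex[OF Q _ less_imp_le[OF e]]) (erule (3) cQ, erule fe, blast)
  have add: "l (a \<oplus> b) = l a + l b" if "a \<in> carrier M" "b \<in> carrier M" for a b
    using l(1) that by (auto simp: bounded_functional_def)
  have "l (u \<ominus> v) = l u - l v" if "u \<in> carrier M" for u
  proof -
    have "l u = l ((u \<ominus> v) \<oplus> v)" using that v by (simp add: minus_eq a_assoc l_neg)
    then show ?thesis using add[of "u \<ominus> v" v] that v by simp
  qed
  then have "l (\<sigma> n) \<ge> l v + e" if "N \<le> n" for n using l(2)[of "\<sigma> n \<ominus> v"] N[OF that] \<sigma>[of n] by auto
  moreover have "(\<lambda>n. l (\<sigma> n)) \<longlonglongrightarrow> l v" using w l(1) by (auto simp: weakly_tendsto_def)
  ultimately have "l v + e \<le> l v" by (intro LIMSEQ_le_const) auto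
  then show False using e by simp
qed

end

section \<open>Groups with a pointwise norm\<close>

text \<open>The part of the theory that involves no multiplication. It is shared by the normed space
  of families, on which only simple functions act, by its completion and by complete
  modules.\<close>

locale pnormed_group = abelian_group M for M :: "('a, 'v, 'z) normed_mod_scheme" (structure) +
  fixes m :: "'a measure" and p :: real
  assumes p1: "1 < p"
    and pnorm_plus: "v \<in> carrier M \<Longrightarrow> pnorm M v \<in> Lp_plus m p"
    and vnorm_eq: "v \<in> carrier M \<Longrightarrow> vnorm M v = Lp_norm m p (pnorm M v)"
    and pnorm_triangle: "u \<in> carrier M \<Longrightarrow> v \<in> carrier M \<Longrightarrow>
      AE x in m. pnorm M (u \<oplus> v) x \<le> pnorm M u x + pnorm M v x"
    and pnorm_minus: "v \<in> carrier M \<Longrightarrow> AE x in m. pnorm M (\<ominus> v) x = pnorm M v x"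
    and pnorm_zero: "AE x in m. pnorm M \<zero> x = 0"
    and vnorm_eq_0: "v \<in> carrier M \<Longrightarrow> vnorm M v = 0 \<Longrightarrow> v = \<zero>"
begin

lemma p_pos: "0 < p" and p_ge_1: "1 \<le> p"
  using p1 by auto

lemma pnorm_Lp: "v \<in> carrier M \<Longrightarrow> pnorm M v \<in> Lp m p"
  using pnorm_plus by (rule Lp_plusD(1))

lemma pnorm_measurable: "v \<in> carrier M \<Longrightarrow> pnorm M v \<in> borel_measurable m"
  using pnorm_Lp by (rule LpD(1))

lemma pnorm_nonneg: "v \<in> carrier M \<Longrightarrow> AE x in m. 0 \<le> pnorm M v x"
  using pnorm_plus by (rule Lp_plusD(2))

lemma vnorm_nonneg: "v \<in> carrier M \<Longrightarrow> 0 \<le> vnorm M v"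
  by (simp add: vnorm_eq)

lemma vnorm_le:
  assumes "u \<in> carrier M" "f \<in> Lp m p" "AE x in m. pnorm M u x \<le> f x"
  shows "vnorm M u \<le> Lp_norm m p f"
  unfolding vnorm_eq[OF assms(1)]
  by (rule Lp_dominated(2)[OF p_pos pnorm_measurable assms(2)])
    (use pnorm_nonneg[OF assms(1)] assms in \<open>auto elim!: eventually_elim2\<close>)

lemma vnorm_mono:
  assumes "u \<in> carrier M" "v \<in> carrier M" "AE x in m. pnorm M u x \<le> pnorm M v x"
  shows "vnorm M u \<le> vnorm M v"
  using vnorm_le[OF assms(1) pnorm_Lp assms(3)] assms(2) by (simp add: vnorm_eq)

lemma vnorm_cong:
  assumes "u \<in> carrier M" "v \<in> carrier M" "AE x in m. pnorm M u x = pnorm M v x"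
  shows "vnorm M u = vnorm M v"
  using assms by (intro order_antisym vnorm_mono) (auto elim: eventually_mono)

lemma vnorm_triangle:
  assumes "u \<in> carrier M" "v \<in> carrier M"
  shows "vnorm M (u \<oplus> v) \<le> vnorm M u + vnorm M v"
proof -
  have "vnorm M (u \<oplus> v) \<le> Lp_norm m p (\<lambda>x. pnorm M u x + pnorm M v x)"
    using assms by (intro vnorm_le Lp_add p_pos pnorm_Lp pnorm_triangle) auto
  also have "\<dots> \<le> vnorm M u + vnorm M v"
    using assms Lp_norm_triangle[OF p_ge_1 pnorm_Lp pnorm_Lp, of u v] by (simp add: vnorm_eq)
  finally show ?thesis .
qed

lemma vnorm_minus: "v \<in> carrier M \<Longrightarrow> vnorm M (\<ominus> v) = vnorm M v"
  by (intro vnorm_cong pnorm_minus) auto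

lemma pnorm_eq_0D:
  assumes "v \<in> carrier M" "AE x in m. pnorm M v x = 0" shows "v = \<zero>"
proof -
  have "vnorm M v \<le> Lp_norm m p (\<lambda>x. 0)" using assms by (intro vnorm_le) auto
  then show ?thesis using assms vnorm_nonneg[of v] by (intro vnorm_eq_0) auto
qed

lemma vnorm_zero [simp]: "vnorm M \<zero> = 0"
proof -
  have "AE x in m. pnorm M \<zero> x \<le> 0" using pnorm_zero by eventually_elim simp
  then show ?thesis using vnorm_le[OF zero_closed Lp_zero] vnorm_nonneg[of \<zero>] by simp
qed

lemma minus_diff: "u \<in> carrier M \<Longrightarrow> v \<in> carrier M \<Longrightarrow> \<ominus> (u \<ominus> v) = v \<ominus> u"
  by (simp add: minus_eq minus_add a_comm)

lemma diff_add_diff: "u \<in> carrier M \<Longrightarrow> v \<in> carrier M \<Longrightarrow> w \<in> carrier M \<Longrightarrow> (u \<ominus> v) \<oplus> (v \<ominus> w) = u \<ominus> w"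
  by (simp add: minus_eq a_assoc r_neg1)

lemma add_diff_add: "u \<in> carrier M \<Longrightarrow> v \<in> carrier M \<Longrightarrow> u' \<in> carrier M \<Longrightarrow> v' \<in> carrier M \<Longrightarrow>
    (u \<oplus> v) \<ominus> (u' \<oplus> v') = (u \<ominus> u') \<oplus> (v \<ominus> v')"
  by (simp add: minus_eq minus_add a_ac)

lemma diff_add_cancel: "u \<in> carrier M \<Longrightarrow> v \<in> carrier M \<Longrightarrow> (u \<ominus> v) \<oplus> v = u"
  by (simp add: minus_eq a_assoc l_neg)

lemma diff_zero: "u \<in> carrier M \<Longrightarrow> u \<ominus> \<zero> = u"
  using diff_add_cancel[of u \<zero>] by simp

lemma diff_self: "u \<in> carrier M \<Longrightarrow> u \<ominus> u = \<zero>"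
  by (simp add: minus_eq r_neg)

lemma diff_eq_0D: "u \<in> carrier M \<Longrightarrow> v \<in> carrier M \<Longrightarrow> u \<ominus> v = \<zero> \<Longrightarrow> u = v"
  using diff_add_cancel[of u v] by simp

lemma vnorm_diff_commute: "u \<in> carrier M \<Longrightarrow> v \<in> carrier M \<Longrightarrow> vnorm M (u \<ominus> v) = vnorm M (v \<ominus> u)"
  using vnorm_minus[of "u \<ominus> v"] by (simp add: minus_diff)

lemma vnorm_diff_triangle: "u \<in> carrier M \<Longrightarrow> v \<in> carrier M \<Longrightarrow> w \<in> carrier M \<Longrightarrow>
    vnorm M (u \<ominus> w) \<le> vnorm M (u \<ominus> v) + vnorm M (v \<ominus> w)"
  using vnorm_triangle[of "u \<ominus> v" "v \<ominus> w"] by (simp add: diff_add_diff)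

lemma pnorm_diff_commute: "u \<in> carrier M \<Longrightarrow> v \<in> carrier M \<Longrightarrow> AE x in m. pnorm M (u \<ominus> v) x = pnorm M (v \<ominus> u) x"
  using pnorm_minus[of "u \<ominus> v"] by (auto simp: minus_diff elim!: eventually_mono)

lemma pnorm_diff_triangle: "u \<in> carrier M \<Longrightarrow> v \<in> carrier M \<Longrightarrow> w \<in> carrier M \<Longrightarrow>
    AE x in m. pnorm M (u \<ominus> w) x \<le> pnorm M (u \<ominus> v) x + pnorm M (v \<ominus> w) x"
  using pnorm_triangle[of "u \<ominus> v" "v \<ominus> w"] by (simp add: diff_add_diff)

lemma abs_pnorm_diff_le:
  assumes "u \<in> carrier M" "v \<in> carrier M"
  shows "AE x in m. \<bar>pnorm M u x - pnorm M v x\<bar> \<le> pnorm M (u \<ominus> v) x"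
proof -
  have "AE x in m. pnorm M u x \<le> pnorm M (u \<ominus> v) x + pnorm M v x"
    using pnorm_triangle[of "u \<ominus> v" v] assms by (simp add: diff_add_cancel)
  moreover have "AE x in m. pnorm M v x \<le> pnorm M (v \<ominus> u) x + pnorm M u x"
    using pnorm_triangle[of "v \<ominus> u" u] assms by (simp add: diff_add_cancel)
  ultimately show ?thesis using pnorm_diff_commute[OF assms] by eventually_elim auto
qed

lemma Lp_norm_pnorm_diff_le:
  assumes "u \<in> carrier M" "v \<in> carrier M"
  shows "Lp_norm m p (\<lambda>x. pnorm M u x - pnorm M v x) \<le> vnorm M (u \<ominus> v)"
proof -
  have "Lp_norm m p (\<lambda>x. pnorm M u x - pnorm M v x) \<le> Lp_norm m p (pnorm M (u \<ominus> v))"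
    using abs_pnorm_diff_le[OF assms] pnorm_measurable assms
    by (intro Lp_dominated(2)[OF p_pos]) (auto intro: pnorm_Lp elim!: eventually_mono)
  then show ?thesis using assms by (simp add: vnorm_eq)
qed

lemma abs_vnorm_diff_le:
  "u \<in> carrier M \<Longrightarrow> v \<in> carrier M \<Longrightarrow> \<bar>vnorm M u - vnorm M v\<bar> \<le> vnorm M (u \<ominus> v)"
  using vnorm_triangle[of "u \<ominus> v" v] vnorm_triangle[of "v \<ominus> u" u]
  by (simp add: diff_add_cancel vnorm_diff_commute abs_le_iff)

lemma pnorm_le_limit:
  assumes u: "\<And>n. u n \<in> carrier M" "u' \<in> carrier M" "(\<lambda>n. vnorm M (u n \<ominus> u')) \<longlonglongrightarrow> 0"
    and h: "\<And>n. h n \<in> Lp m p" "H \<in> Lp m p" "(\<lambda>n. Lp_norm m p (\<lambda>x. h n x - H x)) \<longlonglongrightarrow> 0"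
    and le: "\<And>n. AE x in m. pnorm M (u n) x \<le> h n x"
  shows "AE x in m. pnorm M u' x \<le> H x"
proof (rule Lp_le_limit[OF p_ge_1 _ _ h(1,2) le _ h(3)])
  show "(\<lambda>n. Lp_norm m p (\<lambda>x. pnorm M (u n) x - pnorm M u' x)) \<longlonglongrightarrow> 0"
    using u by (intro tendsto_sandwich[OF _ _ tendsto_const u(3)]) (auto intro!: always_eventually Lp_norm_pnorm_diff_le)
qed (use u in \<open>auto intro: pnorm_Lp\<close>)

lemma le_pnorm_limit:
  assumes u: "\<And>n. u n \<in> carrier M" "u' \<in> carrier M" "(\<lambda>n. vnorm M (u n \<ominus> u')) \<longlonglongrightarrow> 0"
    and h: "h \<in> Lp m p" and le: "\<And>n. AE x in m. h x \<le> pnorm M (u n) x"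
  shows "AE x in m. h x \<le> pnorm M u' x"
proof (rule Lp_le_limit[OF p_ge_1 _ _ _ _ le])
  show "(\<lambda>n. Lp_norm m p (\<lambda>x. pnorm M (u n) x - pnorm M u' x)) \<longlonglongrightarrow> 0"
    using u by (intro tendsto_sandwich[OF _ _ tendsto_const u(3)]) (auto intro!: always_eventually Lp_norm_pnorm_diff_le)
qed (use u h in \<open>auto intro: pnorm_Lp\<close>)

section \<open>The metric of the norm: Cauchy sequences, limits and closed sets\<close>

lemma metric_space: "Metric_space (carrier M) (ndist M)"
proof
  show "0 \<le> ndist M u v" for u v by (simp add: ndist_def vnorm_nonneg)
  show "ndist M u v = ndist M v u" for u v by (simp add: ndist_def vnorm_diff_commute)
  show "ndist M u v = 0 \<longleftrightarrow> u = v" if "u \<in> carrier M" "v \<in> carrier M" for u v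
    using that vnorm_eq_0[of "u \<ominus> v"] diff_eq_0D[of u v] by (auto simp: ndist_def diff_self)
  show "ndist M u w \<le> ndist M u v + ndist M v w" if "u \<in> carrier M" "v \<in> carrier M" "w \<in> carrier M" for u v w
    using that by (simp add: ndist_def vnorm_diff_triangle)
qed

lemma MCauchy_iff:
  "Metric_space.MCauchy (carrier M) (ndist M) \<sigma> \<longleftrightarrow>
     (\<forall>n. \<sigma> n \<in> carrier M) \<and> (\<forall>e>0. \<exists>N. \<forall>n\<ge>N. \<forall>k\<ge>N. vnorm M (\<sigma> n \<ominus> \<sigma> k) < e)"
  unfolding Metric_space.MCauchy_def[OF metric_space] ndist_def by (auto simp: image_subset_iff)

lemma limitin_iff:
  assumes "\<And>n. \<sigma> n \<in> carrier M"
  shows "limitin (ntopology M) \<sigma> v sequentially \<longleftrightarrow> v \<in> carrier M \<and> (\<lambda>n. vnorm M (\<sigma> n \<ominus> v)) \<longlonglongrightarrow> 0"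
  unfolding Metric_space.limitin_metric_dist_null[OF metric_space] using assms by (auto simp: ndist_def)

lemma closedin_iff:
  "closedin (ntopology M) H \<longleftrightarrow> H \<subseteq> carrier M \<and>
     (\<forall>\<sigma> v. (\<forall>n. \<sigma> n \<in> H) \<longrightarrow> v \<in> carrier M \<longrightarrow> (\<lambda>n. vnorm M (\<sigma> n \<ominus> v)) \<longlonglongrightarrow> 0 \<longrightarrow> v \<in> H)"
  unfolding Metric_space.metric_closedin_iff_sequentially_closed[OF metric_space]
proof (intro conj_cong refl iff_allI)
  fix \<sigma> v assume H: "H \<subseteq> carrier M"
  show "(range \<sigma> \<subseteq> H \<and> limitin (ntopology M) \<sigma> v sequentially \<longrightarrow> v \<in> H) \<longleftrightarrow>
    ((\<forall>n. \<sigma> n \<in> H) \<longrightarrow> v \<in> carrier M \<longrightarrow> (\<lambda>n. vnorm M (\<sigma> n \<ominus> v)) \<longlonglongrightarrow> 0 \<longrightarrow> v \<in> H)"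
  proof (cases "\<forall>n. \<sigma> n \<in> H")
    case True
    then have "\<sigma> n \<in> carrier M" for n using H by auto
    from limitin_iff[OF this] show ?thesis using True by (auto simp: image_subset_iff)
  qed auto
qed

lemma convergent_imp_Cauchy:
  assumes "\<And>n. \<sigma> n \<in> carrier M" "v \<in> carrier M" "(\<lambda>n. vnorm M (\<sigma> n \<ominus> v)) \<longlonglongrightarrow> 0" "0 < e"
  shows "\<exists>N. \<forall>n\<ge>N. \<forall>k\<ge>N. vnorm M (\<sigma> n \<ominus> \<sigma> k) < e"
  using Metric_space.convergent_imp_MCauchy[OF metric_space, of \<sigma> v] assms limitin_iff[of \<sigma> v]
  by (auto simp: MCauchy_iff image_subset_iff)

lemma tendsto_add_vnorm:
  assumes "\<And>n. \<sigma> n \<in> carrier M" "u \<in> carrier M" "(\<lambda>n. vnorm M (\<sigma> n \<ominus> u)) \<longlonglongrightarrow> 0"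
    "\<And>n. \<tau> n \<in> carrier M" "v \<in> carrier M" "(\<lambda>n. vnorm M (\<tau> n \<ominus> v)) \<longlonglongrightarrow> 0"
  shows "(\<lambda>n. vnorm M ((\<sigma> n \<oplus> \<tau> n) \<ominus> (u \<oplus> v))) \<longlonglongrightarrow> 0"
proof (rule tendsto_sandwich[OF _ _ tendsto_const])
  show "(\<lambda>n. vnorm M (\<sigma> n \<ominus> u) + vnorm M (\<tau> n \<ominus> v)) \<longlonglongrightarrow> 0"
    using tendsto_add[OF assms(3,6)] by simp
qed (use assms in \<open>auto intro!: always_eventually vnorm_nonneg simp: add_diff_add vnorm_triangle\<close>)

end

section \<open>\<open>L\<^sup>p\<close>-normed modules\<close>

text \<open>A reduced list of axioms, with completeness in terms of sequences. This list is what
  gets checked for completions, quotients and closed submodules; \<open>lp_normed\<close> recovers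
  the full notion.\<close>

locale Lp_mod = pnormed_group M m p
  for M :: "('a, 'v, 'z) normed_mod_scheme" (structure) and m :: "'a measure" and p :: real +
  assumes space_UNIV: "space m = UNIV"
    and smult_closed: "f \<in> carrier (Linf m) \<Longrightarrow> v \<in> carrier M \<Longrightarrow> f \<odot> v \<in> carrier M"
    and smult_l_distr: "f \<in> carrier (Linf m) \<Longrightarrow> h \<in> carrier (Linf m) \<Longrightarrow> v \<in> carrier M \<Longrightarrow>
      (\<lambda>x. f x + h x) \<odot> v = f \<odot> v \<oplus> h \<odot> v"
    and smult_r_distr: "f \<in> carrier (Linf m) \<Longrightarrow> u \<in> carrier M \<Longrightarrow> v \<in> carrier M \<Longrightarrow>
      f \<odot> (u \<oplus> v) = f \<odot> u \<oplus> f \<odot> v"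
    and smult_assoc: "f \<in> carrier (Linf m) \<Longrightarrow> h \<in> carrier (Linf m) \<Longrightarrow> v \<in> carrier M \<Longrightarrow>
      (\<lambda>x. f x * h x) \<odot> v = f \<odot> (h \<odot> v)"
    and smult_one: "v \<in> carrier M \<Longrightarrow> (\<lambda>_. 1) \<odot> v = v"
    and pnorm_smult: "f \<in> carrier (Linf m) \<Longrightarrow> v \<in> carrier M \<Longrightarrow>
      AE x in m. pnorm M (f \<odot> v) x = \<bar>f x\<bar> * pnorm M v x"
    and complete: "(\<And>n. \<sigma> n \<in> carrier M) \<Longrightarrow>
      (\<And>e. 0 < e \<Longrightarrow> \<exists>N. \<forall>n\<ge>N. \<forall>k\<ge>N. vnorm M (\<sigma> n \<ominus> \<sigma> k) < e) \<Longrightarrow>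
      \<exists>v\<in>carrier M. (\<lambda>n. vnorm M (\<sigma> n \<ominus> v)) \<longlonglongrightarrow> 0"
begin

lemma is_module: "Module.module (Linf m) M"
  by (rule moduleI) (auto simp: Linf_cring abelian_group_axioms smult_closed smult_l_distr smult_r_distr smult_assoc smult_one)

lemma smult_minus: "f \<in> carrier (Linf m) \<Longrightarrow> v \<in> carrier M \<Longrightarrow> f \<odot> (\<ominus> v) = \<ominus> (f \<odot> v)"
  by (rule Module.module.smult_r_minus[OF is_module])

lemma smult_zero_right: "f \<in> carrier (Linf m) \<Longrightarrow> f \<odot> \<zero> = \<zero>"
  by (rule Module.module.smult_r_null[OF is_module])

lemma smult_diff: "f \<in> carrier (Linf m) \<Longrightarrow> u \<in> carrier M \<Longrightarrow> v \<in> carrier M \<Longrightarrow> f \<odot> (u \<ominus> v) = f \<odot> u \<ominus> f \<odot> v"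
  by (simp add: minus_eq smult_r_distr smult_minus)

lemma vnorm_smult_le:
  assumes "f \<in> carrier (Linf m)" "0 \<le> C" "AE x in m. \<bar>f x\<bar> \<le> C" "v \<in> carrier M"
  shows "vnorm M (f \<odot> v) \<le> C * vnorm M v"
proof -
  have "vnorm M (f \<odot> v) \<le> Lp_norm m p (\<lambda>x. C * pnorm M v x)"
  proof (rule vnorm_le)
    show "AE x in m. pnorm M (f \<odot> v) x \<le> C * pnorm M v x"
      using pnorm_smult[OF assms(1,4)] assms(3) pnorm_nonneg[OF assms(4)]
      by eventually_elim (auto intro: mult_right_mono)
  qed (use assms in \<open>auto intro: smult_closed Lp_scale pnorm_Lp\<close>)
  then show ?thesis using assms p_pos by (simp add: Lp_norm_scale vnorm_eq)
qed

lemma tendsto_smult: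
  assumes f: "f \<in> carrier (Linf m)" and \<sigma>: "\<And>n. \<sigma> n \<in> carrier M" "v \<in> carrier M" "(\<lambda>n. vnorm M (\<sigma> n \<ominus> v)) \<longlonglongrightarrow> 0"
  shows "(\<lambda>n. vnorm M (f \<odot> \<sigma> n \<ominus> f \<odot> v)) \<longlonglongrightarrow> 0"
proof -
  obtain C where C: "0 < C" "AE x in m. \<bar>f x\<bar> \<le> C" using f by (rule Linf_bound)
  show ?thesis
  proof (rule tendsto_sandwich[OF _ _ tendsto_const])
    show "(\<lambda>n. C * vnorm M (\<sigma> n \<ominus> v)) \<longlonglongrightarrow> 0" using tendsto_mult_right_zero[OF \<sigma>(3)] .
    show "\<forall>\<^sub>F n in sequentially. vnorm M (f \<odot> \<sigma> n \<ominus> f \<odot> v) \<le> C * vnorm M (\<sigma> n \<ominus> v)"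
      using f \<sigma> C by (auto intro!: always_eventually vnorm_smult_le simp: smult_diff[symmetric])
  qed (use f \<sigma> in \<open>auto intro!: always_eventually vnorm_nonneg smult_closed\<close>)
qed

text \<open>Converts the algebraic conditions in locality and glueing into a.e. statements about
  pointwise norms.\<close>

lemma smult_indicator_eq_iff:
  assumes A: "A \<in> sets m" and u: "u \<in> carrier M" and v: "v \<in> carrier M"
  shows "indicat_real A \<odot> u = indicat_real A \<odot> v \<longleftrightarrow> (AE x in m. x \<in> A \<longrightarrow> pnorm M (u \<ominus> v) x = 0)"
proof -
  have c: "indicat_real A \<odot> u \<in> carrier M" "indicat_real A \<odot> v \<in> carrier M" "indicat_real A \<odot> (u \<ominus> v) \<in> carrier M"
    using A u v by (auto intro: smult_closed)
  have uv: "AE x in m. pnorm M (indicat_real A \<odot> (u \<ominus> v)) x = \<bar>indicat_real A x\<bar> * pnorm M (u \<ominus> v) x"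
    using A u v by (intro pnorm_smult) auto
  have "indicat_real A \<odot> u = indicat_real A \<odot> v \<longleftrightarrow> indicat_real A \<odot> (u \<ominus> v) = \<zero>"
    using A u v c diff_eq_0D[OF c(1,2)] by (auto simp: smult_diff diff_self)
  also have "\<dots> \<longleftrightarrow> (AE x in m. pnorm M (indicat_real A \<odot> (u \<ominus> v)) x = 0)"
    using pnorm_eq_0D[OF c(3)] pnorm_zero by auto
  also have "\<dots> \<longleftrightarrow> (AE x in m. x \<in> A \<longrightarrow> pnorm M (u \<ominus> v) x = 0)"
  proof
    assume "AE x in m. pnorm M (indicat_real A \<odot> (u \<ominus> v)) x = 0"
    with uv show "AE x in m. x \<in> A \<longrightarrow> pnorm M (u \<ominus> v) x = 0" by eventually_elim auto
  next
    assume "AE x in m. x \<in> A \<longrightarrow> pnorm M (u \<ominus> v) x = 0"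
    with uv show "AE x in m. pnorm M (indicat_real A \<odot> (u \<ominus> v)) x = 0" by eventually_elim (auto simp: indicator_def)
  qed
  finally show ?thesis .
qed

text \<open>For finite \<open>p\<close> locality and glueing follow from completeness.\<close>

lemma locality: "module_locality m M"
  unfolding module_locality_def
proof (intro ballI allI impI)
  fix v A assume v: "v \<in> carrier M" and A: "range A \<subseteq> sets m" and "\<forall>n::nat. indicat_real (A n) \<odot> v = \<zero>"
  then have "AE x in m. x \<in> A n \<longrightarrow> pnorm M v x = 0" for n
    using smult_indicator_eq_iff[of "A n" v \<zero>] by (auto simp: smult_zero_right diff_zero)
  then have "AE x in m. \<forall>n. x \<in> A n \<longrightarrow> pnorm M v x = 0" by (intro AE_all_countable[THEN iffD2] allI)
  then have "AE x in m. x \<in> (\<Union>n. A n) \<longrightarrow> pnorm M v x = 0" by eventually_elim auto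
  moreover have "(\<Union>n. A n) \<in> sets m" using A by auto
  ultimately show "indicat_real (\<Union>n. A n) \<odot> v = \<zero>"
    using smult_indicator_eq_iff[of "\<Union>n. A n" v \<zero>] v by (auto simp: smult_zero_right diff_zero)
qed

end

section \<open>Glueing\<close>

context Lp_mod
begin

lemma smult_l_diff:
  assumes "f \<in> carrier (Linf m)" "h \<in> carrier (Linf m)" "v \<in> carrier M"
  shows "f \<odot> v \<ominus> h \<odot> v = (\<lambda>x. f x - h x) \<odot> v"
proof -
  have "f \<odot> v = (\<lambda>x. f x - h x) \<odot> v \<oplus> h \<odot> v"
    using smult_l_distr[OF Linf_minus[OF assms(1,2)] assms(2,3)] by simp
  then show ?thesis using assms Linf_minus[OF assms(1,2)]
    by (simp add: minus_eq a_assoc smult_closed r_neg)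
qed

lemma pnorm_smult_l_diff:
  assumes "f \<in> carrier (Linf m)" "h \<in> carrier (Linf m)" "v \<in> carrier M"
  shows "AE x in m. pnorm M (f \<odot> v \<ominus> h \<odot> v) x = \<bar>f x - h x\<bar> * pnorm M v x"
  using pnorm_smult[OF Linf_minus[OF assms(1,2)] assms(3)] assms by (simp add: smult_l_diff)

lemma pnorm_smult_r_diff:
  assumes "f \<in> carrier (Linf m)" "u \<in> carrier M" "v \<in> carrier M"
  shows "AE x in m. pnorm M (f \<odot> u \<ominus> f \<odot> v) x = \<bar>f x\<bar> * pnorm M (u \<ominus> v) x"
  using pnorm_smult[of f "u \<ominus> v"] assms by (simp add: smult_diff)

lemma pnorm_add_diff_le:
  assumes "u \<in> carrier M" "v \<in> carrier M" "u' \<in> carrier M" "v' \<in> carrier M"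
  shows "AE x in m. pnorm M ((u \<oplus> v) \<ominus> (u' \<oplus> v')) x \<le> pnorm M (u \<ominus> u') x + pnorm M (v \<ominus> v') x"
  using pnorm_triangle[of "u \<ominus> u'" "v \<ominus> v'"] assms by (simp add: add_diff_add)

text \<open>The sets \<open>A i\<close> may overlap, so the bounded partial sums \<open>S n\<close>
  are not yet partial glueings. The sums \<open>T n\<close> over the disjoint sets
  \<open>B n\<close> are, and |T n| \<le> |S n| a.e.: on \<open>A j\<close> with j < n the element
  \<open>S n\<close> is \<open>v j\<close> times the number \<open>c n\<close> of sets among the
  first \<open>n\<close> that contain the point, which is at least 1. Disjoint supports make the
  p-th powers of the norms additive along \<open>T n\<close>; bounded and increasing, they converge,
  so \<open>T n\<close> is Cauchy.\<close>

lemma glueing: "module_glueing m M"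
  unfolding module_glueing_def
proof (intro allI impI)
  fix v A
  assume v: "range v \<subseteq> carrier M" and A: "range A \<subseteq> sets m"
    and compat: "\<forall>i j::nat. indicat_real (A i \<inter> A j) \<odot> v i = indicat_real (A i \<inter> A j) \<odot> v j"
    and "\<exists>C. \<forall>n. vnorm M (\<Oplus>i\<in>{..<n}. indicat_real (A i) \<odot> v i) \<le> C"
  then obtain C where C: "\<And>n. vnorm M (\<Oplus>i\<in>{..<n}. indicat_real (A i) \<odot> v i) \<le> C" by auto
  have vc [simp]: "v i \<in> carrier M" for i using v by auto
  have Am [measurable, simp]: "A i \<in> sets m" for i using A by auto
  have cp: "AE x in m. x \<in> A i \<longrightarrow> x \<in> A j \<longrightarrow> pnorm M (v i \<ominus> v j) x = 0" for i j
    using compat smult_indicator_eq_iff[of "A i \<inter> A j" "v i" "v j"] by (auto elim!: eventually_mono)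
  define U where "U n = (\<Union>i<n. A i)" for n
  define B where "B n = A n - U n" for n
  have Bm [measurable, simp]: "B n \<in> sets m" and Um [measurable, simp]: "U n \<in> sets m" for n by (auto simp: B_def U_def)
  have U_Suc: "U (Suc n) = U n \<union> A n" for n by (auto simp: U_def less_Suc_eq)
  define T where "T = rec_nat \<zero> (\<lambda>n t. t \<oplus> indicat_real (B n) \<odot> v n)"
  have T0: "T 0 = \<zero>" and TS: "T (Suc n) = T n \<oplus> indicat_real (B n) \<odot> v n" for n by (simp_all add: T_def)
  have [simp]: "indicat_real (B n) \<odot> v k \<in> carrier M" "indicat_real (A n) \<odot> v k \<in> carrier M" for n k by (auto intro: smult_closed)
  have Tc [simp]: "T n \<in> carrier M" for n by (induction n) (auto simp: T0 TS)
  \<comment> \<open>The induction needs both halves together: agreement with every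
    \<open>v j\<close> inside \<open>U n\<close>, and vanishing outside, where the next piece is
    attached.\<close>
  have T_inv: "AE x in m. (x \<in> A j \<and> x \<in> U n \<longrightarrow> pnorm M (T n \<ominus> v j) x = 0) \<and> (x \<notin> U n \<longrightarrow> pnorm M (T n) x = 0)" for j n
  proof (induction n)
    case 0 then show ?case using pnorm_zero by (auto simp: U_def T0 elim!: eventually_mono)
  next
    case (Suc n)
    have 1: "AE x in m. pnorm M (T (Suc n) \<ominus> v j) x \<le> pnorm M (T n \<ominus> v j) x + pnorm M (indicat_real (B n) \<odot> v n) x"
      using pnorm_add_diff_le[of "T n" "indicat_real (B n) \<odot> v n" "v j" \<zero>] by (simp add: TS diff_zero)
    have 2: "AE x in m. pnorm M (T (Suc n) \<ominus> v j) x \<le> pnorm M (T n) x + pnorm M (indicat_real (B n) \<odot> v n \<ominus> v j) x"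
      using pnorm_add_diff_le[of "T n" "indicat_real (B n) \<odot> v n" \<zero> "v j"] by (simp add: TS diff_zero)
    have 3: "AE x in m. pnorm M (T (Suc n)) x \<le> pnorm M (T n) x + pnorm M (indicat_real (B n) \<odot> v n) x"
      unfolding TS by (rule pnorm_triangle) auto
    have 4: "AE x in m. pnorm M (indicat_real (B n) \<odot> v n) x = \<bar>indicat_real (B n) x\<bar> * pnorm M (v n) x"
      by (intro pnorm_smult) auto
    have 5: "AE x in m. pnorm M (indicat_real (B n) \<odot> v n \<ominus> v j) x \<le>
        pnorm M (indicat_real (B n) \<odot> v n \<ominus> indicat_real (B n) \<odot> v j) x + pnorm M (indicat_real (B n) \<odot> v j \<ominus> v j) x"
      by (intro pnorm_diff_triangle) auto
    have 6: "AE x in m. pnorm M (indicat_real (B n) \<odot> v n \<ominus> indicat_real (B n) \<odot> v j) x = \<bar>indicat_real (B n) x\<bar> * pnorm M (v n \<ominus> v j) x"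
      by (intro pnorm_smult_r_diff) auto
    have 7: "AE x in m. pnorm M (indicat_real (B n) \<odot> v j \<ominus> v j) x = \<bar>indicat_real (B n) x - 1\<bar> * pnorm M (v j) x"
      using pnorm_smult_l_diff[of "indicat_real (B n)" "\<lambda>_. 1" "v j"] by (simp add: smult_one)
    have 8: "AE x in m. 0 \<le> pnorm M (T (Suc n) \<ominus> v j) x \<and> 0 \<le> pnorm M (T (Suc n)) x"
      using pnorm_nonneg[of "T (Suc n) \<ominus> v j"] pnorm_nonneg[of "T (Suc n)"] by simp
    show ?case using Suc 1 2 3 4 5 6 7 8 cp[of n j]
    proof eventually_elim
      case (elim x)
      consider "x \<in> U n" | "x \<notin> U n" "x \<in> A n" | "x \<notin> U n" "x \<notin> A n" by auto
      then show ?case using elim by cases (auto simp: U_Suc B_def)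
    qed
  qed
  have T_v: "AE x in m. x \<in> A j \<longrightarrow> pnorm M (T n \<ominus> v j) x = 0" if "j < n" for j n
    using T_inv[of j n] by eventually_elim (use that in \<open>auto simp: U_def\<close>)
  have T_out: "AE x in m. x \<notin> U n \<longrightarrow> pnorm M (T n) x = 0" for n
    using T_inv[of 0 n] by eventually_elim auto
  define S where "S n = (\<Oplus>i\<in>{..<n}. indicat_real (A i) \<odot> v i)" for n
  define c where "c n x = (\<Sum>i<n. indicat_real (A i) x)" for n x
  have Sc [simp]: "S n \<in> carrier M" for n unfolding S_def by (rule finsum_closed) auto
  have S0: "S 0 = \<zero>" and SS: "S (Suc n) = S n \<oplus> indicat_real (A n) \<odot> v n" for n
    by (auto simp: S_def lessThan_Suc a_comm)
  have cS: "c (Suc n) = (\<lambda>x. c n x + indicat_real (A n) x)" for n by (auto simp: c_def)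
  have cL [simp]: "c n \<in> carrier (Linf m)" for n
  proof (induction n)
    case (Suc n) then show ?case unfolding cS by (intro Linf_plus) auto
  qed (simp add: c_def[abs_def])
  have S_inv: "AE x in m. x \<in> A j \<longrightarrow> pnorm M (S n \<ominus> c n \<odot> v j) x = 0" for j n
  proof (induction n)
    case 0
    have "c 0 \<odot> v j = \<zero>" using Module.module.smult_l_null[OF is_module, of "v j"] by (simp add: c_def[abs_def])
    then show ?case using pnorm_zero by (auto simp: S0 diff_self elim!: eventually_mono)
  next
    case (Suc n)
    have cc [simp]: "c k \<odot> v j \<in> carrier M" for k by (auto intro: smult_closed)
    have 1: "AE x in m. pnorm M (S (Suc n) \<ominus> c (Suc n) \<odot> v j) x \<le> pnorm M (S n \<ominus> c n \<odot> v j) x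
        + pnorm M (indicat_real (A n) \<odot> v n \<ominus> indicat_real (A n) \<odot> v j) x"
      using pnorm_add_diff_le[of "S n" "indicat_real (A n) \<odot> v n" "c n \<odot> v j" "indicat_real (A n) \<odot> v j"]
      by (simp add: SS cS smult_l_distr)
    have 2: "AE x in m. pnorm M (indicat_real (A n) \<odot> v n \<ominus> indicat_real (A n) \<odot> v j) x = \<bar>indicat_real (A n) x\<bar> * pnorm M (v n \<ominus> v j) x"
      by (intro pnorm_smult_r_diff) auto
    have 3: "AE x in m. 0 \<le> pnorm M (S (Suc n) \<ominus> c (Suc n) \<odot> v j) x" by (intro pnorm_nonneg) auto
    show ?case using Suc 1 2 3 cp[of n j] by eventually_elim (auto simp: indicator_def split: if_splits)
  qed
  have T_le_S: "vnorm M (T n) \<le> vnorm M (S n)" for n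
  proof (intro vnorm_mono Tc Sc)
    have "AE x in m. \<forall>j<n. x \<in> A j \<longrightarrow> pnorm M (T n) x \<le> pnorm M (S n) x"
    proof (subst AE_all_countable, intro allI)
      fix j
      show "AE x in m. j < n \<longrightarrow> x \<in> A j \<longrightarrow> pnorm M (T n) x \<le> pnorm M (S n) x"
      proof (cases "j < n")
        case True
        have 1: "AE x in m. \<bar>pnorm M (T n) x - pnorm M (v j) x\<bar> \<le> pnorm M (T n \<ominus> v j) x"
          by (intro abs_pnorm_diff_le) auto
        have 2: "AE x in m. \<bar>pnorm M (S n) x - pnorm M (c n \<odot> v j) x\<bar> \<le> pnorm M (S n \<ominus> c n \<odot> v j) x"
          by (intro abs_pnorm_diff_le) (auto intro: smult_closed)
        have 3: "AE x in m. pnorm M (c n \<odot> v j) x = \<bar>c n x\<bar> * pnorm M (v j) x"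
          by (intro pnorm_smult) auto
        have 4: "1 \<le> c n x" if "x \<in> A j" for x
          using member_le_sum[of j "{..<n}" "\<lambda>i. indicat_real (A i) x"] True that by (simp add: c_def)
        show ?thesis using 1 2 3 T_v[OF True] S_inv[of j n] pnorm_nonneg[OF vc[of j]]
        proof eventually_elim
          case (elim x)
          have "pnorm M (v j) x \<le> \<bar>c n x\<bar> * pnorm M (v j) x" if "x \<in> A j"
            using mult_right_mono[of 1 "\<bar>c n x\<bar>" "pnorm M (v j) x"] 4[OF that] elim by auto
          then show ?case using elim by auto
        qed
      qed auto
    qed
    with T_out[of n] pnorm_nonneg[OF Sc[of n]]
    show "AE x in m. pnorm M (T n) x \<le> pnorm M (S n) x"
      by eventually_elim (auto simp: U_def)
  qed
  \<comment> \<open>T k - T n lives outside \<open>U n\<close> and \<open>T n\<close> inside, so the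
    p-th powers of the norms add.\<close>
  have T_split: "vnorm M (T k \<ominus> T n) powr p + vnorm M (T n) powr p = vnorm M (T k) powr p" if nk: "n \<le> k" for n k
  proof -
    have on: "AE x in m. x \<in> U n \<longrightarrow> pnorm M (T k \<ominus> T n) x = 0"
    proof -
      have "AE x in m. \<forall>j. j < n \<longrightarrow> x \<in> A j \<longrightarrow> pnorm M (T k \<ominus> T n) x = 0"
      proof (subst AE_all_countable, intro allI)
        fix j
        show "AE x in m. j < n \<longrightarrow> x \<in> A j \<longrightarrow> pnorm M (T k \<ominus> T n) x = 0"
        proof (cases "j < n")
          case True
          then have "j < k" using nk by simp
          show ?thesis using T_v[OF True] T_v[OF \<open>j < k\<close>] pnorm_diff_triangle[OF Tc[of k] vc[of j] Tc[of n]]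
            pnorm_diff_commute[OF Tc[of n] vc[of j]] pnorm_nonneg[OF minus_closed[OF Tc[of k] Tc[of n]]] by eventually_elim auto
        qed auto
      qed
      then show ?thesis by eventually_elim (auto simp: U_def)
    qed
    have [measurable]: "pnorm M (T k) \<in> borel_measurable m" "pnorm M (T n) \<in> borel_measurable m"
      "pnorm M (T k \<ominus> T n) \<in> borel_measurable m" by (intro pnorm_measurable; simp)+
    have d: "(T k \<ominus> T n) \<oplus> T n = T k" by (rule diff_add_cancel) auto
    have 1: "AE x in m. pnorm M (T k) x \<le> pnorm M (T k \<ominus> T n) x + pnorm M (T n) x"
      using pnorm_triangle[of "T k \<ominus> T n" "T n"] by (simp add: d)
    have 2: "AE x in m. pnorm M (T k \<ominus> T n) x \<le> pnorm M (T k) x + pnorm M (T n) x"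
      using pnorm_triangle[of "T k" "\<ominus> T n"] pnorm_minus[of "T n"] by (auto simp: minus_eq)
    have "AE x in m. \<bar>pnorm M (T k) x\<bar> powr p = \<bar>pnorm M (T k \<ominus> T n) x\<bar> powr p + \<bar>pnorm M (T n) x\<bar> powr p"
      using on T_out[of n] 1 2 abs_pnorm_diff_le[OF Tc[of k] Tc[of n]]
    proof eventually_elim
      case (elim x)
      show ?case
      proof (cases "x \<in> U n")
        case True
        then have "pnorm M (T k) x = pnorm M (T n) x" "pnorm M (T k \<ominus> T n) x = 0" using elim by auto
        then show ?thesis by simp
      next
        case False
        then have "pnorm M (T k) x = pnorm M (T k \<ominus> T n) x" "pnorm M (T n) x = 0" using elim by auto
        then show ?thesis by simp
      qed
    qed
    then have "(\<integral>x. \<bar>pnorm M (T k) x\<bar> powr p \<partial>m) = (\<integral>x. \<bar>pnorm M (T k \<ominus> T n) x\<bar> powr p + \<bar>pnorm M (T n) x\<bar> powr p \<partial>m)"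
      by (rule integral_cong_AE[rotated 2]) measurable
    also have "\<dots> = (\<integral>x. \<bar>pnorm M (T k \<ominus> T n) x\<bar> powr p \<partial>m) + (\<integral>x. \<bar>pnorm M (T n) x\<bar> powr p \<partial>m)"
      by (intro Bochner_Integration.integral_add LpD(2) pnorm_Lp) auto
    finally show ?thesis using p_pos by (simp add: vnorm_eq Lp_norm_powr)
  qed
  have "convergent (\<lambda>n. vnorm M (T n) powr p)"
  proof (intro Bseq_monoseq_convergent BseqI'[of _ "C powr p"] incseq_imp_monoseq)
    show "incseq (\<lambda>n. vnorm M (T n) powr p)"
    proof (intro monoI)
      fix n k :: nat assume "n \<le> k"
      have "0 \<le> vnorm M (T k \<ominus> T n) powr p" by simp
      then show "vnorm M (T n) powr p \<le> vnorm M (T k) powr p" using T_split[OF \<open>n \<le> k\<close>] by linarith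
    qed
    show "norm (vnorm M (T n) powr p) \<le> C powr p" for n
      using order_trans[OF T_le_S[of n] C[of n, folded S_def]] p_pos by (auto intro!: powr_mono2 vnorm_nonneg)
  qed
  then have Cau: "Cauchy (\<lambda>n. vnorm M (T n) powr p)" by (rule convergent_Cauchy)
  have "\<exists>N. \<forall>n\<ge>N. \<forall>k\<ge>N. vnorm M (T n \<ominus> T k) < e" if e: "0 < e" for e
  proof -
    obtain N where N: "\<And>n k. N \<le> n \<Longrightarrow> N \<le> k \<Longrightarrow> \<bar>vnorm M (T n) powr p - vnorm M (T k) powr p\<bar> < e powr p"
      using CauchyD[OF Cau, of "e powr p"] e by auto
    have *: "vnorm M (T k \<ominus> T n) < e" if "N \<le> n" "n \<le> k" for n k
    proof -
      have "vnorm M (T k \<ominus> T n) powr p < e powr p"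
        using T_split[OF that(2)] N[of n k] that by linarith
      then show ?thesis using p_pos e by (meson not_le powr_mono2 less_imp_le)
    qed
    have "vnorm M (T n \<ominus> T k) < e" if "N \<le> n" "N \<le> k" for n k
      using *[of n k] *[of k n] that vnorm_diff_commute[of "T n" "T k"] by (cases "n \<le> k") auto
    then show ?thesis by blast
  qed
  from complete[OF Tc this] obtain w where w: "w \<in> carrier M" "(\<lambda>n. vnorm M (T n \<ominus> w)) \<longlonglongrightarrow> 0" by blast
  have "indicat_real (A i) \<odot> w = indicat_real (A i) \<odot> v i" for i
  proof -
    \<comment> \<open>The set \<open>A i\<close> has been treated from index \<open>Suc i\<close>
      on, hence the shift.\<close>
    have T_eq: "indicat_real (A i) \<odot> T (n + Suc i) = indicat_real (A i) \<odot> v i" for n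
      using smult_indicator_eq_iff[of "A i" "T (n + Suc i)" "v i"] T_v[of i "n + Suc i"] by auto
    have "(\<lambda>n. vnorm M (indicat_real (A i) \<odot> T n \<ominus> indicat_real (A i) \<odot> w)) \<longlonglongrightarrow> 0"
      by (intro tendsto_smult w) auto
    from LIMSEQ_ignore_initial_segment[OF this, of "Suc i"]
    have "(\<lambda>n. vnorm M (indicat_real (A i) \<odot> v i \<ominus> indicat_real (A i) \<odot> w)) \<longlonglongrightarrow> 0" unfolding T_eq .
    then have "vnorm M (indicat_real (A i) \<odot> v i \<ominus> indicat_real (A i) \<odot> w) = 0" by (simp add: LIMSEQ_const_iff)
    then have "indicat_real (A i) \<odot> v i \<ominus> indicat_real (A i) \<odot> w = \<zero>"
      using w by (intro vnorm_eq_0) (simp_all add: smult_closed)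
    from diff_eq_0D[OF _ _ this] show ?thesis using w by (simp add: smult_closed)
  qed
  then show "\<exists>w\<in>carrier M. \<forall>i. indicat_real (A i) \<odot> w = indicat_real (A i) \<odot> v i" using w by blast
qed

theorem lp_normed: "lp_normed_module m p M"
  unfolding lp_normed_module_def
proof (intro conjI ballI allI)
  show "Metric_space.mcomplete (carrier M) (ndist M)"
    unfolding Metric_space.mcomplete_def[OF metric_space]
  proof (intro allI impI)
    fix \<sigma> assume "Metric_space.MCauchy (carrier M) (ndist M) \<sigma>"
    then have \<sigma>: "\<And>n. \<sigma> n \<in> carrier M" "\<And>e. 0 < e \<Longrightarrow> \<exists>N. \<forall>n\<ge>N. \<forall>k\<ge>N. vnorm M (\<sigma> n \<ominus> \<sigma> k) < e"
      by (auto simp: MCauchy_iff)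
    from complete[OF this] show "\<exists>v. limitin (ntopology M) \<sigma> v sequentially" using \<sigma> by (auto simp: limitin_iff)
  qed
  show "vnorm M ((\<lambda>_. c) \<odot> v) = \<bar>c\<bar> * vnorm M v" if v: "v \<in> carrier M" for v c
  proof -
    have "vnorm M ((\<lambda>_. c) \<odot> v) = Lp_norm m p (\<lambda>x. \<bar>c\<bar> * pnorm M v x)"
      unfolding vnorm_eq[OF smult_closed[OF Linf_const v]]
    proof (rule Lp_norm_cong_AE)
      show "pnorm M ((\<lambda>_. c) \<odot> v) \<in> borel_measurable m" by (rule pnorm_measurable[OF smult_closed[OF Linf_const v]])
      show "(\<lambda>x. \<bar>c\<bar> * pnorm M v x) \<in> borel_measurable m" using pnorm_measurable[OF v] by simp
      show "AE x in m. \<bar>pnorm M ((\<lambda>_. c) \<odot> v) x\<bar> = \<bar>\<bar>c\<bar> * pnorm M v x\<bar>"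
        using pnorm_smult[OF Linf_const[of c] v] by eventually_elim (simp add: abs_mult)
    qed
    then show ?thesis using p_pos v by (simp add: Lp_norm_scale vnorm_eq)
  qed
  show "AE x in m. pnorm M (f \<odot> v) x = \<bar>f x\<bar> * pnorm M v x"
    if "f \<in> carrier (Linf m)" "v \<in> carrier M" for f v by (rule pnorm_smult[OF that])
qed (fact is_module metric_space locality glueing pnorm_plus vnorm_eq)+

lemma seminormed: "seminormed_mod M"
proof
  show "vnorm M ((\<lambda>_. c) \<odot> v) = \<bar>c\<bar> * vnorm M v" if "v \<in> carrier M" for v c
    using lp_normed that by (auto simp: lp_normed_module_def)
  show "(\<lambda>_. a) \<odot> ((\<lambda>_. b) \<odot> v) = (\<lambda>_. a * b) \<odot> v" if "v \<in> carrier M" for v a b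
    using smult_assoc[of "\<lambda>_. a" "\<lambda>_. b" v] that by simp
  show "(\<lambda>_. a + b) \<odot> v = (\<lambda>_. a) \<odot> v \<oplus> (\<lambda>_. b) \<odot> v" if "v \<in> carrier M" for v a b
    using smult_l_distr[of "\<lambda>_. a" "\<lambda>_. b" v] that by simp
qed (simp_all add: smult_closed smult_r_distr smult_one vnorm_nonneg vnorm_triangle)

section \<open>Closed submodules and simple combinations\<close>

lemma closed_submodule:
  assumes H: "H \<subseteq> carrier M" "\<zero> \<in> H" "\<And>u v. u \<in> H \<Longrightarrow> v \<in> H \<Longrightarrow> u \<oplus> v \<in> H"
    "\<And>f v. f \<in> carrier (Linf m) \<Longrightarrow> v \<in> H \<Longrightarrow> f \<odot> v \<in> H"
    and closed: "\<And>\<sigma> v. (\<And>n. \<sigma> n \<in> H) \<Longrightarrow> v \<in> carrier M \<Longrightarrow> (\<lambda>n. vnorm M (\<sigma> n \<ominus> v)) \<longlonglongrightarrow> 0 \<Longrightarrow> v \<in> H"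
  shows "Lp_mod (M\<lparr>carrier := H\<rparr>) m p" "lp_submodule m p M H" "\<And>v. v \<in> H \<Longrightarrow> \<ominus> v \<in> H"
proof -
  let ?N = "M\<lparr>carrier := H\<rparr>"
  have c: "v \<in> carrier M" if "v \<in> H" for v using that H by auto
  have neg: "\<ominus> v \<in> H" if "v \<in> H" for v
  proof -
    have "\<ominus> v = (\<lambda>_. -1) \<odot> v" using seminormed_mod.scal_minus_one[OF seminormed c[OF that]] by simp
    then show ?thesis using H(4)[OF Linf_const that] by simp
  qed
  then show "\<And>v. v \<in> H \<Longrightarrow> \<ominus> v \<in> H" .
  have ag: "abelian_group ?N"
  proof (rule abelian_groupI)
    show "\<exists>y\<in>carrier ?N. y \<oplus>\<^bsub>?N\<^esub> x = \<zero>\<^bsub>?N\<^esub>" if "x \<in> carrier ?N" for x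
      using that neg[of x] c[of x] by (auto simp: l_neg intro: bexI[of _ "\<ominus> x"])
  qed (use H c in \<open>simp_all add: a_ac\<close>)
  have inv: "\<ominus>\<^bsub>?N\<^esub> v = \<ominus> v" if "v \<in> H" for v
    by (rule abelian_group.minus_equality[OF ag]) (use that neg c in \<open>auto simp: l_neg\<close>)
  have diff: "u \<ominus>\<^bsub>?N\<^esub> v = u \<ominus> v" if "v \<in> H" for u v
    using inv[OF that] by (simp add: a_minus_def)
  interpret N: abelian_group ?N by (rule ag)
  show L: "Lp_mod ?N m p"
  proof
    show "\<exists>v\<in>carrier ?N. (\<lambda>n. vnorm ?N (\<sigma> n \<ominus>\<^bsub>?N\<^esub> v)) \<longlonglongrightarrow> 0"
      if "\<And>n. \<sigma> n \<in> carrier ?N" "\<And>e. 0 < e \<Longrightarrow> \<exists>N. \<forall>n\<ge>N. \<forall>k\<ge>N. vnorm ?N (\<sigma> n \<ominus>\<^bsub>?N\<^esub> \<sigma> k) < e" for \<sigma>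
    proof -
      have \<sigma>: "\<And>n. \<sigma> n \<in> H" using that by simp
      have "\<exists>v\<in>carrier M. (\<lambda>n. vnorm M (\<sigma> n \<ominus> v)) \<longlonglongrightarrow> 0"
        by (rule complete) (use that(2) \<sigma> c in \<open>auto simp: diff\<close>)
      then obtain v where v: "v \<in> carrier M" "(\<lambda>n. vnorm M (\<sigma> n \<ominus> v)) \<longlonglongrightarrow> 0" by blast
      moreover have "v \<in> H" by (rule closed[OF \<sigma> v])
      ultimately show ?thesis by (auto simp: diff)
    qed
    show "v = \<zero>\<^bsub>?N\<^esub>" if "v \<in> carrier ?N" "vnorm ?N v = 0" for v
      using vnorm_eq_0[of v] that c by simp
    show "vnorm ?N v = Lp_norm m p (pnorm ?N v)" if "v \<in> carrier ?N" for v
      using vnorm_eq[of v] that c by simp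
    show "(\<lambda>x. f x * h x) \<odot>\<^bsub>?N\<^esub> v = f \<odot>\<^bsub>?N\<^esub> (h \<odot>\<^bsub>?N\<^esub> v)"
      if "f \<in> carrier (Linf m)" "h \<in> carrier (Linf m)" "v \<in> carrier ?N" for f h v
      using smult_assoc[of f h v] that c by simp
    show "(\<lambda>x. f x + h x) \<odot>\<^bsub>?N\<^esub> v = f \<odot>\<^bsub>?N\<^esub> v \<oplus>\<^bsub>?N\<^esub> h \<odot>\<^bsub>?N\<^esub> v"
      if "f \<in> carrier (Linf m)" "h \<in> carrier (Linf m)" "v \<in> carrier ?N" for f h v
      using smult_l_distr[of f h v] that c by simp
  qed (simp_all add: p1 space_UNIV H c inv pnorm_plus pnorm_triangle pnorm_minus pnorm_zero
      smult_r_distr smult_one pnorm_smult)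
  show "lp_submodule m p M H"
    unfolding lp_submodule_def closedin_iff using Lp_mod.lp_normed[OF L] H closed by blast
qed

text \<open>A simple function \<open>s\<close> with values in the module stands for \<open>\<Sum>\<^sub>v \<chi>\<^bsub>{s = v}\<^esub> v\<close>.\<close>

lemma simple_combination_exists:
  assumes s: "simple_function m s" "\<And>x. s x \<in> H"
    and H: "H \<subseteq> carrier M" "\<zero> \<in> H" "\<And>u v. u \<in> H \<Longrightarrow> v \<in> H \<Longrightarrow> u \<oplus> v \<in> H"
    "\<And>A v. A \<in> sets m \<Longrightarrow> v \<in> H \<Longrightarrow> indicat_real A \<odot> v \<in> H"
  obtains u where "u \<in> H" "AE x in m. pnorm M (u \<ominus> s x) x = 0"
proof -
  have fin: "finite (range s)" using simple_functionD(1)[OF s(1)] by (simp add: space_UNIV)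
  \<comment> \<open>The values of \<open>s\<close> are added one at a time; the second conjunct says
    that nothing has been put yet where the next value is taken.\<close>
  have "\<exists>u\<in>H. AE x in m. (s x \<in> F \<longrightarrow> pnorm M (u \<ominus> s x) x = 0) \<and> (s x \<notin> F \<longrightarrow> pnorm M u x = 0)"
    if "finite F" "F \<subseteq> range s" for F
    using that
  proof (induction F rule: finite_induct)
    case empty then show ?case using H(2) pnorm_zero by (intro bexI[of _ \<zero>]) auto
  next
    case (insert w F)
    then obtain u where u: "u \<in> H" "AE x in m. (s x \<in> F \<longrightarrow> pnorm M (u \<ominus> s x) x = 0) \<and> (s x \<notin> F \<longrightarrow> pnorm M u x = 0)"
      by auto
    have wH: "w \<in> H" using insert s(2) by auto
    define A where "A = s -` {w}"
    have A: "A \<in> sets m" using simple_functionD(2)[OF s(1), of "{w}"] by (simp add: A_def space_UNIV)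
    have c: "u \<in> carrier M" "w \<in> carrier M" "indicat_real A \<odot> w \<in> carrier M" using u wH A H by auto
    let ?u = "u \<oplus> indicat_real A \<odot> w"
    have 1: "AE x in m. pnorm M (indicat_real A \<odot> w) x = \<bar>indicat_real A x\<bar> * pnorm M w x"
      using c A by (intro pnorm_smult) auto
    have 2: "AE x in m. \<forall>v\<in>range s. pnorm M (?u \<ominus> v) x \<le> pnorm M (u \<ominus> v) x + pnorm M (indicat_real A \<odot> w) x \<and>
        0 \<le> pnorm M (?u \<ominus> v) x"
    proof (intro AE_finite_allI[OF fin])
      fix v assume "v \<in> range s"
      then have v: "v \<in> carrier M" using s(2) H by auto
      have "AE x in m. pnorm M (?u \<ominus> v) x \<le> pnorm M (u \<ominus> v) x + pnorm M (indicat_real A \<odot> w) x"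
        using pnorm_add_diff_le[of u "indicat_real A \<odot> w" v \<zero>] c v by (simp add: diff_zero)
      moreover have "AE x in m. 0 \<le> pnorm M (?u \<ominus> v) x" using c v by (intro pnorm_nonneg) auto
      ultimately show "AE x in m. pnorm M (?u \<ominus> v) x \<le> pnorm M (u \<ominus> v) x + pnorm M (indicat_real A \<odot> w) x \<and>
        0 \<le> pnorm M (?u \<ominus> v) x" by auto
    qed
    have 3: "AE x in m. pnorm M (?u \<ominus> w) x \<le> pnorm M u x + pnorm M (indicat_real A \<odot> w \<ominus> w) x"
      using pnorm_add_diff_le[of u "indicat_real A \<odot> w" \<zero> w] c by (simp add: diff_zero)
    have 4: "AE x in m. pnorm M (indicat_real A \<odot> w \<ominus> w) x = \<bar>indicat_real A x - 1\<bar> * pnorm M w x"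
      using pnorm_smult_l_diff[of "indicat_real A" "\<lambda>_. 1" w] A c by (simp add: smult_one)
    have 5: "AE x in m. pnorm M ?u x \<le> pnorm M u x + pnorm M (indicat_real A \<odot> w) x"
      using c by (intro pnorm_triangle) auto
    have 6: "AE x in m. 0 \<le> pnorm M ?u x" using c by (intro pnorm_nonneg) auto
    have "AE x in m. (s x \<in> insert w F \<longrightarrow> pnorm M (?u \<ominus> s x) x = 0) \<and> (s x \<notin> insert w F \<longrightarrow> pnorm M ?u x = 0)"
      using u(2) 1 2 3 4 5 6
    proof eventually_elim
      case (elim x)
      have *: "pnorm M (?u \<ominus> s x) x \<le> pnorm M (u \<ominus> s x) x + pnorm M (indicat_real A \<odot> w) x" "0 \<le> pnorm M (?u \<ominus> s x) x"
        using elim by auto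
      consider "s x = w" | "s x \<noteq> w" "s x \<in> F" | "s x \<noteq> w" "s x \<notin> F" by auto
      then show ?case
      proof cases
        case 1
        then have "s x \<notin> F" "x \<in> A" using insert by (auto simp: A_def)
        then show ?thesis using 1 elim * by auto
      next
        case 2
        then have "x \<notin> A" by (simp add: A_def)
        then show ?thesis using 2 elim * by (auto intro: order_antisym)
      next
        case 3
        then have "x \<notin> A" by (simp add: A_def)
        then show ?thesis using 3 elim by (auto intro: order_antisym)
      qed
    qed
    moreover have "?u \<in> H" using u wH A H by auto
    ultimately show ?case by blast
  qed
  from this[OF fin order_refl] show ?thesis using that by (auto elim!: eventually_mono)
qed

end

text \<open>The null set on which \<open>P w\<close> fails may depend on \<open>w\<close>; since
  \<open>s\<close> has finitely many values these sets can be united.\<close>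

lemma simple_function_AE:
  assumes "simple_function m s" "space m = UNIV" "\<And>w. w \<in> range s \<Longrightarrow> AE t in m. P w t"
  shows "AE t in m. P (s t) t"
proof -
  have "finite (range s)" using simple_functionD(1)[OF assms(1)] assms(2) by simp
  then have "AE t in m. \<forall>w\<in>range s. P w t" using assms(3) by (intro AE_finite_allI)
  then show ?thesis by eventually_elim auto
qed

context Lp_mod
begin

lemma vnorm_smult_diff_le:
  assumes f: "f \<in> carrier (Linf m)" "r \<in> carrier (Linf m)" and x: "x \<in> carrier M" "x' \<in> carrier M"
    and C: "0 \<le> C" "AE t in m. \<bar>f t\<bar> \<le> C" and d: "0 \<le> d" "AE t in m. \<bar>r t - f t\<bar> \<le> d"
  shows "vnorm M (f \<odot> x \<ominus> r \<odot> x') \<le> C * vnorm M (x \<ominus> x') + d * vnorm M x'"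
proof -
  have c: "f \<odot> x \<in> carrier M" "f \<odot> x' \<in> carrier M" "r \<odot> x' \<in> carrier M" using f x by (auto intro: smult_closed)
  have "vnorm M (f \<odot> x \<ominus> r \<odot> x') \<le> vnorm M (f \<odot> x \<ominus> f \<odot> x') + vnorm M (f \<odot> x' \<ominus> r \<odot> x')"
    by (rule vnorm_diff_triangle[OF c(1,2,3)])
  moreover have "vnorm M (f \<odot> x \<ominus> f \<odot> x') \<le> C * vnorm M (x \<ominus> x')"
    using vnorm_smult_le[OF f(1) C, of "x \<ominus> x'"] f x by (simp add: smult_diff)
  moreover have "vnorm M (f \<odot> x' \<ominus> r \<odot> x') \<le> d * vnorm M x'"
    using vnorm_smult_le[OF Linf_minus[OF f] d(1) _ x(2)] d(2) f x by (simp add: smult_l_diff abs_minus_commute)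
  ultimately show ?thesis by linarith
qed

text \<open>A way to say that \<open>u\<close> is the finite sum of the pieces chi_{s = w} w without
  writing a sum. Operations on such elements reduce to operations applied pointwise to
  \<open>s\<close>, with no refinement of partitions to handle.\<close>

abbreviation represents :: "('a \<Rightarrow> 'v) \<Rightarrow> 'v \<Rightarrow> bool" where
  "represents s u \<equiv> AE t in m. pnorm M (u \<ominus> s t) t = 0"

lemma represents_pnorm:
  assumes u: "u \<in> carrier M" and s: "simple_function m s" "\<And>t. s t \<in> carrier M" "represents s u"
  shows "AE t in m. pnorm M u t = pnorm M (s t) t"
proof -
  have "AE t in m. \<bar>pnorm M u t - pnorm M (s t) t\<bar> \<le> pnorm M (u \<ominus> s t) t"
    by (rule simple_function_AE[OF s(1) space_UNIV]) (use s(2) u in \<open>auto intro: abs_pnorm_diff_le\<close>)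
  with s(3) show ?thesis by eventually_elim simp
qed

lemma represents_unique:
  assumes u: "u \<in> carrier M" "v \<in> carrier M" and s: "simple_function m s" "\<And>t. s t \<in> carrier M"
    and r: "represents s u" "represents s v"
  shows "u = v"
proof -
  have "AE t in m. pnorm M (u \<ominus> v) t \<le> pnorm M (u \<ominus> s t) t + pnorm M (v \<ominus> s t) t"
  proof (rule simple_function_AE[OF s(1) space_UNIV])
    fix w assume "w \<in> range s"
    then have w: "w \<in> carrier M" using s(2) by auto
    show "AE t in m. pnorm M (u \<ominus> v) t \<le> pnorm M (u \<ominus> w) t + pnorm M (v \<ominus> w) t"
      using pnorm_diff_triangle[OF u(1) w u(2)] pnorm_diff_commute[OF w u(2)] by eventually_elim simp
  qed
  with r pnorm_nonneg[OF minus_closed[OF u]] have "AE t in m. pnorm M (u \<ominus> v) t = 0" by eventually_elim simp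
  then show ?thesis using u pnorm_eq_0D[of "u \<ominus> v"] diff_eq_0D[of u v] by auto
qed

lemma represents_add:
  assumes u: "u \<in> carrier M" "v \<in> carrier M"
    and s: "simple_function m s" "\<And>t. s t \<in> carrier M" "represents s u"
    and r: "simple_function m r" "\<And>t. r t \<in> carrier M" "represents r v"
  shows "represents (\<lambda>t. s t \<oplus> r t) (u \<oplus> v)"
proof -
  \<comment> \<open>Pairing the two simple functions turns the common refinement of their partitions
    into the level sets of one simple function.\<close>
  have "AE t in m. pnorm M ((u \<oplus> v) \<ominus> (fst (s t, r t) \<oplus> snd (s t, r t))) t \<le>
      pnorm M (u \<ominus> fst (s t, r t)) t + pnorm M (v \<ominus> snd (s t, r t)) t \<and>
      0 \<le> pnorm M ((u \<oplus> v) \<ominus> (fst (s t, r t) \<oplus> snd (s t, r t))) t"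
  proof (rule simple_function_AE[OF simple_function_Pair[OF s(1) r(1)] space_UNIV])
    fix w assume "w \<in> range (\<lambda>t. (s t, r t))"
    then have w: "fst w \<in> carrier M" "snd w \<in> carrier M" using s(2) r(2) by auto
    show "AE t in m. pnorm M ((u \<oplus> v) \<ominus> (fst w \<oplus> snd w)) t \<le> pnorm M (u \<ominus> fst w) t + pnorm M (v \<ominus> snd w) t \<and>
        0 \<le> pnorm M ((u \<oplus> v) \<ominus> (fst w \<oplus> snd w)) t"
      using pnorm_add_diff_le[OF u w] pnorm_nonneg[of "(u \<oplus> v) \<ominus> (fst w \<oplus> snd w)"] u w by simp
  qed
  with s(3) r(3) show ?thesis by eventually_elim simp
qed

text \<open>On each common level set of \<open>r\<close> and \<open>s\<close> multiplication by
  \<open>r\<close> is multiplication by a constant. This brings simple coefficients within reach of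
  a relation closed under real scalars.\<close>

lemma represents_smult:
  assumes u: "u \<in> carrier M" and s: "simple_function m s" "\<And>t. s t \<in> carrier M" "represents s u"
    and r: "simple_function m r"
  shows "represents (\<lambda>t. (\<lambda>_. r t) \<odot> s t) (r \<odot> u)"
proof -
  note rL = simple_function_Linf[OF r]
  have "AE t in m. pnorm M (r \<odot> u \<ominus> (\<lambda>_. fst (r t, s t)) \<odot> snd (r t, s t)) t \<le>
      \<bar>r t\<bar> * pnorm M (u \<ominus> snd (r t, s t)) t + \<bar>r t - fst (r t, s t)\<bar> * pnorm M (snd (r t, s t)) t \<and>
      0 \<le> pnorm M (r \<odot> u \<ominus> (\<lambda>_. fst (r t, s t)) \<odot> snd (r t, s t)) t"
  proof (rule simple_function_AE[OF simple_function_Pair[OF r s(1)] space_UNIV])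
    fix w assume "w \<in> range (\<lambda>t. (r t, s t))"
    then have w: "snd w \<in> carrier M" using s(2) by auto
    have c: "r \<odot> u \<in> carrier M" "r \<odot> snd w \<in> carrier M" "(\<lambda>_. fst w) \<odot> snd w \<in> carrier M"
      using w u rL by (auto intro: smult_closed)
    have "AE t in m. pnorm M (r \<odot> u \<ominus> (\<lambda>_. fst w) \<odot> snd w) t \<le>
        \<bar>r t\<bar> * pnorm M (u \<ominus> snd w) t + \<bar>r t - fst w\<bar> * pnorm M (snd w) t"
      using pnorm_diff_triangle[OF c] pnorm_smult_r_diff[OF rL u w] pnorm_smult_l_diff[OF rL Linf_const[of "fst w"] w]
      by eventually_elim simp
    then show "AE t in m. pnorm M (r \<odot> u \<ominus> (\<lambda>_. fst w) \<odot> snd w) t \<le>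
        \<bar>r t\<bar> * pnorm M (u \<ominus> snd w) t + \<bar>r t - fst w\<bar> * pnorm M (snd w) t \<and>
        0 \<le> pnorm M (r \<odot> u \<ominus> (\<lambda>_. fst w) \<odot> snd w) t"
      using pnorm_nonneg[OF minus_closed[OF c(1,3)]] by simp
  qed
  with s(3) show ?thesis by eventually_elim simp
qed

lemma minus_eq_scal: "x \<in> carrier M \<Longrightarrow> \<ominus> x = (\<lambda>_. -1) \<odot> x"
  using seminormed_mod.scal_minus_one[OF seminormed] by simp

lemma eq_if_pnorm_diff_0: "u \<in> carrier M \<Longrightarrow> v \<in> carrier M \<Longrightarrow> AE x in m. pnorm M (u \<ominus> v) x = 0 \<Longrightarrow> u = v"
  using pnorm_eq_0D[of "u \<ominus> v"] diff_eq_0D[of u v] by auto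

end

section \<open>Modules spanned by isometric subspaces\<close>

text \<open>A linear relation whose pairs have equal pointwise norms. Working with a relation keeps
  the two modules symmetric and defers the question whether it is a map. Two instances occur: the
  diagonal over \<open>G0\<close>, which describes \<open>M\<^sub>0\<close>, and the pairs formed by
  a relaxed differential and the coset of the original one.\<close>

locale isometric_span = X: Lp_mod X m p + Y: Lp_mod Y m p
  for X :: "('a, 'v, 'y) normed_mod_scheme" and Y :: "('a, 'w, 'z) normed_mod_scheme" and m p +
  fixes L :: "('v \<times> 'w) set"
  assumes L_carrier: "(x, y) \<in> L \<Longrightarrow> x \<in> carrier X \<and> y \<in> carrier Y"
    and L_zero: "(\<zero>\<^bsub>X\<^esub>, \<zero>\<^bsub>Y\<^esub>) \<in> L"
    and L_add: "(x, y) \<in> L \<Longrightarrow> (x', y') \<in> L \<Longrightarrow> (x \<oplus>\<^bsub>X\<^esub> x', y \<oplus>\<^bsub>Y\<^esub> y') \<in> L"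
    and L_scal: "(x, y) \<in> L \<Longrightarrow> ((\<lambda>_. c) \<odot>\<^bsub>X\<^esub> x, (\<lambda>_. c) \<odot>\<^bsub>Y\<^esub> y) \<in> L"
    and L_pnorm: "(x, y) \<in> L \<Longrightarrow> AE t in m. pnorm Y y t = pnorm X x t"
begin

text \<open>One simple function with values in pairs, so that both components use the same
  partition. Coefficients are absorbed by \<open>L\<close>, which is closed under real
  scalars.\<close>

definition step :: "('v \<times> 'w) set" where
  "step = {(x, y). x \<in> carrier X \<and> y \<in> carrier Y \<and> (\<exists>s. simple_function m s \<and> range s \<subseteq> L \<and>
     X.represents (\<lambda>t. fst (s t)) x \<and> Y.represents (\<lambda>t. snd (s t)) y)}"

text \<open>The graph of an isometry.\<close>

definition span :: "('v \<times> 'w) set" where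
  "span = {(x, y). x \<in> carrier X \<and> y \<in> carrier Y \<and>
     (\<forall>e>0. \<exists>(x', y')\<in>step. vnorm X (x \<ominus>\<^bsub>X\<^esub> x') < e \<and> vnorm Y (y \<ominus>\<^bsub>Y\<^esub> y') < e)}"

lemma step_carrier: "(x, y) \<in> step \<Longrightarrow> x \<in> carrier X" "(x, y) \<in> step \<Longrightarrow> y \<in> carrier Y"
  by (auto simp: step_def)

lemma span_approx:
  assumes "(x, y) \<in> span" "0 < e"
  shows "\<exists>x' y'. (x', y') \<in> step \<and> vnorm X (x \<ominus>\<^bsub>X\<^esub> x') < e \<and> vnorm Y (y \<ominus>\<^bsub>Y\<^esub> y') < e"
  using assms unfolding span_def by blast

lemma span_carrier: "(x, y) \<in> span \<Longrightarrow> x \<in> carrier X" "(x, y) \<in> span \<Longrightarrow> y \<in> carrier Y"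
  by (auto simp: span_def)

lemma stepI:
  assumes "x \<in> carrier X" "y \<in> carrier Y" "simple_function m s" "\<And>t. s t \<in> L"
    "X.represents (\<lambda>t. fst (s t)) x" "Y.represents (\<lambda>t. snd (s t)) y"
  shows "(x, y) \<in> step"
  unfolding step_def using assms by blast

lemma stepE:
  assumes "(x, y) \<in> step"
  obtains s where "simple_function m s" "\<And>t. s t \<in> L"
    "simple_function m (\<lambda>t. fst (s t))" "\<And>t. fst (s t) \<in> carrier X" "X.represents (\<lambda>t. fst (s t)) x"
    "simple_function m (\<lambda>t. snd (s t))" "\<And>t. snd (s t) \<in> carrier Y" "Y.represents (\<lambda>t. snd (s t)) y"
proof -
  obtain s where s: "simple_function m s" "range s \<subseteq> L" "X.represents (\<lambda>t. fst (s t)) x" "Y.represents (\<lambda>t. snd (s t)) y"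
    using assms by (auto simp: step_def)
  have L: "s t \<in> L" for t using s(2) by auto
  have c: "fst (s t) \<in> carrier X" "snd (s t) \<in> carrier Y" for t
    using L_carrier[of "fst (s t)" "snd (s t)"] L by auto
  show ?thesis
    by (rule that[OF s(1) L simple_function_compose1[OF s(1)] c(1) s(3) simple_function_compose1[OF s(1)] c(2) s(4)])
qed

lemma L_step: assumes "(x, y) \<in> L" shows "(x, y) \<in> step"
  using L_carrier[OF assms] assms X.pnorm_zero Y.pnorm_zero
  by (intro stepI[where s="\<lambda>_. (x, y)"]) (simp_all add: X.diff_self Y.diff_self)

lemma step_pnorm:
  assumes xy: "(x, y) \<in> step" shows "AE t in m. pnorm Y y t = pnorm X x t"
proof -
  obtain s where s: "simple_function m s" "\<And>t. s t \<in> L"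
    "simple_function m (\<lambda>t. fst (s t))" "\<And>t. fst (s t) \<in> carrier X" "X.represents (\<lambda>t. fst (s t)) x"
    "simple_function m (\<lambda>t. snd (s t))" "\<And>t. snd (s t) \<in> carrier Y" "Y.represents (\<lambda>t. snd (s t)) y"
    by (rule stepE[OF xy]) blast
  have "AE t in m. pnorm Y (snd (s t)) t = pnorm X (fst (s t)) t"
  proof (rule simple_function_AE[OF s(1) X.space_UNIV])
    fix w assume "w \<in> range s"
    then have "(fst w, snd w) \<in> L" using s(2) by auto
    then show "AE t in m. pnorm Y (snd w) t = pnorm X (fst w) t" by (rule L_pnorm)
  qed
  with X.represents_pnorm[OF step_carrier(1)[OF xy] s(3-5)] Y.represents_pnorm[OF step_carrier(2)[OF xy] s(6-8)]
  show ?thesis by eventually_elim simp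
qed

lemma step_add:
  assumes xy: "(x, y) \<in> step" and xy': "(x', y') \<in> step"
  shows "(x \<oplus>\<^bsub>X\<^esub> x', y \<oplus>\<^bsub>Y\<^esub> y') \<in> step"
proof -
  note c = step_carrier[OF xy] step_carrier[OF xy']
  obtain s where s: "simple_function m s" "\<And>t. s t \<in> L"
    "simple_function m (\<lambda>t. fst (s t))" "\<And>t. fst (s t) \<in> carrier X" "X.represents (\<lambda>t. fst (s t)) x"
    "simple_function m (\<lambda>t. snd (s t))" "\<And>t. snd (s t) \<in> carrier Y" "Y.represents (\<lambda>t. snd (s t)) y"
    by (rule stepE[OF xy]) blast
  obtain r where r: "simple_function m r" "\<And>t. r t \<in> L"
    "simple_function m (\<lambda>t. fst (r t))" "\<And>t. fst (r t) \<in> carrier X" "X.represents (\<lambda>t. fst (r t)) x'"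
    "simple_function m (\<lambda>t. snd (r t))" "\<And>t. snd (r t) \<in> carrier Y" "Y.represents (\<lambda>t. snd (r t)) y'"
    by (rule stepE[OF xy']) blast
  show ?thesis
  proof (rule stepI[where s="\<lambda>t. (fst (s t) \<oplus>\<^bsub>X\<^esub> fst (r t), snd (s t) \<oplus>\<^bsub>Y\<^esub> snd (r t))"])
    show "simple_function m (\<lambda>t. (fst (s t) \<oplus>\<^bsub>X\<^esub> fst (r t), snd (s t) \<oplus>\<^bsub>Y\<^esub> snd (r t)))"
      by (rule simple_function_compose2[OF s(1) r(1)])
    show "(fst (s t) \<oplus>\<^bsub>X\<^esub> fst (r t), snd (s t) \<oplus>\<^bsub>Y\<^esub> snd (r t)) \<in> L" for t
      using L_add[of "fst (s t)" "snd (s t)" "fst (r t)" "snd (r t)"] s(2) r(2) by simp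
  qed (use c X.represents_add[OF c(1,3) s(3-5) r(3-5)] Y.represents_add[OF c(2,4) s(6-8) r(6-8)] in simp_all)
qed

lemma step_smult:
  assumes xy: "(x, y) \<in> step" and r: "simple_function m r"
  shows "(r \<odot>\<^bsub>X\<^esub> x, r \<odot>\<^bsub>Y\<^esub> y) \<in> step"
proof -
  note c = step_carrier[OF xy]
  obtain s where s: "simple_function m s" "\<And>t. s t \<in> L"
    "simple_function m (\<lambda>t. fst (s t))" "\<And>t. fst (s t) \<in> carrier X" "X.represents (\<lambda>t. fst (s t)) x"
    "simple_function m (\<lambda>t. snd (s t))" "\<And>t. snd (s t) \<in> carrier Y" "Y.represents (\<lambda>t. snd (s t)) y"
    by (rule stepE[OF xy]) blast
  show ?thesis
  proof (rule stepI[where s="\<lambda>t. ((\<lambda>_. r t) \<odot>\<^bsub>X\<^esub> fst (s t), (\<lambda>_. r t) \<odot>\<^bsub>Y\<^esub> snd (s t))"])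
    show "r \<odot>\<^bsub>X\<^esub> x \<in> carrier X" "r \<odot>\<^bsub>Y\<^esub> y \<in> carrier Y"
      using c simple_function_Linf[OF r] by (auto intro: X.smult_closed Y.smult_closed)
    show "simple_function m (\<lambda>t. ((\<lambda>_. r t) \<odot>\<^bsub>X\<^esub> fst (s t), (\<lambda>_. r t) \<odot>\<^bsub>Y\<^esub> snd (s t)))"
      by (rule simple_function_compose2[OF r s(1)])
    show "((\<lambda>_. r t) \<odot>\<^bsub>X\<^esub> fst (s t), (\<lambda>_. r t) \<odot>\<^bsub>Y\<^esub> snd (s t)) \<in> L" for t
      using L_scal[of "fst (s t)" "snd (s t)"] s(2) by simp
  qed (use X.represents_smult[OF c(1) s(3-5) r] Y.represents_smult[OF c(2) s(6-8) r] in simp_all)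
qed

lemma step_diff:
  assumes "(x, y) \<in> step" "(x', y') \<in> step"
  shows "(x \<ominus>\<^bsub>X\<^esub> x', y \<ominus>\<^bsub>Y\<^esub> y') \<in> step"
  using step_add[OF assms(1) step_smult[OF assms(2), of "\<lambda>_. -1"]] step_carrier[OF assms(2)]
  by (simp add: X.minus_eq Y.minus_eq X.minus_eq_scal Y.minus_eq_scal)

lemma step_vnorm: "(x, y) \<in> step \<Longrightarrow> vnorm Y y = vnorm X x"
  using step_pnorm[of x y] step_carrier[of x y]
  by (auto simp: X.vnorm_eq Y.vnorm_eq intro!: Lp_norm_cong_AE X.pnorm_measurable Y.pnorm_measurable elim!: eventually_mono)

lemma step_span: "(x, y) \<in> step \<Longrightarrow> (x, y) \<in> span"
  unfolding span_def using step_carrier[of x y]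
  by (auto intro!: bexI[of _ "(x, y)"] simp: X.diff_self Y.diff_self)

section \<open>Operations on the span\<close>

lemma spanD:
  assumes "(x, y) \<in> span"
  obtains xs ys where "\<And>n. (xs n, ys n) \<in> step" "(\<lambda>n. vnorm X (xs n \<ominus>\<^bsub>X\<^esub> x)) \<longlonglongrightarrow> 0" "(\<lambda>n. vnorm Y (ys n \<ominus>\<^bsub>Y\<^esub> y)) \<longlonglongrightarrow> 0"
proof -
  note c = span_carrier[OF assms]
  have "\<exists>x' y'. (x', y') \<in> step \<and> vnorm X (x \<ominus>\<^bsub>X\<^esub> x') < inverse (real (Suc n)) \<and> vnorm Y (y \<ominus>\<^bsub>Y\<^esub> y') < inverse (real (Suc n))" for n
    by (rule span_approx[OF assms]) simp
  then obtain xs ys where s: "\<And>n. (xs n, ys n) \<in> step"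
    "\<And>n. vnorm X (x \<ominus>\<^bsub>X\<^esub> xs n) < inverse (real (Suc n))" "\<And>n. vnorm Y (y \<ominus>\<^bsub>Y\<^esub> ys n) < inverse (real (Suc n))"
    by metis
  note sc = step_carrier[OF s(1)]
  have "(\<lambda>n. vnorm X (xs n \<ominus>\<^bsub>X\<^esub> x)) \<longlonglongrightarrow> 0"
    by (rule tendsto_sandwich[OF _ _ tendsto_const LIMSEQ_inverse_real_of_nat])
      (use s(2) sc c in \<open>auto intro!: always_eventually X.vnorm_nonneg simp: X.vnorm_diff_commute[OF sc(1) c(1)] less_imp_le simp del: of_nat_Suc\<close>)
  moreover have "(\<lambda>n. vnorm Y (ys n \<ominus>\<^bsub>Y\<^esub> y)) \<longlonglongrightarrow> 0"
    by (rule tendsto_sandwich[OF _ _ tendsto_const LIMSEQ_inverse_real_of_nat])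
      (use s(3) sc c in \<open>auto intro!: always_eventually Y.vnorm_nonneg simp: Y.vnorm_diff_commute[OF sc(2) c(2)] less_imp_le simp del: of_nat_Suc\<close>)
  ultimately show ?thesis using s(1) by (rule that[rotated 1])
qed

lemma spanI:
  assumes c: "x \<in> carrier X" "y \<in> carrier Y" and s: "\<And>n. (xs n, ys n) \<in> span"
    and l: "(\<lambda>n. vnorm X (xs n \<ominus>\<^bsub>X\<^esub> x)) \<longlonglongrightarrow> 0" "(\<lambda>n. vnorm Y (ys n \<ominus>\<^bsub>Y\<^esub> y)) \<longlonglongrightarrow> 0"
  shows "(x, y) \<in> span"
  unfolding span_def
proof (intro CollectI case_prodI conjI c allI impI)
  fix e :: real assume e: "0 < e"
  note sc = span_carrier[OF s]
  have "\<forall>\<^sub>F n in sequentially. vnorm X (xs n \<ominus>\<^bsub>X\<^esub> x) < e / 2 \<and> vnorm Y (ys n \<ominus>\<^bsub>Y\<^esub> y) < e / 2"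
    using order_tendstoD(2)[OF l(1), of "e/2"] order_tendstoD(2)[OF l(2), of "e/2"] e by (simp add: eventually_conj)
  then obtain n where n: "vnorm X (xs n \<ominus>\<^bsub>X\<^esub> x) < e / 2" "vnorm Y (ys n \<ominus>\<^bsub>Y\<^esub> y) < e / 2"
    by (auto simp: eventually_sequentially)
  obtain x' y' where xy: "(x', y') \<in> step" "vnorm X (xs n \<ominus>\<^bsub>X\<^esub> x') < e / 2" "vnorm Y (ys n \<ominus>\<^bsub>Y\<^esub> y') < e / 2"
    using s[of n] half_gt_zero[OF e] unfolding span_def by blast
  note c' = step_carrier[OF xy(1)]
  have "vnorm X (x \<ominus>\<^bsub>X\<^esub> x') < e"
    using X.vnorm_diff_triangle[OF c(1) sc(1) c'(1), of n] n xy X.vnorm_diff_commute[OF c(1) sc(1), of n] by linarith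
  moreover have "vnorm Y (y \<ominus>\<^bsub>Y\<^esub> y') < e"
    using Y.vnorm_diff_triangle[OF c(2) sc(2) c'(2), of n] n xy Y.vnorm_diff_commute[OF c(2) sc(2), of n] by linarith
  ultimately show "\<exists>(x', y')\<in>step. vnorm X (x \<ominus>\<^bsub>X\<^esub> x') < e \<and> vnorm Y (y \<ominus>\<^bsub>Y\<^esub> y') < e"
    using xy(1) by blast
qed

lemma span_pnorm:
  assumes "(x, y) \<in> span" shows "AE t in m. pnorm Y y t = pnorm X x t"
proof -
  obtain xs ys where s: "\<And>n. (xs n, ys n) \<in> step" and l: "(\<lambda>n. vnorm X (xs n \<ominus>\<^bsub>X\<^esub> x)) \<longlonglongrightarrow> 0" "(\<lambda>n. vnorm Y (ys n \<ominus>\<^bsub>Y\<^esub> y)) \<longlonglongrightarrow> 0"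
    using spanD[OF assms] by blast
  note c = span_carrier[OF assms] step_carrier[OF s]
  have lx: "(\<lambda>n. Lp_norm m p (\<lambda>t. pnorm X (xs n) t - pnorm X x t)) \<longlonglongrightarrow> 0"
    using c by (intro tendsto_sandwich[OF _ _ tendsto_const l(1)]) (auto intro!: always_eventually X.Lp_norm_pnorm_diff_le)
  have ly: "(\<lambda>n. Lp_norm m p (\<lambda>t. pnorm Y (ys n) t - pnorm Y y t)) \<longlonglongrightarrow> 0"
    using c by (intro tendsto_sandwich[OF _ _ tendsto_const l(2)]) (auto intro!: always_eventually Y.Lp_norm_pnorm_diff_le)
  have le: "AE t in m. pnorm Y (ys n) t \<le> pnorm X (xs n) t" "AE t in m. pnorm X (xs n) t \<le> pnorm Y (ys n) t" for n
    using step_pnorm[OF s, of n] by (auto elim: eventually_mono)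
  have 1: "AE t in m. pnorm Y y t \<le> pnorm X x t"
    by (rule Lp_le_limit[OF X.p_ge_1 _ _ _ _ le(1) ly lx]) (auto intro: X.pnorm_Lp Y.pnorm_Lp c)
  have 2: "AE t in m. pnorm X x t \<le> pnorm Y y t"
    by (rule Lp_le_limit[OF X.p_ge_1 _ _ _ _ le(2) lx ly]) (auto intro: X.pnorm_Lp Y.pnorm_Lp c)
  from 1 2 show ?thesis by eventually_elim simp
qed

lemma span_add:
  assumes "(x, y) \<in> span" "(x', y') \<in> span"
  shows "(x \<oplus>\<^bsub>X\<^esub> x', y \<oplus>\<^bsub>Y\<^esub> y') \<in> span"
proof -
  obtain xs ys where s: "\<And>n. (xs n, ys n) \<in> step" and l: "(\<lambda>n. vnorm X (xs n \<ominus>\<^bsub>X\<^esub> x)) \<longlonglongrightarrow> 0" "(\<lambda>n. vnorm Y (ys n \<ominus>\<^bsub>Y\<^esub> y)) \<longlonglongrightarrow> 0"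
    using spanD[OF assms(1)] by blast
  obtain xs' ys' where s': "\<And>n. (xs' n, ys' n) \<in> step" and l': "(\<lambda>n. vnorm X (xs' n \<ominus>\<^bsub>X\<^esub> x')) \<longlonglongrightarrow> 0" "(\<lambda>n. vnorm Y (ys' n \<ominus>\<^bsub>Y\<^esub> y')) \<longlonglongrightarrow> 0"
    using spanD[OF assms(2)] by blast
  note c = span_carrier[OF assms(1)] span_carrier[OF assms(2)] step_carrier[OF s] step_carrier[OF s']
  show ?thesis
    by (rule spanI[of _ _ "\<lambda>n. xs n \<oplus>\<^bsub>X\<^esub> xs' n" "\<lambda>n. ys n \<oplus>\<^bsub>Y\<^esub> ys' n"])
      (use c l l' in \<open>auto intro!: step_span step_add s s' X.tendsto_add_vnorm Y.tendsto_add_vnorm\<close>)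
qed

text \<open>Steps admit only simple coefficients, so \<open>f\<close> is replaced by a uniformly
  close simple function and the pair by a close step, at a cost of e / 2 each.\<close>

lemma span_smult:
  assumes xy: "(x, y) \<in> span" and f: "f \<in> carrier (Linf m)"
  shows "(f \<odot>\<^bsub>X\<^esub> x, f \<odot>\<^bsub>Y\<^esub> y) \<in> span"
  unfolding span_def
proof (intro CollectI case_prodI conjI allI impI)
  note c = span_carrier[OF xy]
  show "f \<odot>\<^bsub>X\<^esub> x \<in> carrier X" "f \<odot>\<^bsub>Y\<^esub> y \<in> carrier Y" using c f by (auto intro: X.smult_closed Y.smult_closed)
  fix e :: real assume e: "0 < e"
  obtain C where C: "0 < C" "AE t in m. \<bar>f t\<bar> \<le> C" using f by (rule Linf_bound)
  have "0 < e / (2 * C)" using e C by simp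
  then obtain x' y' where xy': "(x', y') \<in> step" "vnorm X (x \<ominus>\<^bsub>X\<^esub> x') < e / (2 * C)" "vnorm Y (y \<ominus>\<^bsub>Y\<^esub> y') < e / (2 * C)"
    using xy unfolding span_def by blast
  note c' = step_carrier[OF xy'(1)]
  \<comment> \<open>One bound serves both components, since they have equal norms; the summand 1
    keeps it positive.\<close>
  define K where "K = vnorm X x' + 1"
  have K: "0 < K" "vnorm X x' < K" "vnorm Y y' < K"
    using X.vnorm_nonneg[OF c'(1)] step_vnorm[OF xy'(1)] by (auto simp: K_def)
  obtain rs where rs: "\<And>n. simple_function m (rs n)" "Linf_tendsto m rs f" by (rule Linf_simple_approx[OF f]) blast
  have d: "0 < e / (2 * K)" using e K by simp
  then obtain n where n: "AE t in m. \<bar>rs n t - f t\<bar> \<le> e / (2 * K)"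
    using rs(2) unfolding Linf_tendsto_def by blast
  have hx: "C * vnorm X (x \<ominus>\<^bsub>X\<^esub> x') < e / 2" "C * vnorm Y (y \<ominus>\<^bsub>Y\<^esub> y') < e / 2"
    using xy'(2,3) C by (auto simp: field_simps)
  have hk: "e / (2 * K) * vnorm X x' \<le> e / 2" "e / (2 * K) * vnorm Y y' \<le> e / 2"
    using mult_left_mono[of "vnorm X x'" K "e / (2 * K)"] mult_left_mono[of "vnorm Y y'" K "e / (2 * K)"] d K by auto
  have "vnorm X (f \<odot>\<^bsub>X\<^esub> x \<ominus>\<^bsub>X\<^esub> rs n \<odot>\<^bsub>X\<^esub> x') < e"
    using X.vnorm_smult_diff_le[OF f simple_function_Linf[OF rs(1)] c(1) c'(1) less_imp_le[OF C(1)] C(2) less_imp_le[OF d] n] hx hk by linarith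
  moreover have "vnorm Y (f \<odot>\<^bsub>Y\<^esub> y \<ominus>\<^bsub>Y\<^esub> rs n \<odot>\<^bsub>Y\<^esub> y') < e"
    using Y.vnorm_smult_diff_le[OF f simple_function_Linf[OF rs(1)] c(2) c'(2) less_imp_le[OF C(1)] C(2) less_imp_le[OF d] n] hx hk by linarith
  ultimately show "\<exists>(x', y')\<in>step. vnorm X (f \<odot>\<^bsub>X\<^esub> x \<ominus>\<^bsub>X\<^esub> x') < e \<and> vnorm Y (f \<odot>\<^bsub>Y\<^esub> y \<ominus>\<^bsub>Y\<^esub> y') < e"
    using step_smult[OF xy'(1) rs(1)] by blast
qed

text \<open>A Cauchy sequence of components on one side forces one on the other side; together with
  completeness this produces partners in the other module.\<close>

lemma step_Cauchy_transfer:
  assumes s: "\<And>n. (xs n, ys n) \<in> step"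
  shows "vnorm Y (ys n \<ominus>\<^bsub>Y\<^esub> ys k) = vnorm X (xs n \<ominus>\<^bsub>X\<^esub> xs k)"
  using step_vnorm[OF step_diff[OF s s]] .

lemma span_extend_left:
  assumes x: "x \<in> carrier X" and s: "\<And>n. (xs n, ys n) \<in> step" and l: "(\<lambda>n. vnorm X (xs n \<ominus>\<^bsub>X\<^esub> x)) \<longlonglongrightarrow> 0"
  obtains y where "(x, y) \<in> span"
proof -
  note sc = step_carrier[OF s]
  have "\<exists>y\<in>carrier Y. (\<lambda>n. vnorm Y (ys n \<ominus>\<^bsub>Y\<^esub> y)) \<longlonglongrightarrow> 0"
    using X.convergent_imp_Cauchy[OF sc(1) x l] by (intro Y.complete sc) (simp add: step_Cauchy_transfer[of xs ys, OF s])
  then show ?thesis using that spanI[OF x _ step_span[OF s] l] by blast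
qed

lemma span_extend_right:
  assumes y: "y \<in> carrier Y" and s: "\<And>n. (xs n, ys n) \<in> step" and l: "(\<lambda>n. vnorm Y (ys n \<ominus>\<^bsub>Y\<^esub> y)) \<longlonglongrightarrow> 0"
  obtains x where "(x, y) \<in> span"
proof -
  note sc = step_carrier[OF s]
  have "\<exists>x\<in>carrier X. (\<lambda>n. vnorm X (xs n \<ominus>\<^bsub>X\<^esub> x)) \<longlonglongrightarrow> 0"
    using Y.convergent_imp_Cauchy[OF sc(2) y l] by (intro X.complete sc) (simp add: step_Cauchy_transfer[of xs ys, OF s])
  then show ?thesis using that spanI[OF _ y step_span[OF s] _ l] by blast
qed

text \<open>Subtracting the two pairs gives a pair with left component zero, hence with right
  component of pointwise norm 0.\<close>

lemma span_unique_right: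
  assumes "(x, y) \<in> span" "(x, y') \<in> span" shows "y = y'"
proof -
  note c = span_carrier[OF assms(1)] span_carrier[OF assms(2)]
  have "(x \<oplus>\<^bsub>X\<^esub> (\<lambda>_. -1) \<odot>\<^bsub>X\<^esub> x, y \<oplus>\<^bsub>Y\<^esub> (\<lambda>_. -1) \<odot>\<^bsub>Y\<^esub> y') \<in> span"
    by (intro span_add span_smult assms Linf_const)
  then have "(\<zero>\<^bsub>X\<^esub>, y \<ominus>\<^bsub>Y\<^esub> y') \<in> span"
    using c by (simp add: X.minus_eq_scal[symmetric] Y.minus_eq_scal[symmetric] X.r_neg Y.minus_eq)
  from span_pnorm[OF this] X.pnorm_zero have "AE t in m. pnorm Y (y \<ominus>\<^bsub>Y\<^esub> y') t = 0" by eventually_elim simp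
  then show ?thesis using c by (intro Y.eq_if_pnorm_diff_0)
qed

lemma span_unique_left:
  assumes "(x, y) \<in> span" "(x', y) \<in> span" shows "x = x'"
proof -
  note c = span_carrier[OF assms(1)] span_carrier[OF assms(2)]
  have "(x \<oplus>\<^bsub>X\<^esub> (\<lambda>_. -1) \<odot>\<^bsub>X\<^esub> x', y \<oplus>\<^bsub>Y\<^esub> (\<lambda>_. -1) \<odot>\<^bsub>Y\<^esub> y) \<in> span"
    by (intro span_add span_smult assms Linf_const)
  then have "(x \<ominus>\<^bsub>X\<^esub> x', \<zero>\<^bsub>Y\<^esub>) \<in> span"
    using c by (simp add: X.minus_eq_scal[symmetric] Y.minus_eq_scal[symmetric] Y.r_neg X.minus_eq)
  from span_pnorm[OF this] Y.pnorm_zero have "AE t in m. pnorm X (x \<ominus>\<^bsub>X\<^esub> x') t = 0" by eventually_elim simp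
  then show ?thesis using c by (intro X.eq_if_pnorm_diff_0)
qed

text \<open>A projection of a closed relation need not be closed. Here steps within 1 / (n + 1) of
  \<open>\<sigma> n\<close> also converge to \<open>v\<close>, and their right components converge
  by isometry and completeness of \<open>Y\<close>.\<close>

lemma fst_span_closed:
  assumes \<sigma>: "\<And>n. \<sigma> n \<in> fst ` span" and v: "v \<in> carrier X" and l: "(\<lambda>n. vnorm X (\<sigma> n \<ominus>\<^bsub>X\<^esub> v)) \<longlonglongrightarrow> 0"
  shows "v \<in> fst ` span"
proof -
  have \<sigma>c: "\<sigma> n \<in> carrier X" for n using \<sigma>[of n] span_carrier by force
  have "\<exists>x' y'. (x', y') \<in> step \<and> vnorm X (\<sigma> n \<ominus>\<^bsub>X\<^esub> x') < inverse (real (Suc n))" for n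
  proof -
    obtain y where "(\<sigma> n, y) \<in> span" using \<sigma>[of n] by force
    from span_approx[OF this, of "inverse (real (Suc n))"] show ?thesis by auto
  qed
  then obtain xs ys where s: "\<And>n. (xs n, ys n) \<in> step" "\<And>n. vnorm X (\<sigma> n \<ominus>\<^bsub>X\<^esub> xs n) < inverse (real (Suc n))" by metis
  note sc = step_carrier[OF s(1)]
  have le: "vnorm X (xs n \<ominus>\<^bsub>X\<^esub> v) \<le> inverse (real (Suc n)) + vnorm X (\<sigma> n \<ominus>\<^bsub>X\<^esub> v)" for n
    using X.vnorm_diff_triangle[OF sc(1) \<sigma>c v, of n n] s(2)[of n] X.vnorm_diff_commute[OF sc(1) \<sigma>c, of n n] by linarith
  have lim: "(\<lambda>n. inverse (real (Suc n)) + vnorm X (\<sigma> n \<ominus>\<^bsub>X\<^esub> v)) \<longlonglongrightarrow> 0"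
    using tendsto_add[OF LIMSEQ_inverse_real_of_nat l] by simp
  have "(\<lambda>n. vnorm X (xs n \<ominus>\<^bsub>X\<^esub> v)) \<longlonglongrightarrow> 0"
    by (rule tendsto_sandwich[OF _ _ tendsto_const lim]) (use le sc v in \<open>auto intro!: always_eventually X.vnorm_nonneg\<close>)
  then obtain y where "(v, y) \<in> span" using span_extend_left[of v xs ys, OF v s(1)] by blast
  then show ?thesis by force
qed

section \<open>The generated submodule and the isometry\<close>

lemma fst_span_submodule:
  "Lp_mod (X\<lparr>carrier := fst ` span\<rparr>) m p" "lp_submodule m p X (fst ` span)"
  "\<And>v. v \<in> fst ` span \<Longrightarrow> \<ominus>\<^bsub>X\<^esub> v \<in> fst ` span"
proof -
  have 1: "fst ` span \<subseteq> carrier X" using span_carrier by force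
  have 2: "\<zero>\<^bsub>X\<^esub> \<in> fst ` span" using step_span[OF L_step[OF L_zero]] by force
  have 3: "u \<oplus>\<^bsub>X\<^esub> v \<in> fst ` span" if "u \<in> fst ` span" "v \<in> fst ` span" for u v
    using that span_add by force
  have 4: "f \<odot>\<^bsub>X\<^esub> v \<in> fst ` span" if "f \<in> carrier (Linf m)" "v \<in> fst ` span" for f v
    using that span_smult by force
  note * = X.closed_submodule[OF 1 2 3 4 fst_span_closed]
  show "Lp_mod (X\<lparr>carrier := fst ` span\<rparr>) m p" "lp_submodule m p X (fst ` span)"
    "\<And>v. v \<in> fst ` span \<Longrightarrow> \<ominus>\<^bsub>X\<^esub> v \<in> fst ` span"
    by (rule *; assumption)+
qed

text \<open>Being a module, \<open>H\<close> contains the left components of steps, and being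
  closed, also their limits.\<close>

lemma fst_span_minimal:
  assumes H: "lp_submodule m p X H" and LH: "fst ` L \<subseteq> H"
  shows "fst ` span \<subseteq> H"
proof
  fix x assume "x \<in> fst ` span"
  then obtain y where xy: "(x, y) \<in> span" by force
  obtain xs ys where s: "\<And>n. (xs n, ys n) \<in> step" and l: "(\<lambda>n. vnorm X (xs n \<ominus>\<^bsub>X\<^esub> x)) \<longlonglongrightarrow> 0"
    using spanD[OF xy] by blast
  have closed: "H \<subseteq> carrier X" "\<And>\<sigma> v. (\<And>n. \<sigma> n \<in> H) \<Longrightarrow> v \<in> carrier X \<Longrightarrow> (\<lambda>n. vnorm X (\<sigma> n \<ominus>\<^bsub>X\<^esub> v)) \<longlonglongrightarrow> 0 \<Longrightarrow> v \<in> H"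
    using H unfolding lp_submodule_def X.closedin_iff by blast+
  interpret H: Module.module "Linf m" "X\<lparr>carrier := H\<rparr>"
    using H by (simp add: lp_submodule_def lp_normed_module_def)
  have "xs n \<in> H" for n
  proof -
    obtain q where q: "\<And>t. q t \<in> L" "simple_function m (\<lambda>t. fst (q t))" "\<And>t. fst (q t) \<in> carrier X"
      "X.represents (\<lambda>t. fst (q t)) (xs n)"
      by (rule stepE[OF s[of n]]) blast
    have "fst (q t) \<in> H" for t using q(1) LH by auto
    with q(2) obtain u where u: "u \<in> H" "X.represents (\<lambda>t. fst (q t)) u"
      by (rule X.simple_combination_exists[OF _ _ closed(1)]) (use H.M.zero_closed H.M.a_closed H.smult_closed in auto)
    have "xs n = u"
      using u closed(1) by (intro X.represents_unique[OF step_carrier(1)[OF s] _ q(2-4)]) auto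
    then show ?thesis using u by simp
  qed
  then show "x \<in> H" using closed(2) span_carrier(1)[OF xy] l by blast
qed

theorem generated_submodule_eq: "generated_submodule m p X (fst ` L) = fst ` span"
proof
  have "fst ` L \<subseteq> fst ` span" using step_span[OF L_step] by force
  then show "generated_submodule m p X (fst ` L) \<subseteq> fst ` span"
    unfolding generated_submodule_def using fst_span_submodule(2) by blast
  show "fst ` span \<subseteq> generated_submodule m p X (fst ` L)"
    unfolding generated_submodule_def using fst_span_minimal by blast
qed

text \<open>It suffices to approximate the elements of \<open>Y\<close> by right components of
  steps: completeness of \<open>X\<close> turns approximation into surjectivity. The map is read off
  the graph by choice, which uniqueness makes harmless.\<close>

theorem lp_isometric_generated:
  assumes dense: "\<And>y e. y \<in> carrier Y \<Longrightarrow> 0 < e \<Longrightarrow> \<exists>(x', y')\<in>step. vnorm Y (y' \<ominus>\<^bsub>Y\<^esub> y) < e"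
  shows "lp_isometric m p (X\<lparr>carrier := generated_submodule m p X (fst ` L)\<rparr>) Y"
proof -
  define \<phi> where "\<phi> x = (SOME y. (x, y) \<in> span)" for x
  have \<phi>: "(x, \<phi> x) \<in> span" if "x \<in> fst ` span" for x
    using that unfolding \<phi>_def by (auto intro: someI)
  have \<phi>_eq: "\<phi> x = y" if "(x, y) \<in> span" for x y
    using span_unique_right[OF \<phi> that] that by force
  have surj: "y \<in> \<phi> ` fst ` span" if y: "y \<in> carrier Y" for y
  proof -
    have "\<exists>x' y'. (x', y') \<in> step \<and> vnorm Y (y' \<ominus>\<^bsub>Y\<^esub> y) < inverse (real (Suc n))" for n
      using dense[OF y, of "inverse (real (Suc n))"] by auto
    then obtain xs ys where s: "\<And>n. (xs n, ys n) \<in> step" "\<And>n. vnorm Y (ys n \<ominus>\<^bsub>Y\<^esub> y) < inverse (real (Suc n))" by metis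
    note sc = step_carrier[OF s(1)]
    have "(\<lambda>n. vnorm Y (ys n \<ominus>\<^bsub>Y\<^esub> y)) \<longlonglongrightarrow> 0"
      by (rule tendsto_sandwich[OF _ _ tendsto_const LIMSEQ_inverse_real_of_nat])
        (use less_imp_le[OF s(2)] sc y in \<open>auto intro!: always_eventually Y.vnorm_nonneg simp del: of_nat_Suc\<close>)
    then obtain x where "(x, y) \<in> span" using span_extend_right[of y xs ys, OF y s(1)] by blast
    then show ?thesis using \<phi>_eq by force
  qed
  have "bij_betw \<phi> (fst ` span) (carrier Y)"
    unfolding bij_betw_def
  proof
    show "inj_on \<phi> (fst ` span)"
    proof (rule inj_onI)
      fix x x' assume "x \<in> fst ` span" "x' \<in> fst ` span" "\<phi> x = \<phi> x'"
      then show "x = x'" using \<phi>[of x] \<phi>[of x'] by (auto intro: span_unique_left)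
    qed
    show "\<phi> ` fst ` span = carrier Y" using surj \<phi> span_carrier(2) by blast
  qed
  moreover have "\<phi> (u \<oplus>\<^bsub>X\<^esub> v) = \<phi> u \<oplus>\<^bsub>Y\<^esub> \<phi> v" if "u \<in> fst ` span" "v \<in> fst ` span" for u v
    by (rule \<phi>_eq[OF span_add[OF \<phi> \<phi>]]) (fact that)+
  moreover have "\<phi> (f \<odot>\<^bsub>X\<^esub> v) = f \<odot>\<^bsub>Y\<^esub> \<phi> v" if "f \<in> carrier (Linf m)" "v \<in> fst ` span" for f v
    by (rule \<phi>_eq[OF span_smult[OF \<phi>]]) (fact that)+
  moreover have pn: "AE x in m. pnorm Y (\<phi> v) x = pnorm X v x" if "v \<in> fst ` span" for v
    by (rule span_pnorm[OF \<phi>[OF that]])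
  moreover have "vnorm Y (\<phi> v) = vnorm X v" if "v \<in> fst ` span" for v
    using pn[OF that] span_carrier[OF \<phi>[OF that]]
    by (auto simp: X.vnorm_eq Y.vnorm_eq intro!: Lp_norm_cong_AE X.pnorm_measurable Y.pnorm_measurable elim!: eventually_mono)
  ultimately show ?thesis
    unfolding lp_isometric_def generated_submodule_eq
    using Lp_mod.lp_normed[OF fst_span_submodule(1)] Y.lp_normed by (intro conjI exI[of _ \<phi>]) simp_all
qed

end

section \<open>Quotients\<close>

locale Lp_submod = Lp_mod M m p for M :: "('a, 'v, 'z) normed_mod_scheme" (structure) and m p +
  fixes H :: "'v set"
  assumes H_carrier: "H \<subseteq> carrier M" and H_zero: "\<zero> \<in> H"
    and H_add: "u \<in> H \<Longrightarrow> v \<in> H \<Longrightarrow> u \<oplus> v \<in> H"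
    and H_smult: "f \<in> carrier (Linf m) \<Longrightarrow> v \<in> H \<Longrightarrow> f \<odot> v \<in> H"
    and H_closed: "(\<And>n. \<sigma> n \<in> H) \<Longrightarrow> v \<in> carrier M \<Longrightarrow> (\<lambda>n. vnorm M (\<sigma> n \<ominus> v)) \<longlonglongrightarrow> 0 \<Longrightarrow> v \<in> H"
begin

abbreviation "Q \<equiv> quotient_module m p M H"
abbreviation "\<pi> v \<equiv> H +> v"

lemma H_minus: "v \<in> H \<Longrightarrow> \<ominus> v \<in> H"
  by (rule closed_submodule(3)[OF H_carrier H_zero H_add H_smult H_closed])

lemma H_in [simp]: "v \<in> H \<Longrightarrow> v \<in> carrier M"
  using H_carrier by auto

section \<open>Cosets and the quotient group\<close>

sublocale H: abelian_subgroup H M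
proof (rule abelian_subgroupI3)
  show "additive_subgroup H M"
    by (intro additive_subgroup.intro subgroup.intro)
      (use H_carrier H_zero H_add H_minus in \<open>auto simp: a_inv_def[symmetric]\<close>)
qed (rule abelian_group_axioms)

lemma mem_coset: "v \<in> carrier M \<Longrightarrow> w \<in> \<pi> v \<longleftrightarrow> w \<in> carrier M \<and> w \<ominus> v \<in> H"
proof
  assume v: "v \<in> carrier M" and "w \<in> \<pi> v"
  then obtain h where h: "h \<in> H" "w = h \<oplus> v" by (auto simp: a_r_coset_def')
  then show "w \<in> carrier M \<and> w \<ominus> v \<in> H" using v by (simp add: minus_eq a_assoc r_neg)
next
  assume v: "v \<in> carrier M" and w: "w \<in> carrier M \<and> w \<ominus> v \<in> H"
  then have "w = (w \<ominus> v) \<oplus> v" by (simp add: diff_add_cancel)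
  then show "w \<in> \<pi> v" using w by (auto simp: a_r_coset_def')
qed

lemma coset_add: "v \<in> carrier M \<Longrightarrow> h \<in> H \<Longrightarrow> v \<oplus> h \<in> \<pi> v"
  by (auto simp: a_r_coset_def' a_comm)

lemma coset_self: "v \<in> carrier M \<Longrightarrow> v \<in> \<pi> v"
  by (simp add: mem_coset diff_self H_zero)

lemma coset_carrier: "v \<in> carrier M \<Longrightarrow> w \<in> \<pi> v \<Longrightarrow> w \<in> carrier M"
  by (simp add: mem_coset)

lemma coset_eqI:
  assumes "u \<in> carrier M" "v \<in> carrier M" "u \<ominus> v \<in> H" shows "\<pi> u = \<pi> v"
proof -
  have 1: "w \<ominus> u \<in> H \<longleftrightarrow> w \<ominus> v \<in> H" if "w \<in> carrier M" for w
    using H_add[OF _ assms(3), of "w \<ominus> u"] H_add[OF _ H_minus[OF assms(3)], of "w \<ominus> v"] that assms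
    by (auto simp: diff_add_diff minus_diff)
  show ?thesis by (rule Set.set_eqI) (use 1 assms in \<open>auto simp: mem_coset\<close>)
qed

lemma coset_zero: "\<pi> \<zero> = H"
  by (rule Set.set_eqI) (auto simp: mem_coset diff_zero)

lemma coset_eq_H: "v \<in> H \<Longrightarrow> \<pi> v = H"
  using coset_eqI[of v \<zero>] by (simp add: coset_zero diff_zero)

lemma Q_simps [simp]:
  "carrier Q = a_rcosets H" "zero Q = H" "add Q = set_add M"
  "vnorm Q C = (INF v\<in>C. vnorm M v)"
  "pnorm Q C = ae_greatest m {G \<in> Lp m p. \<forall>v\<in>C. AE x in m. G x \<le> pnorm M v x}"
  by (simp_all add: quotient_module_def)

lemma Q_carrierE:
  assumes "C \<in> carrier Q" obtains v where "v \<in> carrier M" "C = \<pi> v"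
  using assms by (auto simp: A_RCOSETS_def')

lemma Q_carrierI: "v \<in> carrier M \<Longrightarrow> \<pi> v \<in> carrier Q"
  by (auto simp: A_RCOSETS_def')

lemma Q_add: "u \<in> carrier M \<Longrightarrow> v \<in> carrier M \<Longrightarrow> \<pi> u \<oplus>\<^bsub>Q\<^esub> \<pi> v = \<pi> (u \<oplus> v)"
  by (simp add: H.a_rcos_sum)

lemma Q_smult:
  assumes f: "f \<in> carrier (Linf m)" and v: "v \<in> carrier M"
  shows "f \<odot>\<^bsub>Q\<^esub> \<pi> v = \<pi> (f \<odot> v)"
proof -
  have "\<pi> (f \<odot> w) = \<pi> (f \<odot> v)" if "w \<in> \<pi> v" for w
    using that f v H_smult[OF f, of "w \<ominus> v"] by (intro coset_eqI) (auto simp: mem_coset smult_diff smult_closed)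
  then have "(\<Union>w\<in>\<pi> v. \<pi> (f \<odot> w)) = \<pi> (f \<odot> v)" using coset_self[OF v] by blast
  then show ?thesis by (simp add: quotient_module_def)
qed

lemma Q_abelian_group: "abelian_group Q"
proof (rule abelian_groupI)
  fix C D E assume C: "C \<in> carrier Q" and D: "D \<in> carrier Q" and E: "E \<in> carrier Q"
  obtain u where u: "u \<in> carrier M" "C = \<pi> u" by (rule Q_carrierE[OF C])
  obtain v where v: "v \<in> carrier M" "D = \<pi> v" by (rule Q_carrierE[OF D])
  obtain w where w: "w \<in> carrier M" "E = \<pi> w" by (rule Q_carrierE[OF E])
  show "C \<oplus>\<^bsub>Q\<^esub> D \<in> carrier Q" using u v by (simp add: Q_add Q_carrierI del: Q_simps)
  show "C \<oplus>\<^bsub>Q\<^esub> D \<oplus>\<^bsub>Q\<^esub> E = C \<oplus>\<^bsub>Q\<^esub> (D \<oplus>\<^bsub>Q\<^esub> E)" using u v w by (simp add: Q_add a_assoc del: Q_simps)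
  show "C \<oplus>\<^bsub>Q\<^esub> D = D \<oplus>\<^bsub>Q\<^esub> C" using u v by (simp add: Q_add a_comm del: Q_simps)
next
  have Z: "\<zero>\<^bsub>Q\<^esub> = \<pi> \<zero>" by (simp add: coset_zero)
  show "\<zero>\<^bsub>Q\<^esub> \<in> carrier Q" unfolding Z by (rule Q_carrierI) simp
  fix C assume C: "C \<in> carrier Q"
  obtain u where u: "u \<in> carrier M" "C = \<pi> u" by (rule Q_carrierE[OF C])
  show "\<zero>\<^bsub>Q\<^esub> \<oplus>\<^bsub>Q\<^esub> C = C" unfolding Z using u by (simp add: Q_add del: Q_simps)
  show "\<exists>D\<in>carrier Q. D \<oplus>\<^bsub>Q\<^esub> C = \<zero>\<^bsub>Q\<^esub>" unfolding Z
    using u Q_carrierI[of "\<ominus> u"] by (intro bexI[of _ "\<pi> (\<ominus> u)"]) (simp_all add: Q_add l_neg del: Q_simps)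
qed

lemma Q_minus: "v \<in> carrier M \<Longrightarrow> \<ominus>\<^bsub>Q\<^esub> \<pi> v = \<pi> (\<ominus> v)"
  by (rule abelian_group.minus_equality[OF Q_abelian_group])
    (use Q_add[of "\<ominus> v" v] Q_carrierI[of v] Q_carrierI[of "\<ominus> v"] in \<open>auto simp: l_neg coset_zero\<close>)

lemma Q_diff: "u \<in> carrier M \<Longrightarrow> v \<in> carrier M \<Longrightarrow> \<pi> u \<ominus>\<^bsub>Q\<^esub> \<pi> v = \<pi> (u \<ominus> v)"
  using Q_add[of u "\<ominus> v"] Q_minus[of v] by (simp add: a_minus_def)

text \<open>A coset is stable under pasting two of its elements along a measurable set, since
  \<open>H\<close> is closed under multiplication by indicators. Hence the minimum of two pointwise
  norms is again attained in the coset.\<close>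

lemma coset_combine:
  assumes v: "v \<in> carrier M" and w: "w \<in> \<pi> v" "w' \<in> \<pi> v" and A: "A \<in> sets m"
  defines "z \<equiv> indicat_real A \<odot> w \<oplus> indicat_real (- A) \<odot> w'"
  shows "z \<in> \<pi> v" "AE x in m. pnorm M z x = (if x \<in> A then pnorm M w x else pnorm M w' x)"
proof -
  have A': "- A \<in> sets m" using A sets.compl_sets[OF A] by (simp add: space_UNIV Compl_eq_Diff_UNIV)
  have [simp]: "indicat_real A \<in> carrier (Linf m)" "indicat_real (- A) \<in> carrier (Linf m)" using A A' by simp_all
  have c: "w \<in> carrier M" "w' \<in> carrier M" using w v coset_carrier by auto
  have split: "u = indicat_real A \<odot> u \<oplus> indicat_real (- A) \<odot> u" if "u \<in> carrier M" for u
  proof -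
    have "(\<lambda>x. indicat_real A x + indicat_real (- A) x) = (\<lambda>_. 1)" by (auto simp: indicator_def)
    then show ?thesis using smult_l_distr[of "indicat_real A" "indicat_real (- A)" u] that by (simp add: smult_one)
  qed
  have zc: "z \<in> carrier M" using c by (simp add: z_def smult_closed)
  have "z \<ominus> v = (indicat_real A \<odot> w \<oplus> indicat_real (- A) \<odot> w') \<ominus> (indicat_real A \<odot> v \<oplus> indicat_real (- A) \<odot> v)"
    unfolding z_def using split[OF v] by simp
  also have "\<dots> = indicat_real A \<odot> (w \<ominus> v) \<oplus> indicat_real (- A) \<odot> (w' \<ominus> v)"
    using c v by (simp add: add_diff_add smult_diff smult_closed)
  finally show "z \<in> \<pi> v" using w v zc by (auto simp: mem_coset intro!: H_add H_smult)
  have 1: "AE x in m. pnorm M (indicat_real A \<odot> u) x = \<bar>indicat_real A x\<bar> * pnorm M u x" if "u \<in> carrier M" for u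
    by (intro pnorm_smult that) simp
  have 2: "AE x in m. pnorm M (indicat_real (- A) \<odot> u) x = \<bar>indicat_real (- A) x\<bar> * pnorm M u x" if "u \<in> carrier M" for u
    by (intro pnorm_smult that) simp
  have zw: "z \<ominus> w = indicat_real (- A) \<odot> (w' \<ominus> w)"
  proof -
    have "z \<ominus> w = (indicat_real A \<odot> w \<oplus> indicat_real (- A) \<odot> w') \<ominus> (indicat_real A \<odot> w \<oplus> indicat_real (- A) \<odot> w)"
      unfolding z_def using split[OF c(1)] by simp
    then show ?thesis using c by (simp add: add_diff_add smult_diff smult_closed diff_self)
  qed
  have zw': "z \<ominus> w' = indicat_real A \<odot> (w \<ominus> w')"
  proof -
    have "z \<ominus> w' = (indicat_real A \<odot> w \<oplus> indicat_real (- A) \<odot> w') \<ominus> (indicat_real A \<odot> w' \<oplus> indicat_real (- A) \<odot> w')"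
      unfolding z_def using split[OF c(2)] by simp
    then show ?thesis using c by (simp add: add_diff_add smult_diff smult_closed diff_self)
  qed
  show "AE x in m. pnorm M z x = (if x \<in> A then pnorm M w x else pnorm M w' x)"
    using 2[OF minus_closed[OF c(2,1)]] 1[OF minus_closed[OF c(1,2)]] abs_pnorm_diff_le[OF zc c(1)] abs_pnorm_diff_le[OF zc c(2)]
    unfolding zw zw' by eventually_elim (auto simp: indicator_def split: if_splits)
qed

text \<open>Identifies the chosen value with the essential infimum of the pointwise norms. The
  countable family in the last item supports pointwise arguments where the greatest lower bound
  property alone does not reach.\<close>

lemma Q_pnorm_props:
  assumes v: "v \<in> carrier M"
  shows "pnorm Q (\<pi> v) \<in> Lp_plus m p" "\<And>w. w \<in> \<pi> v \<Longrightarrow> AE x in m. pnorm Q (\<pi> v) x \<le> pnorm M w x"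
    "\<And>G. G \<in> Lp m p \<Longrightarrow> (\<And>w. w \<in> \<pi> v \<Longrightarrow> AE x in m. G x \<le> pnorm M w x) \<Longrightarrow> AE x in m. G x \<le> pnorm Q (\<pi> v) x"
    "\<exists>w. (\<forall>n::nat. w n \<in> \<pi> v) \<and> (AE x in m. pnorm Q (\<pi> v) x = (INF n. \<bar>pnorm M (w n) x\<bar>))"
proof -
  let ?W = "pnorm M ` \<pi> v"
  let ?S = "{G \<in> Lp m p. \<forall>w\<in>\<pi> v. AE x in m. G x \<le> pnorm M w x}"
  have W: "?W \<noteq> {}" "?W \<subseteq> Lp_plus m p" using coset_self[OF v] coset_carrier[OF v] by (auto intro!: pnorm_plus)
  have "\<exists>w G. range w \<subseteq> ?W \<and> G \<in> Lp_plus m p \<and> (\<forall>x. G x = (INF n::nat. \<bar>w n x\<bar>)) \<and> (\<forall>u\<in>?W. AE x in m. G x \<le> u x) \<and>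
    (\<forall>F. (\<forall>u\<in>?W. AE x in m. F x \<le> u x) \<longrightarrow> (AE x in m. F x \<le> G x))"
  proof (rule Lp_essential_infimum[OF p_pos W])
    fix w :: "nat \<Rightarrow> 'a \<Rightarrow> real" and G assume *: "range w \<subseteq> ?W" "G \<in> Lp_plus m p" "\<And>x. G x = (INF n. \<bar>w n x\<bar>)"
      "\<And>u. u \<in> ?W \<Longrightarrow> AE x in m. G x \<le> u x" "\<And>F. (\<And>u. u \<in> ?W \<Longrightarrow> AE x in m. F x \<le> u x) \<Longrightarrow> AE x in m. F x \<le> G x"
    show ?thesis
      by (intro exI[of _ w] exI[of _ G] conjI allI ballI impI) (rule *(1), rule *(2), rule *(3), erule *(4), rule *(5), erule (1) bspec)
  qed
  then obtain w :: "nat \<Rightarrow> 'a \<Rightarrow> real" and G where wG: "range w \<subseteq> ?W \<and> G \<in> Lp_plus m p \<and> (\<forall>x. G x = (INF n. \<bar>w n x\<bar>)) \<and>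
    (\<forall>u\<in>?W. AE x in m. G x \<le> u x) \<and> (\<forall>F. (\<forall>u\<in>?W. AE x in m. F x \<le> u x) \<longrightarrow> (AE x in m. F x \<le> G x))"
    by (elim exE) (rule that)
  then have w: "range w \<subseteq> ?W" and G: "G \<in> Lp_plus m p" "\<And>x. G x = (INF n. \<bar>w n x\<bar>)"
    "\<forall>u\<in>?W. AE x in m. G x \<le> u x" "\<And>F. (\<forall>u\<in>?W. AE x in m. F x \<le> u x) \<Longrightarrow> AE x in m. F x \<le> G x"
    by blast+
  have GS: "G \<in> ?S" using G by (auto dest: Lp_plusD)
  have max: "AE x in m. F x \<le> G x" if "F \<in> ?S" for F using that by (intro G(4)) auto
  note g = ae_greatest_eqI[OF GS max]
  have eq: "AE x in m. pnorm Q (\<pi> v) x = G x" using g(2) by simp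
  have inS: "pnorm Q (\<pi> v) \<in> ?S" using g(1) by simp
  show "pnorm Q (\<pi> v) \<in> Lp_plus m p"
    using inS eq Lp_plusD(2)[OF G(1)] unfolding Lp_plus_def by (auto simp del: Q_simps elim: eventually_elim2)
  show "\<And>w. w \<in> \<pi> v \<Longrightarrow> AE x in m. pnorm Q (\<pi> v) x \<le> pnorm M w x" using inS by (simp del: Q_simps)
  show "AE x in m. F x \<le> pnorm Q (\<pi> v) x" if "F \<in> Lp m p" "\<And>w. w \<in> \<pi> v \<Longrightarrow> AE x in m. F x \<le> pnorm M w x" for F
    using max[of F] eq that by (auto simp del: Q_simps elim: eventually_elim2)
  have "\<exists>u. u \<in> \<pi> v \<and> w n = pnorm M u" for n
    using w by blast
  then obtain u where u: "\<And>n. u n \<in> \<pi> v" "\<And>n. w n = pnorm M (u n)" by metis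
  show "\<exists>w. (\<forall>n::nat. w n \<in> \<pi> v) \<and> (AE x in m. pnorm Q (\<pi> v) x = (INF n. \<bar>pnorm M (w n) x\<bar>))"
    using eq u(1) unfolding G(2) u(2) by blast
qed

text \<open>Pasting \<open>z n\<close> and \<open>w (Suc n)\<close>, each where it is the smaller,
  realises the running minimum inside the coset. These pointwise norms decrease a.e. to that of the
  coset, and dominated convergence with the first one as majorant gives convergence of the
  norms.\<close>

lemma Q_vnorm_approx:
  assumes v: "v \<in> carrier M"
  obtains z :: "nat \<Rightarrow> 'v" where "\<And>n. z n \<in> \<pi> v" "(\<lambda>n. vnorm M (z n)) \<longlonglongrightarrow> Lp_norm m p (pnorm Q (\<pi> v))"
proof -
  let ?G = "pnorm Q (\<pi> v)"
  obtain w :: "nat \<Rightarrow> 'v" where w: "\<And>n. w n \<in> \<pi> v" "AE x in m. ?G x = (INF n. \<bar>pnorm M (w n) x\<bar>)"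
    using Q_pnorm_props(4)[OF v] by blast
  have wc: "w n \<in> carrier M" for n using w(1) v coset_carrier by blast
  define A where "A z u = {x. pnorm M z x \<le> pnorm M u x}" for z u
  have A: "A z u \<in> sets m" if "z \<in> carrier M" "u \<in> carrier M" for z u
  proof -
    have "{x \<in> space m. pnorm M z x \<le> pnorm M u x} \<in> sets m"
      using pnorm_measurable[OF that(1)] pnorm_measurable[OF that(2)] by measurable
    then show ?thesis by (simp add: A_def space_UNIV)
  qed
  define z where "z = rec_nat (w 0) (\<lambda>n z. indicat_real (A z (w (Suc n))) \<odot> z \<oplus> indicat_real (- A z (w (Suc n))) \<odot> w (Suc n))"
  have z0: "z 0 = w 0" and zS: "z (Suc n) = indicat_real (A (z n) (w (Suc n))) \<odot> z n \<oplus> indicat_real (- A (z n) (w (Suc n))) \<odot> w (Suc n)" for n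
    by (simp_all add: z_def)
  have z: "z n \<in> \<pi> v" for n
  proof (induction n)
    case (Suc n)
    then show ?case unfolding zS using A[OF coset_carrier[OF v Suc] wc] by (intro coset_combine(1) v w) auto
  qed (simp add: z0 w)
  have zc: "z n \<in> carrier M" for n using z v coset_carrier by blast
  have zmin: "AE x in m. pnorm M (z (Suc n)) x = min (pnorm M (z n) x) (pnorm M (w (Suc n)) x)" for n
    using coset_combine(2)[OF v z[of n] w(1)[of "Suc n"] A[OF zc wc, of n "Suc n"]]
    unfolding zS by eventually_elim (auto simp: A_def)
  have G_le: "AE x in m. ?G x \<le> pnorm M (z n) x" for n by (rule Q_pnorm_props(2)[OF v z])
  have pos: "AE x in m. \<forall>n. 0 \<le> pnorm M (z n) x \<and> 0 \<le> pnorm M (w n) x \<and> ?G x \<le> pnorm M (z n) x \<and>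
      pnorm M (z (Suc n)) x = min (pnorm M (z n) x) (pnorm M (w (Suc n)) x)"
    using pnorm_nonneg[OF zc] pnorm_nonneg[OF wc] G_le zmin by (intro AE_all_countable[THEN iffD2] allI) (auto simp del: Q_simps)
  have Gp: "AE x in m. 0 \<le> ?G x" using Q_pnorm_props(1)[OF v] by (rule Lp_plusD(2))
  have conv: "AE x in m. (\<lambda>n. pnorm M (z n) x) \<longlonglongrightarrow> ?G x \<and> (\<forall>n. pnorm M (z n) x \<le> pnorm M (z 0) x)"
    using pos w(2)
  proof eventually_elim
    case (elim x)
    have dec: "decseq (\<lambda>n. pnorm M (z n) x)" using elim(1) by (intro decseq_SucI) auto
    have le: "pnorm M (z n) x \<le> pnorm M (w n) x" for n using elim(1) by (cases n) (auto simp: z0)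
    have "(\<lambda>n. pnorm M (z n) x) \<longlonglongrightarrow> (INF n. pnorm M (z n) x)"
      using elim(1) by (intro LIMSEQ_decseq_INF[OF _ dec] bdd_belowI2[of _ 0]) auto
    moreover have "(INF n. pnorm M (z n) x) = ?G x"
    proof (rule antisym)
      show "(INF n. pnorm M (z n) x) \<le> ?G x"
        unfolding elim(2)
        by (rule cINF_mono) (use elim(1) le in \<open>auto intro!: bdd_belowI2[of _ 0] intro: order_trans[OF le abs_ge_self]\<close>)
      show "?G x \<le> (INF n. pnorm M (z n) x)" using elim(1) by (intro cINF_greatest) (auto simp del: Q_simps)
    qed
    moreover have "pnorm M (z n) x \<le> pnorm M (z 0) x" for n using dec by (auto simp: decseq_def)
    ultimately show ?case by auto
  qed
  have [measurable]: "pnorm M (z n) \<in> borel_measurable m" for n by (rule pnorm_measurable[OF zc])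
  have [measurable]: "?G \<in> borel_measurable m" by (rule LpD(1)[OF Lp_plusD(1)[OF Q_pnorm_props(1)[OF v]]])
  have "(\<lambda>n. \<integral>x. \<bar>pnorm M (z n) x\<bar> powr p \<partial>m) \<longlonglongrightarrow> (\<integral>x. \<bar>?G x\<bar> powr p \<partial>m)"
  proof (rule integral_dominated_convergence[where w="\<lambda>x. \<bar>pnorm M (z 0) x\<bar> powr p"])
    show "integrable m (\<lambda>x. \<bar>pnorm M (z 0) x\<bar> powr p)" by (rule LpD(2)[OF pnorm_Lp[OF zc]])
    show "AE x in m. (\<lambda>n. \<bar>pnorm M (z n) x\<bar> powr p) \<longlonglongrightarrow> \<bar>?G x\<bar> powr p"
      using conv by eventually_elim (use p_pos in \<open>auto intro!: tendsto_powr' tendsto_intros simp del: Q_simps\<close>)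
    show "AE x in m. norm (\<bar>pnorm M (z n) x\<bar> powr p) \<le> \<bar>pnorm M (z 0) x\<bar> powr p" for n
      using conv pos
    proof eventually_elim
      case (elim x)
      then have "\<bar>pnorm M (z n) x\<bar> \<le> \<bar>pnorm M (z 0) x\<bar>" by (auto simp del: Q_simps)
      then show ?case using p_pos by (simp add: powr_mono2)
    qed
  qed measurable
  then have "(\<lambda>n. (\<integral>x. \<bar>pnorm M (z n) x\<bar> powr p \<partial>m) powr (1/p)) \<longlonglongrightarrow> (\<integral>x. \<bar>?G x\<bar> powr p \<partial>m) powr (1/p)"
    using p_pos by (intro tendsto_powr' tendsto_const) (auto simp del: Q_simps)
  then have "(\<lambda>n. vnorm M (z n)) \<longlonglongrightarrow> Lp_norm m p ?G"
    unfolding vnorm_eq[OF zc] Lp_norm_def .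
  then show ?thesis using z that by blast
qed

lemma Q_vnorm_bdd: "v \<in> carrier M \<Longrightarrow> bdd_below (vnorm M ` \<pi> v)"
  by (rule bdd_belowI2[of _ 0]) (auto intro: vnorm_nonneg coset_carrier)

lemma Q_vnorm_le: "v \<in> carrier M \<Longrightarrow> w \<in> \<pi> v \<Longrightarrow> vnorm Q (\<pi> v) \<le> vnorm M w"
  by (simp del: Q_simps(5)) (intro cINF_lower Q_vnorm_bdd)

lemma Q_vnorm_lessD:
  assumes v: "v \<in> carrier M" and lt: "vnorm Q (\<pi> v) < e"
  obtains w where "w \<in> \<pi> v" "vnorm M w < e"
proof -
  have "(INF w\<in>\<pi> v. vnorm M w) < e" using lt by (simp del: Q_simps(5))
  then show ?thesis using cInf_lessD[of "vnorm M ` \<pi> v" e] coset_self[OF v] that by blast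
qed

lemma Q_vnorm_eq:
  assumes v: "v \<in> carrier M"
  shows "vnorm Q (\<pi> v) = Lp_norm m p (pnorm Q (\<pi> v))"
proof (rule antisym)
  obtain z where z: "\<And>n. z n \<in> \<pi> v" "(\<lambda>n. vnorm M (z n)) \<longlonglongrightarrow> Lp_norm m p (pnorm Q (\<pi> v))"
    by (rule Q_vnorm_approx[OF v]) blast
  show "vnorm Q (\<pi> v) \<le> Lp_norm m p (pnorm Q (\<pi> v))"
    by (rule LIMSEQ_le_const[OF z(2)]) (use Q_vnorm_le[OF v z(1)] in blast)
  have "Lp_norm m p (pnorm Q (\<pi> v)) \<le> vnorm M w" if "w \<in> \<pi> v" for w
  proof -
    have wc: "w \<in> carrier M" using that v coset_carrier by blast
    show ?thesis unfolding vnorm_eq[OF wc]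
    proof (rule Lp_dominated(2)[OF p_pos _ pnorm_Lp[OF wc]])
      show "pnorm Q (\<pi> v) \<in> borel_measurable m" by (rule LpD(1)[OF Lp_plusD(1)[OF Q_pnorm_props(1)[OF v]]])
      show "AE x in m. \<bar>pnorm Q (\<pi> v) x\<bar> \<le> \<bar>pnorm M w x\<bar>"
        using Q_pnorm_props(2)[OF v that] Lp_plusD(2)[OF Q_pnorm_props(1)[OF v]] by eventually_elim (simp del: Q_simps)
    qed
  qed
  then have "Lp_norm m p (pnorm Q (\<pi> v)) \<le> (INF w\<in>\<pi> v. vnorm M w)"
    using coset_self[OF v] by (intro cINF_greatest) auto
  then show "Lp_norm m p (pnorm Q (\<pi> v)) \<le> vnorm Q (\<pi> v)" by (simp del: Q_simps(5))
qed

text \<open>The greatest lower bound property is used twice: with one representative fixed the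
  inequality is optimised over the other, and then over the first.\<close>

lemma Q_pnorm_triangle:
  assumes u: "u \<in> carrier M" and v: "v \<in> carrier M"
  shows "AE x in m. pnorm Q (\<pi> (u \<oplus> v)) x \<le> pnorm Q (\<pi> u) x + pnorm Q (\<pi> v) x"
proof -
  note uv = a_closed[OF u v]
  note L = Lp_plusD(1)[OF Q_pnorm_props(1)]
  have 1: "AE x in m. pnorm Q (\<pi> (u \<oplus> v)) x \<le> pnorm M u' x + pnorm M v' x" if u': "u' \<in> \<pi> u" and v': "v' \<in> \<pi> v" for u' v'
  proof -
    have c: "u' \<in> carrier M" "v' \<in> carrier M" using u' v' u v coset_carrier by auto
    have "u' \<oplus> v' \<in> \<pi> (u \<oplus> v)"
      using u' v' c u v H_add[of "u' \<ominus> u" "v' \<ominus> v"] by (simp add: mem_coset add_diff_add)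
    from Q_pnorm_props(2)[OF uv this] pnorm_triangle[OF c] show ?thesis by eventually_elim simp
  qed
  have 2: "AE x in m. pnorm Q (\<pi> (u \<oplus> v)) x - pnorm M u' x \<le> pnorm Q (\<pi> v) x" if u': "u' \<in> \<pi> u" for u'
  proof (rule Q_pnorm_props(3)[OF v])
    show "(\<lambda>x. pnorm Q (\<pi> (u \<oplus> v)) x - pnorm M u' x) \<in> Lp m p"
      by (intro Lp_diff p_pos L uv pnorm_Lp coset_carrier[OF u u'])
    show "AE x in m. pnorm Q (\<pi> (u \<oplus> v)) x - pnorm M u' x \<le> pnorm M w x" if "w \<in> \<pi> v" for w
      using 1[OF u' that] by eventually_elim simp
  qed
  have "AE x in m. pnorm Q (\<pi> (u \<oplus> v)) x - pnorm Q (\<pi> v) x \<le> pnorm Q (\<pi> u) x"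
  proof (rule Q_pnorm_props(3)[OF u])
    show "(\<lambda>x. pnorm Q (\<pi> (u \<oplus> v)) x - pnorm Q (\<pi> v) x) \<in> Lp m p"
      by (intro Lp_diff p_pos L uv v)
    show "AE x in m. pnorm Q (\<pi> (u \<oplus> v)) x - pnorm Q (\<pi> v) x \<le> pnorm M w x" if "w \<in> \<pi> u" for w
      using 2[OF that] by eventually_elim simp
  qed
  then show ?thesis by eventually_elim simp
qed

text \<open>The lower estimate needs division by \<open>f\<close>, which has a bounded quotient only
  where |f| \<ge> 1 / (n + 1). There an element f v + h of the coset of f v is \<open>f\<close>
  times v + h / f, which comes from the coset of \<open>v\<close>; as \<open>n\<close> varies these
  sets exhaust the points where \<open>f\<close> does not vanish.\<close>

lemma Q_pnorm_smult:
  assumes f: "f \<in> carrier (Linf m)" and v: "v \<in> carrier M"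
  shows "AE x in m. pnorm Q (\<pi> (f \<odot> v)) x = \<bar>f x\<bar> * pnorm Q (\<pi> v) x"
proof -
  note fv = smult_closed[OF f v]
  note G = Q_pnorm_props(1)[OF v] and G' = Q_pnorm_props(1)[OF fv]
  have fm: "f \<in> borel_measurable m" using f by (simp add: Linf_carrier)
  obtain w :: "nat \<Rightarrow> 'v" where w: "\<And>n. w n \<in> \<pi> v" "AE x in m. pnorm Q (\<pi> v) x = (INF n. \<bar>pnorm M (w n) x\<bar>)"
    using Q_pnorm_props(4)[OF v] by blast
  have wc: "w n \<in> carrier M" for n using w(1) v coset_carrier by blast
  have 1: "AE x in m. \<forall>n. pnorm Q (\<pi> (f \<odot> v)) x \<le> \<bar>f x\<bar> * pnorm M (w n) x"
  proof (intro AE_all_countable[THEN iffD2] allI)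
    fix n
    have "f \<odot> w n \<in> \<pi> (f \<odot> v)"
      using w(1)[of n] v fv wc[of n] f H_smult[OF f, of "w n \<ominus> v"] by (auto simp: mem_coset smult_diff smult_closed)
    from Q_pnorm_props(2)[OF fv this] pnorm_smult[OF f wc[of n]]
    show "AE x in m. pnorm Q (\<pi> (f \<odot> v)) x \<le> \<bar>f x\<bar> * pnorm M (w n) x" by eventually_elim simp
  qed
  have le: "AE x in m. pnorm Q (\<pi> (f \<odot> v)) x \<le> \<bar>f x\<bar> * pnorm Q (\<pi> v) x"
    using 1 w(2)
  proof eventually_elim
    case (elim x)
    show ?case
    proof (cases "f x = 0")
      case False
      have "pnorm Q (\<pi> (f \<odot> v)) x / \<bar>f x\<bar> \<le> (INF n. \<bar>pnorm M (w n) x\<bar>)"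
      proof (rule cINF_greatest)
        fix n
        have "pnorm Q (\<pi> (f \<odot> v)) x / \<bar>f x\<bar> \<le> pnorm M (w n) x"
          using elim(1) False by (simp add: field_simps del: Q_simps)
        then show "pnorm Q (\<pi> (f \<odot> v)) x / \<bar>f x\<bar> \<le> \<bar>pnorm M (w n) x\<bar>" by linarith
      qed simp
      then show ?thesis using False elim(2) by (simp add: field_simps del: Q_simps)
    qed (use elim in auto)
  qed
  have ge: "AE x in m. \<bar>f x\<bar> * pnorm Q (\<pi> v) x \<le> pnorm Q (\<pi> (f \<odot> v)) x"
  proof (rule Q_pnorm_props(3)[OF fv])
    obtain C where C: "0 < C" "AE x in m. \<bar>f x\<bar> \<le> C" using f by (rule Linf_bound)
    show "(\<lambda>x. \<bar>f x\<bar> * pnorm Q (\<pi> v) x) \<in> Lp m p"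
      by (rule Lp_mult_Linf(1)[OF p_pos _ less_imp_le[OF C(1)] _ Lp_plusD(1)[OF G]]) (use fm C in \<open>auto simp del: Q_simps\<close>)
    fix w assume w: "w \<in> \<pi> (f \<odot> v)"
    then have wc: "w \<in> carrier M" and h: "w \<ominus> f \<odot> v \<in> H" using fv by (simp_all add: mem_coset)
    let ?h = "w \<ominus> f \<odot> v"
    have hc: "?h \<in> carrier M" using h by simp
    have "AE x in m. \<forall>n. 1 / real (Suc n) \<le> \<bar>f x\<bar> \<longrightarrow> \<bar>f x\<bar> * pnorm Q (\<pi> v) x \<le> pnorm M w x"
    proof (intro AE_all_countable[THEN iffD2] allI)
      fix n
      define A where "A = {x. 1 / real (Suc n) \<le> \<bar>f x\<bar>}"
      have "{x \<in> space m. 1 / real (Suc n) \<le> \<bar>f x\<bar>} \<in> sets m" using fm by measurable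
      then have A: "A \<in> sets m" by (simp add: A_def space_UNIV)
      define r where "r x = indicat_real A x / f x" for x
      have "\<bar>r x\<bar> \<le> real (Suc n)" for x
        by (auto simp: r_def A_def indicator_def divide_simps mult.commute)
      then have r: "r \<in> carrier (Linf m)"
        using fm A unfolding Linf_carrier by (auto simp: r_def[abs_def] intro!: exI[of _ "real (Suc n)"] AE_I2)
      let ?v = "v \<oplus> r \<odot> ?h"
      have v': "?v \<in> \<pi> v" using v h r by (intro coset_add H_smult)
      have v'c: "?v \<in> carrier M" using v' v coset_carrier by blast
      have fr: "(\<lambda>x. f x * r x) = indicat_real A" by (auto simp: r_def A_def indicator_def)
      have "f \<odot> ?v = f \<odot> v \<oplus> indicat_real A \<odot> ?h"
        using smult_r_distr[OF f v smult_closed[OF r hc]] smult_assoc[OF f r hc] by (simp add: fr)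
      moreover have "w = f \<odot> v \<oplus> ?h" using wc fv diff_add_cancel[OF wc fv] by (simp add: a_comm)
      ultimately have "w \<ominus> f \<odot> ?v = (f \<odot> v \<oplus> ?h) \<ominus> (f \<odot> v \<oplus> indicat_real A \<odot> ?h)" by simp
      also have "\<dots> = (f \<odot> v \<ominus> f \<odot> v) \<oplus> (?h \<ominus> indicat_real A \<odot> ?h)"
        using fv hc A by (intro add_diff_add) (auto intro: smult_closed)
      also have "\<dots> = (\<lambda>_. 1) \<odot> ?h \<ominus> indicat_real A \<odot> ?h"
        using fv hc A by (simp add: diff_self smult_one smult_closed)
      finally have eq: "w \<ominus> f \<odot> ?v = (\<lambda>_. 1) \<odot> ?h \<ominus> indicat_real A \<odot> ?h" .
      have "AE x in m. pnorm M (w \<ominus> f \<odot> ?v) x = \<bar>1 - indicat_real A x\<bar> * pnorm M ?h x"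
        unfolding eq by (rule pnorm_smult_l_diff) (use A hc in auto)
      with abs_pnorm_diff_le[OF wc smult_closed[OF f v'c]] pnorm_smult[OF f v'c] Q_pnorm_props(2)[OF v v']
      show "AE x in m. 1 / real (Suc n) \<le> \<bar>f x\<bar> \<longrightarrow> \<bar>f x\<bar> * pnorm Q (\<pi> v) x \<le> pnorm M w x"
      proof eventually_elim
        case (elim x)
        show ?case
        proof
          assume "1 / real (Suc n) \<le> \<bar>f x\<bar>"
          then have "x \<in> A" by (simp add: A_def)
          then have "pnorm M w x = \<bar>f x\<bar> * pnorm M ?v x" using elim by (simp del: Q_simps)
          then show "\<bar>f x\<bar> * pnorm Q (\<pi> v) x \<le> pnorm M w x" using elim(3) by (simp add: mult_left_mono del: Q_simps)
        qed
      qed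
    qed
    with pnorm_nonneg[OF wc] show "AE x in m. \<bar>f x\<bar> * pnorm Q (\<pi> v) x \<le> pnorm M w x"
    proof eventually_elim
      case (elim x)
      show ?case
      proof (cases "f x = 0")
        case False
        then obtain n where "inverse (real (Suc n)) < \<bar>f x\<bar>" using reals_Archimedean[of "\<bar>f x\<bar>"] by auto
        then have "1 / real (Suc n) \<le> \<bar>f x\<bar>" by (simp add: inverse_eq_divide del: of_nat_Suc)
        then show ?thesis using elim(2) by blast
      qed (use elim in auto)
    qed
  qed
  from le ge show ?thesis by eventually_elim (simp del: Q_simps)
qed

section \<open>Completeness of the quotient\<close>

lemma Q_complete:
  assumes \<sigma>: "\<And>n. \<sigma> n \<in> carrier Q"
    and Cau: "\<And>e. 0 < e \<Longrightarrow> \<exists>N. \<forall>n\<ge>N. \<forall>k\<ge>N. vnorm Q (\<sigma> n \<ominus>\<^bsub>Q\<^esub> \<sigma> k) < e"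
  shows "\<exists>C\<in>carrier Q. (\<lambda>n. vnorm Q (\<sigma> n \<ominus>\<^bsub>Q\<^esub> C)) \<longlonglongrightarrow> 0"
proof -
  obtain r where r: "strict_mono r" and rk: "\<And>k n. r k \<le> n \<Longrightarrow> vnorm Q (\<sigma> (r k) \<ominus>\<^bsub>Q\<^esub> \<sigma> n) < (1/2)^k"
    using fast_Cauchy_subsequence[of "\<lambda>n k. vnorm Q (\<sigma> n \<ominus>\<^bsub>Q\<^esub> \<sigma> k)", OF Cau] by metis
  \<comment> \<open>The cosets of a rapidly Cauchy subsequence are lifted one after another, each
    representative chosen within 2^-k of the previous one, so that the lifts are Cauchy.\<close>
  define P where "P k u \<longleftrightarrow> u \<in> carrier M \<and> \<pi> u = \<sigma> (r k)" for k u
  have start: "\<exists>u. P 0 u" by (rule Q_carrierE[OF \<sigma>[of "r 0"]]) (auto simp: P_def)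
  have next_ex: "\<exists>u'. P (Suc k) u' \<and> vnorm M (u \<ominus> u') < (1/2)^k" if u: "P k u" for k u
  proof -
    obtain v where v: "v \<in> carrier M" "\<sigma> (r (Suc k)) = \<pi> v" by (rule Q_carrierE[OF \<sigma>])
    have uc: "u \<in> carrier M" using u by (simp add: P_def)
    have "r k \<le> r (Suc k)" using r by (simp add: strict_mono_less_eq)
    from rk[OF this] have "vnorm Q (\<pi> (u \<ominus> v)) < (1/2)^k"
      using u v Q_diff[OF uc v(1)] by (simp add: P_def del: Q_simps)
    then obtain w where w: "w \<in> \<pi> (u \<ominus> v)" "vnorm M w < (1/2)^k"
      by (rule Q_vnorm_lessD[OF minus_closed[OF uc v(1)]])
    have wc: "w \<in> carrier M" and wH: "w \<ominus> (u \<ominus> v) \<in> H" using w(1) uc v by (simp_all add: mem_coset)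
    have "(u \<ominus> w) \<ominus> v = \<ominus> (w \<ominus> (u \<ominus> v))"
      using uc v wc by (simp add: minus_eq minus_add a_ac)
    then have "(u \<ominus> w) \<ominus> v \<in> H" using H_minus[OF wH] by simp
    then have "\<pi> (u \<ominus> w) = \<pi> v" using uc v wc by (intro coset_eqI) auto
    moreover have "u \<ominus> (u \<ominus> w) = w" using uc wc by (simp add: minus_eq minus_add a_assoc[symmetric] r_neg)
    ultimately show ?thesis using v w uc wc by (intro exI[of _ "u \<ominus> w"]) (simp add: P_def)
  qed
  obtain u where u: "\<And>k. P k (u k)" "\<And>k. vnorm M (u k \<ominus> u (Suc k)) < (1/2)^k"
    using dependent_nat_choice[of P "\<lambda>k u u'. vnorm M (u \<ominus> u') < (1/2)^k", OF start next_ex] by blast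
  have uc: "u k \<in> carrier M" and \<pi>u: "\<pi> (u k) = \<sigma> (r k)" for k using u(1) by (auto simp: P_def)
  \<comment> \<open>The subtracted term is what makes the geometric estimate inductive in
    \<open>j\<close>.\<close>
  have tail: "vnorm M (u n \<ominus> u (n + j)) \<le> 2 * (1/2)^n - 2 * (1/2)^(n + j)" for n j
  proof (induction j)
    case 0 then show ?case using uc by (simp add: diff_self)
  next
    case (Suc j)
    have "vnorm M (u n \<ominus> u (n + Suc j)) \<le> vnorm M (u n \<ominus> u (n + j)) + vnorm M (u (n + j) \<ominus> u (Suc (n + j)))"
      using vnorm_diff_triangle[of "u n" "u (n + j)" "u (n + Suc j)"] uc by simp
    also have "\<dots> \<le> (2 * (1/2)^n - 2 * (1/2)^(n + j)) + (1/2)^(n + j)"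
      using Suc u(2)[of "n + j"] by simp
    finally show ?case by simp
  qed
  have "\<exists>v\<in>carrier M. (\<lambda>n. vnorm M (u n \<ominus> v)) \<longlonglongrightarrow> 0"
  proof (rule complete[OF uc])
    fix e :: real assume e: "0 < e"
    obtain N where N: "(1/2::real)^N < e/2" using real_arch_pow_inv[of "e/2" "1/2"] e by auto
    have *: "vnorm M (u n \<ominus> u k) < e" if "N \<le> n" "n \<le> k" for n k
    proof -
      have "vnorm M (u n \<ominus> u k) \<le> 2 * (1/2)^n - 2 * (1/2)^(n + (k - n))" using tail[of n "k - n"] that by simp
      also have "\<dots> \<le> 2 * (1/2)^n" by simp
      also have "\<dots> \<le> 2 * (1/2)^N" using that by (intro mult_left_mono power_decreasing) auto
      also have "\<dots> < e" using N by simp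
      finally show ?thesis .
    qed
    have "vnorm M (u n \<ominus> u k) < e" if "N \<le> n" "N \<le> k" for n k
      using *[of n k] *[of k n] that vnorm_diff_commute[OF uc uc, of n k] by (cases "n \<le> k") auto
    then show "\<exists>N. \<forall>n\<ge>N. \<forall>k\<ge>N. vnorm M (u n \<ominus> u k) < e" by blast
  qed
  then obtain v where v: "v \<in> carrier M" "(\<lambda>n. vnorm M (u n \<ominus> v)) \<longlonglongrightarrow> 0" by blast
  have "(\<lambda>n. vnorm Q (\<sigma> n \<ominus>\<^bsub>Q\<^esub> \<pi> v)) \<longlonglongrightarrow> 0"
  proof (rule LIMSEQ_I)
    fix e :: real assume e: "0 < e"
    obtain N where N: "(1/2::real)^N < e/2" using real_arch_pow_inv[of "e/2" "1/2"] e by auto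
    obtain N' where N': "\<And>n. N' \<le> n \<Longrightarrow> vnorm M (u n \<ominus> v) < e/2"
      using order_tendstoD(2)[OF v(2), of "e/2"] half_gt_zero[OF e] unfolding eventually_sequentially by blast
    define k where "k = max N N'"
    have "norm (vnorm Q (\<sigma> n \<ominus>\<^bsub>Q\<^esub> \<pi> v) - 0) < e" if n: "r k \<le> n" for n
    proof -
      obtain y where y: "y \<in> carrier M" "\<sigma> n = \<pi> y" by (rule Q_carrierE[OF \<sigma>])
      have "vnorm Q (\<pi> (u k \<ominus> y)) < (1/2)^k" using rk[OF n] y \<pi>u[of k] Q_diff[OF uc y(1), of k] by (simp del: Q_simps)
      also have "\<dots> \<le> (1/2)^N" unfolding k_def by (intro power_decreasing) auto
      finally have "vnorm Q (\<pi> (u k \<ominus> y)) < e/2" using N by linarith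
      then obtain w where w: "w \<in> \<pi> (u k \<ominus> y)" "vnorm M w < e/2"
        by (rule Q_vnorm_lessD[OF minus_closed[OF uc y(1)]])
      have wc: "w \<in> carrier M" and wH: "w \<ominus> (u k \<ominus> y) \<in> H" using w(1) uc y by (simp_all add: mem_coset)
      \<comment> \<open>This lies in the coset of \<open>y \<ominus> v\<close>, from which it
        differs by minus the element w - (u k - y) of \<open>H\<close>; its norm is controlled by u
        k - v and \<open>w\<close>.\<close>
      let ?z = "(u k \<ominus> v) \<ominus> w"
      have "?z \<ominus> (y \<ominus> v) = \<ominus> (w \<ominus> (u k \<ominus> y))"
      proof -
        have "?z \<ominus> (y \<ominus> v) = ((u k \<ominus> v) \<ominus> (y \<ominus> v)) \<ominus> w"
          using uc[of k] y v wc by (simp add: minus_eq[of _ w] minus_eq[of _ "y \<ominus> v"] a_ac)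
        also have "(u k \<ominus> v) \<ominus> (y \<ominus> v) = u k \<ominus> y"
          using uc[of k] y v by (simp add: minus_eq[of _ "y \<ominus> v"] minus_diff diff_add_diff)
        also have "(u k \<ominus> y) \<ominus> w = \<ominus> (w \<ominus> (u k \<ominus> y))" using uc[of k] y wc by (simp add: minus_diff)
        finally show ?thesis .
      qed
      then have "?z \<in> \<pi> (y \<ominus> v)" using H_minus[OF wH] uc y v wc by (simp add: mem_coset)
      then have "vnorm Q (\<sigma> n \<ominus>\<^bsub>Q\<^esub> \<pi> v) \<le> vnorm M ?z"
        using Q_vnorm_le[of "y \<ominus> v" ?z] y v Q_diff[OF y(1) v(1)] by (simp del: Q_simps)
      also have "\<dots> \<le> vnorm M (u k \<ominus> v) + vnorm M w"
        using vnorm_triangle[of "u k \<ominus> v" "\<ominus> w"] uc v wc by (simp add: minus_eq[of _ w] vnorm_minus)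
      also have "\<dots> < e" using N'[of k] w by (simp add: k_def)
      moreover have "0 \<le> vnorm Q (\<sigma> n \<ominus>\<^bsub>Q\<^esub> \<pi> v)"
        using Q_vnorm_eq[of "y \<ominus> v"] y v Q_diff[OF y(1) v(1)] by (simp del: Q_simps)
      ultimately show ?thesis by (simp del: Q_simps)
    qed
    then show "\<exists>N. \<forall>n\<ge>N. norm (vnorm Q (\<sigma> n \<ominus>\<^bsub>Q\<^esub> \<pi> v) - 0) < e" by blast
  qed
  then show ?thesis using Q_carrierI[OF v(1)] by blast
qed

theorem quotient_Lp_mod: "Lp_mod Q m p"
proof -
  interpret Q: abelian_group Q by (rule Q_abelian_group)
  note [simp del] = Q_simps
  show ?thesis
  proof
    show "1 < p" "space m = UNIV" by (fact p1 space_UNIV)+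
    show "pnorm Q C \<in> Lp_plus m p" if "C \<in> carrier Q" for C
      by (rule Q_carrierE[OF that]) (simp add: Q_pnorm_props(1))
    show "vnorm Q C = Lp_norm m p (pnorm Q C)" if "C \<in> carrier Q" for C
      by (rule Q_carrierE[OF that]) (simp add: Q_vnorm_eq)
    show "AE x in m. pnorm Q (C \<oplus>\<^bsub>Q\<^esub> D) x \<le> pnorm Q C x + pnorm Q D x" if "C \<in> carrier Q" "D \<in> carrier Q" for C D
    proof -
      note h = that
      obtain u where u: "u \<in> carrier M" "C = \<pi> u" by (rule Q_carrierE[OF h(1)])
      obtain v where v: "v \<in> carrier M" "D = \<pi> v" by (rule Q_carrierE[OF h(2)])
      show ?thesis using Q_pnorm_triangle[OF u(1) v(1)] u v by (simp add: Q_add)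
    qed
    show "AE x in m. pnorm Q (\<ominus>\<^bsub>Q\<^esub> C) x = pnorm Q C x" if "C \<in> carrier Q" for C
    proof -
      note h = that
      obtain v where v: "v \<in> carrier M" "C = \<pi> v" by (rule Q_carrierE[OF h])
      show ?thesis using Q_pnorm_smult[OF Linf_const[of "-1"] v(1)] v Q_minus[OF v(1)] by (simp add: minus_eq_scal)
    qed
    show "AE x in m. pnorm Q \<zero>\<^bsub>Q\<^esub> x = 0"
    proof -
      have "pnorm Q \<zero>\<^bsub>Q\<^esub> = pnorm Q (\<pi> \<zero>)" by (simp add: coset_zero Q_simps(2))
      then show ?thesis
        using Lp_plusD(2)[OF Q_pnorm_props(1)[OF zero_closed]] Q_pnorm_props(2)[OF zero_closed coset_self[OF zero_closed]] pnorm_zero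
        by (auto elim!: eventually_elim2 dest: eventually_conj)
    qed
    show "C = \<zero>\<^bsub>Q\<^esub>" if "C \<in> carrier Q" "vnorm Q C = 0" for C
    proof -
      note h = that
      obtain v where v: "v \<in> carrier M" "C = \<pi> v" by (rule Q_carrierE[OF h(1)])
      obtain z where z: "\<And>n. z n \<in> \<pi> v" "(\<lambda>n. vnorm M (z n)) \<longlonglongrightarrow> 0"

      proof (rule Q_vnorm_approx[OF v(1)])
        fix z :: "nat \<Rightarrow> 'v" assume z: "\<And>n. z n \<in> \<pi> v" "(\<lambda>n. vnorm M (z n)) \<longlonglongrightarrow> Lp_norm m p (pnorm Q (\<pi> v))"
        have "Lp_norm m p (pnorm Q (\<pi> v)) = 0" using Q_vnorm_eq[OF v(1)] h(2) v(2) by simp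
        then show thesis using z that[of z] by simp
      qed
      have zc: "z n \<in> carrier M" for n using z(1) v coset_carrier by blast
      \<comment> \<open>Closedness of \<open>H\<close> enters here: a coset of norm 0 contains
        \<open>z n\<close> tending to zero, so \<open>v\<close> is the limit of the elements v - z n
        of \<open>H\<close>.\<close>
      have zH: "v \<ominus> z n \<in> H" for n using H_minus[of "z n \<ominus> v"] z(1)[of n] v zc by (simp add: mem_coset minus_diff)
      have "(v \<ominus> z n) \<ominus> v = \<ominus> z n" for n using v zc[of n] by (simp add: minus_eq a_ac r_neg2 r_neg1 r_neg)
      then have "(\<lambda>n. vnorm M ((v \<ominus> z n) \<ominus> v)) \<longlonglongrightarrow> 0" using z(2) zc by (simp add: vnorm_minus)
      then have "v \<in> H" using H_closed[of "\<lambda>n. v \<ominus> z n" v, OF zH v(1)] by blast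
      then show ?thesis using v by (simp add: coset_eq_H Q_simps(2))
    qed
    show "f \<odot>\<^bsub>Q\<^esub> C \<in> carrier Q" if "f \<in> carrier (Linf m)" "C \<in> carrier Q" for f C
      by (rule Q_carrierE[OF that(2)]) (simp add: that Q_smult smult_closed Q_carrierI)
    show "(\<lambda>x. f x + h x) \<odot>\<^bsub>Q\<^esub> C = f \<odot>\<^bsub>Q\<^esub> C \<oplus>\<^bsub>Q\<^esub> h \<odot>\<^bsub>Q\<^esub> C"
      if "f \<in> carrier (Linf m)" "h \<in> carrier (Linf m)" "C \<in> carrier Q" for f h C
    proof -
      note h = that
      obtain v where v: "v \<in> carrier M" "C = \<pi> v" by (rule Q_carrierE[OF h(3)])
      show ?thesis using v that by (simp add: Q_smult Q_add Linf_plus smult_closed smult_l_distr)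
    qed
    show "f \<odot>\<^bsub>Q\<^esub> (C \<oplus>\<^bsub>Q\<^esub> D) = f \<odot>\<^bsub>Q\<^esub> C \<oplus>\<^bsub>Q\<^esub> f \<odot>\<^bsub>Q\<^esub> D"
      if "f \<in> carrier (Linf m)" "C \<in> carrier Q" "D \<in> carrier Q" for f C D
    proof -
      note h = that
      obtain v where v: "v \<in> carrier M" "C = \<pi> v" by (rule Q_carrierE[OF h(2)])
      obtain u where u: "u \<in> carrier M" "D = \<pi> u" by (rule Q_carrierE[OF h(3)])
      show ?thesis using u v that by (simp add: Q_smult Q_add smult_closed smult_r_distr)
    qed
    show "(\<lambda>x. f x * h x) \<odot>\<^bsub>Q\<^esub> C = f \<odot>\<^bsub>Q\<^esub> (h \<odot>\<^bsub>Q\<^esub> C)"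
      if "f \<in> carrier (Linf m)" "h \<in> carrier (Linf m)" "C \<in> carrier Q" for f h C
    proof -
      note h = that
      obtain v where v: "v \<in> carrier M" "C = \<pi> v" by (rule Q_carrierE[OF h(3)])
      show ?thesis using v that by (simp add: Q_smult Linf_times smult_closed smult_assoc)
    qed
    show "(\<lambda>_. 1) \<odot>\<^bsub>Q\<^esub> C = C" if "C \<in> carrier Q" for C
      by (rule Q_carrierE[OF that]) (simp add: Q_smult smult_one)
    show "AE x in m. pnorm Q (f \<odot>\<^bsub>Q\<^esub> C) x = \<bar>f x\<bar> * pnorm Q C x"
      if "f \<in> carrier (Linf m)" "C \<in> carrier Q" for f C
      by (rule Q_carrierE[OF that(2)]) (simp add: that Q_smult Q_pnorm_smult)
    show "\<exists>C\<in>carrier Q. (\<lambda>n. vnorm Q (\<sigma> n \<ominus>\<^bsub>Q\<^esub> C)) \<longlonglongrightarrow> 0"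
      if "\<And>n. \<sigma> n \<in> carrier Q" "\<And>e. 0 < e \<Longrightarrow> \<exists>N. \<forall>n\<ge>N. \<forall>k\<ge>N. vnorm Q (\<sigma> n \<ominus>\<^bsub>Q\<^esub> \<sigma> k) < e" for \<sigma>
      by (rule Q_complete[OF that])
  qed
qed

end

section \<open>Completions\<close>

lemma Lp_tendsto_add:
  assumes p: "1 \<le> p" and f: "\<And>n. f n \<in> Lp m p" "F \<in> Lp m p" and h: "\<And>n. h n \<in> Lp m p" "H \<in> Lp m p"
    and lf: "(\<lambda>n. Lp_norm m p (\<lambda>x. f n x - F x)) \<longlonglongrightarrow> 0"
    and lh: "(\<lambda>n. Lp_norm m p (\<lambda>x. h n x - H x)) \<longlonglongrightarrow> 0"
  shows "(\<lambda>n. Lp_norm m p (\<lambda>x. (f n x + h n x) - (F x + H x))) \<longlonglongrightarrow> 0"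
proof (rule tendsto_sandwich[OF _ _ tendsto_const])
  show "(\<lambda>n. Lp_norm m p (\<lambda>x. f n x - F x) + Lp_norm m p (\<lambda>x. h n x - H x)) \<longlonglongrightarrow> 0"
    using tendsto_add[OF lf lh] by simp
  have "Lp_norm m p (\<lambda>x. (f n x + h n x) - (F x + H x)) \<le> Lp_norm m p (\<lambda>x. f n x - F x) + Lp_norm m p (\<lambda>x. h n x - H x)" for n
    using Lp_norm_triangle[OF p Lp_diff[OF _ f(1) f(2)] Lp_diff[OF _ h(1) h(2)], of n n] p by (simp add: algebra_simps)
  then show "\<forall>\<^sub>F n in sequentially. Lp_norm m p (\<lambda>x. (f n x + h n x) - (F x + H x)) \<le>
      Lp_norm m p (\<lambda>x. f n x - F x) + Lp_norm m p (\<lambda>x. h n x - H x)"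
    by (intro always_eventually allI)
qed simp

lemma Lp_tendsto_mult:
  assumes p: "1 \<le> p" and f: "\<And>n. f n \<in> Lp m p" "F \<in> Lp m p"
    and lf: "(\<lambda>n. Lp_norm m p (\<lambda>x. f n x - F x)) \<longlonglongrightarrow> 0"
    and s: "\<And>n. s n \<in> carrier (Linf m)" "h \<in> carrier (Linf m)" "Linf_tendsto m s h"
  shows "(\<lambda>n. Lp_norm m p (\<lambda>x. \<bar>s n x\<bar> * f n x - \<bar>h x\<bar> * F x)) \<longlonglongrightarrow> 0"
proof (rule LIMSEQ_I)
  fix e :: real assume e: "0 < e"
  have p0: "0 < p" using p by simp
  obtain C where C: "0 < C" "AE x in m. \<bar>h x\<bar> \<le> C" using s(2) by (rule Linf_bound)
  define K where "K = Lp_norm m p F + 1"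
  have K: "0 < K" "Lp_norm m p F < K" using Lp_norm_nonneg[of m p F] unfolding K_def by linarith+
  \<comment> \<open>The cap 1 gives |s n| \<le> C + 1; the other bound takes care of the error (|s
    n| - |h|) F.\<close>
  define d where "d = min 1 (e / (2 * K))"
  have d: "0 < d" "d \<le> 1" "d * K \<le> e / 2" using e K by (auto simp: d_def min_def field_simps)
  obtain N where N: "\<And>n. N \<le> n \<Longrightarrow> AE x in m. \<bar>s n x - h x\<bar> \<le> d" using s(3) d unfolding Linf_tendsto_def by blast
  have "0 < e / (2 * (C + 1))" using e C by simp
  then obtain N' where N': "\<And>n. N' \<le> n \<Longrightarrow> Lp_norm m p (\<lambda>x. f n x - F x) < e / (2 * (C + 1))"
    using order_tendstoD(2)[OF lf] unfolding eventually_sequentially by blast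
  have "norm (Lp_norm m p (\<lambda>x. \<bar>s n x\<bar> * f n x - \<bar>h x\<bar> * F x) - 0) < e" if n: "max N N' \<le> n" for n
  proof -
    have n': "N \<le> n" "N' \<le> n" using n by auto
    have m1: "(\<lambda>x. \<bar>s n x\<bar>) \<in> borel_measurable m" "(\<lambda>x. \<bar>s n x\<bar> - \<bar>h x\<bar>) \<in> borel_measurable m"
      using s(1)[of n] s(2) by (auto simp: Linf_carrier)
    have b1: "AE x in m. \<bar>\<bar>s n x\<bar>\<bar> \<le> C + 1" using C(2) N[OF n'(1)] by eventually_elim (use d in auto)
    have b2: "AE x in m. \<bar>\<bar>s n x\<bar> - \<bar>h x\<bar>\<bar> \<le> d" using N[OF n'(1)] by eventually_elim auto
    have l: "(\<lambda>x. f n x - F x) \<in> Lp m p" by (rule Lp_diff[OF p0 f])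
    note A = Lp_mult_Linf[OF p0 m1(1) _ b1 l]
    note B = Lp_mult_Linf[OF p0 m1(2) less_imp_le[OF d(1)] b2 f(2)]
    have "Lp_norm m p (\<lambda>x. \<bar>s n x\<bar> * f n x - \<bar>h x\<bar> * F x) =
        Lp_norm m p (\<lambda>x. \<bar>s n x\<bar> * (f n x - F x) + (\<bar>s n x\<bar> - \<bar>h x\<bar>) * F x)"
      by (simp add: algebra_simps)
    also have "\<dots> \<le> (C + 1) * Lp_norm m p (\<lambda>x. f n x - F x) + d * Lp_norm m p F"
      using Lp_norm_triangle[OF p A(1) B(1)] A(2) B(2) C by linarith
    also have "\<dots> < e / 2 + e / 2"
    proof (rule add_less_le_mono)
      show "(C + 1) * Lp_norm m p (\<lambda>x. f n x - F x) < e / 2" using N'[OF n'(2)] C by (simp add: field_simps)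
      show "d * Lp_norm m p F \<le> e / 2" using mult_left_mono[OF less_imp_le[OF K(2)], of d] d by linarith
    qed
    finally show ?thesis by simp
  qed
  then show "\<exists>N. \<forall>n\<ge>N. norm (Lp_norm m p (\<lambda>x. \<bar>s n x\<bar> * f n x - \<bar>h x\<bar> * F x) - 0) < e" by blast
qed

lemma Linf_tendsto_const: "Linf_tendsto m (\<lambda>_. f) f"
  by (auto simp: Linf_tendsto_def)

lemma Linf_tendsto_add:
  assumes "Linf_tendsto m s f" "Linf_tendsto m t h"
  shows "Linf_tendsto m (\<lambda>n x. s n x + t n x) (\<lambda>x. f x + h x)"
  unfolding Linf_tendsto_def
proof (intro allI impI)
  fix e :: real assume "0 < e"
  then have e: "0 < e / 2" by simp
  obtain N where N: "\<And>n. N \<le> n \<Longrightarrow> AE x in m. \<bar>s n x - f x\<bar> \<le> e / 2" using assms(1) e unfolding Linf_tendsto_def by blast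
  obtain N' where N': "\<And>n. N' \<le> n \<Longrightarrow> AE x in m. \<bar>t n x - h x\<bar> \<le> e / 2" using assms(2) e unfolding Linf_tendsto_def by blast
  have "AE x in m. \<bar>s n x + t n x - (f x + h x)\<bar> \<le> e" if "max N N' \<le> n" for n
  proof -
    have "N \<le> n" "N' \<le> n" using that by auto
    from N[OF this(1)] N'[OF this(2)] show ?thesis by eventually_elim linarith
  qed
  then show "\<exists>N. \<forall>n\<ge>N. AE x in m. \<bar>s n x + t n x - (f x + h x)\<bar> \<le> e" by blast
qed

lemma Linf_tendsto_mult:
  assumes "f \<in> carrier (Linf m)" "h \<in> carrier (Linf m)" and s: "Linf_tendsto m s f" and t: "Linf_tendsto m t h"
  shows "Linf_tendsto m (\<lambda>n x. s n x * t n x) (\<lambda>x. f x * h x)"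
  unfolding Linf_tendsto_def
proof (intro allI impI)
  fix e :: real assume e: "0 < e"
  obtain C where C: "0 < C" "AE x in m. \<bar>f x\<bar> \<le> C" using assms(1) by (rule Linf_bound)
  obtain C' where C': "0 < C'" "AE x in m. \<bar>h x\<bar> \<le> C'" using assms(2) by (rule Linf_bound)
  \<comment> \<open>With |t n| \<le> C' + 1 thanks to the cap, the two error terms add up to at most
    d (C' + 1) + C d.\<close>
  define d where "d = min 1 (e / (C + C' + 1))"
  have "d \<le> e / (C + C' + 1)" by (simp add: d_def)
  moreover have "0 < C + C' + 1" using C C' by simp
  ultimately have "d * (C + C' + 1) \<le> e" by (simp add: pos_le_divide_eq)
  moreover have "0 < d" "d \<le> 1" using e C C' by (auto simp: d_def)
  ultimately have d: "0 < d" "d \<le> 1" "d * (C + C' + 1) \<le> e" by auto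
  obtain N where N: "\<And>n. N \<le> n \<Longrightarrow> AE x in m. \<bar>s n x - f x\<bar> \<le> d" using s d unfolding Linf_tendsto_def by blast
  obtain N' where N': "\<And>n. N' \<le> n \<Longrightarrow> AE x in m. \<bar>t n x - h x\<bar> \<le> d" using t d unfolding Linf_tendsto_def by blast
  have "AE x in m. \<bar>s n x * t n x - f x * h x\<bar> \<le> e" if n: "max N N' \<le> n" for n
  proof -
    have "N \<le> n" "N' \<le> n" using n by auto
    from N[OF this(1)] N'[OF this(2)] C(2) C'(2) show ?thesis
    proof eventually_elim
      case (elim x)
      have "\<bar>s n x * t n x - f x * h x\<bar> = \<bar>(s n x - f x) * t n x + f x * (t n x - h x)\<bar>" by (simp add: algebra_simps)
      also have "\<dots> \<le> \<bar>s n x - f x\<bar> * \<bar>t n x\<bar> + \<bar>f x\<bar> * \<bar>t n x - h x\<bar>" by (metis abs_mult abs_triangle_ineq)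
      also have "\<dots> \<le> d * (C' + 1) + C * d"
        using elim d C C' by (intro add_mono mult_mono) auto
      also have "\<dots> \<le> e" using d by (simp add: algebra_simps)
      finally show ?case .
    qed
  qed
  then show "\<exists>N. \<forall>n\<ge>N. AE x in m. \<bar>s n x * t n x - f x * h x\<bar> \<le> e" by blast
qed

text \<open>The normed space before completion. A countable family times a simple function is again
  a countable family, whereas multiplication by general bounded functions appears only in the
  completion.\<close>

locale simple_mod = pnormed_group N m p for N :: "('a, 'v, 'z) normed_mod_scheme" (structure) and m p +
  assumes space_UNIV: "space m = UNIV"
    and smult_closed: "simple_function m s \<Longrightarrow> v \<in> carrier N \<Longrightarrow> s \<odot> v \<in> carrier N"
    and smult_l_distr: "simple_function m s \<Longrightarrow> simple_function m t \<Longrightarrow> v \<in> carrier N \<Longrightarrow>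
      (\<lambda>x. s x + t x) \<odot> v = s \<odot> v \<oplus> t \<odot> v"
    and smult_r_distr: "simple_function m s \<Longrightarrow> u \<in> carrier N \<Longrightarrow> v \<in> carrier N \<Longrightarrow> s \<odot> (u \<oplus> v) = s \<odot> u \<oplus> s \<odot> v"
    and smult_assoc: "simple_function m s \<Longrightarrow> simple_function m t \<Longrightarrow> v \<in> carrier N \<Longrightarrow> (\<lambda>x. s x * t x) \<odot> v = s \<odot> (t \<odot> v)"
    and smult_one: "v \<in> carrier N \<Longrightarrow> (\<lambda>_. 1) \<odot> v = v"
    and pnorm_smult: "simple_function m s \<Longrightarrow> v \<in> carrier N \<Longrightarrow> AE x in m. pnorm N (s \<odot> v) x = \<bar>s x\<bar> * pnorm N v x"
begin

abbreviation "R \<equiv> Cauchy_rel N"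
abbreviation "C \<equiv> module_completion m p N"
abbreviation cls :: "(nat \<Rightarrow> 'v) \<Rightarrow> (nat \<Rightarrow> 'v) set" where "cls u \<equiv> R `` {u}"
definition \<iota> :: "'v \<Rightarrow> (nat \<Rightarrow> 'v) set" where "\<iota> v = cls (\<lambda>_. v)"
abbreviation MC :: "(nat \<Rightarrow> 'v) \<Rightarrow> bool" where "MC u \<equiv> Metric_space.MCauchy (carrier N) (ndist N) u"

lemma smult_minus_one: "v \<in> carrier N \<Longrightarrow> (\<lambda>_. -1) \<odot> v = \<ominus> v"
proof -
  assume v: "v \<in> carrier N"
  have 1: "(\<lambda>_. 0) \<odot> v = \<zero>"
    using smult_l_distr[of "\<lambda>_. 0" "\<lambda>_. 0" v] v add.l_cancel_one'[of "(\<lambda>_. 0) \<odot> v" "(\<lambda>_. 0) \<odot> v"] smult_closed[of "\<lambda>_. 0" v] by simp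
  have "(\<lambda>_. -1) \<odot> v \<oplus> v = \<zero>" using smult_l_distr[of "\<lambda>_. -1" "\<lambda>_. 1" v] v 1 by (simp add: smult_one)
  then show ?thesis using v smult_closed[of "\<lambda>_. -1" v] by (intro minus_equality[symmetric]) auto
qed

lemma smult_diff: "simple_function m s \<Longrightarrow> u \<in> carrier N \<Longrightarrow> v \<in> carrier N \<Longrightarrow> s \<odot> (u \<ominus> v) = s \<odot> u \<ominus> s \<odot> v"
proof -
  assume s: "simple_function m s" and u: "u \<in> carrier N" and v: "v \<in> carrier N"
  have "s \<odot> (\<ominus> v) = (\<lambda>x. s x * -1) \<odot> v" using smult_assoc[OF s simple_function_const v, of "-1"] v by (simp add: smult_minus_one)
  also have "\<dots> = (\<lambda>x. -1 * s x) \<odot> v" by simp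
  also have "\<dots> = \<ominus> (s \<odot> v)" unfolding smult_assoc[OF simple_function_const s v] using smult_closed[OF s v] by (rule smult_minus_one)
  finally show ?thesis using s u v by (simp add: minus_eq smult_r_distr)
qed

lemma smult_l_diff: "simple_function m s \<Longrightarrow> simple_function m t \<Longrightarrow> v \<in> carrier N \<Longrightarrow> s \<odot> v \<ominus> t \<odot> v = (\<lambda>x. s x - t x) \<odot> v"
proof -
  assume s: "simple_function m s" and t: "simple_function m t" and v: "v \<in> carrier N"
  have d: "simple_function m (\<lambda>x. s x - t x)" using s t by (rule simple_function_diff)
  have "s \<odot> v = (\<lambda>x. s x - t x) \<odot> v \<oplus> t \<odot> v" using smult_l_distr[OF d t v] by simp
  then show ?thesis using smult_closed[OF d v] smult_closed[OF t v] by (simp add: minus_eq a_assoc r_neg)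
qed

lemma vnorm_smult_le:
  assumes s: "simple_function m s" and K: "0 \<le> K" "AE x in m. \<bar>s x\<bar> \<le> K" and v: "v \<in> carrier N"
  shows "vnorm N (s \<odot> v) \<le> K * vnorm N v"
proof -
  have "vnorm N (s \<odot> v) \<le> Lp_norm m p (\<lambda>x. K * pnorm N v x)"
  proof (rule vnorm_le[OF smult_closed[OF s v] Lp_scale[OF pnorm_Lp[OF v]]])
    show "AE x in m. pnorm N (s \<odot> v) x \<le> K * pnorm N v x"
      using pnorm_smult[OF s v] K(2) pnorm_nonneg[OF v]
      by eventually_elim (auto intro: mult_right_mono)
  qed
  then show ?thesis using K p_pos v by (simp add: Lp_norm_scale vnorm_eq)
qed

lemma vnorm_smult_diff_le:
  assumes s: "simple_function m s" "simple_function m r" and x: "x \<in> carrier N" "x' \<in> carrier N"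
    and K: "0 \<le> K" "AE t in m. \<bar>s t\<bar> \<le> K" and d: "0 \<le> d" "AE t in m. \<bar>s t - r t\<bar> \<le> d"
  shows "vnorm N (s \<odot> x \<ominus> r \<odot> x') \<le> K * vnorm N (x \<ominus> x') + d * vnorm N x'"
proof -
  have c: "s \<odot> x \<in> carrier N" "s \<odot> x' \<in> carrier N" "r \<odot> x' \<in> carrier N" using s x by (auto intro: smult_closed)
  have "vnorm N (s \<odot> x \<ominus> r \<odot> x') \<le> vnorm N (s \<odot> x \<ominus> s \<odot> x') + vnorm N (s \<odot> x' \<ominus> r \<odot> x')"
    by (rule vnorm_diff_triangle[OF c(1,2,3)])
  moreover have "vnorm N (s \<odot> x \<ominus> s \<odot> x') \<le> K * vnorm N (x \<ominus> x')"
    using vnorm_smult_le[OF s(1) K, of "x \<ominus> x'"] s x by (simp add: smult_diff)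
  moreover have "vnorm N (s \<odot> x' \<ominus> r \<odot> x') \<le> d * vnorm N x'"
    using vnorm_smult_le[OF simple_function_diff[OF s] d x(2)] s x by (simp add: smult_l_diff)
  ultimately show ?thesis by linarith
qed

section \<open>Classes of Cauchy sequences\<close>

lemma MC_D: "MC u \<Longrightarrow> u n \<in> carrier N" "MC u \<Longrightarrow> 0 < e \<Longrightarrow> \<exists>N'. \<forall>n\<ge>N'. \<forall>k\<ge>N'. vnorm N (u n \<ominus> u k) < e"
  by (auto simp: MCauchy_iff)

lemma rel_iff: "(u, v) \<in> R \<longleftrightarrow> MC u \<and> MC v \<and> (\<lambda>n. vnorm N (u n \<ominus> v n)) \<longlonglongrightarrow> 0"
proof -
  have "ndist N (u n) (v n) = vnorm N (u n \<ominus> v n)" if "MC u" "MC v" for n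
    using that by (auto simp: ndist_def MCauchy_iff)
  then show ?thesis unfolding Cauchy_rel_def by auto
qed

lemma rel_equiv: "equiv {u. MC u} R"
proof (rule equivI)
  show "R \<subseteq> {u. MC u} \<times> {u. MC u}" by (auto simp: rel_iff)
  show "refl_on {u. MC u} R" by (auto simp: refl_on_def rel_iff diff_self MC_D(1))
  show "sym R"
  proof (rule symI)
    fix u v assume "(u, v) \<in> R"
    then show "(v, u) \<in> R" using vnorm_diff_commute[of "u _" "v _"] by (auto simp: rel_iff MC_D(1))
  qed
  show "trans R"
  proof (rule transI)
    fix u v w assume uv: "(u, v) \<in> R" and vw: "(v, w) \<in> R"
    then have c: "u n \<in> carrier N" "v n \<in> carrier N" "w n \<in> carrier N" for n by (auto simp: rel_iff MC_D(1))
    have "(\<lambda>n. vnorm N (u n \<ominus> v n) + vnorm N (v n \<ominus> w n)) \<longlonglongrightarrow> 0"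
      using tendsto_add[of "\<lambda>n. vnorm N (u n \<ominus> v n)" 0 sequentially "\<lambda>n. vnorm N (v n \<ominus> w n)" 0] uv vw by (simp add: rel_iff)
    then have "(\<lambda>n. vnorm N (u n \<ominus> w n)) \<longlonglongrightarrow> 0"
      by (rule tendsto_sandwich[OF _ _ tendsto_const, rotated 2]) (use c in \<open>auto intro!: always_eventually vnorm_nonneg vnorm_diff_triangle\<close>)
    then show "(u, w) \<in> R" using uv vw by (simp add: rel_iff)
  qed
qed

lemma cls_eq_iff: "MC u \<Longrightarrow> MC v \<Longrightarrow> cls u = cls v \<longleftrightarrow> (\<lambda>n. vnorm N (u n \<ominus> v n)) \<longlonglongrightarrow> 0"
  using eq_equiv_class_iff[OF rel_equiv, of u v] by (simp add: rel_iff)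

lemma C_carrier: "carrier C = {u. MC u} // R" and C_zero: "\<zero>\<^bsub>C\<^esub> = \<iota> \<zero>"
  by (simp_all add: module_completion_def Let_def \<iota>_def)

lemma C_carrierE: assumes "U \<in> carrier C" obtains u where "MC u" "U = cls u"
  using assms unfolding C_carrier by (auto elim: quotientE)

lemma C_carrierI: "MC u \<Longrightarrow> cls u \<in> carrier C"
  unfolding C_carrier by (intro quotientI) simp

lemma MC_const: "v \<in> carrier N \<Longrightarrow> MC (\<lambda>_. v)"
  by (simp add: MCauchy_iff diff_self)

lemma MC_add: assumes u: "MC u" and v: "MC v" shows "MC (\<lambda>n. u n \<oplus> v n)"
  unfolding MCauchy_iff
proof (intro conjI allI impI)
  show "u n \<oplus> v n \<in> carrier N" for n using MC_D(1)[OF u] MC_D(1)[OF v] by simp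
  fix e :: real assume "0 < e"
  then have e: "0 < e / 2" by simp
  obtain K where K: "\<And>n k. K \<le> n \<Longrightarrow> K \<le> k \<Longrightarrow> vnorm N (u n \<ominus> u k) < e / 2" using MC_D(2)[OF u e] by blast
  obtain K' where K': "\<And>n k. K' \<le> n \<Longrightarrow> K' \<le> k \<Longrightarrow> vnorm N (v n \<ominus> v k) < e / 2" using MC_D(2)[OF v e] by blast
  have "vnorm N ((u n \<oplus> v n) \<ominus> (u k \<oplus> v k)) < e" if "max K K' \<le> n" "max K K' \<le> k" for n k
    using vnorm_triangle[of "u n \<ominus> u k" "v n \<ominus> v k"] K[of n k] K'[of n k] that MC_D(1)[OF u] MC_D(1)[OF v]
    by (simp add: add_diff_add)
  then show "\<exists>K. \<forall>n\<ge>K. \<forall>k\<ge>K. vnorm N ((u n \<oplus> v n) \<ominus> (u k \<oplus> v k)) < e" by blast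
qed

lemma C_add: assumes u: "MC u" and v: "MC v" shows "cls u \<oplus>\<^bsub>C\<^esub> cls v = cls (\<lambda>n. u n \<oplus> v n)"
proof -
  have "cls (\<lambda>n. u' n \<oplus> v' n) = cls (\<lambda>n. u n \<oplus> v n)" if "u' \<in> cls u" "v' \<in> cls v" for u' v'
  proof -
    have r: "MC u'" "MC v'" "(\<lambda>n. vnorm N (u n \<ominus> u' n)) \<longlonglongrightarrow> 0" "(\<lambda>n. vnorm N (v n \<ominus> v' n)) \<longlonglongrightarrow> 0"
      using that by (auto simp: rel_iff)
    note c = MC_D(1)[OF u] MC_D(1)[OF v] MC_D(1)[OF r(1)] MC_D(1)[OF r(2)]
    have "(\<lambda>n. vnorm N (u n \<ominus> u' n) + vnorm N (v n \<ominus> v' n)) \<longlonglongrightarrow> 0" using tendsto_add[OF r(3,4)] by simp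
    then have "(\<lambda>n. vnorm N ((u n \<oplus> v n) \<ominus> (u' n \<oplus> v' n))) \<longlonglongrightarrow> 0"
      by (rule tendsto_sandwich[OF _ _ tendsto_const, rotated 2])
        (use c in \<open>auto intro!: always_eventually vnorm_nonneg simp: add_diff_add vnorm_triangle\<close>)
    then have "cls (\<lambda>n. u n \<oplus> v n) = cls (\<lambda>n. u' n \<oplus> v' n)" using MC_add[OF u v] MC_add[OF r(1,2)] by (simp add: cls_eq_iff)
    then show ?thesis by (rule sym)
  qed
  moreover have "u \<in> cls u" "v \<in> cls v" using equiv_class_self[OF rel_equiv] u v by auto
  ultimately have "(\<Union>u'\<in>cls u. \<Union>v'\<in>cls v. cls (\<lambda>n. u' n \<oplus> v' n)) = cls (\<lambda>n. u n \<oplus> v n)" by blast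
  then show ?thesis by (simp add: module_completion_def Let_def)
qed

lemma MC_bounded: assumes "MC u" obtains K where "0 < K" "\<And>n. vnorm N (u n) \<le> K"
proof -
  obtain K where K: "\<And>n k. K \<le> n \<Longrightarrow> K \<le> k \<Longrightarrow> vnorm N (u n \<ominus> u k) < 1" using MC_D(2)[OF assms, of 1] by auto
  note c = MC_D(1)[OF assms]
  define B where "B = 1 + vnorm N (u K) + (\<Sum>k<K. vnorm N (u k))"
  have s: "0 \<le> (\<Sum>k<K. vnorm N (u k))" using c by (intro sum_nonneg vnorm_nonneg)
  have "vnorm N (u n) \<le> B" for n
  proof (cases "n < K")
    case True
    then have "vnorm N (u n) \<le> (\<Sum>k<K. vnorm N (u k))" using c by (intro member_le_sum) (auto intro: vnorm_nonneg)
    then show ?thesis using vnorm_nonneg[OF c, of K] by (simp add: B_def)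
  next
    case False
    then show ?thesis using K[of n K] abs_vnorm_diff_le[OF c c, of n K] s unfolding B_def by auto
  qed
  moreover have "0 < B" using s vnorm_nonneg[OF c, of K] by (simp add: B_def)
  ultimately show ?thesis by (rule that[rotated])
qed

text \<open>Applied to one approximating sequence it gives the Cauchy property, applied to two it
  compares different approximations of the same function.\<close>

lemma Linf_tendsto_Cauchy:
  assumes "Linf_tendsto m s f" "Linf_tendsto m t f" "0 < d"
  obtains K where "\<And>n k. K \<le> n \<Longrightarrow> K \<le> k \<Longrightarrow> AE x in m. \<bar>s n x - t k x\<bar> \<le> d"
proof -
  have d: "0 < d / 2" using assms by simp
  obtain K where K: "\<And>n. K \<le> n \<Longrightarrow> AE x in m. \<bar>s n x - f x\<bar> \<le> d / 2" using assms(1) d unfolding Linf_tendsto_def by blast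
  obtain K' where K': "\<And>n. K' \<le> n \<Longrightarrow> AE x in m. \<bar>t n x - f x\<bar> \<le> d / 2" using assms(2) d unfolding Linf_tendsto_def by blast
  have "AE x in m. \<bar>s n x - t k x\<bar> \<le> d" if "max K K' \<le> n" "max K K' \<le> k" for n k
  proof -
    have "K \<le> n" "K' \<le> k" using that by auto
    from K[OF this(1)] K'[OF this(2)] show ?thesis by eventually_elim linarith
  qed
  then show ?thesis by (rule that)
qed

text \<open>The first estimate makes the product independent of the representative and of the
  approximating simple functions, so that the union defining multiplication in the completion is a
  single class; the second makes the product sequence Cauchy.\<close>

lemma smult_Cauchy:
  assumes f: "f \<in> carrier (Linf m)" and s: "\<And>n. simple_function m (s n)" "Linf_tendsto m s f"
    and t: "\<And>n. simple_function m (t n)" "Linf_tendsto m t f" and uv: "(u, v) \<in> R" and e: "0 < e"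
  shows "\<exists>K. \<forall>n\<ge>K. vnorm N (s n \<odot> u n \<ominus> t n \<odot> v n) < e"
    "\<exists>K. \<forall>n\<ge>K. \<forall>k\<ge>K. vnorm N (s n \<odot> u n \<ominus> s k \<odot> u k) < e"
proof -
  have u: "MC u" and v: "MC v" and l: "(\<lambda>n. vnorm N (u n \<ominus> v n)) \<longlonglongrightarrow> 0" using uv by (auto simp: rel_iff)
  note c = MC_D(1)[OF u] MC_D(1)[OF v]
  obtain A where A: "0 < A" "\<And>n. vnorm N (u n) \<le> A" by (rule MC_bounded[OF u]) blast
  obtain A' where A': "0 < A'" "\<And>n. vnorm N (v n) \<le> A'" by (rule MC_bounded[OF v]) blast
  obtain B where B: "0 < B" "AE x in m. \<bar>f x\<bar> \<le> B" using f by (rule Linf_bound)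
  \<comment> \<open>From \<open>K0\<close> on the approximants share the bound B + 1, which limits
    how much differences of vectors are amplified.\<close>
  obtain K0 where K0: "\<And>n. K0 \<le> n \<Longrightarrow> AE x in m. \<bar>s n x - f x\<bar> \<le> 1" using s(2) unfolding Linf_tendsto_def by (meson zero_less_one)
  have sb: "AE x in m. \<bar>s n x\<bar> \<le> B + 1" if "K0 \<le> n" for n
    using K0[OF that] B(2) by eventually_elim linarith
  have pos: "0 < e / (2 * (B + 1))" "0 < e / (2 * A)" "0 < e / (2 * A')" using e A A' B by auto
  obtain K1 where K1: "\<And>n k. K1 \<le> n \<Longrightarrow> K1 \<le> k \<Longrightarrow> AE x in m. \<bar>s n x - t k x\<bar> \<le> e / (2 * A')"
    by (rule Linf_tendsto_Cauchy[OF s(2) t(2) pos(3)]) blast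
  obtain K2 where K2: "\<And>n k. K2 \<le> n \<Longrightarrow> K2 \<le> k \<Longrightarrow> AE x in m. \<bar>s n x - s k x\<bar> \<le> e / (2 * A)"
    by (rule Linf_tendsto_Cauchy[OF s(2) s(2) pos(2)]) blast
  obtain K3 where K3: "\<And>n. K3 \<le> n \<Longrightarrow> vnorm N (u n \<ominus> v n) < e / (2 * (B + 1))"
    using order_tendstoD(2)[OF l pos(1)] unfolding eventually_sequentially by blast
  obtain K4 where K4: "\<And>n k. K4 \<le> n \<Longrightarrow> K4 \<le> k \<Longrightarrow> vnorm N (u n \<ominus> u k) < e / (2 * (B + 1))"
    using MC_D(2)[OF u pos(1)] by blast
  have "vnorm N (s n \<odot> u n \<ominus> t n \<odot> v n) < e" if n: "K0 + K1 + K3 \<le> n" for n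
  proof -
    have n': "K0 \<le> n" "K1 \<le> n" "K3 \<le> n" using n by auto
    have "vnorm N (s n \<odot> u n \<ominus> t n \<odot> v n) \<le> (B + 1) * vnorm N (u n \<ominus> v n) + e / (2 * A') * vnorm N (v n)"
      using B pos by (intro vnorm_smult_diff_le s t c sb K1 n') auto
    moreover have "(B + 1) * vnorm N (u n \<ominus> v n) < e / 2" using K3[OF n'(3)] B by (simp add: field_simps)
    moreover have "e / (2 * A') * vnorm N (v n) \<le> e / 2" using mult_left_mono[OF A'(2), of "e / (2 * A')" n] pos(3) A' by simp
    ultimately show ?thesis by linarith
  qed
  then show "\<exists>K. \<forall>n\<ge>K. vnorm N (s n \<odot> u n \<ominus> t n \<odot> v n) < e" by blast
  have "vnorm N (s n \<odot> u n \<ominus> s k \<odot> u k) < e" if n: "K0 + K2 + K4 \<le> n" "K0 + K2 + K4 \<le> k" for n k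
  proof -
    have n': "K0 \<le> n" "K2 \<le> n" "K4 \<le> n" "K2 \<le> k" "K4 \<le> k" using n by auto
    have "vnorm N (s n \<odot> u n \<ominus> s k \<odot> u k) \<le> (B + 1) * vnorm N (u n \<ominus> u k) + e / (2 * A) * vnorm N (u k)"
      using B pos by (intro vnorm_smult_diff_le s t c sb K2 n') auto
    moreover have "(B + 1) * vnorm N (u n \<ominus> u k) < e / 2" using K4[OF n'(3,5)] B by (simp add: field_simps)
    moreover have "e / (2 * A) * vnorm N (u k) \<le> e / 2" using mult_left_mono[OF A(2), of "e / (2 * A)" k] pos(2) A by simp
    ultimately show ?thesis by linarith
  qed
  then show "\<exists>K. \<forall>n\<ge>K. \<forall>k\<ge>K. vnorm N (s n \<odot> u n \<ominus> s k \<odot> u k) < e" by blast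
qed

lemma MC_smult:
  assumes f: "f \<in> carrier (Linf m)" and s: "\<And>n. simple_function m (s n)" "Linf_tendsto m s f" and u: "MC u"
  shows "MC (\<lambda>n. s n \<odot> u n)"
proof -
  have "(u, u) \<in> R" using u by (simp add: rel_iff diff_self MC_D(1))
  then show ?thesis
    unfolding MCauchy_iff using smult_Cauchy(2)[OF f s s] smult_closed[OF s(1) MC_D(1)[OF u]] by blast
qed

lemma C_smult:
  assumes f: "f \<in> carrier (Linf m)" and s: "\<And>n. simple_function m (s n)" "Linf_tendsto m s f" and u: "MC u"
  shows "f \<odot>\<^bsub>C\<^esub> cls u = cls (\<lambda>n. s n \<odot> u n)"
proof -
  let ?S = "{s. (\<forall>n. simple_function m (s n)) \<and> Linf_tendsto m s f}"
  have "cls (\<lambda>n. t n \<odot> v n) = cls (\<lambda>n. s n \<odot> u n)" if v: "v \<in> cls u" and t: "t \<in> ?S" for t v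
  proof -
    have uv: "(u, v) \<in> R" "MC v" using v by (auto simp: rel_iff)
    have t': "\<And>n. simple_function m (t n)" "Linf_tendsto m t f" using t by auto
    have "(\<lambda>n. vnorm N (s n \<odot> u n \<ominus> t n \<odot> v n)) \<longlonglongrightarrow> 0"
    proof (rule LIMSEQ_I)
      fix e :: real assume "0 < e"
      from smult_Cauchy(1)[OF f s t' uv(1) this]
      show "\<exists>K. \<forall>n\<ge>K. norm (vnorm N (s n \<odot> u n \<ominus> t n \<odot> v n) - 0) < e"
        using vnorm_nonneg[OF minus_closed[OF smult_closed[OF s(1) MC_D(1)[OF u]] smult_closed[OF t'(1) MC_D(1)[OF uv(2)]]]] by simp
    qed
    then have "cls (\<lambda>n. s n \<odot> u n) = cls (\<lambda>n. t n \<odot> v n)"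
      using MC_smult[OF f s u] MC_smult[OF f t' uv(2)] by (simp add: cls_eq_iff)
    then show ?thesis by (rule sym)
  qed
  moreover have "u \<in> cls u" "s \<in> ?S" using equiv_class_self[OF rel_equiv] u s by auto
  ultimately have "(\<Union>v\<in>cls u. \<Union>t\<in>?S. cls (\<lambda>n. t n \<odot> v n)) = cls (\<lambda>n. s n \<odot> u n)" by blast
  then show ?thesis by (simp add: module_completion_def Let_def)
qed

section \<open>Norm and pointwise norm of the completion\<close>

lemma C_vnorm: assumes u: "MC u" shows "(\<lambda>n. vnorm N (u n)) \<longlonglongrightarrow> vnorm C (cls u)"
proof -
  define v where "v = (SOME v. v \<in> cls u)"
  have "v \<in> cls u" unfolding v_def by (rule someI[of _ u]) (use equiv_class_self[OF rel_equiv] u in auto)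
  then have uv: "MC v" "(\<lambda>n. vnorm N (u n \<ominus> v n)) \<longlonglongrightarrow> 0" by (auto simp: rel_iff)
  have "Cauchy (\<lambda>n. vnorm N (v n))"
  proof (rule CauchyI)
    fix e :: real assume "0 < e"
    from MC_D(2)[OF uv(1) this] show "\<exists>K. \<forall>n\<ge>K. \<forall>k\<ge>K. norm (vnorm N (v n) - vnorm N (v k)) < e"
      using abs_vnorm_diff_le[OF MC_D(1)[OF uv(1)] MC_D(1)[OF uv(1)]] by (metis le_less_trans real_norm_def)
  qed
  then have "(\<lambda>n. vnorm N (v n)) \<longlonglongrightarrow> lim (\<lambda>n. vnorm N (v n))" by (simp add: Cauchy_convergent_iff convergent_LIMSEQ_iff)
  moreover have "vnorm C (cls u) = lim (\<lambda>n. vnorm N (v n))" by (simp add: module_completion_def Let_def v_def)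
  ultimately have l: "(\<lambda>n. vnorm N (v n)) \<longlonglongrightarrow> vnorm C (cls u)" by simp
  have "(\<lambda>n. \<bar>vnorm N (u n) - vnorm N (v n)\<bar>) \<longlonglongrightarrow> 0"
    by (rule tendsto_sandwich[OF _ _ tendsto_const uv(2)])
      (auto intro!: always_eventually abs_vnorm_diff_le MC_D(1)[OF u] MC_D(1)[OF uv(1)])
  then have "(\<lambda>n. vnorm N (u n) - vnorm N (v n)) \<longlonglongrightarrow> 0" by (rule tendsto_rabs_zero_cancel)
  from tendsto_add[OF this l] show ?thesis by simp
qed

text \<open>The pointwise norm is 1-Lipschitz into L^p, so along a Cauchy sequence it converges by
  completeness of L^p. This makes the choice in the definition meaningful, and the same estimate
  carries the limit over to every representative.\<close>

lemma C_pnorm: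
  assumes u: "MC u"
  shows "pnorm C (cls u) \<in> Lp_plus m p" "(\<lambda>n. Lp_norm m p (\<lambda>x. pnorm N (u n) x - pnorm C (cls u) x)) \<longlonglongrightarrow> 0"
proof -
  let ?P = "\<lambda>G. G \<in> Lp_plus m p \<and> (\<exists>v\<in>cls u. (\<lambda>n. Lp_norm m p (\<lambda>x. pnorm N (v n) x - G x)) \<longlonglongrightarrow> 0)"
  note c = MC_D(1)[OF u]
  have Cau: "\<exists>K. \<forall>n\<ge>K. \<forall>k\<ge>K. Lp_norm m p (\<lambda>x. pnorm N (u n) x - pnorm N (u k) x) < e" if "0 < e" for e
  proof -
    obtain K where K: "\<And>n k. K \<le> n \<Longrightarrow> K \<le> k \<Longrightarrow> vnorm N (u n \<ominus> u k) < e" using MC_D(2)[OF u \<open>0 < e\<close>] by blast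
    have "Lp_norm m p (\<lambda>x. pnorm N (u n) x - pnorm N (u k) x) < e" if "K \<le> n" "K \<le> k" for n k
      by (rule le_less_trans[OF Lp_norm_pnorm_diff_le[OF c c] K[OF that]])
    then show ?thesis by blast
  qed
  obtain G where G: "G \<in> Lp m p" "(\<lambda>n. Lp_norm m p (\<lambda>x. pnorm N (u n) x - G x)) \<longlonglongrightarrow> 0"
    by (rule Lp_complete[of p "\<lambda>n. pnorm N (u n)" m, OF p_ge_1 pnorm_Lp[OF c]]) (erule Cau, rule that)
  have "AE x in m. (\<lambda>x. 0) x \<le> G x"
    by (rule Lp_le_limit[OF p_ge_1 _ _ pnorm_Lp[OF c] G(1) _ _ G(2), where f="\<lambda>_ _. 0"]) (use pnorm_nonneg[OF c] in auto)
  then have "?P G" using G equiv_class_self[OF rel_equiv, of u] u by (auto simp: Lp_plus_def)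
  moreover have "pnorm C (cls u) = (SOME G. ?P G)" by (simp add: module_completion_def Let_def)
  ultimately have P: "?P (pnorm C (cls u))" by (simp only:) (rule someI[of ?P])
  then show L: "pnorm C (cls u) \<in> Lp_plus m p" by simp
  obtain v where v: "v \<in> cls u" "(\<lambda>n. Lp_norm m p (\<lambda>x. pnorm N (v n) x - pnorm C (cls u) x)) \<longlonglongrightarrow> 0" using P by blast
  then have uv: "MC v" "(\<lambda>n. vnorm N (u n \<ominus> v n)) \<longlonglongrightarrow> 0" by (auto simp: rel_iff)
  note c' = MC_D(1)[OF uv(1)]
  have le: "Lp_norm m p (\<lambda>x. pnorm N (u n) x - pnorm C (cls u) x) \<le> vnorm N (u n \<ominus> v n) + Lp_norm m p (\<lambda>x. pnorm N (v n) x - pnorm C (cls u) x)" for n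
    using Lp_norm_triangle[OF p_ge_1 Lp_diff[OF p_pos pnorm_Lp[OF c] pnorm_Lp[OF c']] Lp_diff[OF p_pos pnorm_Lp[OF c'] Lp_plusD(1)[OF L]], of n n n]
      Lp_norm_pnorm_diff_le[OF c c', of n n] by simp
  have "(\<lambda>n. vnorm N (u n \<ominus> v n) + Lp_norm m p (\<lambda>x. pnorm N (v n) x - pnorm C (cls u) x)) \<longlonglongrightarrow> 0"
    using tendsto_add[OF uv(2) v(2)] by simp
  then show "(\<lambda>n. Lp_norm m p (\<lambda>x. pnorm N (u n) x - pnorm C (cls u) x)) \<longlonglongrightarrow> 0"
    by (rule tendsto_sandwich[OF _ _ tendsto_const, rotated 2]) (use le in auto)
qed

lemma C_pnorm_\<iota>: assumes v: "v \<in> carrier N" shows "AE x in m. pnorm C (\<iota> v) x = pnorm N v x"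
  using Lp_limit_unique[OF p_ge_1 pnorm_Lp[OF v] Lp_plusD(1)[OF C_pnorm(1)[OF MC_const[OF v]]] pnorm_Lp[OF v] C_pnorm(2)[OF MC_const[OF v]]]
  by (simp add: \<iota>_def)

lemma \<iota>_closed: "v \<in> carrier N \<Longrightarrow> \<iota> v \<in> carrier C"
  unfolding \<iota>_def by (intro C_carrierI MC_const)

lemma \<iota>_add: "u \<in> carrier N \<Longrightarrow> v \<in> carrier N \<Longrightarrow> \<iota> (u \<oplus> v) = \<iota> u \<oplus>\<^bsub>C\<^esub> \<iota> v"
  unfolding \<iota>_def by (simp add: C_add MC_const)

lemma \<iota>_smult: "simple_function m s \<Longrightarrow> v \<in> carrier N \<Longrightarrow> \<iota> (s \<odot> v) = s \<odot>\<^bsub>C\<^esub> \<iota> v"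
  unfolding \<iota>_def by (simp add: C_smult[OF simple_function_Linf _ Linf_tendsto_const MC_const])

lemma C_abelian_group: "abelian_group C"
proof (rule abelian_groupI)
  fix U V W assume U: "U \<in> carrier C" and V: "V \<in> carrier C" and W: "W \<in> carrier C"
  obtain u where u: "MC u" "U = cls u" by (rule C_carrierE[OF U])
  obtain v where v: "MC v" "V = cls v" by (rule C_carrierE[OF V])
  obtain w where w: "MC w" "W = cls w" by (rule C_carrierE[OF W])
  show "U \<oplus>\<^bsub>C\<^esub> V \<in> carrier C" using u v by (simp add: C_add C_carrierI MC_add)
  show "U \<oplus>\<^bsub>C\<^esub> V \<oplus>\<^bsub>C\<^esub> W = U \<oplus>\<^bsub>C\<^esub> (V \<oplus>\<^bsub>C\<^esub> W)"
    using u v w MC_D(1)[OF u(1)] MC_D(1)[OF v(1)] MC_D(1)[OF w(1)] by (simp add: C_add MC_add a_assoc)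
  show "U \<oplus>\<^bsub>C\<^esub> V = V \<oplus>\<^bsub>C\<^esub> U"
    using u v MC_D(1)[OF u(1)] MC_D(1)[OF v(1)] by (simp add: C_add a_comm)
next
  show "\<zero>\<^bsub>C\<^esub> \<in> carrier C" unfolding C_zero by (intro \<iota>_closed) simp
  fix U assume U: "U \<in> carrier C"
  obtain u where u: "MC u" "U = cls u" by (rule C_carrierE[OF U])
  note c = MC_D(1)[OF u(1)]
  show "\<zero>\<^bsub>C\<^esub> \<oplus>\<^bsub>C\<^esub> U = U" unfolding C_zero \<iota>_def using u c by (simp add: C_add MC_const)
  have m: "MC (\<lambda>n. \<ominus> u n)" using MC_smult[OF Linf_const _ Linf_tendsto_const u(1), of "-1"] c by (simp add: smult_minus_one)
  show "\<exists>V\<in>carrier C. V \<oplus>\<^bsub>C\<^esub> U = \<zero>\<^bsub>C\<^esub>"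
    unfolding C_zero \<iota>_def using u c m by (intro bexI[OF _ C_carrierI[OF m]]) (simp add: C_add l_neg)
qed

lemma C_minus: assumes u: "MC u" shows "MC (\<lambda>n. \<ominus> u n)" "\<ominus>\<^bsub>C\<^esub> cls u = cls (\<lambda>n. \<ominus> u n)"
proof -
  note c = MC_D(1)[OF u]
  show m: "MC (\<lambda>n. \<ominus> u n)" using MC_smult[OF Linf_const _ Linf_tendsto_const u, of "-1"] c by (simp add: smult_minus_one)
  show "\<ominus>\<^bsub>C\<^esub> cls u = cls (\<lambda>n. \<ominus> u n)"
    by (rule abelian_group.minus_equality[OF C_abelian_group]) (use u m c in \<open>auto simp: C_add C_carrierI C_zero \<iota>_def l_neg\<close>)
qed

lemma C_diff: "MC u \<Longrightarrow> MC v \<Longrightarrow> cls u \<ominus>\<^bsub>C\<^esub> cls v = cls (\<lambda>n. u n \<ominus> v n)" "MC u \<Longrightarrow> MC v \<Longrightarrow> MC (\<lambda>n. u n \<ominus> v n)"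
  using C_add[of u "\<lambda>n. \<ominus> v n"] C_minus[of v] MC_add[of u "\<lambda>n. \<ominus> v n"] by (auto simp: a_minus_def)

lemma C_pnormed_group: "pnormed_group C m p"
proof -
  interpret C: abelian_group C by (rule C_abelian_group)
  note L = Lp_plusD(1)[OF C_pnorm(1)]
  show ?thesis
  proof
    show "1 < p" by (rule p1)
    show "pnorm C U \<in> Lp_plus m p" if "U \<in> carrier C" for U
      by (rule C_carrierE[OF that]) (simp add: C_pnorm(1))
    show "vnorm C U = Lp_norm m p (pnorm C U)" if U: "U \<in> carrier C" for U
    proof -
      obtain u where u: "MC u" "U = cls u" by (rule C_carrierE[OF U])
      have "(\<lambda>n. \<bar>vnorm N (u n) - Lp_norm m p (pnorm C U)\<bar>) \<longlonglongrightarrow> 0"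
        by (rule tendsto_sandwich[OF _ _ tendsto_const C_pnorm(2)[OF u(1)]])
          (use Lp_norm_triangle_diff[OF p_ge_1 pnorm_Lp L[OF u(1)]] MC_D(1)[OF u(1)] u in \<open>auto simp: vnorm_eq intro!: always_eventually\<close>)
      then have "(\<lambda>n. vnorm N (u n) - Lp_norm m p (pnorm C U)) \<longlonglongrightarrow> 0" by (rule tendsto_rabs_zero_cancel)
      then have "(\<lambda>n. vnorm N (u n)) \<longlonglongrightarrow> Lp_norm m p (pnorm C U)" by (rule LIM_zero_cancel)
      then show ?thesis using C_vnorm[OF u(1)] u(2) LIMSEQ_unique by blast
    qed
    show "AE x in m. pnorm C (U \<oplus>\<^bsub>C\<^esub> V) x \<le> pnorm C U x + pnorm C V x" if U: "U \<in> carrier C" and V: "V \<in> carrier C" for U V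
    proof -
      obtain u where u: "MC u" "U = cls u" by (rule C_carrierE[OF U])
      obtain v where v: "MC v" "V = cls v" by (rule C_carrierE[OF V])
      note c = MC_D(1)[OF u(1)] MC_D(1)[OF v(1)]
      have "AE x in m. pnorm C (cls (\<lambda>n. u n \<oplus> v n)) x \<le> pnorm C U x + pnorm C V x"
      proof (rule Lp_le_limit[OF p_ge_1 _ L[OF MC_add[OF u(1) v(1)]] _ _ _ C_pnorm(2)[OF MC_add[OF u(1) v(1)]]])
        show "pnorm N (u n \<oplus> v n) \<in> Lp m p" for n using c by (simp add: pnorm_Lp)
        show "(\<lambda>x. pnorm N (u n) x + pnorm N (v n) x) \<in> Lp m p" for n using c by (intro Lp_add p_pos pnorm_Lp)
        show "(\<lambda>x. pnorm C U x + pnorm C V x) \<in> Lp m p" using L u v by (intro Lp_add p_pos) auto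
        show "AE x in m. pnorm N (u n \<oplus> v n) x \<le> pnorm N (u n) x + pnorm N (v n) x" for n using c by (intro pnorm_triangle)
        show "(\<lambda>n. Lp_norm m p (\<lambda>x. pnorm N (u n) x + pnorm N (v n) x - (pnorm C U x + pnorm C V x))) \<longlonglongrightarrow> 0"
          using C_pnorm(2)[OF u(1)] C_pnorm(2)[OF v(1)] L[OF u(1)] L[OF v(1)] c u v by (intro Lp_tendsto_add p_ge_1 pnorm_Lp) auto
      qed
      then show ?thesis using u v by (simp add: C_add)
    qed
    show "AE x in m. pnorm C (\<ominus>\<^bsub>C\<^esub> U) x = pnorm C U x" if U: "U \<in> carrier C" for U
    proof -
      obtain u where u: "MC u" "U = cls u" by (rule C_carrierE[OF U])
      note c = MC_D(1)[OF u(1)] and mn = C_minus[OF u(1)]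
      have AE: "AE x in m. pnorm N (\<ominus> u n) x \<le> pnorm N (u n) x" "AE x in m. pnorm N (u n) x \<le> pnorm N (\<ominus> u n) x" for n
        using pnorm_minus[OF c, of n] by (auto elim: eventually_mono)
      note a = pnorm_Lp[OF c] and b = pnorm_Lp[OF a_inv_closed[OF c]]
      note 1 = Lp_le_limit[OF p_ge_1 b L[OF mn(1)] a L[OF u(1)] AE(1) C_pnorm(2)[OF mn(1)] C_pnorm(2)[OF u(1)]]
      note 2 = Lp_le_limit[OF p_ge_1 a L[OF u(1)] b L[OF mn(1)] AE(2) C_pnorm(2)[OF u(1)] C_pnorm(2)[OF mn(1)]]
      from 1 2 show ?thesis unfolding u(2) mn(2) by eventually_elim simp
    qed
    show "AE x in m. pnorm C \<zero>\<^bsub>C\<^esub> x = 0"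
      using C_pnorm_\<iota>[OF zero_closed] pnorm_zero unfolding C_zero by eventually_elim simp
    show "U = \<zero>\<^bsub>C\<^esub>" if U: "U \<in> carrier C" and 0: "vnorm C U = 0" for U
    proof -
      obtain u where u: "MC u" "U = cls u" by (rule C_carrierE[OF U])
      have "(\<lambda>n. vnorm N (u n \<ominus> \<zero>)) \<longlonglongrightarrow> 0" using C_vnorm[OF u(1)] 0 u MC_D(1)[OF u(1)] by (simp add: diff_zero)
      then show ?thesis unfolding u(2) C_zero \<iota>_def using u(1) by (simp add: cls_eq_iff MC_const)
    qed
  qed
qed

text \<open>The distance from a constant sequence to the class is the limit of distances inside the
  sequence, hence small once the Cauchy condition applies.\<close>

lemma \<iota>_approx:
  assumes u: "MC u" and e: "0 < e"
  shows "\<exists>K. \<forall>n\<ge>K. vnorm C (\<iota> (u n) \<ominus>\<^bsub>C\<^esub> cls u) < e"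
proof -
  have e2: "0 < e / 2" using e by simp
  note c = MC_D(1)[OF u]
  obtain K where K: "\<And>n k. K \<le> n \<Longrightarrow> K \<le> k \<Longrightarrow> vnorm N (u n \<ominus> u k) < e / 2" using MC_D(2)[OF u e2] by blast
  have "vnorm C (\<iota> (u n) \<ominus>\<^bsub>C\<^esub> cls u) < e" if n: "K \<le> n" for n
  proof -
    have "(\<lambda>k. vnorm N (u n \<ominus> u k)) \<longlonglongrightarrow> vnorm C (\<iota> (u n) \<ominus>\<^bsub>C\<^esub> cls u)"
      using C_vnorm[OF C_diff(2)[OF MC_const[OF c] u]] C_diff(1)[OF MC_const[OF c] u] by (simp add: \<iota>_def)
    then have "vnorm C (\<iota> (u n) \<ominus>\<^bsub>C\<^esub> cls u) \<le> e / 2"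
      by (rule LIMSEQ_le_const2) (use K[OF n] in \<open>auto intro: less_imp_le\<close>)
    then show ?thesis using e by simp
  qed
  then show ?thesis by blast
qed

lemma \<iota>_dense:
  assumes U: "U \<in> carrier C" and e: "0 < e"
  obtains v where "v \<in> carrier N" "vnorm C (\<iota> v \<ominus>\<^bsub>C\<^esub> U) < e"
proof -
  obtain u where u: "MC u" "U = cls u" by (rule C_carrierE[OF U])
  then show ?thesis using \<iota>_approx[OF u(1) e] MC_D(1)[OF u(1)] that by blast
qed

theorem completion_Lp_mod: "Lp_mod C m p"
proof -
  interpret C: pnormed_group C m p by (rule C_pnormed_group)
  note L = Lp_plusD(1)[OF C_pnorm(1)]
  show ?thesis
  proof
    show "space m = UNIV" by (rule space_UNIV)
    fix f assume f: "f \<in> carrier (Linf m)"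
    obtain s where s: "\<And>n. simple_function m (s n)" "Linf_tendsto m s f" by (rule Linf_simple_approx[OF f]) blast
    {
      fix U assume U: "U \<in> carrier C"
      obtain u where u: "MC u" "U = cls u" by (rule C_carrierE[OF U])
      note c = MC_D(1)[OF u(1)] and us = MC_smult[OF f s u(1)] and eq = C_smult[OF f s u(1)]
      show "f \<odot>\<^bsub>C\<^esub> U \<in> carrier C" unfolding u(2) eq by (rule C_carrierI[OF us])
      show "AE x in m. pnorm C (f \<odot>\<^bsub>C\<^esub> U) x = \<bar>f x\<bar> * pnorm C U x"
      proof -
        have cs: "s n \<odot> u n \<in> carrier N" for n by (rule smult_closed[OF s(1) c])
        have AE: "AE x in m. pnorm N (s n \<odot> u n) x \<le> \<bar>s n x\<bar> * pnorm N (u n) x" "AE x in m. \<bar>s n x\<bar> * pnorm N (u n) x \<le> pnorm N (s n \<odot> u n) x" for n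
          using pnorm_smult[OF s(1) c, of n n] by (auto elim: eventually_mono)
        have Lf: "(\<lambda>x. \<bar>h x\<bar> * G x) \<in> Lp m p" if "h \<in> carrier (Linf m)" "G \<in> Lp m p" for h G
        proof -
          note h = that(1)
          obtain K where K: "0 < K" "AE x in m. \<bar>h x\<bar> \<le> K" by (rule Linf_bound[OF h])
          show ?thesis by (rule Lp_mult_Linf(1)[OF p_pos _ less_imp_le[OF K(1)] _ that(2)]) (use that(1) K in \<open>auto simp: Linf_carrier\<close>)
        qed
        note lim = Lp_tendsto_mult[OF p_ge_1 pnorm_Lp[OF c] L[OF u(1)] C_pnorm(2)[OF u(1)] simple_function_Linf[OF s(1)] f s(2)]
        note a = pnorm_Lp[OF cs] and b = Lf[OF simple_function_Linf[OF s(1)] pnorm_Lp[OF c]] and d = Lf[OF f L[OF u(1)]]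
        have "AE x in m. pnorm C (cls (\<lambda>n. s n \<odot> u n)) x \<le> \<bar>f x\<bar> * pnorm C (cls u) x"
          by (rule Lp_le_limit[OF p_ge_1 a L[OF us] b d AE(1) C_pnorm(2)[OF us] lim])
        moreover have "AE x in m. \<bar>f x\<bar> * pnorm C (cls u) x \<le> pnorm C (cls (\<lambda>n. s n \<odot> u n)) x"
          by (rule Lp_le_limit[OF p_ge_1 b d a L[OF us] AE(2) lim C_pnorm(2)[OF us]])
        ultimately show ?thesis unfolding u(2) eq by eventually_elim simp
      qed
      show "f \<odot>\<^bsub>C\<^esub> (U \<oplus>\<^bsub>C\<^esub> V) = f \<odot>\<^bsub>C\<^esub> U \<oplus>\<^bsub>C\<^esub> f \<odot>\<^bsub>C\<^esub> V" if V: "V \<in> carrier C" for V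
      proof -
        obtain v where v: "MC v" "V = cls v" by (rule C_carrierE[OF V])
        show ?thesis using C_smult[OF f s MC_add[OF u(1) v(1)]] MC_smult[OF f s v(1)] us eq C_smult[OF f s v(1)] MC_D(1)[OF v(1)] c
          unfolding u(2) v(2) C_add[OF u(1) v(1)] by (simp add: C_add smult_r_distr[OF s(1)])
      qed
      fix h assume h: "h \<in> carrier (Linf m)"
      obtain t where t: "\<And>n. simple_function m (t n)" "Linf_tendsto m t h" by (rule Linf_simple_approx[OF h]) blast
      note ut = MC_smult[OF h t u(1)] and eqt = C_smult[OF h t u(1)]
      show "(\<lambda>x. f x + h x) \<odot>\<^bsub>C\<^esub> U = f \<odot>\<^bsub>C\<^esub> U \<oplus>\<^bsub>C\<^esub> h \<odot>\<^bsub>C\<^esub> U"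
        using C_smult[OF Linf_plus[OF f h] simple_function_add[OF s(1) t(1)] Linf_tendsto_add[OF s(2) t(2)] u(1)]
        unfolding u(2) eq eqt by (simp add: C_add us ut smult_l_distr[OF s(1) t(1) c])
      show "(\<lambda>x. f x * h x) \<odot>\<^bsub>C\<^esub> U = f \<odot>\<^bsub>C\<^esub> (h \<odot>\<^bsub>C\<^esub> U)"
        using C_smult[OF Linf_times[OF f h] simple_function_mult[OF s(1) t(1)] Linf_tendsto_mult[OF f h s(2) t(2)] u(1)] C_smult[OF f s ut]
        unfolding u(2) eqt by (simp add: smult_assoc[OF s(1) t(1) c])
    }
  next
    show "(\<lambda>_. 1) \<odot>\<^bsub>C\<^esub> U = U" if "U \<in> carrier C" for U
    proof -
      note h = that
      obtain u where u: "MC u" "U = cls u" by (rule C_carrierE[OF h])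
      show ?thesis using C_smult[OF Linf_const _ Linf_tendsto_const u(1), of 1] MC_D(1)[OF u(1)] unfolding u(2) by (simp add: smult_one)
    qed
    fix \<sigma> :: "nat \<Rightarrow> (nat \<Rightarrow> 'v) set" assume \<sigma>: "\<And>n. \<sigma> n \<in> carrier C"
      and Cau: "\<And>e. 0 < e \<Longrightarrow> \<exists>N. \<forall>n\<ge>N. \<forall>k\<ge>N. vnorm C (\<sigma> n \<ominus>\<^bsub>C\<^esub> \<sigma> k) < e"
    \<comment> \<open>Each class is replaced by a constant sequence within 1 / (n + 1); the elements
      so chosen form a Cauchy sequence, and its class is the limit.\<close>
    have "\<exists>v. v \<in> carrier N \<and> vnorm C (\<iota> v \<ominus>\<^bsub>C\<^esub> \<sigma> n) < inverse (real (Suc n))" for n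
      by (rule \<iota>_dense[OF \<sigma>[of n], of "inverse (real (Suc n))"]) auto
    then obtain x where x: "\<And>n. x n \<in> carrier N" "\<And>n. vnorm C (\<iota> (x n) \<ominus>\<^bsub>C\<^esub> \<sigma> n) < inverse (real (Suc n))" by metis
    have \<iota>x: "\<iota> (x n) \<in> carrier C" for n by (rule \<iota>_closed[OF x(1)])
    have dist: "vnorm N (a \<ominus> b) = vnorm C (\<iota> a \<ominus>\<^bsub>C\<^esub> \<iota> b)" if "a \<in> carrier N" "b \<in> carrier N" for a b
      using C_vnorm[OF C_diff(2)[OF MC_const[OF that(1)] MC_const[OF that(2)]]] C_diff(1)[OF MC_const[OF that(1)] MC_const[OF that(2)]]
      by (simp add: \<iota>_def LIMSEQ_const_iff)
    have small: "\<exists>K. \<forall>n\<ge>K. inverse (real (Suc n)) < e" if "0 < e" for e :: real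
      using order_tendstoD(2)[OF LIMSEQ_inverse_real_of_nat that] unfolding eventually_sequentially .
    have MCx: "MC x"
      unfolding MCauchy_iff
    proof (intro conjI allI impI x(1))
      fix e :: real assume "0 < e"
      then have e: "0 < e / 3" by simp
      obtain K where K: "\<And>n k. K \<le> n \<Longrightarrow> K \<le> k \<Longrightarrow> vnorm C (\<sigma> n \<ominus>\<^bsub>C\<^esub> \<sigma> k) < e / 3" using Cau[OF e] by blast
      obtain K' where K': "\<And>n. K' \<le> n \<Longrightarrow> inverse (real (Suc n)) < e / 3" using small[OF e] by blast
      have "vnorm N (x n \<ominus> x k) < e" if n: "max K K' \<le> n" "max K K' \<le> k" for n k
      proof -
        have "vnorm C (\<iota> (x n) \<ominus>\<^bsub>C\<^esub> \<iota> (x k)) \<le> vnorm C (\<iota> (x n) \<ominus>\<^bsub>C\<^esub> \<sigma> n) + vnorm C (\<sigma> n \<ominus>\<^bsub>C\<^esub> \<iota> (x k))"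
          by (rule C.vnorm_diff_triangle[OF \<iota>x \<sigma> \<iota>x])
        also have "vnorm C (\<sigma> n \<ominus>\<^bsub>C\<^esub> \<iota> (x k)) \<le> vnorm C (\<sigma> n \<ominus>\<^bsub>C\<^esub> \<sigma> k) + vnorm C (\<sigma> k \<ominus>\<^bsub>C\<^esub> \<iota> (x k))"
          by (rule C.vnorm_diff_triangle[OF \<sigma> \<sigma> \<iota>x])
        finally have "vnorm C (\<iota> (x n) \<ominus>\<^bsub>C\<^esub> \<iota> (x k)) < e / 3 + (e / 3 + e / 3)"
          using x(2)[of n] x(2)[of k] K[of n k] K'[of n] K'[of k] n C.vnorm_diff_commute[OF \<sigma>[of k] \<iota>x[of k]] by linarith
        then show ?thesis using dist[OF x(1) x(1), of n k] by simp
      qed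
      then show "\<exists>K. \<forall>n\<ge>K. \<forall>k\<ge>K. vnorm N (x n \<ominus> x k) < e" by blast
    qed
    have cx: "cls x \<in> carrier C" by (rule C_carrierI[OF MCx])
    have "(\<lambda>n. vnorm C (\<sigma> n \<ominus>\<^bsub>C\<^esub> cls x)) \<longlonglongrightarrow> 0"
    proof (rule LIMSEQ_I)
      fix e :: real assume "0 < e"
      then have e: "0 < e / 2" by simp
      obtain K where K: "\<And>n. K \<le> n \<Longrightarrow> vnorm C (\<iota> (x n) \<ominus>\<^bsub>C\<^esub> cls x) < e / 2" using \<iota>_approx[OF MCx e] by blast
      obtain K' where K': "\<And>n. K' \<le> n \<Longrightarrow> inverse (real (Suc n)) < e / 2" using small[OF e] by blast
      have "norm (vnorm C (\<sigma> n \<ominus>\<^bsub>C\<^esub> cls x) - 0) < e" if n: "max K K' \<le> n" for n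
        using C.vnorm_diff_triangle[OF \<sigma>[of n] \<iota>x[of n] cx] x(2)[of n] K[of n] K'[of n] n
          C.vnorm_diff_commute[OF \<sigma>[of n] \<iota>x[of n]] C.vnorm_nonneg[OF C.minus_closed[OF \<sigma>[of n] cx]] by simp
      then show "\<exists>K. \<forall>n\<ge>K. norm (vnorm C (\<sigma> n \<ominus>\<^bsub>C\<^esub> cls x) - 0) < e" by blast
    qed
    then show "\<exists>V\<in>carrier C. (\<lambda>n. vnorm C (\<sigma> n \<ominus>\<^bsub>C\<^esub> V)) \<longlonglongrightarrow> 0" using cx by blast
  qed
qed

end

section \<open>The module generated by a subadditive map\<close>

text \<open>Regards a family as a function from points to members of \<open>D\<close> that is
  constant on the pieces. Operations on families become pointwise, and conditions on all pairs of
  pieces become single a.e. statements.\<close>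

definition pfm_value :: "'a pfm \<Rightarrow> 'a \<Rightarrow> 'a \<Rightarrow> real" where
  "pfm_value u x = fst (u (THE i. x \<in> snd (u i)))"

lemma pfm_pnorm_eq: "pfm_pnorm g u x = g (pfm_value u x) x"
  by (simp add: pfm_pnorm_def pfm_value_def)

locale subadditive_map =
  fixes m :: "'a measure" and p :: real and D :: "('a \<Rightarrow> real) set" and g :: "('a \<Rightarrow> real) \<Rightarrow> 'a \<Rightarrow> real"
  assumes p1: "1 < p" and space_UNIV: "space m = UNIV" and subadditive: "subadditive_homogeneous m p D g"
begin

lemma p_pos: "0 < p" and p_ge_1: "1 \<le> p"
  using p1 by auto

lemma D_measurable: "f \<in> D \<Longrightarrow> f \<in> borel_measurable m"
  and g_plus: "f \<in> D \<Longrightarrow> g f \<in> Lp_plus m p"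
  and D_zero: "(\<lambda>x. 0) \<in> D"
  and D_add: "f \<in> D \<Longrightarrow> h \<in> D \<Longrightarrow> (\<lambda>x. f x + h x) \<in> D"
  and g_add: "f \<in> D \<Longrightarrow> h \<in> D \<Longrightarrow> AE x in m. g (\<lambda>x. f x + h x) x \<le> g f x + g h x"
  and D_scale: "f \<in> D \<Longrightarrow> (\<lambda>x. c * f x) \<in> D"
  and g_scale: "f \<in> D \<Longrightarrow> AE x in m. g (\<lambda>x. c * f x) x = \<bar>c\<bar> * g f x"
  using subadditive by (auto simp: subadditive_homogeneous_def)

lemma g_Lp: "f \<in> D \<Longrightarrow> g f \<in> Lp m p" and g_nonneg: "f \<in> D \<Longrightarrow> AE x in m. 0 \<le> g f x"
  using g_plus by (auto dest: Lp_plusD)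

lemma g_measurable: "f \<in> D \<Longrightarrow> g f \<in> borel_measurable m"
  using g_Lp by (rule LpD(1))

lemma g_zero: "AE x in m. g (\<lambda>x. 0) x = 0"
  using g_scale[OF D_zero, of 0] by simp

lemma D_diff: assumes "f \<in> D" "h \<in> D" shows "(\<lambda>x. f x - h x) \<in> D"
  using D_add[OF assms(1) D_scale[OF assms(2), of "-1"]] by simp

lemma g_diff_commute: assumes "f \<in> D" "h \<in> D" shows "AE x in m. g (\<lambda>x. f x - h x) x = g (\<lambda>x. h x - f x) x"
  using g_scale[OF D_diff[OF assms(2,1)], of "-1"] by simp

lemma g_abs_diff_le:
  assumes f: "f \<in> D" and h: "h \<in> D" shows "AE x in m. \<bar>g f x - g h x\<bar> \<le> g (\<lambda>x. f x - h x) x"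
  using g_add[OF D_diff[OF f h] h] g_add[OF D_diff[OF h f] f] g_diff_commute[OF f h]
  by eventually_elim auto

lemma g_diff_triangle:
  assumes "f \<in> D" "h \<in> D" "k \<in> D"
  shows "AE x in m. g (\<lambda>x. f x - k x) x \<le> g (\<lambda>x. f x - h x) x + g (\<lambda>x. h x - k x) x"
  using g_add[OF D_diff[OF assms(1,2)] D_diff[OF assms(2,3)]] by simp

text \<open>\<open>Pfm\<close> without the summability: the calculus of values rests on the
  countable partition and on membership in \<open>D\<close>, and integrability is added
  separately.\<close>

definition fam :: "'a pfm \<Rightarrow> bool" where
  "fam u \<longleftrightarrow> (\<forall>i. fst (u i) \<in> D \<and> snd (u i) \<in> sets m) \<and>
     disjoint_family (\<lambda>i. snd (u i)) \<and> (\<Union>i. snd (u i)) = UNIV"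

lemma fam_D: "fam u \<Longrightarrow> fst (u i) \<in> D" and fam_sets: "fam u \<Longrightarrow> snd (u i) \<in> sets m"
  and fam_disjoint: "fam u \<Longrightarrow> disjoint_family (\<lambda>i. snd (u i))"
  by (auto simp: fam_def)

lemma fam_ex: assumes "fam u" obtains i where "x \<in> snd (u i)"
  using assms by (auto simp: fam_def set_eq_iff)

lemma fam_value: assumes "fam u" "x \<in> snd (u i)" shows "pfm_value u x = fst (u i)"
proof -
  have "(THE i. x \<in> snd (u i)) = i"
    using assms by (intro the_equality) (auto simp: fam_def disjoint_family_on_def)
  then show ?thesis by (simp add: pfm_value_def)
qed

lemma fam_value_D: "fam u \<Longrightarrow> pfm_value u x \<in> D"
  by (simp add: pfm_value_def fam_D)

text \<open>The exceptional null set may depend on \<open>f\<close>, but only the countably many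
  functions of the family occur.\<close>

lemma fam_AE:
  assumes "\<And>f. f \<in> D \<Longrightarrow> AE x in m. P f x" "fam u" shows "AE x in m. P (pfm_value u x) x"
proof -
  have "AE x in m. \<forall>i. P (fst (u i)) x" using assms by (intro AE_all_countable[THEN iffD2] allI) (auto simp: fam_D)
  then show ?thesis by eventually_elim (simp add: pfm_value_def)
qed

lemma fam_AE2:
  assumes "\<And>f h. f \<in> D \<Longrightarrow> h \<in> D \<Longrightarrow> AE x in m. P f h x" "fam u" "fam v"
  shows "AE x in m. P (pfm_value u x) (pfm_value v x) x"
proof -
  have "AE x in m. \<forall>i j. P (fst (u i)) (fst (v j)) x"
    using assms by (intro AE_all_countable[THEN iffD2] allI) (auto simp: fam_D)
  then show ?thesis by eventually_elim (simp add: pfm_value_def)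
qed

lemma fam_AE3:
  assumes "\<And>f h k. f \<in> D \<Longrightarrow> h \<in> D \<Longrightarrow> k \<in> D \<Longrightarrow> AE x in m. P f h k x" "fam u" "fam v" "fam w"
  shows "AE x in m. P (pfm_value u x) (pfm_value v x) (pfm_value w x) x"
proof -
  have "AE x in m. \<forall>i j k. P (fst (u i)) (fst (v j)) (fst (w k)) x"
    using assms by (intro AE_all_countable[THEN iffD2] allI) (auto simp: fam_D)
  then show ?thesis by eventually_elim (simp add: pfm_value_def)
qed

lemma fam_piecewise_measurable:
  assumes u: "fam u" and G: "\<And>i. G (fst (u i)) \<in> borel_measurable m"
  shows "(\<lambda>x. G (pfm_value u x) x :: real) \<in> borel_measurable m"
proof (rule measurableI)
  fix S :: "real set" assume S: "S \<in> sets borel"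
  have "(\<lambda>x. G (pfm_value u x) x) -` S \<inter> space m = (\<Union>i. snd (u i) \<inter> (G (fst (u i)) -` S \<inter> space m))"
    using fam_value[OF u] fam_ex[OF u] by (auto simp: space_UNIV) (metis fam_ex[OF u])
  also have "\<dots> \<in> sets m" using G S fam_sets[OF u] by (intro sets.countable_UN' sets.Int measurable_sets) auto
  finally show "(\<lambda>x. G (pfm_value u x) x) -` S \<inter> space m \<in> sets m" .
qed simp

lemma fam_pnorm_measurable: "fam u \<Longrightarrow> pfm_pnorm g u \<in> borel_measurable m"
  using fam_piecewise_measurable[of u g] by (simp add: pfm_pnorm_eq[abs_def] g_measurable fam_D)

text \<open>Summation over the pieces commutes with the integral, and at each point a single summand
  survives, so the summability condition says that the pasted function lies in L^p.\<close>

lemma Pfm_iff: "u \<in> Pfm m p D g \<longleftrightarrow> fam u \<and> pfm_pnorm g u \<in> Lp m p"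
proof -
  have "(\<Sum>i. \<integral>\<^sup>+x\<in>snd (u i). ennreal (\<bar>g (fst (u i)) x\<bar> powr p) \<partial>m) < \<infinity> \<longleftrightarrow> pfm_pnorm g u \<in> Lp m p" if u: "fam u"
  proof -
    have [measurable]: "g (fst (u i)) \<in> borel_measurable m" "snd (u i) \<in> sets m" for i
      using u by (auto simp: g_measurable fam_D fam_sets)
    have "(\<Sum>i. \<integral>\<^sup>+x\<in>snd (u i). ennreal (\<bar>g (fst (u i)) x\<bar> powr p) \<partial>m) =
        (\<integral>\<^sup>+x. (\<Sum>i. ennreal (\<bar>g (fst (u i)) x\<bar> powr p) * indicator (snd (u i)) x) \<partial>m)"
      by (rule nn_integral_suminf[symmetric]) measurable
    also have "\<dots> = (\<integral>\<^sup>+x. ennreal (\<bar>pfm_pnorm g u x\<bar> powr p) \<partial>m)"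
    proof (rule nn_integral_cong)
      fix x
      obtain i where i: "x \<in> snd (u i)" by (rule fam_ex[OF u])
      show "(\<Sum>i. ennreal (\<bar>g (fst (u i)) x\<bar> powr p) * indicator (snd (u i)) x) = ennreal (\<bar>pfm_pnorm g u x\<bar> powr p)"
        using suminf_cmult_indicator[OF fam_disjoint[OF u] i, of "\<lambda>i. ennreal (\<bar>g (fst (u i)) x\<bar> powr p)"] fam_value[OF u i]
        by (simp add: pfm_pnorm_eq)
    qed
    finally show ?thesis using fam_pnorm_measurable[OF u] by (simp add: Lp_def integrable_iff_bounded)
  qed
  then show ?thesis by (auto simp: Pfm_def fam_def space_UNIV)
qed

lemma Pfm_fam: "u \<in> Pfm m p D g \<Longrightarrow> fam u" and Pfm_Lp: "u \<in> Pfm m p D g \<Longrightarrow> pfm_pnorm g u \<in> Lp m p"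
  by (auto simp: Pfm_iff)

section \<open>The equivalence of families and operations on them\<close>

abbreviation "PR \<equiv> pfm_rel m p D g"
abbreviation "N \<equiv> pfm_module m p D g"
abbreviation pcls :: "'a pfm \<Rightarrow> 'a pfm set" where "pcls u \<equiv> PR `` {u}"

lemma pfm_rel_iff: "(u, v) \<in> PR \<longleftrightarrow> u \<in> Pfm m p D g \<and> v \<in> Pfm m p D g \<and>
    (AE x in m. g (\<lambda>y. pfm_value u x y - pfm_value v x y) x = 0)"
proof -
  have eq: "(\<forall>i j. AE x in m. x \<in> snd (u i) \<inter> snd (v j) \<longrightarrow> g (\<lambda>y. fst (u i) y - fst (v j) y) x = 0) \<longleftrightarrow>
     (AE x in m. g (\<lambda>y. pfm_value u x y - pfm_value v x y) x = 0)" if u: "fam u" and v: "fam v"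
  proof
    assume "\<forall>i j. AE x in m. x \<in> snd (u i) \<inter> snd (v j) \<longrightarrow> g (\<lambda>y. fst (u i) y - fst (v j) y) x = 0"
    then have "AE x in m. \<forall>i j. x \<in> snd (u i) \<inter> snd (v j) \<longrightarrow> g (\<lambda>y. fst (u i) y - fst (v j) y) x = 0"
      by (intro AE_all_countable[THEN iffD2] allI) blast
    then show "AE x in m. g (\<lambda>y. pfm_value u x y - pfm_value v x y) x = 0"
    proof eventually_elim
      case (elim x)
      obtain i where i: "x \<in> snd (u i)" by (rule fam_ex[OF u])
      obtain j where j: "x \<in> snd (v j)" by (rule fam_ex[OF v])
      show ?case using elim i j by (simp add: fam_value[OF u i] fam_value[OF v j])
    qed
  next
    assume A: "AE x in m. g (\<lambda>y. pfm_value u x y - pfm_value v x y) x = 0"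
    show "\<forall>i j. AE x in m. x \<in> snd (u i) \<inter> snd (v j) \<longrightarrow> g (\<lambda>y. fst (u i) y - fst (v j) y) x = 0"
    proof (intro allI)
      fix i j
      show "AE x in m. x \<in> snd (u i) \<inter> snd (v j) \<longrightarrow> g (\<lambda>y. fst (u i) y - fst (v j) y) x = 0"
        using A by eventually_elim (auto simp: fam_value[OF u] fam_value[OF v])
    qed
  qed
  have "(u, v) \<in> PR \<longleftrightarrow> u \<in> Pfm m p D g \<and> v \<in> Pfm m p D g \<and>
      (\<forall>i j. AE x in m. x \<in> snd (u i) \<inter> snd (v j) \<longrightarrow> g (\<lambda>y. fst (u i) y - fst (v j) y) x = 0)"
    unfolding pfm_rel_def by blast
  also have "\<dots> \<longleftrightarrow> u \<in> Pfm m p D g \<and> v \<in> Pfm m p D g \<and> (AE x in m. g (\<lambda>y. pfm_value u x y - pfm_value v x y) x = 0)"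
    by (intro conj_cong refl eq Pfm_fam)
  finally show ?thesis .
qed

lemma pfm_rel_equiv: "equiv (Pfm m p D g) PR"
proof (rule equivI)
  show "PR \<subseteq> Pfm m p D g \<times> Pfm m p D g" by (auto simp: pfm_rel_iff)
  show "refl_on (Pfm m p D g) PR"
    using g_zero by (auto simp: refl_on_def pfm_rel_iff)
  show "sym PR"
  proof (rule symI)
    fix u v assume uv: "(u, v) \<in> PR"
    then have f: "fam u" "fam v" by (auto simp: pfm_rel_iff Pfm_fam)
    have "AE x in m. g (\<lambda>y. pfm_value u x y - pfm_value v x y) x = g (\<lambda>y. pfm_value v x y - pfm_value u x y) x"
      by (rule fam_AE2[OF _ f, where P="\<lambda>a b x. g (\<lambda>y. a y - b y) x = g (\<lambda>y. b y - a y) x"]) (rule g_diff_commute)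
    then show "(v, u) \<in> PR" using uv by (auto simp: pfm_rel_iff elim!: eventually_elim2)
  qed
  show "trans PR"
  proof (rule transI)
    fix u v w assume uv: "(u, v) \<in> PR" and vw: "(v, w) \<in> PR"
    then have f: "fam u" "fam v" "fam w" by (auto simp: pfm_rel_iff Pfm_fam)
    have A: "AE x in m. g (\<lambda>y. pfm_value u x y - pfm_value w x y) x \<le>
        g (\<lambda>y. pfm_value u x y - pfm_value v x y) x + g (\<lambda>y. pfm_value v x y - pfm_value w x y) x"
      by (rule fam_AE3[OF _ f, where P="\<lambda>a b c x. g (\<lambda>y. a y - c y) x \<le> g (\<lambda>y. a y - b y) x + g (\<lambda>y. b y - c y) x"])
        (rule g_diff_triangle)
    have B: "AE x in m. 0 \<le> g (\<lambda>y. pfm_value u x y - pfm_value w x y) x"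
      by (rule fam_AE2[OF _ f(1,3), where P="\<lambda>a b x. 0 \<le> g (\<lambda>y. a y - b y) x"]) (intro g_nonneg D_diff)
    have "AE x in m. g (\<lambda>y. pfm_value u x y - pfm_value v x y) x = 0" "AE x in m. g (\<lambda>y. pfm_value v x y - pfm_value w x y) x = 0"
      using uv vw by (auto simp: pfm_rel_iff)
    with A B have "AE x in m. g (\<lambda>y. pfm_value u x y - pfm_value w x y) x = 0" by eventually_elim linarith
    then show "(u, w) \<in> PR" using uv vw by (simp add: pfm_rel_iff)
  qed
qed

text \<open>The two sides of a module law have different partitions or enumerations in general. What
  they share is the value at every point, and in the quotient that suffices.\<close>

lemma pcls_eqI:
  assumes "u \<in> Pfm m p D g" "v \<in> Pfm m p D g" "\<And>x. pfm_value u x = pfm_value v x" shows "pcls u = pcls v"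
  by (rule equiv_class_eq[OF pfm_rel_equiv]) (use assms g_zero in \<open>simp add: pfm_rel_iff\<close>)

text \<open>The common pattern of \<open>pfm_add\<close> and \<open>pfm_smult\<close>: two
  partitions are intersected, and the function on a piece may depend on both indices.\<close>

lemma fam_product:
  assumes f: "\<And>i j. f i j \<in> D"
    and A: "\<And>i. A i \<in> sets m" "disjoint_family A" "(\<Union>i. A i) = UNIV"
    and B: "\<And>j. B j \<in> sets m" "disjoint_family B" "(\<Union>j. B j) = UNIV"
  defines "w \<equiv> (\<lambda>n. case prod_decode n of (i, j) \<Rightarrow> (f i j, A i \<inter> B j))"
  shows "fam w" "x \<in> A i \<Longrightarrow> x \<in> B j \<Longrightarrow> pfm_value w x = f i j"
proof -
  have w: "fst (w (prod_encode (i, j))) = f i j" "snd (w (prod_encode (i, j))) = A i \<inter> B j" for i j by (simp_all add: w_def)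
  show fam: "fam w"
    unfolding fam_def
  proof (intro conjI allI)
    fix n
    obtain i j where n: "n = prod_encode (i, j)" by (metis prod_decode_inverse surj_pair)
    show "fst (w n) \<in> D" "snd (w n) \<in> sets m" unfolding n w using f A B by auto
  next
    show "disjoint_family (\<lambda>n. snd (w n))"
      unfolding disjoint_family_on_def
    proof (intro ballI impI)
      fix n k :: nat assume "n \<noteq> k"
      obtain i j where n: "n = prod_encode (i, j)" by (metis prod_decode_inverse surj_pair)
      obtain i' j' where k: "k = prod_encode (i', j')" by (metis prod_decode_inverse surj_pair)
      have "i \<noteq> i' \<or> j \<noteq> j'" using \<open>n \<noteq> k\<close> n k by auto
      then have "A i \<inter> A i' = {} \<or> B j \<inter> B j' = {}"
        using disjoint_family_onD[OF A(2), of i i'] disjoint_family_onD[OF B(2), of j j'] by blast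
      then show "snd (w n) \<inter> snd (w k) = {}" unfolding n k w by blast
    qed
    have "x \<in> (\<Union>n. snd (w n))" for x
    proof -
      obtain i j where "x \<in> A i" "x \<in> B j" using A(3) B(3) by blast
      then have "x \<in> snd (w (prod_encode (i, j)))" by (simp add: w)
      then show ?thesis by blast
    qed
    then show "(\<Union>n. snd (w n)) = UNIV" by auto
  qed
  show "x \<in> A i \<Longrightarrow> x \<in> B j \<Longrightarrow> pfm_value w x = f i j"
    using fam_value[OF fam, of x "prod_encode (i, j)"] by (simp add: w)
qed

lemma pfm_add_fam:
  assumes u: "fam u" and v: "fam v"
  shows "fam (pfm_add u v)" "pfm_value (pfm_add u v) x = (\<lambda>y. pfm_value u x y + pfm_value v x y)"
proof -
  let ?f = "\<lambda>i j x. fst (u i) x + fst (v j) x"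
  have D: "?f i j \<in> D" for i j using u v by (intro D_add fam_D)
  have U: "(\<Union>i. snd (u i)) = UNIV" "(\<Union>i. snd (v i)) = UNIV" using u v by (auto simp: fam_def)
  note * = fam_product[OF D fam_sets[OF u] fam_disjoint[OF u] U(1) fam_sets[OF v] fam_disjoint[OF v] U(2)]
  show "fam (pfm_add u v)" using *(1) by (simp add: pfm_add_def)
  obtain i where i: "x \<in> snd (u i)" by (rule fam_ex[OF u])
  obtain j where j: "x \<in> snd (v j)" by (rule fam_ex[OF v])
  show "pfm_value (pfm_add u v) x = (\<lambda>y. pfm_value u x y + pfm_value v x y)"
    using *(2)[OF i j] by (simp add: pfm_add_def fam_value[OF u i] fam_value[OF v j])
qed

lemma pfm_smult_fam:
  assumes s: "simple_function m s" and u: "fam u"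
  shows "fam (pfm_smult s u)" "pfm_value (pfm_smult s u) x = (\<lambda>y. s x * pfm_value u x y)"
proof -
  let ?f = "\<lambda>i j x. from_nat_into (range s) j * fst (u i) x"
  let ?B = "\<lambda>j. {x. to_nat_on (range s) (s x) = j}"
  have D: "?f i j \<in> D" for i j using u by (intro D_scale fam_D)
  have U: "(\<Union>i. snd (u i)) = UNIV" using u by (auto simp: fam_def)
  have fin: "finite (range s)" using simple_functionD(1)[OF s] by (simp add: space_UNIV)
  have B: "?B j \<in> sets m" for j
  proof -
    have "?B j = s -` {c. to_nat_on (range s) c = j} \<inter> space m" by (auto simp: space_UNIV)
    then show ?thesis by (simp only: simple_functionD(2)[OF s])
  qed
  have B2: "disjoint_family ?B" "(\<Union>j. ?B j) = UNIV" by (auto simp: disjoint_family_on_def)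
  note * = fam_product[OF D fam_sets[OF u] fam_disjoint[OF u] U B B2]
  show "fam (pfm_smult s u)" using *(1) by (simp add: pfm_smult_def)
  obtain i where i: "x \<in> snd (u i)" by (rule fam_ex[OF u])
  \<comment> \<open>The range is finite, hence countable, so its enumeration recovers each
    value.\<close>
  have "from_nat_into (range s) (to_nat_on (range s) (s x)) = s x"
    by (rule from_nat_into_to_nat_on) (use fin in \<open>auto intro: countable_finite\<close>)
  then show "pfm_value (pfm_smult s u) x = (\<lambda>y. s x * pfm_value u x y)"
    using *(2)[OF i, of "to_nat_on (range s) (s x)"] by (simp add: pfm_smult_def fam_value[OF u i])
qed

lemma pfm_single_fam:
  assumes "f \<in> D" shows "fam (pfm_single m f)" "pfm_value (pfm_single m f) x = f"
proof -
  show fam: "fam (pfm_single m f)"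
    using assms by (auto simp: fam_def pfm_single_def space_UNIV[symmetric] disjoint_family_on_def)
  show "pfm_value (pfm_single m f) x = f"
    using fam_value[OF fam, of x 0] by (simp add: pfm_single_def space_UNIV)
qed

lemma pfm_add_pnorm_le:
  assumes "fam u" "fam v" shows "AE x in m. pfm_pnorm g (pfm_add u v) x \<le> pfm_pnorm g u x + pfm_pnorm g v x"
  using fam_AE2[OF g_add assms] by (simp add: pfm_pnorm_eq pfm_add_fam[OF assms])

lemma pfm_smult_pnorm:
  assumes s: "simple_function m s" and u: "fam u"
  shows "AE x in m. pfm_pnorm g (pfm_smult s u) x = \<bar>s x\<bar> * pfm_pnorm g u x"
proof -
  have "AE x in m. \<forall>c\<in>range s. g (\<lambda>y. c * pfm_value u x y) x = \<bar>c\<bar> * g (pfm_value u x) x"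
    using simple_functionD(1)[OF s] fam_AE[OF g_scale u] by (intro AE_finite_allI) (auto simp: space_UNIV)
  then show ?thesis by eventually_elim (simp add: pfm_pnorm_eq pfm_smult_fam[OF s u])
qed

lemma pfm_pnorm_nonneg: "fam u \<Longrightarrow> AE x in m. 0 \<le> pfm_pnorm g u x"
  using fam_AE[OF g_nonneg] by (simp add: pfm_pnorm_eq)

lemma pfm_add_Pfm:
  assumes u: "u \<in> Pfm m p D g" and v: "v \<in> Pfm m p D g" shows "pfm_add u v \<in> Pfm m p D g"
proof -
  note f = Pfm_fam[OF u] Pfm_fam[OF v]
  have "pfm_pnorm g (pfm_add u v) \<in> Lp m p"
  proof (rule Lp_dominated(1)[OF p_pos fam_pnorm_measurable Lp_add[OF p_pos Pfm_Lp[OF u] Pfm_Lp[OF v]]])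
    show "fam (pfm_add u v)" by (rule pfm_add_fam(1)[OF f])
    show "AE x in m. \<bar>pfm_pnorm g (pfm_add u v) x\<bar> \<le> \<bar>pfm_pnorm g u x + pfm_pnorm g v x\<bar>"
      using pfm_add_pnorm_le[OF f] pfm_pnorm_nonneg[OF pfm_add_fam(1)[OF f]] by eventually_elim linarith
  qed
  then show ?thesis using pfm_add_fam(1)[OF f] by (simp add: Pfm_iff)
qed

lemma pfm_smult_Pfm:
  assumes s: "simple_function m s" and u: "u \<in> Pfm m p D g" shows "pfm_smult s u \<in> Pfm m p D g"
proof -
  note f = Pfm_fam[OF u]
  obtain K where K: "0 < K" "AE x in m. \<bar>s x\<bar> \<le> K" by (rule Linf_bound[OF simple_function_Linf[OF s]])
  have "(\<lambda>x. \<bar>s x\<bar> * pfm_pnorm g u x) \<in> Lp m p"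
    by (rule Lp_mult_Linf(1)[OF p_pos _ less_imp_le[OF K(1)] _ Pfm_Lp[OF u]])
      (use K borel_measurable_simple_function[OF s] in auto)
  then have "pfm_pnorm g (pfm_smult s u) \<in> Lp m p"
    by (rule Lp_cong_AE[OF _ fam_pnorm_measurable[OF pfm_smult_fam(1)[OF s f]]])
      (use pfm_smult_pnorm[OF s f] in \<open>auto elim: eventually_mono\<close>)
  then show ?thesis using pfm_smult_fam(1)[OF s f] by (simp add: Pfm_iff)
qed

lemma pfm_single_Pfm: assumes "f \<in> D" shows "pfm_single m f \<in> Pfm m p D g"
proof -
  have "pfm_pnorm g (pfm_single m f) = g f" by (rule ext) (simp add: pfm_pnorm_eq pfm_single_fam[OF assms])
  then show ?thesis using assms by (simp add: Pfm_iff pfm_single_fam g_Lp)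
qed

section \<open>The normed space of classes of families\<close>

lemma N_carrier: "carrier N = Pfm m p D g // PR" and N_zero: "\<zero>\<^bsub>N\<^esub> = pcls (pfm_single m (\<lambda>x. 0))"
  by (simp_all add: pfm_module_def Let_def)

lemma N_carrierE: assumes "U \<in> carrier N" obtains u where "u \<in> Pfm m p D g" "U = pcls u"
  using assms unfolding N_carrier by (auto elim: quotientE)

lemma N_carrierI: "u \<in> Pfm m p D g \<Longrightarrow> pcls u \<in> carrier N"
  unfolding N_carrier by (rule quotientI)

lemma pcls_self: "u \<in> Pfm m p D g \<Longrightarrow> u \<in> pcls u"
  using equiv_class_self[OF pfm_rel_equiv] by simp

lemma N_add:
  assumes u: "u \<in> Pfm m p D g" and v: "v \<in> Pfm m p D g" shows "pcls u \<oplus>\<^bsub>N\<^esub> pcls v = pcls (pfm_add u v)"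
proof -
  have "pcls (pfm_add u' v') = pcls (pfm_add u v)" if "u' \<in> pcls u" "v' \<in> pcls v" for u' v'
  proof -
    have r: "u' \<in> Pfm m p D g" "v' \<in> Pfm m p D g" "AE x in m. g (\<lambda>y. pfm_value u x y - pfm_value u' x y) x = 0"
      "AE x in m. g (\<lambda>y. pfm_value v x y - pfm_value v' x y) x = 0" using that by (auto simp: pfm_rel_iff)
    note f = Pfm_fam[OF u] Pfm_fam[OF v] Pfm_fam[OF r(1)] Pfm_fam[OF r(2)]
    \<comment> \<open>Four families are involved, so the null sets are united over all quadruples of
      indices before the indices of the pieces containing \<open>x\<close> are inserted.\<close>
    have "AE x in m. \<forall>i j k l. g (\<lambda>y. (fst (u i) y - fst (u' k) y) + (fst (v j) y - fst (v' l) y)) x \<le>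
        g (\<lambda>y. fst (u i) y - fst (u' k) y) x + g (\<lambda>y. fst (v j) y - fst (v' l) y) x \<and>
        0 \<le> g (\<lambda>y. (fst (u i) y - fst (u' k) y) + (fst (v j) y - fst (v' l) y)) x"
      using f by (intro AE_all_countable[THEN iffD2] allI AE_conjI g_add g_nonneg D_add D_diff fam_D)
    with r(3,4) have "AE x in m. g (\<lambda>y. (pfm_value u x y - pfm_value u' x y) + (pfm_value v x y - pfm_value v' x y)) x = 0"
      unfolding pfm_value_def
    proof eventually_elim
      case (elim x)
      let ?i = "\<lambda>u. THE i. x \<in> snd (u i)"
      show ?case using elim(1,2) elim(3)[rule_format, of "?i u" "?i u'" "?i v" "?i v'"] by linarith
    qed
    then have "(pfm_add u v, pfm_add u' v') \<in> PR"
      using u v r(1,2) f by (simp add: pfm_rel_iff pfm_add_Pfm pfm_add_fam algebra_simps)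
    then show ?thesis using equiv_class_eq[OF pfm_rel_equiv] by metis
  qed
  then have "(\<Union>u'\<in>pcls u. \<Union>v'\<in>pcls v. pcls (pfm_add u' v')) = pcls (pfm_add u v)"
    using pcls_self[OF u] pcls_self[OF v] by blast
  then show ?thesis by (simp add: pfm_module_def Let_def)
qed

lemma N_smult:
  assumes s: "simple_function m s" and u: "u \<in> Pfm m p D g" shows "s \<odot>\<^bsub>N\<^esub> pcls u = pcls (pfm_smult s u)"
proof -
  have "pcls (pfm_smult s u') = pcls (pfm_smult s u)" if "u' \<in> pcls u" for u'
  proof -
    have r: "u' \<in> Pfm m p D g" "AE x in m. g (\<lambda>y. pfm_value u x y - pfm_value u' x y) x = 0"
      using that by (auto simp: pfm_rel_iff)
    note f = Pfm_fam[OF u] Pfm_fam[OF r(1)]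
    have "AE x in m. \<forall>c\<in>range s. g (\<lambda>y. c * (pfm_value u x y - pfm_value u' x y)) x = \<bar>c\<bar> * g (\<lambda>y. pfm_value u x y - pfm_value u' x y) x"
      using simple_functionD(1)[OF s] fam_AE2[OF g_scale[OF D_diff] f] by (intro AE_finite_allI) (auto simp: space_UNIV)
    with r(2) have "AE x in m. g (\<lambda>y. s x * (pfm_value u x y - pfm_value u' x y)) x = 0" by eventually_elim auto
    then have "(pfm_smult s u, pfm_smult s u') \<in> PR"
      using u r(1) f s by (simp add: pfm_rel_iff pfm_smult_Pfm pfm_smult_fam right_diff_distrib)
    then show ?thesis using equiv_class_eq[OF pfm_rel_equiv] by metis
  qed
  then have "(\<Union>u'\<in>pcls u. pcls (pfm_smult s u')) = pcls (pfm_smult s u)" using pcls_self[OF u] by blast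
  then show ?thesis by (simp add: pfm_module_def Let_def)
qed

text \<open>The definition evaluates a chosen representative; |g f - g h| \<le> g (f - h) shows that
  any other one gives the same function a.e.\<close>

lemma N_pnorm:
  assumes u: "u \<in> Pfm m p D g"
  shows "pnorm N (pcls u) \<in> Lp_plus m p" "AE x in m. pnorm N (pcls u) x = pfm_pnorm g u x"
    "vnorm N (pcls u) = Lp_norm m p (pnorm N (pcls u))"
proof -
  define v where "v = (SOME v. v \<in> pcls u)"
  have "v \<in> pcls u" unfolding v_def by (rule someI[of "\<lambda>v. v \<in> pcls u", OF pcls_self[OF u]])
  then have v: "v \<in> Pfm m p D g" "AE x in m. g (\<lambda>y. pfm_value u x y - pfm_value v x y) x = 0" by (auto simp: pfm_rel_iff)
  have eq: "pnorm N (pcls u) = pfm_pnorm g v" "vnorm N (pcls u) = Lp_norm m p (pfm_pnorm g v)"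
    by (simp_all add: pfm_module_def Let_def v_def)
  show "pnorm N (pcls u) \<in> Lp_plus m p" unfolding eq using Pfm_Lp[OF v(1)] pfm_pnorm_nonneg[OF Pfm_fam[OF v(1)]] by (simp add: Lp_plus_def)
  show "vnorm N (pcls u) = Lp_norm m p (pnorm N (pcls u))" unfolding eq ..
  have "AE x in m. \<bar>pfm_pnorm g u x - pfm_pnorm g v x\<bar> \<le> g (\<lambda>y. pfm_value u x y - pfm_value v x y) x"
    using fam_AE2[OF g_abs_diff_le Pfm_fam[OF u] Pfm_fam[OF v(1)]] by (simp add: pfm_pnorm_eq)
  with v(2) show "AE x in m. pnorm N (pcls u) x = pfm_pnorm g u x" unfolding eq by eventually_elim simp
qed

lemma N_abelian_group: "abelian_group N"
proof (rule abelian_groupI)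
  fix U V W assume U: "U \<in> carrier N" and V: "V \<in> carrier N" and W: "W \<in> carrier N"
  obtain u where u: "u \<in> Pfm m p D g" "U = pcls u" by (rule N_carrierE[OF U])
  obtain v where v: "v \<in> Pfm m p D g" "V = pcls v" by (rule N_carrierE[OF V])
  obtain w where w: "w \<in> Pfm m p D g" "W = pcls w" by (rule N_carrierE[OF W])
  note f = Pfm_fam[OF u(1)] Pfm_fam[OF v(1)] Pfm_fam[OF w(1)]
  show "U \<oplus>\<^bsub>N\<^esub> V \<in> carrier N" using u v by (simp add: N_add N_carrierI pfm_add_Pfm)
  have "pcls (pfm_add (pfm_add u v) w) = pcls (pfm_add u (pfm_add v w))"
    by (rule pcls_eqI) (use u v w f in \<open>simp_all add: pfm_add_Pfm pfm_add_fam add.assoc\<close>)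
  then show "U \<oplus>\<^bsub>N\<^esub> V \<oplus>\<^bsub>N\<^esub> W = U \<oplus>\<^bsub>N\<^esub> (V \<oplus>\<^bsub>N\<^esub> W)" using u v w by (simp add: N_add pfm_add_Pfm)
  have "pcls (pfm_add u v) = pcls (pfm_add v u)"
    by (rule pcls_eqI) (use u v f in \<open>simp_all add: pfm_add_Pfm pfm_add_fam add.commute\<close>)
  then show "U \<oplus>\<^bsub>N\<^esub> V = V \<oplus>\<^bsub>N\<^esub> U" using u v by (simp add: N_add)
next
  show "\<zero>\<^bsub>N\<^esub> \<in> carrier N" unfolding N_zero by (intro N_carrierI pfm_single_Pfm D_zero)
  fix U assume U: "U \<in> carrier N"
  obtain u where u: "u \<in> Pfm m p D g" "U = pcls u" by (rule N_carrierE[OF U])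
  note f = Pfm_fam[OF u(1)]
  have "pcls (pfm_add (pfm_single m (\<lambda>x. 0)) u) = pcls u"
    by (rule pcls_eqI) (use u f D_zero in \<open>simp_all add: pfm_add_Pfm pfm_add_fam pfm_single_fam pfm_single_Pfm\<close>)
  then show "\<zero>\<^bsub>N\<^esub> \<oplus>\<^bsub>N\<^esub> U = U" unfolding N_zero using u D_zero by (simp add: N_add pfm_single_Pfm)
  have s: "simple_function m (\<lambda>_. -1 :: real)" by simp
  let ?v = "pfm_smult (\<lambda>_. -1) u"
  have "pcls (pfm_add ?v u) = pcls (pfm_single m (\<lambda>x. 0))"
    by (rule pcls_eqI) (use u f D_zero in \<open>simp_all add: pfm_add_Pfm pfm_add_fam pfm_single_fam pfm_single_Pfm pfm_smult_fam[OF s] pfm_smult_Pfm[OF s]\<close>)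
  then show "\<exists>V\<in>carrier N. V \<oplus>\<^bsub>N\<^esub> U = \<zero>\<^bsub>N\<^esub>"
    unfolding N_zero using u by (intro bexI[of _ "pcls ?v"]) (simp_all add: N_add N_carrierI pfm_smult_Pfm[OF s])
qed

lemma N_minus:
  assumes u: "u \<in> Pfm m p D g" shows "\<ominus>\<^bsub>N\<^esub> pcls u = pcls (pfm_smult (\<lambda>_. -1) u)"
proof (rule abelian_group.minus_equality[OF N_abelian_group])
  have s: "simple_function m (\<lambda>_. -1 :: real)" by simp
  note f = Pfm_fam[OF u]
  show "pcls (pfm_smult (\<lambda>_. -1) u) \<in> carrier N" "pcls u \<in> carrier N" using u by (simp_all add: N_carrierI pfm_smult_Pfm[OF s])
  have "pcls (pfm_add (pfm_smult (\<lambda>_. -1) u) u) = pcls (pfm_single m (\<lambda>x. 0))"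
    by (rule pcls_eqI) (use u f D_zero in \<open>simp_all add: pfm_add_Pfm pfm_add_fam pfm_single_fam pfm_single_Pfm pfm_smult_fam[OF s] pfm_smult_Pfm[OF s]\<close>)
  then show "pcls (pfm_smult (\<lambda>_. -1) u) \<oplus>\<^bsub>N\<^esub> pcls u = \<zero>\<^bsub>N\<^esub>"
    unfolding N_zero using u by (simp add: N_add pfm_smult_Pfm[OF s])
qed

lemma N_pnorm_diff:
  assumes u: "u \<in> Pfm m p D g" and v: "v \<in> Pfm m p D g"
  shows "AE x in m. pnorm N (pcls u \<ominus>\<^bsub>N\<^esub> pcls v) x = g (\<lambda>y. pfm_value u x y - pfm_value v x y) x"
proof -
  have s: "simple_function m (\<lambda>_. -1 :: real)" by simp
  let ?w = "pfm_add u (pfm_smult (\<lambda>_. -1) v)"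
  have w: "?w \<in> Pfm m p D g" "pcls u \<ominus>\<^bsub>N\<^esub> pcls v = pcls ?w"
    using u v by (simp_all add: a_minus_def N_minus N_add pfm_add_Pfm pfm_smult_Pfm[OF s])
  show ?thesis using N_pnorm(2)[OF w(1)] Pfm_fam[OF u] Pfm_fam[OF v] unfolding w(2)
    by (simp add: pfm_pnorm_eq pfm_add_fam pfm_smult_fam[OF s])
qed

lemma N_simple_mod: "simple_mod N m p"
proof -
  interpret N: abelian_group N by (rule N_abelian_group)
  show ?thesis
  proof
    show "1 < p" "space m = UNIV" by (rule p1 space_UNIV)+
    show "AE x in m. pnorm N \<zero>\<^bsub>N\<^esub> x = 0"
      unfolding N_zero using N_pnorm(2)[OF pfm_single_Pfm[OF D_zero]] g_zero
      by eventually_elim (simp add: pfm_pnorm_eq pfm_single_fam[OF D_zero])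
    fix U assume U: "U \<in> carrier N"
    obtain u where u: "u \<in> Pfm m p D g" "U = pcls u" by (rule N_carrierE[OF U])
    note f = Pfm_fam[OF u(1)]
    show "pnorm N U \<in> Lp_plus m p" "vnorm N U = Lp_norm m p (pnorm N U)" using N_pnorm[OF u(1)] u(2) by simp_all
    have s1: "simple_function m (\<lambda>_. -1 :: real)" by simp
    show "AE x in m. pnorm N (\<ominus>\<^bsub>N\<^esub> U) x = pnorm N U x"
      unfolding u(2) N_minus[OF u(1)]
      using N_pnorm(2)[OF u(1)] N_pnorm(2)[OF pfm_smult_Pfm[OF s1 u(1)]] pfm_smult_pnorm[OF s1 f] by eventually_elim simp
    show "U = \<zero>\<^bsub>N\<^esub>" if "vnorm N U = 0"
    proof -
      have "AE x in m. pnorm N U x = 0"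
        using that N_pnorm[OF u(1)] u(2) by (intro Lp_norm_eq_0[OF p_pos]) (auto dest: Lp_plusD)
      then have "AE x in m. g (pfm_value u x) x = 0" using N_pnorm(2)[OF u(1)] unfolding u(2) by eventually_elim (simp add: pfm_pnorm_eq)
      then have "(u, pfm_single m (\<lambda>x. 0)) \<in> PR"
        using u(1) by (simp add: pfm_rel_iff pfm_single_Pfm[OF D_zero] pfm_single_fam[OF D_zero])
      then show ?thesis unfolding u(2) N_zero by (rule equiv_class_eq[OF pfm_rel_equiv])
    qed
    show "(\<lambda>_. 1) \<odot>\<^bsub>N\<^esub> U = U"
    proof -
      have s: "simple_function m (\<lambda>_. 1 :: real)" by simp
      show ?thesis unfolding u(2) N_smult[OF s u(1)]
        by (rule pcls_eqI) (use u(1) f in \<open>simp_all add: pfm_smult_Pfm[OF s] pfm_smult_fam[OF s]\<close>)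
    qed
    {
      fix s :: "'a \<Rightarrow> real" assume s: "simple_function m s"
      show "s \<odot>\<^bsub>N\<^esub> U \<in> carrier N" unfolding u(2) N_smult[OF s u(1)] by (rule N_carrierI[OF pfm_smult_Pfm[OF s u(1)]])
      show "AE x in m. pnorm N (s \<odot>\<^bsub>N\<^esub> U) x = \<bar>s x\<bar> * pnorm N U x"
        unfolding u(2) N_smult[OF s u(1)] using N_pnorm(2)[OF pfm_smult_Pfm[OF s u(1)]] N_pnorm(2)[OF u(1)] pfm_smult_pnorm[OF s f]
        by eventually_elim simp
      fix t :: "'a \<Rightarrow> real" assume t: "simple_function m t"
      have st: "simple_function m (\<lambda>x. s x + t x)" "simple_function m (\<lambda>x. s x * t x)"
        using s t by (auto intro: simple_function_add simple_function_mult)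
      have "pcls (pfm_smult (\<lambda>x. s x + t x) u) = pcls (pfm_add (pfm_smult s u) (pfm_smult t u))"
        by (rule pcls_eqI) (use u(1) f s t st in \<open>simp_all add: pfm_smult_Pfm pfm_add_Pfm pfm_smult_fam pfm_add_fam algebra_simps\<close>)
      then show "(\<lambda>x. s x + t x) \<odot>\<^bsub>N\<^esub> U = s \<odot>\<^bsub>N\<^esub> U \<oplus>\<^bsub>N\<^esub> t \<odot>\<^bsub>N\<^esub> U"
        unfolding u(2) using u(1) s t st by (simp add: N_smult N_add pfm_smult_Pfm)
      have "pcls (pfm_smult (\<lambda>x. s x * t x) u) = pcls (pfm_smult s (pfm_smult t u))"
        by (rule pcls_eqI) (use u(1) f s t st in \<open>simp_all add: pfm_smult_Pfm pfm_smult_fam algebra_simps\<close>)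
      then show "(\<lambda>x. s x * t x) \<odot>\<^bsub>N\<^esub> U = s \<odot>\<^bsub>N\<^esub> (t \<odot>\<^bsub>N\<^esub> U)"
        unfolding u(2) using u(1) s t st by (simp add: N_smult pfm_smult_Pfm)
    }
    fix V assume V: "V \<in> carrier N"
    obtain v where v: "v \<in> Pfm m p D g" "V = pcls v" by (rule N_carrierE[OF V])
    note f' = Pfm_fam[OF v(1)]
    show "AE x in m. pnorm N (U \<oplus>\<^bsub>N\<^esub> V) x \<le> pnorm N U x + pnorm N V x"
      unfolding u(2) v(2) N_add[OF u(1) v(1)]
      using N_pnorm(2)[OF pfm_add_Pfm[OF u(1) v(1)]] N_pnorm(2)[OF u(1)] N_pnorm(2)[OF v(1)] pfm_add_pnorm_le[OF f f']
      by eventually_elim simp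
    show "s \<odot>\<^bsub>N\<^esub> (U \<oplus>\<^bsub>N\<^esub> V) = s \<odot>\<^bsub>N\<^esub> U \<oplus>\<^bsub>N\<^esub> s \<odot>\<^bsub>N\<^esub> V" if s: "simple_function m s" for s
    proof -
      have "pcls (pfm_smult s (pfm_add u v)) = pcls (pfm_add (pfm_smult s u) (pfm_smult s v))"
        by (rule pcls_eqI) (use u(1) v(1) f f' s in \<open>simp_all add: pfm_smult_Pfm pfm_add_Pfm pfm_smult_fam pfm_add_fam algebra_simps\<close>)
      then show ?thesis unfolding u(2) v(2) using u(1) v(1) s by (simp add: N_smult N_add pfm_smult_Pfm pfm_add_Pfm)
    qed
  qed
qed

sublocale N: simple_mod N m p
  by (rule N_simple_mod)

section \<open>The generated module and its differential\<close>

abbreviation "M \<equiv> gen_module m p D g"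
abbreviation "d \<equiv> gen_diff m p D g"

sublocale M: Lp_mod M m p
  unfolding gen_module_def by (rule N.completion_Lp_mod)

lemma d_eq: "d f = N.\<iota> (pcls (pfm_single m f))"
  by (simp add: gen_diff_def N.\<iota>_def)

lemma d_closed: "f \<in> D \<Longrightarrow> d f \<in> carrier M"
  unfolding d_eq gen_module_def by (intro N.\<iota>_closed N_carrierI pfm_single_Pfm)

lemma d_add: assumes "f \<in> D" "h \<in> D" shows "d (\<lambda>x. f x + h x) = d f \<oplus>\<^bsub>M\<^esub> d h"
proof -
  have "pcls (pfm_single m (\<lambda>x. f x + h x)) = pcls (pfm_add (pfm_single m f) (pfm_single m h))"
    by (rule pcls_eqI) (use assms in \<open>simp_all add: D_add pfm_add_Pfm pfm_single_Pfm pfm_add_fam pfm_single_fam\<close>)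
  then show ?thesis unfolding d_eq gen_module_def
    using N.\<iota>_add[OF N_carrierI[OF pfm_single_Pfm[OF assms(1)]] N_carrierI[OF pfm_single_Pfm[OF assms(2)]]] assms
    by (simp add: N_add pfm_single_Pfm)
qed

lemma d_scale: assumes "f \<in> D" shows "d (\<lambda>x. c * f x) = (\<lambda>_. c) \<odot>\<^bsub>M\<^esub> d f"
proof -
  have s: "simple_function m (\<lambda>_. c)" by simp
  have "pcls (pfm_single m (\<lambda>x. c * f x)) = pcls (pfm_smult (\<lambda>_. c) (pfm_single m f))"
    by (rule pcls_eqI) (use assms in \<open>simp_all add: D_scale pfm_single_Pfm pfm_smult_Pfm[OF s] pfm_smult_fam[OF s] pfm_single_fam\<close>)
  then show ?thesis unfolding d_eq gen_module_def
    using N.\<iota>_smult[OF s N_carrierI[OF pfm_single_Pfm[OF assms]]] N_smult[OF s pfm_single_Pfm[OF assms]] by simp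
qed

lemma pnorm_d: assumes "f \<in> D" shows "AE x in m. pnorm M (d f) x = g f x"
  unfolding d_eq gen_module_def
  using N.C_pnorm_\<iota>[OF N_carrierI[OF pfm_single_Pfm[OF assms]]] N_pnorm(2)[OF pfm_single_Pfm[OF assms]]
  by eventually_elim (simp add: pfm_pnorm_eq pfm_single_fam[OF assms])

lemma vnorm_d: "f \<in> D \<Longrightarrow> vnorm M (d f) = Lp_norm m p (g f)"
  using pnorm_d[of f] d_closed[of f]
  by (auto simp: M.vnorm_eq intro!: Lp_norm_cong_AE M.pnorm_measurable g_measurable elim!: eventually_mono)

text \<open>A family may have infinitely many pieces, while \<open>isometric_span\<close> works with
  simple functions. Replacing the functions by 0 from index \<open>k\<close> on leaves finitely many
  values, and the error tends to 0 by dominated convergence with the pointwise norm of the whole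
  family as majorant.\<close>

lemma simple_combinations_dense:
  assumes y: "y \<in> carrier M" and e: "0 < e"
  obtains s z where "simple_function m s" "\<And>t. s t \<in> D" "z \<in> carrier M"
    "AE t in m. pnorm M (z \<ominus>\<^bsub>M\<^esub> d (s t)) t = 0" "vnorm M (z \<ominus>\<^bsub>M\<^esub> y) < e"
proof -
  have e2: "0 < e / 2" using e by simp
  obtain U where U: "U \<in> carrier N" "vnorm M (N.\<iota> U \<ominus>\<^bsub>M\<^esub> y) < e / 2"
    using N.\<iota>_dense[OF y[unfolded gen_module_def] e2] by (auto simp: gen_module_def)
  obtain u where u: "u \<in> Pfm m p D g" "U = pcls u" by (rule N_carrierE[OF U(1)])
  note f = Pfm_fam[OF u(1)]
  define w where "w k i = (if i < k then fst (u i) else (\<lambda>x. 0), snd (u i))" for k i :: nat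
  have wf: "fam (w k)" for k using f D_zero by (auto simp: fam_def w_def)
  have wv: "pfm_value (w k) x = (if i < k then pfm_value u x else (\<lambda>x. 0))" if "x \<in> snd (u i)" for k i x
    using fam_value[OF wf, of x k i] fam_value[OF f that] that by (simp add: w_def)
  have wv': "pfm_value (w k) x = pfm_value u x \<or> pfm_value (w k) x = (\<lambda>x. 0)" for k x
  proof -
    obtain i where "x \<in> snd (u i)" by (rule fam_ex[OF f])
    from wv[OF this, of k] show ?thesis by auto
  qed
  have wL: "pfm_pnorm g (w k) \<in> Lp m p" for k
  proof (rule Lp_dominated(1)[OF p_pos fam_pnorm_measurable[OF wf] Pfm_Lp[OF u(1)]])
    show "AE x in m. \<bar>pfm_pnorm g (w k) x\<bar> \<le> \<bar>pfm_pnorm g u x\<bar>"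
      using g_zero
    proof eventually_elim
      case (elim x)
      then show ?case using wv'[of k x] by (auto simp: pfm_pnorm_eq)
    qed
  qed
  have wP: "w k \<in> Pfm m p D g" for k using wf wL by (simp add: Pfm_iff)
  let ?q = "\<lambda>k x. g (\<lambda>y. pfm_value (w k) x y - pfm_value u x y) x"
  have q: "AE x in m. pnorm N (pcls (w k) \<ominus>\<^bsub>N\<^esub> pcls u) x = ?q k x" for k by (rule N_pnorm_diff[OF wP u(1)])
  have Nc: "pcls (w k) \<ominus>\<^bsub>N\<^esub> pcls u \<in> carrier N" for k by (intro N.minus_closed N_carrierI wP u(1))
  \<comment> \<open>Needed for the majorant: from index \<open>k\<close> on the difference is the
    negative of the value of \<open>u\<close>.\<close>
  have minus: "AE x in m. g (\<lambda>y. - pfm_value u x y) x = g (pfm_value u x) x"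
    using fam_AE[OF g_scale[where c="-1"] f] by simp
  have "(\<lambda>k. \<integral>x. \<bar>pnorm N (pcls (w k) \<ominus>\<^bsub>N\<^esub> pcls u) x\<bar> powr p \<partial>m) \<longlonglongrightarrow> (\<integral>x. 0 \<partial>m)"
  proof (rule integral_dominated_convergence[where w="\<lambda>x. \<bar>pfm_pnorm g u x\<bar> powr p"])
    show "integrable m (\<lambda>x. \<bar>pfm_pnorm g u x\<bar> powr p)" by (rule LpD(2)[OF Pfm_Lp[OF u(1)]])
    show "(\<lambda>x. \<bar>pnorm N (pcls (w k) \<ominus>\<^bsub>N\<^esub> pcls u) x\<bar> powr p) \<in> borel_measurable m" for k
      using N.pnorm_measurable[OF Nc, of k] by measurable
    have all: "AE x in m. \<forall>k. pnorm N (pcls (w k) \<ominus>\<^bsub>N\<^esub> pcls u) x = ?q k x"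
      using q by (intro AE_all_countable[THEN iffD2] allI)
    show "AE x in m. (\<lambda>k. \<bar>pnorm N (pcls (w k) \<ominus>\<^bsub>N\<^esub> pcls u) x\<bar> powr p) \<longlonglongrightarrow> 0"
      using all g_zero
    proof eventually_elim
      case (elim x)
      obtain i where i: "x \<in> snd (u i)" by (rule fam_ex[OF f])
      have "\<bar>pnorm N (pcls (w k) \<ominus>\<^bsub>N\<^esub> pcls u) x\<bar> powr p = 0" if "Suc i \<le> k" for k
        using elim wv[OF i, of k] that by simp
      then show ?case by (intro tendsto_eventually eventually_sequentiallyI[of "Suc i"])
    qed
    show "AE x in m. norm (\<bar>pnorm N (pcls (w k) \<ominus>\<^bsub>N\<^esub> pcls u) x\<bar> powr p) \<le> \<bar>pfm_pnorm g u x\<bar> powr p" for k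
      using q[of k] g_zero minus
    proof eventually_elim
      case (elim x)
      then have "\<bar>pnorm N (pcls (w k) \<ominus>\<^bsub>N\<^esub> pcls u) x\<bar> \<le> \<bar>pfm_pnorm g u x\<bar>"
        using wv'[of k x] by (auto simp: pfm_pnorm_eq)
      then show ?case using p_pos by (simp add: powr_mono2)
    qed
  qed simp
  then have "(\<lambda>k. \<integral>x. \<bar>pnorm N (pcls (w k) \<ominus>\<^bsub>N\<^esub> pcls u) x\<bar> powr p \<partial>m) \<longlonglongrightarrow> 0" by simp
  then have "(\<lambda>k. (\<integral>x. \<bar>pnorm N (pcls (w k) \<ominus>\<^bsub>N\<^esub> pcls u) x\<bar> powr p \<partial>m) powr (1/p)) \<longlonglongrightarrow> 0 powr (1/p)"
    using p_pos by (intro tendsto_powr' tendsto_const) auto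
  then have "(\<lambda>k. vnorm N (pcls (w k) \<ominus>\<^bsub>N\<^esub> pcls u)) \<longlonglongrightarrow> 0"
    by (simp add: N.vnorm_eq[OF Nc] Lp_norm_def)
  from order_tendstoD(2)[OF this e2] obtain k where k: "vnorm N (pcls (w k) \<ominus>\<^bsub>N\<^esub> pcls u) < e / 2"
    by (auto simp: eventually_sequentially)
  define s where "s = pfm_value (w k)"
  define z where "z = N.\<iota> (pcls (w k))"
  have \<iota>_diff: "N.\<iota> (A \<ominus>\<^bsub>N\<^esub> B) = N.\<iota> A \<ominus>\<^bsub>M\<^esub> N.\<iota> B" if "A \<in> carrier N" "B \<in> carrier N" for A B
    using N.C_diff(1)[OF N.MC_const[OF that(1)] N.MC_const[OF that(2)]] by (simp add: N.\<iota>_def gen_module_def)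
  have vnorm_\<iota>: "vnorm M (N.\<iota> A) = vnorm N A" if "A \<in> carrier N" for A
  proof -
    have c: "N.\<iota> A \<in> carrier M" unfolding gen_module_def by (rule N.\<iota>_closed[OF that])
    have "AE x in m. \<bar>pnorm M (N.\<iota> A) x\<bar> = \<bar>pnorm N A x\<bar>"
      using N.C_pnorm_\<iota>[OF that] unfolding gen_module_def[symmetric] by eventually_elim simp
    then show ?thesis unfolding M.vnorm_eq[OF c] N.vnorm_eq[OF that]
      by (intro Lp_norm_cong_AE M.pnorm_measurable[OF c] N.pnorm_measurable[OF that])
  qed
  have wc: "pcls (w k) \<in> carrier N" by (rule N_carrierI[OF wP])
  have zc: "z \<in> carrier M" unfolding z_def gen_module_def by (rule N.\<iota>_closed[OF wc])
  have Uc: "N.\<iota> U \<in> carrier M" unfolding gen_module_def by (rule N.\<iota>_closed[OF U(1)])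
  have "vnorm M (z \<ominus>\<^bsub>M\<^esub> y) \<le> vnorm M (z \<ominus>\<^bsub>M\<^esub> N.\<iota> U) + vnorm M (N.\<iota> U \<ominus>\<^bsub>M\<^esub> y)" by (rule M.vnorm_diff_triangle[OF zc Uc y])
  also have "vnorm M (z \<ominus>\<^bsub>M\<^esub> N.\<iota> U) = vnorm N (pcls (w k) \<ominus>\<^bsub>N\<^esub> pcls u)"
    using vnorm_\<iota>[OF Nc[of k]] \<iota>_diff[OF wc U(1)] u(2) by (simp add: z_def)
  finally have 1: "vnorm M (z \<ominus>\<^bsub>M\<^esub> y) < e" using k U(2) by simp
  have rng: "range s \<subseteq> insert (\<lambda>x. 0) ((\<lambda>i. fst (u i)) ` {..<k})"
  proof safe
    fix x assume ne: "s x \<notin> (\<lambda>i. fst (u i)) ` {..<k}"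
    obtain i where i: "x \<in> snd (u i)" by (rule fam_ex[OF f])
    show "s x = (\<lambda>x. 0)" using ne wv[OF i, of k] fam_value[OF f i] by (auto simp: s_def split: if_splits)
  qed
  have sf: "simple_function m s"
    unfolding simple_function_def
  proof (intro conjI ballI)
    show "finite (s ` space m)" using finite_subset[OF rng] by (simp add: space_UNIV)
    fix h
    have "s -` {h} \<inter> space m = (\<Union>i\<in>{i. fst (w k i) = h}. snd (u i))"
    proof (intro Set.set_eqI iffI)
      fix x assume x: "x \<in> s -` {h} \<inter> space m"
      obtain i where i: "x \<in> snd (u i)" by (rule fam_ex[OF f])
      then have "x \<in> snd (w k i)" by (simp add: w_def)
      from fam_value[OF wf this] have "fst (w k i) = h" using x by (simp add: s_def)
      then show "x \<in> (\<Union>i\<in>{i. fst (w k i) = h}. snd (u i))" using i by blast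
    next
      fix x assume "x \<in> (\<Union>i\<in>{i. fst (w k i) = h}. snd (u i))"
      then obtain i where i: "x \<in> snd (u i)" "fst (w k i) = h" by auto
      then show "x \<in> s -` {h} \<inter> space m" using fam_value[OF wf, of x k i] by (auto simp: s_def w_def space_UNIV)
    qed
    also have "\<dots> \<in> sets m" using fam_sets[OF f] by (intro sets.countable_UN') auto
    finally show "s -` {h} \<inter> space m \<in> sets m" .
  qed
  have sD: "s t \<in> D" for t unfolding s_def by (rule fam_value_D[OF wf])
  \<comment> \<open>The identity is proved for each fixed value \<open>h\<close> of \<open>s\<close>
    and then read at h = s t, where the right-hand side becomes \<open>g\<close> of the zero
    function.\<close>
  have "AE t in m. pnorm M (z \<ominus>\<^bsub>M\<^esub> d (s t)) t = g (\<lambda>y. s t y - s t y) t"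
  proof (rule simple_function_AE[OF sf space_UNIV, where P="\<lambda>h t. pnorm M (z \<ominus>\<^bsub>M\<^esub> d h) t = g (\<lambda>y. s t y - h y) t"])
    fix h assume "h \<in> range s"
    then have h: "h \<in> D" using sD by auto
    have hc: "pcls (pfm_single m h) \<in> carrier N" by (rule N_carrierI[OF pfm_single_Pfm[OF h]])
    have "z \<ominus>\<^bsub>M\<^esub> d h = N.\<iota> (pcls (w k) \<ominus>\<^bsub>N\<^esub> pcls (pfm_single m h))"
      unfolding z_def d_eq by (rule \<iota>_diff[OF wc hc, symmetric])
    note eq = this
    show "AE t in m. pnorm M (z \<ominus>\<^bsub>M\<^esub> d h) t = g (\<lambda>y. s t y - h y) t"
      unfolding eq using N.C_pnorm_\<iota>[OF N.minus_closed[OF wc hc]] N_pnorm_diff[OF wP[of k] pfm_single_Pfm[OF h]]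
      unfolding gen_module_def[symmetric] by eventually_elim (simp add: pfm_single_fam[OF h] s_def)
  qed
  then have 2: "AE t in m. pnorm M (z \<ominus>\<^bsub>M\<^esub> d (s t)) t = 0" using g_zero by eventually_elim simp
  show ?thesis by (rule that[OF sf sD zc 2 1])
qed

end

section \<open>The lower relaxation\<close>

lemma (in seminormed_mod) strong_imp_weak:
  assumes \<sigma>: "\<And>n. \<sigma> n \<in> carrier M" and v: "v \<in> carrier M" and l: "(\<lambda>n. vnorm M (\<sigma> n \<ominus> v)) \<longlonglongrightarrow> 0"
  shows "weakly_tendsto M \<sigma> v"
  unfolding weakly_tendsto_def
proof (intro conjI allI impI v)
  show "range \<sigma> \<subseteq> carrier M" using \<sigma> by auto
  fix f assume f: "bounded_functional M f"
  then obtain C where C: "\<And>u. u \<in> carrier M \<Longrightarrow> \<bar>f u\<bar> \<le> C * vnorm M u"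
    unfolding bounded_functional_def by blast
  have add: "f (a \<oplus> b) = f a + f b" if "a \<in> carrier M" "b \<in> carrier M" for a b
    using f that by (auto simp: bounded_functional_def)
  have diff: "f (\<sigma> n) - f v = f (\<sigma> n \<ominus> v)" for n
  proof -
    have "\<sigma> n = (\<sigma> n \<ominus> v) \<oplus> v" using \<sigma>[of n] v by (simp add: minus_eq a_assoc l_neg)
    then show ?thesis using add[of "\<sigma> n \<ominus> v" v] \<sigma>[of n] v by (metis add_diff_cancel_right' minus_closed)
  qed
  have "(\<lambda>n. f (\<sigma> n) - f v) \<longlonglongrightarrow> 0"
  proof (rule tendsto_rabs_zero_cancel, rule tendsto_sandwich[OF _ _ tendsto_const])
    show "(\<lambda>n. C * vnorm M (\<sigma> n \<ominus> v)) \<longlonglongrightarrow> 0" using tendsto_mult_right_zero[OF l] .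
    show "\<forall>\<^sub>F n in sequentially. \<bar>f (\<sigma> n) - f v\<bar> \<le> C * vnorm M (\<sigma> n \<ominus> v)"
      unfolding diff using C[OF minus_closed[OF \<sigma> v]] by (intro always_eventually allI)
  qed simp
  then show "(\<lambda>n. f (\<sigma> n)) \<longlonglongrightarrow> f v" by (rule LIM_zero_cancel)
qed

lemma Lp_space_simps [simp]:
  "carrier (Lp_space m p) = Lp m p" "zero (Lp_space m p) = (\<lambda>x. 0)" "add (Lp_space m p) = (\<lambda>f h x. f x + h x)"
  "smult (Lp_space m p) = (\<lambda>f h x. f x * h x)" "vnorm (Lp_space m p) = Lp_norm m p"
  by (simp_all add: Lp_space_def)

lemma Lp_space_seminormed:
  assumes p: "1 \<le> p" shows "seminormed_mod (Lp_space m p)"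
proof -
  have p0: "0 < p" using p by simp
  have "abelian_group (Lp_space m p)"
  proof (rule abelian_groupI)
    show "\<exists>h\<in>carrier (Lp_space m p). h \<oplus>\<^bsub>Lp_space m p\<^esub> f = \<zero>\<^bsub>Lp_space m p\<^esub>" if "f \<in> carrier (Lp_space m p)" for f
      using that by (intro bexI[of _ "\<lambda>x. - f x"]) (auto intro: Lp_uminus)
  qed (use p0 in \<open>auto simp: Lp_add algebra_simps\<close>)
  then interpret abelian_group "Lp_space m p" .
  show ?thesis
    by unfold_locales (use p p0 in \<open>auto simp: Lp_scale Lp_norm_scale Lp_norm_triangle algebra_simps\<close>)
qed

lemma Lp_space_diff:
  assumes "1 \<le> p" "f \<in> Lp m p" "h \<in> Lp m p" shows "f \<ominus>\<^bsub>Lp_space m p\<^esub> h = (\<lambda>x. f x - h x)"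
proof -
  interpret seminormed_mod "Lp_space m p" by (rule Lp_space_seminormed[OF assms(1)])
  have "\<ominus>\<^bsub>Lp_space m p\<^esub> h = (\<lambda>x. - h x)" using scal_minus_one[of h] assms(3) by simp
  then show ?thesis by (simp add: a_minus_def)
qed

text \<open>Contains all convex combinations of the tail \<open>(\<phi> n)\<close>, \<open>n \<ge> k\<close>.\<close>

definition tail_hull :: "(nat \<Rightarrow> 'a \<Rightarrow> real) \<Rightarrow> nat \<Rightarrow> ('a \<Rightarrow> real) set" where
  "tail_hull \<phi> k = {\<psi>. \<forall>x a b. (\<forall>n\<ge>k. a \<le> \<phi> n x \<and> \<phi> n x \<le> b) \<longrightarrow> a \<le> \<psi> x \<and> \<psi> x \<le> b}"

lemma tail_hull_mem: "k \<le> n \<Longrightarrow> \<phi> n \<in> tail_hull \<phi> k"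
  by (auto simp: tail_hull_def)

lemma tail_hull_convex:
  assumes "\<psi> \<in> tail_hull \<phi> k" "\<xi> \<in> tail_hull \<phi> k" "0 < t" "t < 1"
  shows "(\<lambda>x. t * \<psi> x + (1 - t) * \<xi> x) \<in> tail_hull \<phi> k"
  unfolding tail_hull_def
proof (intro CollectI allI impI)
  fix x a b assume "\<forall>n\<ge>k. a \<le> \<phi> n x \<and> \<phi> n x \<le> b"
  then have "a \<le> \<psi> x" "\<psi> x \<le> b" "a \<le> \<xi> x" "\<xi> x \<le> b" using assms(1,2) unfolding tail_hull_def by blast+
  moreover have "a = t * a + (1 - t) * a" "b = t * b + (1 - t) * b" by (simp_all add: algebra_simps)
  ultimately show "a \<le> t * \<psi> x + (1 - t) * \<xi> x \<and> t * \<psi> x + (1 - t) * \<xi> x \<le> b"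
    using assms(3,4) by (metis add_mono diff_ge_0_iff_ge less_imp_le mult_left_mono)
qed

text \<open>The hull is defined by pointwise order bounds, so a tail lying within e / 2 of
  \<open>f x\<close> confines all elements of the hull to the same interval.\<close>

lemma tail_hull_tendsto:
  assumes \<xi>: "\<And>k. \<xi> k \<in> tail_hull \<phi> k" and \<phi>: "L0_tendsto m \<phi> f" shows "L0_tendsto m \<xi> f"
  using \<phi> unfolding L0_tendsto_def
proof eventually_elim
  case (elim x)
  show ?case
  proof (rule LIMSEQ_I)
    fix e :: real assume "0 < e"
    then have e: "0 < e / 2" by simp
    obtain K where K: "\<And>n. K \<le> n \<Longrightarrow> \<bar>\<phi> n x - f x\<bar> < e / 2" using LIMSEQ_D[OF elim e] by auto
    have "norm (\<xi> k x - f x) < e" if "K \<le> k" for k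
    proof -
      have "\<forall>n\<ge>k. f x - e / 2 \<le> \<phi> n x \<and> \<phi> n x \<le> f x + e / 2"
      proof (intro allI impI)
        fix n assume "k \<le> n"
        then show "f x - e / 2 \<le> \<phi> n x \<and> \<phi> n x \<le> f x + e / 2" using K[of n] that by linarith
      qed
      then have "f x - e / 2 \<le> \<xi> k x \<and> \<xi> k x \<le> f x + e / 2" using \<xi>[of k] unfolding tail_hull_def by blast
      then show ?thesis using e unfolding real_norm_def by linarith
    qed
    then show "\<exists>K. \<forall>k\<ge>K. norm (\<xi> k x - f x) < e" by blast
  qed
qed

locale reflexive_map = subadditive_map m p D g for m :: "'a measure" and p D g +
  assumes reflexive: "weakly_reflexive m p D g"
begin

section \<open>Limits of differentials along a.e. convergent sequences\<close>

definition T :: "('a \<Rightarrow> real) \<Rightarrow> (nat \<Rightarrow> 'a pfm set) set set" where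
  "T f = {\<omega> \<in> carrier M. \<exists>\<phi>. range \<phi> \<subseteq> D \<and> L0_tendsto m \<phi> f \<and> (\<lambda>n. vnorm M (d (\<phi> n) \<ominus>\<^bsub>M\<^esub> \<omega>)) \<longlonglongrightarrow> 0}"

lemma TE:
  assumes "\<omega> \<in> T f"
  obtains \<phi> where "\<And>n. \<phi> n \<in> D" "L0_tendsto m \<phi> f" "(\<lambda>n. vnorm M (d (\<phi> n) \<ominus>\<^bsub>M\<^esub> \<omega>)) \<longlonglongrightarrow> 0"
  using assms by (auto simp: T_def)

lemma TI:
  assumes "\<omega> \<in> carrier M" "\<And>n. \<phi> n \<in> D" "L0_tendsto m \<phi> f" "(\<lambda>n. vnorm M (d (\<phi> n) \<ominus>\<^bsub>M\<^esub> \<omega>)) \<longlonglongrightarrow> 0"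
  shows "\<omega> \<in> T f"
  using assms unfolding T_def by (auto intro!: exI[of _ \<phi>])

lemma T_carrier: "\<omega> \<in> T f \<Longrightarrow> \<omega> \<in> carrier M"
  by (simp add: T_def)

lemma G0_eq: "G0 m p D g = T (\<lambda>x. 0)"
proof -
  have "limitin (ntopology M) (\<lambda>n. d (\<phi> n)) \<omega> sequentially \<longleftrightarrow> (\<lambda>n. vnorm M (d (\<phi> n) \<ominus>\<^bsub>M\<^esub> \<omega>)) \<longlonglongrightarrow> 0"
    if "range \<phi> \<subseteq> D" "\<omega> \<in> carrier M" for \<phi> \<omega>
    using M.limitin_iff[of "\<lambda>n. d (\<phi> n)" \<omega>] that by (auto simp: d_closed image_subset_iff)
  then show ?thesis unfolding G0_def T_def by blast
qed

lemma T_cong: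
  assumes "AE x in m. f x = h x" shows "T f = T h"
proof -
  have "L0_tendsto m \<phi> f \<longleftrightarrow> L0_tendsto m \<phi> h" for \<phi>
  proof
    assume "L0_tendsto m \<phi> f"
    with assms show "L0_tendsto m \<phi> h" unfolding L0_tendsto_def by eventually_elim simp
  next
    assume "L0_tendsto m \<phi> h"
    with assms show "L0_tendsto m \<phi> f" unfolding L0_tendsto_def by eventually_elim simp
  qed
  then show ?thesis by (simp add: T_def)
qed

lemma T_add:
  assumes "\<omega> \<in> T f" "\<eta> \<in> T h" shows "\<omega> \<oplus>\<^bsub>M\<^esub> \<eta> \<in> T (\<lambda>x. f x + h x)"
proof -
  obtain \<phi> where \<phi>: "\<And>n. \<phi> n \<in> D" "L0_tendsto m \<phi> f" "(\<lambda>n. vnorm M (d (\<phi> n) \<ominus>\<^bsub>M\<^esub> \<omega>)) \<longlonglongrightarrow> 0"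
    using TE[OF assms(1)] by blast
  obtain \<psi> where \<psi>: "\<And>n. \<psi> n \<in> D" "L0_tendsto m \<psi> h" "(\<lambda>n. vnorm M (d (\<psi> n) \<ominus>\<^bsub>M\<^esub> \<eta>)) \<longlonglongrightarrow> 0"
    using TE[OF assms(2)] by blast
  note c = T_carrier[OF assms(1)] T_carrier[OF assms(2)]
  show ?thesis
  proof (rule TI[where \<phi>="\<lambda>n x. \<phi> n x + \<psi> n x"])
    show "\<omega> \<oplus>\<^bsub>M\<^esub> \<eta> \<in> carrier M" using c by simp
    show "(\<lambda>x. \<phi> n x + \<psi> n x) \<in> D" for n by (rule D_add[OF \<phi>(1) \<psi>(1)])
    show "L0_tendsto m (\<lambda>n x. \<phi> n x + \<psi> n x) (\<lambda>x. f x + h x)"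
      using \<phi>(2) \<psi>(2) unfolding L0_tendsto_def by eventually_elim (rule tendsto_add)
    show "(\<lambda>n. vnorm M (d (\<lambda>x. \<phi> n x + \<psi> n x) \<ominus>\<^bsub>M\<^esub> (\<omega> \<oplus>\<^bsub>M\<^esub> \<eta>))) \<longlonglongrightarrow> 0"
      unfolding d_add[OF \<phi>(1) \<psi>(1)] by (rule M.tendsto_add_vnorm[OF d_closed[OF \<phi>(1)] c(1) \<phi>(3) d_closed[OF \<psi>(1)] c(2) \<psi>(3)])
  qed
qed

lemma T_scale:
  assumes "\<omega> \<in> T f" shows "(\<lambda>_. c) \<odot>\<^bsub>M\<^esub> \<omega> \<in> T (\<lambda>x. c * f x)"
proof -
  obtain \<phi> where \<phi>: "\<And>n. \<phi> n \<in> D" "L0_tendsto m \<phi> f" "(\<lambda>n. vnorm M (d (\<phi> n) \<ominus>\<^bsub>M\<^esub> \<omega>)) \<longlonglongrightarrow> 0"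
    using TE[OF assms] by blast
  note cr = T_carrier[OF assms]
  show ?thesis
  proof (rule TI[where \<phi>="\<lambda>n x. c * \<phi> n x"])
    show "(\<lambda>_. c) \<odot>\<^bsub>M\<^esub> \<omega> \<in> carrier M" using cr by (simp add: M.smult_closed)
    show "(\<lambda>x. c * \<phi> n x) \<in> D" for n by (rule D_scale[OF \<phi>(1)])
    show "L0_tendsto m (\<lambda>n x. c * \<phi> n x) (\<lambda>x. c * f x)"
      using \<phi>(2) unfolding L0_tendsto_def by eventually_elim (rule tendsto_mult_left)
    show "(\<lambda>n. vnorm M (d (\<lambda>x. c * \<phi> n x) \<ominus>\<^bsub>M\<^esub> (\<lambda>_. c) \<odot>\<^bsub>M\<^esub> \<omega>)) \<longlonglongrightarrow> 0"
      unfolding d_scale[OF \<phi>(1)] by (rule M.tendsto_smult[OF Linf_const d_closed[OF \<phi>(1)] cr \<phi>(3)])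
  qed
qed

lemma d_T: "f \<in> D \<Longrightarrow> d f \<in> T f"
  by (rule TI[where \<phi>="\<lambda>_. f"]) (auto simp: d_closed L0_tendsto_def M.diff_self)

text \<open>Weak reflexivity and Mazur's lemma turn boundedness into strong convergence, while keeping any
  convex constraint that holds along the tails of the sequence.\<close>

lemma strong_limit_exists:
  assumes f: "f \<in> borel_measurable m" and \<phi>: "\<And>n. \<phi> n \<in> D" "L0_tendsto m \<phi> f" and C: "\<And>n. Lp_norm m p (g (\<phi> n)) \<le> C"
    and Q: "\<And>k. Q k \<subseteq> D" "\<And>k n. k \<le> n \<Longrightarrow> \<phi> n \<in> Q k"
    and convex: "\<And>k \<psi> \<xi> t. \<psi> \<in> Q k \<Longrightarrow> \<xi> \<in> Q k \<Longrightarrow> 0 < t \<Longrightarrow> t < 1 \<Longrightarrow> (\<lambda>x. t * \<psi> x + (1 - t) * \<xi> x) \<in> Q k"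
  obtains \<xi> \<omega> where "\<And>k. \<xi> k \<in> Q k" "L0_tendsto m \<xi> f" "\<omega> \<in> carrier M" "(\<lambda>k. vnorm M (d (\<xi> k) \<ominus>\<^bsub>M\<^esub> \<omega>)) \<longlonglongrightarrow> 0"
proof -
  interpret S: seminormed_mod M by (rule M.seminormed)
  have "range \<phi> \<subseteq> D" "\<exists>C. \<forall>n. vnorm M (d (\<phi> n)) \<le> C" using \<phi> C by (auto simp: vnorm_d)
  then obtain r \<omega> where r: "strict_mono r" and w: "weakly_tendsto M (\<lambda>n. d (\<phi> (r n))) \<omega>"
    using reflexive f \<phi>(2) unfolding weakly_reflexive_def by blast
  have \<omega>: "\<omega> \<in> carrier M" using w by (simp add: weakly_tendsto_def)
  have "\<exists>\<xi>. \<xi> \<in> Q k \<inter> tail_hull \<phi> k \<and> vnorm M (d \<xi> \<ominus>\<^bsub>M\<^esub> \<omega>) < inverse (real (Suc k))" for k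
  proof -
    \<comment> \<open>Linearity of \<open>d\<close> makes this image convex. The hull constraint
      secures a.e. convergence, while \<open>Q k\<close> is the constraint to be preserved.\<close>
    let ?P = "d ` (Q k \<inter> tail_hull \<phi> k)"
    have P1: "?P \<subseteq> carrier M" using Q(1) by (auto intro: d_closed)
    have P2: "S.scal t u \<oplus>\<^bsub>M\<^esub> S.scal (1 - t) v \<in> ?P" if uv: "u \<in> ?P" "v \<in> ?P" and t: "0 < t" "t < 1" for u v t
    proof -
      obtain \<psi> \<xi> where \<psi>: "\<psi> \<in> Q k" "\<psi> \<in> tail_hull \<phi> k" "u = d \<psi>" and \<xi>: "\<xi> \<in> Q k" "\<xi> \<in> tail_hull \<phi> k" "v = d \<xi>" using uv by auto
      have D: "\<psi> \<in> D" "\<xi> \<in> D" using \<psi> \<xi> Q(1) by auto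
      have "S.scal t u \<oplus>\<^bsub>M\<^esub> S.scal (1 - t) v = d (\<lambda>x. t * \<psi> x + (1 - t) * \<xi> x)"
        using D \<psi>(3) \<xi>(3) d_add[OF D_scale[OF D(1), of t] D_scale[OF D(2), of "1 - t"]] by (simp add: d_scale)
      then show ?thesis using convex[OF \<psi>(1) \<xi>(1) t] tail_hull_convex[OF \<psi>(2) \<xi>(2) t] by blast
    qed
    \<comment> \<open>A strictly increasing \<open>r\<close> satisfies r n \<ge> n, so the
      subsequence meets the constraints from the same index on.\<close>
    have P3: "d (\<phi> (r n)) \<in> ?P" if "k \<le> n" for n
      using order_trans[OF that seq_suble[OF r]] Q(2) tail_hull_mem by blast
    obtain u where u: "u \<in> ?P" "vnorm M (u \<ominus>\<^bsub>M\<^esub> \<omega>) < inverse (real (Suc k))"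
    proof (rule S.Mazur[OF w P1 P2])
      show "0 < inverse (real (Suc k))" by simp
    qed (use P3 in auto)
    then show ?thesis by blast
  qed
  then obtain \<xi> where \<xi>: "\<And>k. \<xi> k \<in> Q k \<inter> tail_hull \<phi> k" "\<And>k. vnorm M (d (\<xi> k) \<ominus>\<^bsub>M\<^esub> \<omega>) < inverse (real (Suc k))" by metis
  have D: "\<xi> k \<in> D" for k using \<xi>(1) Q(1) by blast
  have "(\<lambda>k. vnorm M (d (\<xi> k) \<ominus>\<^bsub>M\<^esub> \<omega>)) \<longlonglongrightarrow> 0"
    by (rule tendsto_sandwich[OF _ _ tendsto_const LIMSEQ_inverse_real_of_nat])
      (use less_imp_le[OF \<xi>(2)] d_closed[OF D] \<omega> in \<open>auto intro!: always_eventually M.vnorm_nonneg simp del: of_nat_Suc\<close>)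
  moreover have "L0_tendsto m \<xi> f" using \<xi>(1) by (intro tail_hull_tendsto[OF _ \<phi>(2)]) auto
  ultimately show ?thesis using \<xi>(1) \<omega> by (intro that) auto
qed

section \<open>The relaxed domain and the relaxed map\<close>

abbreviation "D' \<equiv> relax_dom m p D g"
abbreviation "g' \<equiv> relax_map m p D g"

text \<open>Boundedness of \<open>g (\<phi> n)\<close> can be traded for convergence of
  differentials: one direction is \<open>strong_limit_exists\<close> with the trivial constraint
  \<open>D\<close>, the other is the boundedness of convergent sequences.\<close>

lemma relax_dom_eq: "D' = {f \<in> borel_measurable m. T f \<noteq> {}}"
proof (intro Set.set_eqI iffI)
  fix f assume "f \<in> D'"
  then obtain \<phi> C where f: "f \<in> borel_measurable m" and \<phi>: "\<And>n. \<phi> n \<in> D" "L0_tendsto m \<phi> f" "\<And>n. Lp_norm m p (g (\<phi> n)) \<le> C"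
    unfolding relax_dom_def by blast
  obtain \<xi> \<omega> where "\<And>k. \<xi> k \<in> D" "L0_tendsto m \<xi> f" "\<omega> \<in> carrier M" "(\<lambda>k. vnorm M (d (\<xi> k) \<ominus>\<^bsub>M\<^esub> \<omega>)) \<longlonglongrightarrow> 0"
    by (rule strong_limit_exists[OF f \<phi>, of "\<lambda>_. D"]) (auto intro: \<phi> D_add D_scale)
  then have "\<omega> \<in> T f" by (intro TI)
  then show "f \<in> {f \<in> borel_measurable m. T f \<noteq> {}}" using f by auto
next
  fix f assume "f \<in> {f \<in> borel_measurable m. T f \<noteq> {}}"
  then obtain \<omega> where f: "f \<in> borel_measurable m" and \<omega>: "\<omega> \<in> T f" by auto
  obtain \<phi> where \<phi>: "\<And>n. \<phi> n \<in> D" "L0_tendsto m \<phi> f" "(\<lambda>n. vnorm M (d (\<phi> n) \<ominus>\<^bsub>M\<^esub> \<omega>)) \<longlonglongrightarrow> 0"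
    using TE[OF \<omega>] by blast
  note c = T_carrier[OF \<omega>]
  obtain K where "\<forall>n. norm (vnorm M (d (\<phi> n) \<ominus>\<^bsub>M\<^esub> \<omega>)) \<le> K"
    using convergent_imp_Bseq[OF convergentI[OF \<phi>(3)]] by (rule BseqE)
  then have K: "vnorm M (d (\<phi> n) \<ominus>\<^bsub>M\<^esub> \<omega>) \<le> K" for n using abs_le_D1 unfolding real_norm_def by blast
  have "Lp_norm m p (g (\<phi> n)) \<le> K + vnorm M \<omega>" for n
    using M.abs_vnorm_diff_le[OF d_closed[OF \<phi>(1)] c, of n] K[of n] vnorm_d[OF \<phi>(1), of n] by linarith
  then show "f \<in> D'" unfolding relax_dom_def using f \<phi>(1,2) by blast
qed

text \<open>Sublinearity makes the pairs of a function and an upper bound of its \<open>g\<close> a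
  convex set; the convexity checks of both applications of Mazur's lemma in
  \<open>weak_limit_bound\<close> rest on this.\<close>

lemma g_convex:
  assumes "\<psi> \<in> D" "\<xi> \<in> D" "AE x in m. g \<psi> x \<le> H x" "AE x in m. g \<xi> x \<le> H' x" "0 < t" "t < 1"
  shows "AE x in m. g (\<lambda>x. t * \<psi> x + (1 - t) * \<xi> x) x \<le> t * H x + (1 - t) * H' x"
  using g_add[OF D_scale[OF assms(1), of t] D_scale[OF assms(2), of "1 - t"]] g_scale[OF assms(1), of t]
    g_scale[OF assms(2), of "1 - t"] assms(3,4)
proof eventually_elim
  case (elim x)
  have "t * g \<psi> x \<le> t * H x" "(1 - t) * g \<xi> x \<le> (1 - t) * H' x" using elim assms(5,6) by (auto intro: mult_left_mono)
  moreover have "g (\<lambda>x. t * \<psi> x) x = t * g \<psi> x" "g (\<lambda>x. (1 - t) * \<xi> x) x = (1 - t) * g \<xi> x"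
    using elim(2,3) assms(5,6) by simp_all
  ultimately show ?case using elim(1) by linarith
qed

text \<open>The first application of Mazur's lemma, in L^p, concerns the upper bounds of values
  \<open>g \<psi>\<close> and yields functions \<open>\<psi> k\<close> with upper bounds close to
  \<open>G\<close>. Having an upper bound within 1 / (k + 1) of \<open>G\<close> is a convex
  condition on functions, so the second application, inside \<open>strong_limit_exists\<close>, can
  keep it while making the differentials converge.\<close>

lemma weak_limit_bound:
  assumes f: "f \<in> borel_measurable m" and \<phi>: "\<And>n. \<phi> n \<in> D" "L0_tendsto m \<phi> f"
    and w: "weakly_tendsto (Lp_space m p) (\<lambda>n. g (\<phi> n)) G"
  shows "\<exists>\<omega>\<in>T f. AE x in m. pnorm M \<omega> x \<le> G x"
proof -
  interpret S: seminormed_mod "Lp_space m p" by (rule Lp_space_seminormed[OF p_ge_1])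
  have G: "G \<in> Lp m p" using w by (simp add: weakly_tendsto_def)
  have "\<exists>\<psi> H. \<psi> \<in> D \<inter> tail_hull \<phi> k \<and> H \<in> Lp m p \<and> (AE x in m. g \<psi> x \<le> H x) \<and> Lp_norm m p (\<lambda>x. H x - G x) < inverse (real (Suc k))" for k
  proof -
    let ?P = "{H \<in> Lp m p. \<exists>\<psi>\<in>D \<inter> tail_hull \<phi> k. AE x in m. g \<psi> x \<le> H x}"
    have P1: "?P \<subseteq> carrier (Lp_space m p)" by auto
    have P2: "S.scal t u \<oplus>\<^bsub>Lp_space m p\<^esub> S.scal (1 - t) v \<in> ?P" if uv: "u \<in> ?P" "v \<in> ?P" and t: "0 < t" "t < 1" for u v t
    proof -
      obtain \<psi> \<xi> where \<psi>: "\<psi> \<in> D" "\<psi> \<in> tail_hull \<phi> k" "AE x in m. g \<psi> x \<le> u x"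
        and \<xi>: "\<xi> \<in> D" "\<xi> \<in> tail_hull \<phi> k" "AE x in m. g \<xi> x \<le> v x" using uv by auto
      have "(\<lambda>x. t * \<psi> x + (1 - t) * \<xi> x) \<in> D \<inter> tail_hull \<phi> k"
        using tail_hull_convex[OF \<psi>(2) \<xi>(2) t] D_add[OF D_scale[OF \<psi>(1)] D_scale[OF \<xi>(1)]] by blast
      moreover have "(\<lambda>x. t * u x + (1 - t) * v x) \<in> Lp m p" using uv by (intro Lp_add p_pos Lp_scale) auto
      ultimately show ?thesis using g_convex[OF \<psi>(1) \<xi>(1) \<psi>(3) \<xi>(3) t] by auto
    qed
    have P3: "g (\<phi> n) \<in> ?P" if "k \<le> n" for n
      using tail_hull_mem[OF that, of \<phi>] \<phi>(1) g_Lp[OF \<phi>(1)] by (auto intro!: bexI[of _ "\<phi> n"])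
    obtain u where u: "u \<in> ?P" "vnorm (Lp_space m p) (u \<ominus>\<^bsub>Lp_space m p\<^esub> G) < inverse (real (Suc k))"
    proof (rule S.Mazur[OF w P1 P2])
      show "0 < inverse (real (Suc k))" by simp
    qed (use P3 in auto)
    then show ?thesis using Lp_space_diff[OF p_ge_1 _ G, of u] by auto
  qed
  then obtain \<psi> H where \<psi>: "\<And>k. \<psi> k \<in> D \<inter> tail_hull \<phi> k" and H: "\<And>k. H k \<in> Lp m p" "\<And>k. AE x in m. g (\<psi> k) x \<le> H k x"
    "\<And>k. Lp_norm m p (\<lambda>x. H k x - G x) < inverse (real (Suc k))" by metis
  have \<psi>D: "\<psi> k \<in> D" for k using \<psi> by auto
  have \<psi>f: "L0_tendsto m \<psi> f" using \<psi> by (intro tail_hull_tendsto[OF _ \<phi>(2)]) auto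
  have inv1: "inverse (real (Suc k)) \<le> 1" for k by (simp add: field_simps)
  have bound: "Lp_norm m p (g (\<psi> k)) \<le> Lp_norm m p G + 1" for k
  proof -
    have "Lp_norm m p (g (\<psi> k)) \<le> Lp_norm m p (H k)"
      by (rule Lp_dominated(2)[OF p_pos g_measurable[OF \<psi>D] H(1)])
        (use H(2)[of k] g_nonneg[OF \<psi>D, of k] in \<open>eventually_elim, simp\<close>)
    also have "\<dots> \<le> Lp_norm m p G + 1"
      using Lp_norm_triangle_diff[OF p_ge_1 H(1) G, of k] H(3)[of k] inv1[of k] by linarith
    finally show ?thesis .
  qed
  \<comment> \<open>The radius shrinks with \<open>k\<close>, so the sets decrease and contain the
    tails of \<open>\<psi>\<close>; they are convex because balls of L^p are.\<close>
  define Q where "Q k = {\<xi> \<in> D. \<exists>H\<in>Lp m p. Lp_norm m p (\<lambda>x. H x - G x) \<le> inverse (real (Suc k)) \<and> (AE x in m. g \<xi> x \<le> H x)}" for k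
  have QD: "Q k \<subseteq> D" for k by (auto simp: Q_def)
  have Q\<psi>: "\<psi> n \<in> Q k" if "k \<le> n" for k n
  proof -
    have "inverse (real (Suc n)) \<le> inverse (real (Suc k))" using that by (intro le_imp_inverse_le) auto
    then show ?thesis unfolding Q_def using \<psi>D H(1,2) less_imp_le[OF H(3), of n] by (blast intro: order_trans)
  qed
  have Qc: "(\<lambda>x. t * a x + (1 - t) * b x) \<in> Q k" if ab: "a \<in> Q k" "b \<in> Q k" and t: "0 < t" "t < 1" for k a b t
  proof -
    obtain A where A: "A \<in> Lp m p" "Lp_norm m p (\<lambda>x. A x - G x) \<le> inverse (real (Suc k))" "AE x in m. g a x \<le> A x" "a \<in> D"
      using ab(1) by (auto simp: Q_def)
    obtain B where B: "B \<in> Lp m p" "Lp_norm m p (\<lambda>x. B x - G x) \<le> inverse (real (Suc k))" "AE x in m. g b x \<le> B x" "b \<in> D"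
      using ab(2) by (auto simp: Q_def)
    have l: "(\<lambda>x. t * (A x - G x)) \<in> Lp m p" "(\<lambda>x. (1 - t) * (B x - G x)) \<in> Lp m p"
      by (intro Lp_scale Lp_diff p_pos A B G)+
    have "Lp_norm m p (\<lambda>x. (t * A x + (1 - t) * B x) - G x) = Lp_norm m p (\<lambda>x. t * (A x - G x) + (1 - t) * (B x - G x))"
      by (simp add: algebra_simps)
    also have "\<dots> \<le> Lp_norm m p (\<lambda>x. t * (A x - G x)) + Lp_norm m p (\<lambda>x. (1 - t) * (B x - G x))"
      by (rule Lp_norm_triangle[OF p_ge_1 l])
    also have "\<dots> = t * Lp_norm m p (\<lambda>x. A x - G x) + (1 - t) * Lp_norm m p (\<lambda>x. B x - G x)"
      using t by (simp add: Lp_norm_scale[OF p_pos])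
    also have "\<dots> \<le> t * inverse (real (Suc k)) + (1 - t) * inverse (real (Suc k))"
      using A(2) B(2) t by (intro add_mono mult_left_mono) auto
    also have "\<dots> = inverse (real (Suc k))" by (simp add: algebra_simps)
    finally have "Lp_norm m p (\<lambda>x. (t * A x + (1 - t) * B x) - G x) \<le> inverse (real (Suc k))" .
    moreover have "(\<lambda>x. t * A x + (1 - t) * B x) \<in> Lp m p" by (intro Lp_add Lp_scale p_pos A B)
    ultimately show ?thesis unfolding Q_def
      by (intro CollectI conjI bexI[of _ "\<lambda>x. t * A x + (1 - t) * B x"] g_convex[OF A(4) B(4) A(3) B(3) t]
        D_add D_scale A(4) B(4))
  qed
  obtain \<xi> \<omega> where \<xi>: "\<And>k. \<xi> k \<in> Q k" "L0_tendsto m \<xi> f" and \<omega>: "\<omega> \<in> carrier M" "(\<lambda>k. vnorm M (d (\<xi> k) \<ominus>\<^bsub>M\<^esub> \<omega>)) \<longlonglongrightarrow> 0"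
    by (rule strong_limit_exists[OF f \<psi>D \<psi>f bound QD Q\<psi> Qc]) blast+
  have \<xi>D: "\<xi> k \<in> D" for k using \<xi>(1) QD by blast
  have "\<exists>H\<in>Lp m p. Lp_norm m p (\<lambda>x. H x - G x) \<le> inverse (real (Suc k)) \<and> (AE x in m. g (\<xi> k) x \<le> H x)" for k
    using \<xi>(1)[of k] by (simp add: Q_def)
  then obtain K where K: "\<And>k. K k \<in> Lp m p" "\<And>k. Lp_norm m p (\<lambda>x. K k x - G x) \<le> inverse (real (Suc k))" "\<And>k. AE x in m. g (\<xi> k) x \<le> K k x"
    by metis
  have "AE x in m. pnorm M \<omega> x \<le> G x"
  proof (rule M.pnorm_le_limit[OF d_closed[OF \<xi>D] \<omega> K(1) G])
    show "(\<lambda>n. Lp_norm m p (\<lambda>x. K n x - G x)) \<longlonglongrightarrow> 0"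
      by (rule tendsto_sandwich[OF _ _ tendsto_const LIMSEQ_inverse_real_of_nat]) (use K(2) in \<open>auto intro!: always_eventually simp del: of_nat_Suc\<close>)
    show "AE x in m. pnorm M (d (\<xi> n)) x \<le> K n x" for n using pnorm_d[OF \<xi>D, of n] K(3)[of n] by eventually_elim simp
  qed
  moreover have "\<omega> \<in> T f" by (rule TI[OF \<omega>(1) \<xi>D \<xi>(2) \<omega>(2)])
  ultimately show ?thesis by blast
qed

text \<open>If \<open>d (\<phi> n)\<close> converges to \<open>\<omega>\<close>, then
  \<open>g (\<phi> n)\<close> converges strongly, hence weakly, to |\<omega>|, so |\<omega>| is one
  of the weak limits tested in the definition. Conversely every such weak limit lies above some
  |\<omega>| by \<open>weak_limit_bound\<close>.\<close>

lemma relax_set_eq: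
  assumes f: "f \<in> borel_measurable m"
  shows "relax_set m p D g f = {G \<in> Lp m p. \<forall>\<omega>\<in>T f. AE x in m. G x \<le> pnorm M \<omega> x}"
proof (intro Set.set_eqI iffI)
  fix G assume G: "G \<in> relax_set m p D g f"
  have "AE x in m. G x \<le> pnorm M \<omega> x" if \<omega>: "\<omega> \<in> T f" for \<omega>
  proof -
    obtain \<phi> where \<phi>: "\<And>n. \<phi> n \<in> D" "L0_tendsto m \<phi> f" "(\<lambda>n. vnorm M (d (\<phi> n) \<ominus>\<^bsub>M\<^esub> \<omega>)) \<longlonglongrightarrow> 0"
      using TE[OF \<omega>] by blast
    note c = T_carrier[OF \<omega>]
    have eq: "Lp_norm m p (\<lambda>x. g (\<phi> n) x - pnorm M \<omega> x) = Lp_norm m p (\<lambda>x. pnorm M (d (\<phi> n)) x - pnorm M \<omega> x)" for n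
    proof (rule Lp_norm_cong_AE)
      show "(\<lambda>x. g (\<phi> n) x - pnorm M \<omega> x) \<in> borel_measurable m" "(\<lambda>x. pnorm M (d (\<phi> n)) x - pnorm M \<omega> x) \<in> borel_measurable m"
        using g_measurable[OF \<phi>(1)] M.pnorm_measurable[OF c] M.pnorm_measurable[OF d_closed[OF \<phi>(1)]] by auto
      show "AE x in m. \<bar>g (\<phi> n) x - pnorm M \<omega> x\<bar> = \<bar>pnorm M (d (\<phi> n)) x - pnorm M \<omega> x\<bar>"
        using pnorm_d[OF \<phi>(1), of n] by eventually_elim simp
    qed
    have "(\<lambda>n. vnorm (Lp_space m p) (g (\<phi> n) \<ominus>\<^bsub>Lp_space m p\<^esub> pnorm M \<omega>)) \<longlonglongrightarrow> 0"
      by (rule tendsto_sandwich[OF _ _ tendsto_const \<phi>(3)])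
        (use M.Lp_norm_pnorm_diff_le[OF d_closed[OF \<phi>(1)] c] in
          \<open>auto intro!: always_eventually simp: Lp_space_diff[OF p_ge_1 g_Lp[OF \<phi>(1)] M.pnorm_Lp[OF c]] eq\<close>)
    then have "weakly_tendsto (Lp_space m p) (\<lambda>n. g (\<phi> n)) (pnorm M \<omega>)"
      by (intro seminormed_mod.strong_imp_weak[OF Lp_space_seminormed[OF p_ge_1]]) (use g_Lp[OF \<phi>(1)] M.pnorm_Lp[OF c] in auto)
    moreover have "range \<phi> \<subseteq> D" using \<phi>(1) by auto
    ultimately show ?thesis using G \<phi>(2) unfolding relax_set_def by blast
  qed
  then show "G \<in> {G \<in> Lp m p. \<forall>\<omega>\<in>T f. AE x in m. G x \<le> pnorm M \<omega> x}" using G by (auto simp: relax_set_def)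
next
  fix G assume G: "G \<in> {G \<in> Lp m p. \<forall>\<omega>\<in>T f. AE x in m. G x \<le> pnorm M \<omega> x}"
  have "AE x in m. G x \<le> G' x" if "range \<phi> \<subseteq> D" "L0_tendsto m \<phi> f" "weakly_tendsto (Lp_space m p) (\<lambda>n. g (\<phi> n)) G'" for \<phi> G'
  proof -
    note h = that
    obtain \<omega> where \<omega>: "\<omega> \<in> T f" "AE x in m. pnorm M \<omega> x \<le> G' x"
      using weak_limit_bound[OF f _ h(2,3)] h(1) by blast
    have "AE x in m. G x \<le> pnorm M \<omega> x" using G \<omega>(1) by blast
    with \<omega>(2) show ?thesis by eventually_elim simp
  qed
  then show "G \<in> relax_set m p D g f" using G unfolding relax_set_def by blast
qed

lemma relax_map_props:
  assumes f: "f \<in> D'"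
  shows "g' f \<in> Lp_plus m p" "\<And>\<omega>. \<omega> \<in> T f \<Longrightarrow> AE x in m. g' f x \<le> pnorm M \<omega> x"
    "\<And>G. G \<in> Lp m p \<Longrightarrow> (\<And>\<omega>. \<omega> \<in> T f \<Longrightarrow> AE x in m. G x \<le> pnorm M \<omega> x) \<Longrightarrow> AE x in m. G x \<le> g' f x"
proof -
  have fm: "f \<in> borel_measurable m" and ne: "T f \<noteq> {}" using f by (auto simp: relax_dom_eq)
  let ?W = "pnorm M ` T f"
  have W: "?W \<noteq> {}" "?W \<subseteq> Lp_plus m p" using ne by (auto intro: M.pnorm_plus T_carrier)
  let ?S = "relax_set m p D g f"
  have "\<exists>G. G \<in> Lp_plus m p \<and> (\<forall>u\<in>?W. AE x in m. G x \<le> u x) \<and> (\<forall>F. (\<forall>u\<in>?W. AE x in m. F x \<le> u x) \<longrightarrow> (AE x in m. F x \<le> G x))"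
  proof (rule Lp_essential_infimum[OF p_pos W])
    fix w :: "nat \<Rightarrow> 'a \<Rightarrow> real" and G assume *: "G \<in> Lp_plus m p"
      "\<And>u. u \<in> ?W \<Longrightarrow> AE x in m. G x \<le> u x" "\<And>F. (\<And>u. u \<in> ?W \<Longrightarrow> AE x in m. F x \<le> u x) \<Longrightarrow> AE x in m. F x \<le> G x"
    show ?thesis
      by (intro exI[of _ G] conjI allI ballI impI) (rule *(1), erule *(2), rule *(3), erule (1) bspec)
  qed
  then obtain G where G: "G \<in> Lp_plus m p" "\<forall>u\<in>?W. AE x in m. G x \<le> u x"
    "\<forall>F. (\<forall>u\<in>?W. AE x in m. F x \<le> u x) \<longrightarrow> (AE x in m. F x \<le> G x)" by blast
  have GS: "G \<in> ?S" using G(2) Lp_plusD(1)[OF G(1)] unfolding relax_set_eq[OF fm] by blast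
  have max: "AE x in m. F x \<le> G x" if "F \<in> ?S" for F using that G(3) unfolding relax_set_eq[OF fm] by blast
  note gr = ae_greatest_eqI[OF GS max]
  have S: "g' f \<in> ?S" and eq: "AE x in m. g' f x = G x" using gr by (simp_all add: relax_map_def)
  have "AE x in m. 0 \<le> g' f x" using eq Lp_plusD(2)[OF G(1)] by eventually_elim simp
  then show "g' f \<in> Lp_plus m p" using S unfolding relax_set_eq[OF fm] Lp_plus_def by blast
  show "\<And>\<omega>. \<omega> \<in> T f \<Longrightarrow> AE x in m. g' f x \<le> pnorm M \<omega> x" using S unfolding relax_set_eq[OF fm] by blast
  show "AE x in m. F x \<le> g' f x" if F: "F \<in> Lp m p" "\<And>\<omega>. \<omega> \<in> T f \<Longrightarrow> AE x in m. F x \<le> pnorm M \<omega> x" for F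
  proof -
    have "AE x in m. F x \<le> G x" using F by (intro max) (simp add: relax_set_eq[OF fm])
    with eq show ?thesis by eventually_elim simp
  qed
qed

lemma relax_dom_add: "f \<in> D' \<Longrightarrow> h \<in> D' \<Longrightarrow> (\<lambda>x. f x + h x) \<in> D'"
  unfolding relax_dom_eq using T_add by fastforce

lemma relax_dom_scale: "f \<in> D' \<Longrightarrow> (\<lambda>x. c * f x) \<in> D'"
  unfolding relax_dom_eq using T_scale by fastforce

lemma D_relax_dom: "f \<in> D \<Longrightarrow> f \<in> D'"
  unfolding relax_dom_eq using d_T D_measurable by blast

text \<open>Additivity of \<open>T\<close> gives the inequality for each pair of elements; as for
  cosets, the greatest lower bound property is then used in one argument at a time.\<close>

lemma relax_map_add:
  assumes f: "f \<in> D'" and h: "h \<in> D'"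
  shows "AE x in m. g' (\<lambda>x. f x + h x) x \<le> g' f x + g' h x"
proof -
  note fh = relax_dom_add[OF f h]
  let ?s = "\<lambda>x. f x + h x"
  note L = Lp_plusD(1)[OF relax_map_props(1)]
  have 1: "AE x in m. g' ?s x - pnorm M \<omega> x \<le> g' h x" if \<omega>: "\<omega> \<in> T f" for \<omega>
  proof (rule relax_map_props(3)[OF h])
    show "(\<lambda>x. g' ?s x - pnorm M \<omega> x) \<in> Lp m p" by (intro Lp_diff p_pos L fh M.pnorm_Lp T_carrier[OF \<omega>])
    show "AE x in m. g' ?s x - pnorm M \<omega> x \<le> pnorm M \<eta> x" if \<eta>: "\<eta> \<in> T h" for \<eta>
      using relax_map_props(2)[OF fh T_add[OF \<omega> \<eta>]] M.pnorm_triangle[OF T_carrier[OF \<omega>] T_carrier[OF \<eta>]]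
      by eventually_elim simp
  qed
  have "AE x in m. g' ?s x - g' h x \<le> g' f x"
  proof (rule relax_map_props(3)[OF f])
    show "(\<lambda>x. g' ?s x - g' h x) \<in> Lp m p" by (intro Lp_diff p_pos L fh h)
    show "AE x in m. g' ?s x - g' h x \<le> pnorm M \<omega> x" if "\<omega> \<in> T f" for \<omega> using 1[OF that] by eventually_elim simp
  qed
  then show ?thesis by eventually_elim simp
qed

lemma relax_map_scale_le:
  assumes f: "f \<in> D'" and c: "c \<noteq> 0" shows "AE x in m. g' (\<lambda>x. c * f x) x \<le> \<bar>c\<bar> * g' f x"
proof -
  note cf = relax_dom_scale[OF f, of c]
  have "AE x in m. inverse \<bar>c\<bar> * g' (\<lambda>x. c * f x) x \<le> g' f x"
  proof (rule relax_map_props(3)[OF f])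
    show "(\<lambda>x. inverse \<bar>c\<bar> * g' (\<lambda>x. c * f x) x) \<in> Lp m p" by (rule Lp_scale[OF Lp_plusD(1)[OF relax_map_props(1)[OF cf]]])
    show "AE x in m. inverse \<bar>c\<bar> * g' (\<lambda>x. c * f x) x \<le> pnorm M \<omega> x" if \<omega>: "\<omega> \<in> T f" for \<omega>
      using relax_map_props(2)[OF cf T_scale[OF \<omega>]] M.pnorm_smult[OF Linf_const[of c] T_carrier[OF \<omega>]]
      by eventually_elim (use c in \<open>simp add: field_simps\<close>)
  qed
  then show ?thesis by eventually_elim (use c in \<open>simp add: field_simps\<close>)
qed

text \<open>For c \<noteq> 0 the missing inequality is the one already proved, applied to 1 / c. For
  c = 0 the differential of the zero function has pointwise norm 0.\<close>

lemma relax_map_scale: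
  assumes f: "f \<in> D'" shows "AE x in m. g' (\<lambda>x. c * f x) x = \<bar>c\<bar> * g' f x"
proof (cases "c = 0")
  case True
  have z: "(\<lambda>x. 0) \<in> D'" by (rule D_relax_dom[OF D_zero])
  show ?thesis using relax_map_props(2)[OF z d_T[OF D_zero]] pnorm_d[OF D_zero] g_zero Lp_plusD(2)[OF relax_map_props(1)[OF z]]
    unfolding True by eventually_elim simp
next
  case False
  have "AE x in m. g' (\<lambda>x. inverse c * (c * f x)) x \<le> \<bar>inverse c\<bar> * g' (\<lambda>x. c * f x) x"
    by (rule relax_map_scale_le[OF relax_dom_scale[OF f]]) (use False in simp)
  moreover have "(\<lambda>x. inverse c * (c * f x)) = f" using False by (simp add: mult.assoc[symmetric])
  ultimately have "AE x in m. g' f x \<le> \<bar>inverse c\<bar> * g' (\<lambda>x. c * f x) x" by simp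
  with relax_map_scale_le[OF f False] show ?thesis by eventually_elim (use False in \<open>simp add: field_simps\<close>)
qed

text \<open>With this the theory of generated modules applies to the relaxation as well, through the
  instance \<open>E\<close>.\<close>

theorem relaxation_subadditive: "subadditive_homogeneous m p D' g'"
  unfolding subadditive_homogeneous_def
proof (intro conjI ballI allI impI)
  show "D' \<subseteq> borel_measurable m" by (auto simp: relax_dom_eq)
  show "(\<lambda>x. 0) \<in> D'" by (rule D_relax_dom[OF D_zero])
  fix f assume f: "f \<in> D'"
  then have fm: "f \<in> borel_measurable m" by (simp add: relax_dom_eq)
  show "g' f \<in> Lp_plus m p" by (rule relax_map_props(1)[OF f])
  show "h \<in> D'" "AE x in m. g' f x = g' h x" if h: "h \<in> borel_measurable m" "AE x in m. f x = h x" for h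
    using f T_cong[OF h(2)] h(1) relax_set_eq[OF fm] relax_set_eq[OF h(1)] by (auto simp: relax_dom_eq relax_map_def)
  show "(\<lambda>x. f x + h x) \<in> D'" "AE x in m. g' (\<lambda>x. f x + h x) x \<le> g' f x + g' h x" if h: "h \<in> D'" for h
    by (rule relax_dom_add[OF f h], rule relax_map_add[OF f h])
  show "(\<lambda>x. c * f x) \<in> D'" "AE x in m. g' (\<lambda>x. c * f x) x = \<bar>c\<bar> * g' f x" for c
    by (rule relax_dom_scale[OF f], rule relax_map_scale[OF f])
qed

end

section \<open>The relaxed module as a quotient\<close>

lemma (in subadditive_map) d_zero: "d (\<lambda>x. 0) = \<zero>\<^bsub>M\<^esub>"
proof (rule M.pnorm_eq_0D[OF d_closed[OF D_zero]])
  show "AE x in m. pnorm M (d (\<lambda>x. 0)) x = 0" using g_zero pnorm_d[OF D_zero] by eventually_elim simp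
qed

context reflexive_map
begin

section \<open>The submodule generated by limits of differentials of null sequences\<close>

abbreviation "S\<^sub>0 \<equiv> T (\<lambda>x. 0)"

text \<open>The diagonal makes the isometry trivial; the instance is there for its description of
  generated submodules.\<close>

sublocale I0: isometric_span M M m p "Id_on S\<^sub>0"
proof
  show "x \<in> carrier M \<and> y \<in> carrier M" if "(x, y) \<in> Id_on S\<^sub>0" for x y
    using that by (auto intro: T_carrier)
  show "(\<zero>\<^bsub>M\<^esub>, \<zero>\<^bsub>M\<^esub>) \<in> Id_on S\<^sub>0" using d_T[OF D_zero] by (auto simp: d_zero)
  show "(x \<oplus>\<^bsub>M\<^esub> x', y \<oplus>\<^bsub>M\<^esub> y') \<in> Id_on S\<^sub>0" if "(x, y) \<in> Id_on S\<^sub>0" "(x', y') \<in> Id_on S\<^sub>0" for x y x' y'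
    using that T_add[of x "\<lambda>x. 0" x' "\<lambda>x. 0"] by auto
  show "((\<lambda>_. c) \<odot>\<^bsub>M\<^esub> x, (\<lambda>_. c) \<odot>\<^bsub>M\<^esub> y) \<in> Id_on S\<^sub>0" if "(x, y) \<in> Id_on S\<^sub>0" for x y c
    using that T_scale[of x "\<lambda>x. 0" c] by auto
  show "AE t in m. pnorm M y t = pnorm M x t" if "(x, y) \<in> Id_on S\<^sub>0" for x y
    using that by auto
qed

abbreviation "M\<^sub>0 \<equiv> generated_submodule m p M (G0 m p D g)"

lemma M0_eq: "M\<^sub>0 = fst ` I0.span"
proof -
  have "fst ` Id_on S\<^sub>0 = S\<^sub>0" by force
  then show ?thesis using I0.generated_submodule_eq by (simp add: G0_eq)
qed

lemma S0_subset_M0: "S\<^sub>0 \<subseteq> M\<^sub>0"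
  unfolding M0_eq using I0.step_span[OF I0.L_step] by force

sublocale Q0: Lp_submod M m p M\<^sub>0
proof
  show "M\<^sub>0 \<subseteq> carrier M" unfolding M0_eq using I0.span_carrier(1) by force
  show "\<zero>\<^bsub>M\<^esub> \<in> M\<^sub>0" using S0_subset_M0 d_T[OF D_zero] by (auto simp: d_zero)
  show "u \<oplus>\<^bsub>M\<^esub> v \<in> M\<^sub>0" if "u \<in> M\<^sub>0" "v \<in> M\<^sub>0" for u v
    using that I0.span_add unfolding M0_eq by force
  show "f \<odot>\<^bsub>M\<^esub> v \<in> M\<^sub>0" if "f \<in> carrier (Linf m)" "v \<in> M\<^sub>0" for f v
    using that I0.span_smult unfolding M0_eq by force
  show "v \<in> M\<^sub>0" if "\<And>n. \<sigma> n \<in> M\<^sub>0" "v \<in> carrier M" "(\<lambda>n. vnorm M (\<sigma> n \<ominus>\<^bsub>M\<^esub> v)) \<longlonglongrightarrow> 0" for \<sigma> v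
    using I0.fst_span_closed[of \<sigma> v] that unfolding M0_eq by blast
qed

sublocale Q: Lp_mod Q0.Q m p
  by (rule Q0.quotient_Lp_mod)

lemma T_add_S0: "f \<in> D \<Longrightarrow> \<eta> \<in> S\<^sub>0 \<Longrightarrow> d f \<oplus>\<^bsub>M\<^esub> \<eta> \<in> T f"
  using T_add[OF d_T, of f \<eta> "\<lambda>x. 0"] by simp

lemma T_diff_S0:
  assumes f: "f \<in> D" and \<omega>: "\<omega> \<in> T f" shows "\<omega> \<ominus>\<^bsub>M\<^esub> d f \<in> S\<^sub>0"
  using T_add[OF \<omega> T_scale[OF d_T[OF f], of "-1"]] d_closed[OF f] by (simp add: M.minus_eq M.minus_eq_scal)

text \<open>On a piece where an element of the span agrees with some \<open>\<eta> \<in> S\<^sub>0\<close>, adding it to \<open>d f\<close>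
  gives an element of \<open>T f\<close> there.\<close>

lemma relax_map_le_step:
  assumes f: "f \<in> D" and xy: "(x, y) \<in> I0.step"
  shows "AE t in m. g' f t \<le> pnorm M (d f \<oplus>\<^bsub>M\<^esub> x) t"
proof -
  obtain s where s: "simple_function m s" "range s \<subseteq> Id_on S\<^sub>0" "AE t in m. pnorm M (x \<ominus>\<^bsub>M\<^esub> fst (s t)) t = 0"
    using xy by (auto simp: I0.step_def)
  note c = I0.step_carrier(1)[OF xy] d_closed[OF f]
  have "AE t in m. g' f t \<le> pnorm M (d f \<oplus>\<^bsub>M\<^esub> x) t + pnorm M (x \<ominus>\<^bsub>M\<^esub> fst (s t)) t"
  proof (rule simple_function_AE[OF s(1) space_UNIV])
    fix w assume "w \<in> range s"
    then have w: "fst w \<in> S\<^sub>0" using s(2) by auto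
    note wc = T_carrier[OF w]
    have eq: "(d f \<oplus>\<^bsub>M\<^esub> fst w) \<ominus>\<^bsub>M\<^esub> (d f \<oplus>\<^bsub>M\<^esub> x) = fst w \<ominus>\<^bsub>M\<^esub> x"
      using c wc M.add_diff_add[of "d f" "fst w" "d f" x] by (simp add: M.diff_self)
    have "AE t in m. \<bar>pnorm M (d f \<oplus>\<^bsub>M\<^esub> fst w) t - pnorm M (d f \<oplus>\<^bsub>M\<^esub> x) t\<bar> \<le> pnorm M (fst w \<ominus>\<^bsub>M\<^esub> x) t"
      using M.abs_pnorm_diff_le[of "d f \<oplus>\<^bsub>M\<^esub> fst w" "d f \<oplus>\<^bsub>M\<^esub> x"] c wc by (simp add: eq)
    with relax_map_props(2)[OF D_relax_dom[OF f] T_add_S0[OF f w]] M.pnorm_diff_commute[OF wc c(1)]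
    show "AE t in m. g' f t \<le> pnorm M (d f \<oplus>\<^bsub>M\<^esub> x) t + pnorm M (x \<ominus>\<^bsub>M\<^esub> fst w) t" by eventually_elim linarith
  qed
  with s(3) show ?thesis by eventually_elim simp
qed

text \<open>\<open>M\<^sub>0\<close> can be larger than \<open>S\<^sub>0\<close>, and then d f +
  \<eta> need not belong to \<open>T f\<close>. The inequality is available for steps and is
  preserved by limits in norm.\<close>

lemma relax_map_le_M0:
  assumes f: "f \<in> D" and \<eta>: "\<eta> \<in> M\<^sub>0"
  shows "AE t in m. g' f t \<le> pnorm M (d f \<oplus>\<^bsub>M\<^esub> \<eta>) t"
proof -
  obtain y where y: "(\<eta>, y) \<in> I0.span" using \<eta> unfolding M0_eq by force
  obtain xs ys where s: "\<And>n. (xs n, ys n) \<in> I0.step" and l: "(\<lambda>n. vnorm M (xs n \<ominus>\<^bsub>M\<^esub> \<eta>)) \<longlonglongrightarrow> 0"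
    using I0.spanD[OF y] by blast
  note c = I0.step_carrier(1)[OF s] I0.span_carrier(1)[OF y] d_closed[OF f]
  show ?thesis
  proof (rule M.le_pnorm_limit[of "\<lambda>n. d f \<oplus>\<^bsub>M\<^esub> xs n"])
    show "d f \<oplus>\<^bsub>M\<^esub> xs n \<in> carrier M" for n using c by simp
    show "d f \<oplus>\<^bsub>M\<^esub> \<eta> \<in> carrier M" using c by simp
    show "(\<lambda>n. vnorm M (d f \<oplus>\<^bsub>M\<^esub> xs n \<ominus>\<^bsub>M\<^esub> (d f \<oplus>\<^bsub>M\<^esub> \<eta>))) \<longlonglongrightarrow> 0"
      using l c by (simp add: M.add_diff_add M.diff_self)
    show "g' f \<in> Lp m p" by (rule Lp_plusD(1)[OF relax_map_props(1)[OF D_relax_dom[OF f]]])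
    show "AE t in m. g' f t \<le> pnorm M (d f \<oplus>\<^bsub>M\<^esub> xs n) t" for n by (rule relax_map_le_step[OF f s])
  qed
qed

lemma coset_d: assumes f: "f \<in> D" shows "Q0.\<pi> (d f) = (\<lambda>\<omega>. d f \<oplus>\<^bsub>M\<^esub> \<omega>) ` M\<^sub>0"
proof -
  have "Q0.\<pi> (d f) = (\<Union>h\<in>M\<^sub>0. {h \<oplus>\<^bsub>M\<^esub> d f})" by (simp add: a_r_coset_def')
  also have "\<dots> = (\<Union>h\<in>M\<^sub>0. {d f \<oplus>\<^bsub>M\<^esub> h})" using d_closed[OF f] by (intro SUP_cong refl) (simp add: M.a_comm)
  finally show ?thesis by auto
qed

text \<open>Both sides are essential infima, one over the coset and one over its subset
  \<open>T f\<close>. The larger set has the smaller infimum, and \<open>relax_map_le_M0\<close>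
  shows that nothing is lost.\<close>

lemma pnorm_coset_d:
  assumes f: "f \<in> D" shows "AE t in m. pnorm Q0.Q (Q0.\<pi> (d f)) t = g' f t"
proof -
  note c = d_closed[OF f] and f' = D_relax_dom[OF f]
  have "AE t in m. pnorm Q0.Q (Q0.\<pi> (d f)) t \<le> g' f t"
  proof (rule relax_map_props(3)[OF f'])
    show "pnorm Q0.Q (Q0.\<pi> (d f)) \<in> Lp m p" by (rule Lp_plusD(1)[OF Q0.Q_pnorm_props(1)[OF c]])
    fix \<omega> assume \<omega>: "\<omega> \<in> T f"
    have "\<omega> \<in> Q0.\<pi> (d f)"
      using T_diff_S0[OF f \<omega>] S0_subset_M0 T_carrier[OF \<omega>] c by (auto simp: Q0.mem_coset)
    then show "AE t in m. pnorm Q0.Q (Q0.\<pi> (d f)) t \<le> pnorm M \<omega> t" by (rule Q0.Q_pnorm_props(2)[OF c])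
  qed
  moreover have "AE t in m. g' f t \<le> pnorm Q0.Q (Q0.\<pi> (d f)) t"
  proof (rule Q0.Q_pnorm_props(3)[OF c])
    show "g' f \<in> Lp m p" by (rule Lp_plusD(1)[OF relax_map_props(1)[OF f']])
    show "AE t in m. g' f t \<le> pnorm M w t" if "w \<in> Q0.\<pi> (d f)" for w
      using that relax_map_le_M0[OF f] unfolding coset_d[OF f] by blast
  qed
  ultimately show ?thesis by eventually_elim simp
qed

section \<open>The isometry with the quotient\<close>

sublocale E: subadditive_map m p D' g'
  by unfold_locales (fact p1 space_UNIV relaxation_subadditive)+

text \<open>Kept as a relation: that \<open>E.d f\<close> determines the coset of \<open>d f\<close>
  then follows from the equality of pointwise norms.\<close>

definition L :: "((nat \<Rightarrow> 'a pfm set) set \<times> (nat \<Rightarrow> 'a pfm set) set set) set" where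
  "L = (\<lambda>f. (E.d f, Q0.\<pi> (d f))) ` D"

sublocale I: isometric_span E.M Q0.Q m p L
proof
  have D': "f \<in> D'" if "f \<in> D" for f using that by (rule D_relax_dom)
  note [simp del] = Q0.Q_simps
  show "x \<in> carrier E.M \<and> y \<in> carrier Q0.Q" if "(x, y) \<in> L" for x y
    using that by (auto simp: L_def intro!: E.d_closed D' Q0.Q_carrierI d_closed)
  show "(\<zero>\<^bsub>E.M\<^esub>, \<zero>\<^bsub>Q0.Q\<^esub>) \<in> L"
  proof -
    have "Q0.\<pi> (d (\<lambda>x. 0)) = \<zero>\<^bsub>Q0.Q\<^esub>" by (simp add: d_zero Q0.coset_zero Q0.Q_simps(2))
    then show ?thesis unfolding L_def using D_zero E.d_zero by (intro image_eqI[of _ _ "\<lambda>x. 0"]) simp_all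
  qed
  show "(x \<oplus>\<^bsub>E.M\<^esub> x', y \<oplus>\<^bsub>Q0.Q\<^esub> y') \<in> L" if xy: "(x, y) \<in> L" "(x', y') \<in> L" for x y x' y'
  proof -
    obtain f h where f: "f \<in> D" "x = E.d f" "y = Q0.\<pi> (d f)" and h: "h \<in> D" "x' = E.d h" "y' = Q0.\<pi> (d h)"
      using xy by (auto simp: L_def)
    show ?thesis unfolding L_def
      using f h by (intro image_eqI[of _ _ "\<lambda>x. f x + h x"]) (simp_all add: E.d_add D' d_add Q0.Q_add d_closed D_add)
  qed
  show "((\<lambda>_. c) \<odot>\<^bsub>E.M\<^esub> x, (\<lambda>_. c) \<odot>\<^bsub>Q0.Q\<^esub> y) \<in> L" if xy: "(x, y) \<in> L" for x y c
  proof -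
    obtain f where f: "f \<in> D" "x = E.d f" "y = Q0.\<pi> (d f)" using xy by (auto simp: L_def)
    show ?thesis unfolding L_def
      using f by (intro image_eqI[of _ _ "\<lambda>x. c * f x"]) (simp_all add: E.d_scale D' d_scale Q0.Q_smult d_closed D_scale)
  qed
  show "AE t in m. pnorm Q0.Q y t = pnorm E.M x t" if xy: "(x, y) \<in> L" for x y
  proof -
    obtain f where f: "f \<in> D" "x = E.d f" "y = Q0.\<pi> (d f)" using xy by (auto simp: L_def)
    show ?thesis unfolding f(2,3) using pnorm_coset_d[OF f(1)] E.pnorm_d[OF D'[OF f(1)]] by eventually_elim simp
  qed
qed

text \<open>Simple combinations of differentials are dense in \<open>M\<close>, and passing to
  cosets does not increase norms. The same simple function with values in \<open>D\<close>, read
  through \<open>E.d\<close>, supplies the left component of the step.\<close>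

lemma quotient_dense:
  assumes y: "y \<in> carrier Q0.Q" and e: "0 < e"
  shows "\<exists>(x', y')\<in>I.step. vnorm Q0.Q (y' \<ominus>\<^bsub>Q0.Q\<^esub> y) < e"
proof -
  note [simp del] = Q0.Q_simps
  obtain v where v: "v \<in> carrier M" "y = Q0.\<pi> v" by (rule Q0.Q_carrierE[OF y])
  obtain s z where s: "simple_function m s" "\<And>t. s t \<in> D" and z: "z \<in> carrier M"
    "AE t in m. pnorm M (z \<ominus>\<^bsub>M\<^esub> d (s t)) t = 0" "vnorm M (z \<ominus>\<^bsub>M\<^esub> v) < e"
    by (rule simple_combinations_dense[OF v(1) e]) blast
  have sd: "simple_function m (\<lambda>t. E.d (s t))" using s(1) by (rule simple_function_compose1)
  have sc: "E.d (s t) \<in> carrier E.M" for t by (intro E.d_closed D_relax_dom s)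
  obtain x where x: "x \<in> carrier E.M" "AE t in m. pnorm E.M (x \<ominus>\<^bsub>E.M\<^esub> E.d (s t)) t = 0"
    by (rule E.M.simple_combination_exists[OF sd sc order_refl]) (auto intro: E.M.smult_closed)
  have "AE t in m. pnorm Q0.Q (Q0.\<pi> z \<ominus>\<^bsub>Q0.Q\<^esub> Q0.\<pi> (d (s t))) t \<le> pnorm M (z \<ominus>\<^bsub>M\<^esub> d (s t)) t \<and>
      0 \<le> pnorm Q0.Q (Q0.\<pi> z \<ominus>\<^bsub>Q0.Q\<^esub> Q0.\<pi> (d (s t))) t"
  proof (rule simple_function_AE[OF s(1) space_UNIV])
    fix h assume "h \<in> range s"
    then have h: "h \<in> D" using s(2) by auto
    note c = M.minus_closed[OF z(1) d_closed[OF h]]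
    show "AE t in m. pnorm Q0.Q (Q0.\<pi> z \<ominus>\<^bsub>Q0.Q\<^esub> Q0.\<pi> (d h)) t \<le> pnorm M (z \<ominus>\<^bsub>M\<^esub> d h) t \<and>
        0 \<le> pnorm Q0.Q (Q0.\<pi> z \<ominus>\<^bsub>Q0.Q\<^esub> Q0.\<pi> (d h)) t"
      using Q0.Q_pnorm_props(2)[OF c Q0.coset_self[OF c]] Lp_plusD(2)[OF Q0.Q_pnorm_props(1)[OF c]]
      by (simp add: Q0.Q_diff[OF z(1) d_closed[OF h]])
  qed
  with z(2) have "AE t in m. pnorm Q0.Q (Q0.\<pi> z \<ominus>\<^bsub>Q0.Q\<^esub> Q0.\<pi> (d (s t))) t = 0" by eventually_elim simp
  then have "(x, Q0.\<pi> z) \<in> I.step"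
    using x s Q0.Q_carrierI[OF z(1)]
    by (intro I.stepI[where s="\<lambda>t. (E.d (s t), Q0.\<pi> (d (s t)))"] simple_function_compose1[OF s(1)])
      (auto simp: L_def)
  moreover have "vnorm Q0.Q (Q0.\<pi> z \<ominus>\<^bsub>Q0.Q\<^esub> y) < e"
  proof -
    note c = M.minus_closed[OF z(1) v(1)]
    show ?thesis using Q0.Q_vnorm_le[OF c Q0.coset_self[OF c]] z(3) unfolding v(2) Q0.Q_diff[OF z(1) v(1)] by linarith
  qed
  ultimately show ?thesis by blast
qed

theorem relaxed_module_isometric:
  "lp_isometric m p (E.M\<lparr>carrier := generated_submodule m p E.M (E.d ` D)\<rparr>) (quotient_module m p M M\<^sub>0)"
proof -
  have "fst ` L = E.d ` D" by (auto simp: L_def image_image)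
  then show ?thesis using I.lp_isometric_generated[OF quotient_dense] by simp
qed

theorem vnorm_relaxed:
  assumes f: "f \<in> D" shows "vnorm E.M (E.d f) = (INF \<omega>\<in>M\<^sub>0. vnorm M (d f \<oplus>\<^bsub>M\<^esub> \<omega>))"
proof -
  note c = d_closed[OF f] and f' = D_relax_dom[OF f]
  have "vnorm E.M (E.d f) = Lp_norm m p (g' f)" by (rule E.vnorm_d[OF f'])
  also have "\<dots> = Lp_norm m p (pnorm Q0.Q (Q0.\<pi> (d f)))"
  proof (rule Lp_norm_cong_AE)
    show "g' f \<in> borel_measurable m" by (rule E.g_measurable[OF f'])
    show "pnorm Q0.Q (Q0.\<pi> (d f)) \<in> borel_measurable m" by (rule Q.pnorm_measurable[OF Q0.Q_carrierI[OF c]])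
    show "AE t in m. \<bar>g' f t\<bar> = \<bar>pnorm Q0.Q (Q0.\<pi> (d f)) t\<bar>" using pnorm_coset_d[OF f] by eventually_elim simp
  qed
  also have "\<dots> = vnorm Q0.Q (Q0.\<pi> (d f))" by (rule Q0.Q_vnorm_eq[OF c, symmetric])
  also have "\<dots> = (INF \<omega>\<in>M\<^sub>0. vnorm M (d f \<oplus>\<^bsub>M\<^esub> \<omega>))" unfolding Q0.Q_simps(4) coset_d[OF f] by (simp add: image_image)
  finally show ?thesis .
qed

end

theorem theorem2p15:
  fixes m :: "'a::complete_space measure"
    and p :: real
    and D :: "('a \<Rightarrow> real) set"
    and g :: "('a \<Rightarrow> real) \<Rightarrow> 'a \<Rightarrow> real"
  defines "D' \<equiv> relax_dom m p D g"
    and "g' \<equiv> relax_map m p D g"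
  defines "M \<equiv> gen_module m p D g"
    and "M' \<equiv> gen_module m p D' g'"
  defines "M\<^sub>0 \<equiv> generated_submodule m p M (G0 m p D g)"
    and "N' \<equiv> generated_submodule m p M' (gen_diff m p D' g' ` D)"
  assumes "radon_measure m"
    and "1 < p"
    and "subadditive_homogeneous m p D g"
    and "weakly_reflexive m p D g"
  shows "lp_isometric m p (M'\<lparr>carrier := N'\<rparr>) (quotient_module m p M M\<^sub>0) \<and>
    (\<forall>f\<in>D. vnorm M' (gen_diff m p D' g' f) =
       (INF \<omega>\<in>M\<^sub>0. vnorm M (gen_diff m p D g f \<oplus>\<^bsub>M\<^esub> \<omega>)))"
proof -
  have "sets m = sets borel" using assms(7) by (simp add: radon_measure_def)
  then have "space m = UNIV" using sets_eq_imp_space_eq[of m borel] by simp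
  then interpret reflexive_map m p D g
    using assms(8-10) by (intro reflexive_map.intro subadditive_map.intro reflexive_map_axioms.intro)
  show ?thesis
    unfolding D'_def g'_def M_def M'_def M\<^sub>0_def N'_def
    by (intro conjI ballI) (rule relaxed_module_isometric, rule vnorm_relaxed)
qed

end
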